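(* Let $T>0$, let $a\in\mathbb{R}$ with $a\neq 0$, let $(\Omega,\mathcal{F},\mathsf{P})$ be a complete probability space, and let $\mu$ be a stochastic measure on the Borel $\sigma$-algebra of $[0,T]$. Let $u_0:\mathbb{R}\times\Omega\to\mathbb{R}$, $f:[0,T]\times\mathbb{R}\times\mathbb{R}\to\mathbb{R}$ and $\sigma:[0,T]\times\mathbb{R}\to\mathbb{R}$ satisfy the following assumptions. (A1) $u_0(y)=u_0(y,\omega)$ is measurable and $\omega$-wise bounded: $|u_0(y,\omega)|\le C(\omega)$. (A2) $u_0$ is Hölder continuous: $|u_0(y_1)-u_0(y_2)|\le C(\omega)|y_1-y_2|^{\beta(u_0)}$ for all $y_1,y_2\in\mathbb{R}$, for some $\beta(u_0)\ge 1/2$. (A3) $f$ is measurable and bounded: $|f(s,y,v)|\le C$. (A4) $f$ is uniformly Lipschitz in $y,v$: $|f(s,y_1,v_1)-f(s,y_2,v_2)|\le C(|y_1-y_2|+|v_1-v_2|)$ for all $s\in[0,T]$, $y_1,y_2,v_1,v_2\in\mathbb{R}$. (A5) $\sigma$ is measurable and bounded: $|\sigma(s,y)|\le C$. (A6) $\sigma$ is Hölder continuous: $|\sigma(s_1,y_1)-\sigma(s_2,y_2)|\le C\left(|s_1-s_2|^{\beta(\sigma)}+|y_1-y_2|^{\beta(\sigma)}\right)$ for all $s_1,s_2\in[0,T]$, $y_1,y_2\in\mathbb{R}$, for some $\beta(\sigma)>1/2$. Consider the equation, for $(t,x)\in[0,T]\times\mathbb{R}$, $$u(t,x)=\int_{\mathbb{R}}p(t,x-y)u_0(y)\,dy+\int_0^t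 ds\int_{\mathbb{R}}p(t-s,x-y)f(s,y,u(s,y))\,dy+\int_{(0,t]}d\mu(s)\int_{\mathbb{R}}p(t-s,x-y)\sigma(s,y)\,dy. \quad ( * )$$ Then: 1. Equation $( * )$ has a solution $u(t,x)$. If $v(t,x)$ is another solution to $( * )$, then for all $t\in[0,T]$ and $x\in\mathbb{R}$, $u(t,x)=v(t,x)$ almost surely. 2. For any fixed $t\in[0,T]$ and any $\gamma_1<\beta(\sigma)-1/2$, the stochastic function $u(t,x)$, $x\in\mathbb{R}$, has a Hölder continuous version with exponent $\gamma_1$. 3. Suppose in addition that (A7) $\mu$ is Hölder continuous: $|\mu((s_1,s_2])|\le C(\omega)|s_1-s_2|^{\beta(\mu)}$ for all $s_1<s_2$ in $[0,T]$, for some $\beta(\mu)>0$. Then for any fixed $\delta>0$ and any $\gamma_1,\gamma_2$ such that $\gamma_1<\beta(\sigma)-1/2$, $\gamma_2\le\beta(\mu)$ and $\gamma_2<\beta(\sigma)-1/2$, the stochastic function $u(t,x)$ has a version $\tilde u(t,x)$ such that $$|\tilde u(t_1,x_1)-\tilde u(t_2,x_2)|\le C(\omega)\left(|t_1-t_2|^{\gamma_2}+|x_1-x_2|^{\gamma_1}\right),\quad t_1,t_2\in[\delta,T],\ x_1,x_2\in\mathbb{R}.$$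
   Context: Constants: $C$ denotes a finite deterministic constant and $C(\omega)$ a finite random constant (not depending on the time and space arguments); they may differ from formula to formula. All Hölder exponents ($\beta(u_0),\beta(\sigma),\beta(\mu),\gamma_1,\gamma_2$) are taken in $(0,1]$. A random function on $\mathbb{R}$ is Hölder continuous with exponent $\gamma$ if $|g(x_1)-g(x_2)|\le C(\omega)|x_1-x_2|^{\gamma}$ for all $x_1,x_2$. A version of a random function is a random function that coincides with it almost surely at each fixed value of the argument. Stochastic measure: $\mathsf{L}_0=\mathsf{L}_0(\Omega,\mathcal{F},\mathsf{P})$ is the space of equivalence classes of real random variables with convergence in probability. A stochastic measure on a $\sigma$-algebra $\mathcal{B}$ is a $\sigma$-additive mapping $\mu:\mathcal{B}\to\mathsf{L}_0$ (countable additivity in the sense of convergence in probability; no further assumptions such as moments, independence or positivity). For a deterministic simple function the integral with respect to $\mu$ is defined by linearity; a deterministic measurable function $g$ is integrable if there are simple functions $g_n\to g$ pointwise such that $\int_A g_n\,d\mu$ converges in probability for every $A\in\mathcal{B}$, and then $\int_A g\,d\mu$ is this limit. Every bounded measurable deterministic function is integrable. In (A7), the inequality is understood for a suitable choice of representatives of the random variables $\mu((s_1,s_2])$. Heat kernel: $p(t,x)=\frac{1}{2|a|\sqrt{\pi t}}e^{-\frac{x^2}{4a^2t}}$ for $t>0$, $x\in\mathbb{R}$, and by convention $\int_{\mathbb{R}}p(0,x-y)g(y)\,dy:=g(x)$. Solution: a solution of $( * )$ is a measurable random function $u(t,x)=u(t,x,\omega):[0,T]\times\mathbb{R}\times\Omega\to\mathbb{R}$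 such that for every $(t,x)\in[0,T]\times\mathbb{R}$ equality $( * )$ holds almost surely, where the integrals of random functions with respect to $dy$ and $ds$ are taken for each fixed $\omega\in\Omega$. ($( * )$ is the mild form of $du=a^2\,\partial^2u/\partial x^2\,dt+f(t,x,u)\,dt+\sigma(t,x)\,d\mu(t)$, $u(0,x)=u_0(x)$.) *)

theory Defs
  imports "HOL-Probability.Probability"
begin

definition tendsto_in_probability ::
  "'w measure \<Rightarrow> (nat \<Rightarrow> 'w \<Rightarrow> real) \<Rightarrow> ('w \<Rightarrow> real) \<Rightarrow> bool" where
  "tendsto_in_probability M X Y \<longleftrightarrow>
     (\<forall>\<epsilon>>0. (\<lambda>n. measure M {\<omega> \<in> space M. \<bar>X n \<omega> - Y \<omega>\<bar> > \<epsilon>}) \<longlonglongrightarrow> 0)"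

text \<open>
  Elements of \<open>L\<^sub>0\<close> are handled through representatives: \<open>\<mu> A\<close> is a random variable
  standing for its class modulo almost sure equality.  All conditions below are invariant under
  a change of representatives.  The \<open>\<sigma>\<close>-algebra is \<open>sets B\<close>; the measure carried by \<open>B\<close> is
  irrelevant.
\<close>

definition stochastic_measure ::
  "'w measure \<Rightarrow> 'a measure \<Rightarrow> ('a set \<Rightarrow> 'w \<Rightarrow> real) \<Rightarrow> bool" where
  "stochastic_measure M B \<mu> \<longleftrightarrow>
     (\<forall>A\<in>sets B. \<mu> A \<in> borel_measurable M) \<and>
     (\<forall>A :: nat \<Rightarrow> 'a set. range A \<subseteq> sets B \<longrightarrow> disjoint_family A \<longrightarrow>
        tendsto_in_probability M (\<lambda>n \<omega>. \<Sum>i<n. \<mu> (A i) \<omega>) (\<mu> (\<Union>i. A i)))"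

definition simple_stochastic_integral ::
  "'a measure \<Rightarrow> ('a set \<Rightarrow> 'w \<Rightarrow> real) \<Rightarrow> 'a set \<Rightarrow> ('a \<Rightarrow> real) \<Rightarrow> 'w \<Rightarrow> real" where
  "simple_stochastic_integral B \<mu> A g \<omega> =
     (\<Sum>c\<in>g ` space B. c * \<mu> (A \<inter> (g -` {c} \<inter> space B)) \<omega>)"

definition approximates_stochastic_integrand ::
  "'w measure \<Rightarrow> 'a measure \<Rightarrow> ('a set \<Rightarrow> 'w \<Rightarrow> real) \<Rightarrow> (nat \<Rightarrow> 'a \<Rightarrow> real) \<Rightarrow> ('a \<Rightarrow> real) \<Rightarrow> bool" where
  "approximates_stochastic_integrand M B \<mu> gs g \<longleftrightarrow>
     (\<forall>n. simple_function B (gs n)) \<and>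
     (\<forall>s\<in>space B. (\<lambda>n. gs n s) \<longlonglongrightarrow> g s) \<and>
     (\<forall>A\<in>sets B. \<exists>J\<in>borel_measurable M.
        tendsto_in_probability M (\<lambda>n. simple_stochastic_integral B \<mu> A (gs n)) J)"

definition stochastic_integrable ::
  "'w measure \<Rightarrow> 'a measure \<Rightarrow> ('a set \<Rightarrow> 'w \<Rightarrow> real) \<Rightarrow> ('a \<Rightarrow> real) \<Rightarrow> bool" where
  "stochastic_integrable M B \<mu> g \<longleftrightarrow>
     g \<in> borel_measurable B \<and> (\<exists>gs. approximates_stochastic_integrand M B \<mu> gs g)"

text \<open>
  For a stochastic measure the limit does not depend, up to almost sure equality, on the
  approximating sequence, so \<open>SOME\<close> only selects a representative.
\<close>

definition stochastic_integral ::
  "'w measure \<Rightarrow> 'a measure \<Rightarrow> ('a set \<Rightarrow> 'w \<Rightarrow> real) \<Rightarrow> 'a set \<Rightarrow> ('a \<Rightarrow> real) \<Rightarrow> 'w \<Rightarrow> real" where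
  "stochastic_integral M B \<mu> A g =
     (SOME J. J \<in> borel_measurable M \<and>
        (\<exists>gs. approximates_stochastic_integrand M B \<mu> gs g \<and>
           tendsto_in_probability M (\<lambda>n. simple_stochastic_integral B \<mu> A (gs n)) J))"

definition heat_kernel :: "real \<Rightarrow> real \<Rightarrow> real \<Rightarrow> real" where
  "heat_kernel a t x = 1 / (2 * \<bar>a\<bar> * sqrt (pi * t)) * exp (- (x\<^sup>2 / (4 * a\<^sup>2 * t)))"

definition heat_convolution :: "real \<Rightarrow> real \<Rightarrow> real \<Rightarrow> (real \<Rightarrow> real) \<Rightarrow> real" where
  "heat_convolution a t x g =
     (if t = 0 then g x else (LINT y|lborel. heat_kernel a t (x - y) * g y))"

text \<open>
  Functions on \<open>[0,T]\<close> are total functions whose values off \<open>[0,T]\<close> are never used.  The last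
  integrand is cut off by the indicator of \<open>(0,t]\<close>, so that the meaningless values of
  \<open>heat_convolution\<close> at negative times play no role in its integrability over \<open>[0,T]\<close>.
\<close>

definition mild_solution ::
  "'w measure \<Rightarrow> real \<Rightarrow> real \<Rightarrow> (real set \<Rightarrow> 'w \<Rightarrow> real) \<Rightarrow> (real \<Rightarrow> 'w \<Rightarrow> real) \<Rightarrow>
   (real \<Rightarrow> real \<Rightarrow> real \<Rightarrow> real) \<Rightarrow> (real \<Rightarrow> real \<Rightarrow> real) \<Rightarrow>
   (real \<Rightarrow> real \<Rightarrow> 'w \<Rightarrow> real) \<Rightarrow> bool" where
  "mild_solution M T a \<mu> u0 f \<sigma> u \<longleftrightarrow>
     (\<lambda>(t, x, \<omega>). u t x \<omega>) \<in>
        borel_measurable (restrict_space borel {0..T} \<Otimes>\<^sub>M borel \<Otimes>\<^sub>M M) \<and>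
     (\<forall>t\<in>{0..T}. \<forall>x.
        stochastic_integrable M (restrict_space borel {0..T}) \<mu>
          (\<lambda>s. indicator {0<..t} s * heat_convolution a (t - s) x (\<lambda>y. \<sigma> s y)) \<and>
        (AE \<omega> in M.
           u t x \<omega> =
             heat_convolution a t x (\<lambda>y. u0 y \<omega>)
             + (LINT s:{0..t}|lborel. heat_convolution a (t - s) x (\<lambda>y. f s y (u s y \<omega>)))
             + stochastic_integral M (restrict_space borel {0..T}) \<mu> {0<..t}
                 (\<lambda>s. indicator {0<..t} s * heat_convolution a (t - s) x (\<lambda>y. \<sigma> s y)) \<omega>))"

definition is_version ::
  "'w measure \<Rightarrow> 'i set \<Rightarrow> ('i \<Rightarrow> 'w \<Rightarrow> real) \<Rightarrow> ('i \<Rightarrow> 'w \<Rightarrow> real) \<Rightarrow> bool" where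
  "is_version M I X Y \<longleftrightarrow>
     (\<forall>i\<in>I. Y i \<in> borel_measurable M \<and> (AE \<omega> in M. Y i \<omega> = X i \<omega>))"

definition random_holder :: "'w measure \<Rightarrow> real \<Rightarrow> (real \<Rightarrow> 'w \<Rightarrow> real) \<Rightarrow> bool" where
  "random_holder M \<gamma> g \<longleftrightarrow>
     (\<exists>C\<in>borel_measurable M. \<forall>\<omega>\<in>space M. \<forall>x1 x2.
        \<bar>g x1 \<omega> - g x2 \<omega>\<bar> \<le> C \<omega> * \<bar>x1 - x2\<bar> powr \<gamma>)"

text \<open>Here \<open>m s1 s2\<close> is the chosen representative of \<open>\<mu> (s1, s2]\<close>.\<close>

definition holder_stochastic_measure ::
  "'w measure \<Rightarrow> real \<Rightarrow> (real set \<Rightarrow> 'w \<Rightarrow> real) \<Rightarrow> real \<Rightarrow> bool" where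
  "holder_stochastic_measure M T \<mu> \<beta> \<longleftrightarrow>
     (\<exists>m. \<exists>C\<in>borel_measurable M. \<forall>s1 s2. 0 \<le> s1 \<and> s1 < s2 \<and> s2 \<le> T \<longrightarrow>
        m s1 s2 \<in> borel_measurable M \<and>
        (AE \<omega> in M. m s1 s2 \<omega> = \<mu> {s1<..s2} \<omega>) \<and>
        (\<forall>\<omega>\<in>space M. \<bar>m s1 s2 \<omega>\<bar> \<le> C \<omega> * \<bar>s1 - s2\<bar> powr \<beta>))"

end

theory Submission
  imports Defs
begin

text \<open>
  The integral of a deterministic function against \<open>\<mu>\<close> is controlled by two facts about a
  stochastic measure on a \<open>\<sigma>\<close>-algebra, neither of which needs moments.  Its range is bounded in
  probability; a Paley--Zygmund argument with random signs turns this into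
  \<open>\<Sum>\<^sub>n \<mu>(A\<^sub>n)\<^sup>2 < \<infinity>\<close> almost surely, also for a superposition of partitions with summable
  squared weights.  In particular the increments of \<open>F(t) = \<mu>((0,t])\<close> over the dyadic grids satisfy
  \<open>\<Sum>\<^sub>n 4\<^sup>-\<^sup>n\<^sup>\<epsilon> \<Sum>\<^sub>k (\<Delta>\<^sub>n\<^sub>k F)\<^sup>2 < \<infinity>\<close>.  By a Nikodym type theorem the integral does not depend on the
  approximating simple functions, and it is continuous under uniform convergence of the integrands;
  so the integral of a continuous function is the limit of Riemann--Stieltjes sums along these grids.

  For the integrand \<open>q(s) = \<integral> p(t - s, x - y) \<sigma>(s,y) dy\<close> consecutive Riemann--Stieltjes sums differ
  by a sum of products of increments of \<open>q\<close> and \<open>F\<close>.  The increments of \<open>q\<close> are of order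
  \<open>h\<^sup>\<beta> (t - s)\<^sup>-\<^sup>\<beta>\<^sup>/\<^sup>2\<close> with \<open>\<beta> > 1/2\<close>, hence the Cauchy--Schwarz inequality gives pathwise
  convergence.  Interpolating between this bound and the increments of \<open>q\<close> in \<open>x\<close> or \<open>t\<close> leaves
  every Hoelder exponent below \<open>\<beta> - 1/2\<close>.

  Given the stochastic term, the equation is solved pathwise by Picard iteration; measurability in
  all variables comes from a jointly measurable version of the stochastic term.
\<close>

section \<open>Stochastic measures\<close>

text \<open>The obstacle is that L0 is not locally convex. If \<open>\<mu>\<close> is unbounded on a
  set with probability \<open>d\<close>, then halving the set keeps this on one half only with
  probability \<open>d / 2\<close>, so the usual exhaustion by halving dies out; and a bound on
  indicators gives no bound on their convex combinations. The remedy for both is to let a finite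
  partition act as a whole: the large cell may depend on \<omega>, and averages over random cells or
  signs are exchanged with the probability. Every \<open>\<mu> A\<close> is a class, so almost sure
  relations can be combined only over countably many sets; this is why paths are handled on dyadic
  grids. The margin in the Riemann--Stieltjes estimate is \<open>\<alpha> - 1/2\<close> with
  \<open>\<alpha> = \<beta> - \<gamma>\<close>; half of it is spent on the growth of the quadratic
  sums of \<open>F\<close>, the other half makes the series over the levels converge. The drift
  needs a separate argument: no regularity of the solution in \<open>y\<close> is known beforehand,
  so its smoothness comes from the kernel alone.\<close>

definition l0norm :: "'w measure \<Rightarrow> ('w \<Rightarrow> real) \<Rightarrow> real" where
  "l0norm M X = (LINT \<omega>|M. min 1 \<bar>X \<omega>\<bar>)"

section \<open>Convergence in probability as convergence in a metric\<close>

context prob_space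
begin

lemma l0norm_integrable [simp]:
  fixes X :: "'a \<Rightarrow> real"
  shows "X \<in> borel_measurable M \<Longrightarrow> integrable M (\<lambda>\<omega>. min 1 \<bar>X \<omega>\<bar>)"
  by (intro integrable_const_bound[of _ 1]) auto

lemma l0norm_nonneg [simp]: "0 \<le> l0norm M X"
  unfolding l0norm_def by (rule integral_nonneg_AE) auto

lemma l0norm_mono_AE:
  assumes "X \<in> borel_measurable M" "Y \<in> borel_measurable M" "AE \<omega> in M. \<bar>X \<omega>\<bar> \<le> \<bar>Y \<omega>\<bar>"
  shows "l0norm M X \<le> l0norm M Y"
  unfolding l0norm_def using assms by (intro integral_mono_AE) auto

lemma l0norm_cong_AE:
  assumes "X \<in> borel_measurable M" "Y \<in> borel_measurable M" "AE \<omega> in M. X \<omega> = Y \<omega>"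
  shows "l0norm M X = l0norm M Y"
  using assms by (intro antisym l0norm_mono_AE) auto

lemma l0norm_triangle_AE:
  assumes "X \<in> borel_measurable M" "Y \<in> borel_measurable M" "Z \<in> borel_measurable M"
    "AE \<omega> in M. \<bar>Z \<omega>\<bar> \<le> \<bar>X \<omega>\<bar> + \<bar>Y \<omega>\<bar>"
  shows "l0norm M Z \<le> l0norm M X + l0norm M Y"
proof -
  have "l0norm M Z \<le> (LINT \<omega>|M. min 1 \<bar>X \<omega>\<bar> + min 1 \<bar>Y \<omega>\<bar>)"
    unfolding l0norm_def using assms by (intro integral_mono_AE) (auto elim!: eventually_mono)
  also have "\<dots> = l0norm M X + l0norm M Y"
    unfolding l0norm_def using assms by (subst Bochner_Integration.integral_add) auto
  finally show ?thesis .
qed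

lemma l0norm_minus [simp]: "l0norm M (\<lambda>\<omega>. - X \<omega>) = l0norm M X"
  by (simp add: l0norm_def)

lemma prob_le_l0norm:
  assumes "X \<in> borel_measurable M" "0 < e" "e \<le> 1"
  shows "prob {\<omega>\<in>space M. \<bar>X \<omega>\<bar> > e} \<le> l0norm M X / e"
proof -
  have "e * prob {\<omega>\<in>space M. \<bar>X \<omega>\<bar> > e} = (LINT \<omega>|M. e * indicator {\<omega>\<in>space M. \<bar>X \<omega>\<bar> > e} \<omega>)"
    using assms by simp
  also have "\<dots> \<le> l0norm M X"
    unfolding l0norm_def using assms
    by (intro integral_mono) (auto split: split_indicator simp: less_top[symmetric] emeasure_eq_measure)
  finally show ?thesis using assms by (simp add: field_simps)
qed

lemma l0norm_le_prob:
  assumes "X \<in> borel_measurable M" "0 \<le> e"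
  shows "l0norm M X \<le> e + prob {\<omega>\<in>space M. \<bar>X \<omega>\<bar> > e}"
proof -
  have "l0norm M X \<le> (LINT \<omega>|M. e + indicator {\<omega>\<in>space M. \<bar>X \<omega>\<bar> > e} \<omega>)"
    unfolding l0norm_def using assms
    by (intro integral_mono) (auto split: split_indicator simp: less_top[symmetric] emeasure_eq_measure)
  also have "\<dots> = e + prob {\<omega>\<in>space M. \<bar>X \<omega>\<bar> > e}"
    using assms by (subst Bochner_Integration.integral_add) (auto simp: less_top[symmetric] emeasure_eq_measure prob_space)
  finally show ?thesis .
qed

lemma l0norm_eq_0_AE:
  assumes "X \<in> borel_measurable M" "l0norm M X = 0"
  shows "AE \<omega> in M. X \<omega> = 0"
proof -
  have "AE \<omega> in M. min 1 \<bar>X \<omega>\<bar> = 0"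
    using integral_nonneg_eq_0_iff_AE[OF l0norm_integrable[OF assms(1)]] assms(2)
    unfolding l0norm_def by simp
  then show ?thesis by (rule eventually_mono) (auto simp: min_def split: if_splits)
qed

lemma l0norm_0_AE:
  assumes "AE \<omega> in M. X \<omega> = 0" "X \<in> borel_measurable M"
  shows "l0norm M X = 0"
  using l0norm_cong_AE[OF assms(2) _ assms(1)] by (simp add: l0norm_def)

lemma tendsto_in_probability_iff_l0norm:
  assumes [measurable]: "\<And>n. X n \<in> borel_measurable M" "Y \<in> borel_measurable M"
  shows "tendsto_in_probability M X Y \<longleftrightarrow> (\<lambda>n. l0norm M (\<lambda>\<omega>. X n \<omega> - Y \<omega>)) \<longlonglongrightarrow> 0"
proof
  assume L: "tendsto_in_probability M X Y"
  show "(\<lambda>n. l0norm M (\<lambda>\<omega>. X n \<omega> - Y \<omega>)) \<longlonglongrightarrow> 0"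
  proof (rule LIMSEQ_I)
    fix r :: real assume "r > 0"
    then have "(\<lambda>n. prob {\<omega>\<in>space M. \<bar>X n \<omega> - Y \<omega>\<bar> > r/2}) \<longlonglongrightarrow> 0"
      using L half_gt_zero unfolding tendsto_in_probability_def by blast
    from LIMSEQ_D[OF this, of "r/2"] \<open>r > 0\<close> obtain N where
      N: "\<And>n. n \<ge> N \<Longrightarrow> prob {\<omega>\<in>space M. \<bar>X n \<omega> - Y \<omega>\<bar> > r/2} < r/2" by auto
    show "\<exists>N. \<forall>n\<ge>N. norm (l0norm M (\<lambda>\<omega>. X n \<omega> - Y \<omega>) - 0) < r"
    proof (intro exI[of _ N] allI impI)
      fix n assume "n \<ge> N"
      have "l0norm M (\<lambda>\<omega>. X n \<omega> - Y \<omega>) \<le> r/2 + prob {\<omega>\<in>space M. \<bar>X n \<omega> - Y \<omega>\<bar> > r/2}"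
        using \<open>r>0\<close> by (intro l0norm_le_prob) auto
      then show "norm (l0norm M (\<lambda>\<omega>. X n \<omega> - Y \<omega>) - 0) < r" using N[OF \<open>n \<ge> N\<close>] by simp
    qed
  qed
next
  assume L: "(\<lambda>n. l0norm M (\<lambda>\<omega>. X n \<omega> - Y \<omega>)) \<longlonglongrightarrow> 0"
  show "tendsto_in_probability M X Y"
    unfolding tendsto_in_probability_def
  proof (intro allI impI)
    fix e :: real assume "e > 0"
    define d where "d = min e 1"
    have d: "0 < d" "d \<le> 1" "d \<le> e" using \<open>e > 0\<close> by (auto simp: d_def)
    show "(\<lambda>n. prob {\<omega> \<in> space M. e < \<bar>X n \<omega> - Y \<omega>\<bar>}) \<longlonglongrightarrow> 0"
    proof (rule tendsto_sandwich[OF _ _ tendsto_const])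
      show "\<forall>\<^sub>F n in sequentially. prob {\<omega> \<in> space M. e < \<bar>X n \<omega> - Y \<omega>\<bar>} \<le> l0norm M (\<lambda>\<omega>. X n \<omega> - Y \<omega>) / d"
      proof (rule always_eventually, rule allI)
        fix n
        have "prob {\<omega> \<in> space M. e < \<bar>X n \<omega> - Y \<omega>\<bar>} \<le> prob {\<omega> \<in> space M. d < \<bar>X n \<omega> - Y \<omega>\<bar>}"
          using d by (intro finite_measure_mono) auto
        also have "\<dots> \<le> l0norm M (\<lambda>\<omega>. X n \<omega> - Y \<omega>) / d" using d by (intro prob_le_l0norm) auto
        finally show "prob {\<omega> \<in> space M. e < \<bar>X n \<omega> - Y \<omega>\<bar>} \<le> l0norm M (\<lambda>\<omega>. X n \<omega> - Y \<omega>) / d" .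
      qed
      show "(\<lambda>n. l0norm M (\<lambda>\<omega>. X n \<omega> - Y \<omega>) / d) \<longlonglongrightarrow> 0" using tendsto_divide[OF L tendsto_const[of d]] d by simp
    qed auto
  qed
qed

text \<open>The series of truncated terms has finite expectation, hence converges almost surely; its
  terms then tend to 0, so the truncation at 1 is eventually inactive.\<close>

lemma l0norm_summable_AE:
  assumes [measurable]: "\<And>n. X n \<in> borel_measurable M" and s: "summable (\<lambda>n. l0norm M (X n))"
  shows "AE \<omega> in M. summable (\<lambda>n. \<bar>X n \<omega>\<bar>)"
proof -
  have "(\<integral>\<^sup>+\<omega>. (\<Sum>n. ennreal (min 1 \<bar>X n \<omega>\<bar>)) \<partial>M) = (\<Sum>n. \<integral>\<^sup>+\<omega>. ennreal (min 1 \<bar>X n \<omega>\<bar>) \<partial>M)"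
    by (rule nn_integral_suminf) auto
  also have "\<dots> = (\<Sum>n. ennreal (l0norm M (X n)))"
    unfolding l0norm_def by (subst nn_integral_eq_integral) auto
  also have "\<dots> = ennreal (\<Sum>n. l0norm M (X n))" using s by (intro suminf_ennreal2) auto
  finally have "(\<integral>\<^sup>+\<omega>. (\<Sum>n. ennreal (min 1 \<bar>X n \<omega>\<bar>)) \<partial>M) \<noteq> \<infinity>" by simp
  then have "AE \<omega> in M. (\<Sum>n. ennreal (min 1 \<bar>X n \<omega>\<bar>)) \<noteq> \<infinity>" by (intro nn_integral_PInf_AE) auto
  then show ?thesis
  proof eventually_elim
    case (elim \<omega>)
    then have su: "summable (\<lambda>n. min 1 \<bar>X n \<omega>\<bar>)" by (intro summable_suminf_not_top) auto
    from summable_LIMSEQ_zero[OF su] have "\<forall>\<^sub>F n in sequentially. min 1 \<bar>X n \<omega>\<bar> < 1"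
      by (rule order_tendstoD) simp
    then have "\<forall>\<^sub>F n in sequentially. min 1 \<bar>X n \<omega>\<bar> = \<bar>X n \<omega>\<bar>" by eventually_elim auto
    from summable_cong[OF this] su show ?case by simp
  qed
qed

lemma l0norm_convergent_AE:
  assumes [measurable]: "\<And>n. X n \<in> borel_measurable M"
    and s: "summable (\<lambda>n. l0norm M (\<lambda>\<omega>. X (Suc n) \<omega> - X n \<omega>))"
  shows "AE \<omega> in M. convergent (\<lambda>n. X n \<omega>)"
proof -
  have "AE \<omega> in M. summable (\<lambda>n. \<bar>X (Suc n) \<omega> - X n \<omega>\<bar>)"
    by (rule l0norm_summable_AE[OF _ s]) auto
  then show ?thesis
  proof eventually_elim
    case (elim \<omega>)
    then have "summable (\<lambda>n. X (Suc n) \<omega> - X n \<omega>)" by (rule summable_rabs_cancel)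
    then have "(\<lambda>n. \<Sum>i<n. X (Suc i) \<omega> - X i \<omega>) \<longlonglongrightarrow> (\<Sum>n. X (Suc n) \<omega> - X n \<omega>)"
      by (rule summable_LIMSEQ)
    then have "(\<lambda>n. X n \<omega> - X 0 \<omega>) \<longlonglongrightarrow> (\<Sum>n. X (Suc n) \<omega> - X n \<omega>)"
      using sum_lessThan_telescope[of "\<lambda>n. X n \<omega>"] by simp
    from tendsto_add[OF this tendsto_const[of "X 0 \<omega>"]] show ?case by (auto simp: convergent_def)
  qed
qed

lemma l0norm_tendsto_AE:
  assumes [measurable]: "\<And>n. X n \<in> borel_measurable M" "Y \<in> borel_measurable M"
    and c: "AE \<omega> in M. (\<lambda>n. X n \<omega>) \<longlonglongrightarrow> Y \<omega>"
  shows "(\<lambda>n. l0norm M (\<lambda>\<omega>. X n \<omega> - Y \<omega>)) \<longlonglongrightarrow> 0"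
proof -
  have "(\<lambda>n. LINT \<omega>|M. min 1 \<bar>X n \<omega> - Y \<omega>\<bar>) \<longlonglongrightarrow> (LINT \<omega>|M. 0::real)"
  proof (rule integral_dominated_convergence[where w="\<lambda>_. 1"])
    show "AE \<omega> in M. (\<lambda>n. min 1 \<bar>X n \<omega> - Y \<omega>\<bar>) \<longlonglongrightarrow> 0"
      using c
    proof eventually_elim
      case (elim \<omega>)
      have "(\<lambda>n. min 1 \<bar>X n \<omega> - Y \<omega>\<bar>) \<longlonglongrightarrow> min 1 \<bar>Y \<omega> - Y \<omega>\<bar>"
        by (intro tendsto_intros elim)
      then show ?case by simp
    qed
  qed auto
  then show ?thesis by (simp add: l0norm_def)
qed

lemma l0norm_unique:
  assumes [measurable]: "\<And>n. X n \<in> borel_measurable M" "Y \<in> borel_measurable M" "Z \<in> borel_measurable M"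
    and "(\<lambda>n. l0norm M (\<lambda>\<omega>. X n \<omega> - Y \<omega>)) \<longlonglongrightarrow> 0" "(\<lambda>n. l0norm M (\<lambda>\<omega>. X n \<omega> - Z \<omega>)) \<longlonglongrightarrow> 0"
  shows "AE \<omega> in M. Y \<omega> = Z \<omega>"
proof -
  have "l0norm M (\<lambda>\<omega>. Y \<omega> - Z \<omega>) \<le> l0norm M (\<lambda>\<omega>. X n \<omega> - Y \<omega>) + l0norm M (\<lambda>\<omega>. X n \<omega> - Z \<omega>)" for n
    by (rule l0norm_triangle_AE) auto
  moreover have "(\<lambda>n. l0norm M (\<lambda>\<omega>. X n \<omega> - Y \<omega>) + l0norm M (\<lambda>\<omega>. X n \<omega> - Z \<omega>)) \<longlonglongrightarrow> 0"
    using tendsto_add[OF assms(4,5)] by simp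
  ultimately have "l0norm M (\<lambda>\<omega>. Y \<omega> - Z \<omega>) \<le> 0"
    by (intro LIMSEQ_le_const) auto
  then have "l0norm M (\<lambda>\<omega>. Y \<omega> - Z \<omega>) = 0" using l0norm_nonneg by (intro antisym) auto
  then have "AE \<omega> in M. Y \<omega> - Z \<omega> = 0" by (intro l0norm_eq_0_AE) auto
  then show ?thesis by simp
qed

text \<open>Riesz argument: a subsequence with summable increments converges almost surely, and its
  limit serves the whole Cauchy sequence.\<close>

lemma l0norm_complete:
  assumes [measurable]: "\<And>n. X n \<in> borel_measurable M"
    and c: "\<And>e. e > 0 \<Longrightarrow> \<exists>N. \<forall>n\<ge>N. \<forall>m\<ge>N. l0norm M (\<lambda>\<omega>. X n \<omega> - X m \<omega>) < e"
  shows "\<exists>Y\<in>borel_measurable M. (\<lambda>n. l0norm M (\<lambda>\<omega>. X n \<omega> - Y \<omega>)) \<longlonglongrightarrow> 0"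
proof -
  have "\<exists>N. \<forall>n\<ge>N. \<forall>m\<ge>N. l0norm M (\<lambda>\<omega>. X n \<omega> - X m \<omega>) < (1/2)^k" for k :: nat
    using c[of "(1/2)^k"] by simp
  then obtain N where N: "\<And>k n m. n \<ge> N k \<Longrightarrow> m \<ge> N k \<Longrightarrow> l0norm M (\<lambda>\<omega>. X n \<omega> - X m \<omega>) < (1/2)^k"
    by metis
  \<comment> \<open>Adding up the \<open>N i\<close> makes the subsequence indices monotone while
    keeping each above \<open>N k\<close>.\<close>
  define r where "r k = (\<Sum>i\<le>k. N i)" for k
  have r1: "N k \<le> r k" for k unfolding r_def by (simp add: member_le_sum)
  have r2: "r k \<le> r (Suc k)" for k unfolding r_def by simp
  have "AE \<omega> in M. convergent (\<lambda>k. X (r k) \<omega>)"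
  proof (rule l0norm_convergent_AE)
    show "summable (\<lambda>n. l0norm M (\<lambda>\<omega>. X (r (Suc n)) \<omega> - X (r n) \<omega>))"
    proof (rule summable_comparison_test')
      show "summable (\<lambda>n. (1/2::real)^n)" by (rule summable_geometric) simp
      fix n
      show "norm (l0norm M (\<lambda>\<omega>. X (r (Suc n)) \<omega> - X (r n) \<omega>)) \<le> (1/2)^n"
        using N[of n "r (Suc n)" "r n"] r1[of n] r2[of n] by simp
    qed
  qed auto
  then have ae: "AE \<omega> in M. (\<lambda>k. X (r k) \<omega>) \<longlonglongrightarrow> lim (\<lambda>k. X (r k) \<omega>)"
    by (simp add: convergent_LIMSEQ_iff)
  define Y where "Y \<omega> = lim (\<lambda>k. X (r k) \<omega>)" for \<omega>
  have Ym[measurable]: "Y \<in> borel_measurable M" unfolding Y_def by measurable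
  have conv: "(\<lambda>k. l0norm M (\<lambda>\<omega>. X (r k) \<omega> - Y \<omega>)) \<longlonglongrightarrow> 0"
    using ae by (intro l0norm_tendsto_AE) (auto simp: Y_def[symmetric])
  show ?thesis
  proof (intro bexI[OF _ Ym] LIMSEQ_I)
    fix e :: real assume "e > 0"
    obtain k0 where k0: "(1/2::real)^k0 < e/2" using real_arch_pow_inv[of "e/2" "1/2"] \<open>e > 0\<close> by auto
    from LIMSEQ_D[OF conv, of "e/2"] \<open>e > 0\<close> obtain k1 where
      k1: "\<And>k. k \<ge> k1 \<Longrightarrow> l0norm M (\<lambda>\<omega>. X (r k) \<omega> - Y \<omega>) < e/2" by auto
    define k where "k = max k0 k1"
    have rk: "r k \<ge> N k0"
    proof -
      have "r k0 \<le> r k" unfolding k_def by (rule lift_Suc_mono_le[of r, OF r2]) simp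
      then show ?thesis using r1[of k0] by simp
    qed
    show "\<exists>no. \<forall>n\<ge>no. norm (l0norm M (\<lambda>\<omega>. X n \<omega> - Y \<omega>) - 0) < e"
    proof (intro exI[of _ "N k0"] allI impI)
      fix n assume n: "n \<ge> N k0"
      have "l0norm M (\<lambda>\<omega>. X n \<omega> - Y \<omega>) \<le> l0norm M (\<lambda>\<omega>. X n \<omega> - X (r k) \<omega>) + l0norm M (\<lambda>\<omega>. X (r k) \<omega> - Y \<omega>)"
        by (rule l0norm_triangle_AE) auto
      also have "\<dots> < (1/2)^k0 + e/2" using N[OF n rk] k1[of k] by (simp add: k_def)
      finally show "norm (l0norm M (\<lambda>\<omega>. X n \<omega> - Y \<omega>) - 0) < e" using k0 by simp
    qed
  qed
qed

end

section \<open>Additivity and continuity of a stochastic measure\<close>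

locale stoch_measure = prob_space M for M :: "'w measure" +
  fixes B :: "'a measure" and \<mu> :: "'a set \<Rightarrow> 'w \<Rightarrow> real"
  assumes stochastic_measure: "stochastic_measure M B \<mu>"
begin

lemma mu_measurable [measurable, simp]: "A \<in> sets B \<Longrightarrow> \<mu> A \<in> borel_measurable M"
  using stochastic_measure by (simp add: stochastic_measure_def)

lemma mu_sigma:
  assumes "range A \<subseteq> sets B" "disjoint_family A"
  shows "(\<lambda>n. l0norm M (\<lambda>\<omega>. (\<Sum>i<n. \<mu> (A i) \<omega>) - \<mu> (\<Union>i. A i) \<omega>)) \<longlonglongrightarrow> 0"
proof -
  have [measurable]: "\<And>i. A i \<in> sets B" using assms by auto
  have "tendsto_in_probability M (\<lambda>n \<omega>. \<Sum>i<n. \<mu> (A i) \<omega>) (\<mu> (\<Union>i. A i))"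
    using stochastic_measure assms by (simp add: stochastic_measure_def)
  then show ?thesis
    by (subst (asm) tendsto_in_probability_iff_l0norm) auto
qed

text \<open>For the constant sequence of empty sets the error in \<sigma>-additivity is
  \<open>(n - 1) * \<mu> {}\<close>; it tends to 0 and dominates \<open>\<mu> {}\<close> from
  \<open>n = 2\<close> on.\<close>

lemma mu_empty: "AE \<omega> in M. \<mu> {} \<omega> = 0"
proof -
  have L: "(\<lambda>n. l0norm M (\<lambda>\<omega>. (\<Sum>i<n. \<mu> {} \<omega>) - \<mu> (\<Union>i::nat. {}) \<omega>)) \<longlonglongrightarrow> 0"
    by (rule mu_sigma) (auto simp: disjoint_family_on_def)
  have "l0norm M (\<mu> {}) \<le> l0norm M (\<lambda>\<omega>. (\<Sum>i<n. \<mu> {} \<omega>) - \<mu> (\<Union>i::nat. {}) \<omega>)" if "n \<ge> 2" for n :: nat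
  proof (rule l0norm_mono_AE)
    show "AE \<omega> in M. \<bar>\<mu> {} \<omega>\<bar> \<le> \<bar>(\<Sum>i<n. \<mu> {} \<omega>) - \<mu> (\<Union>i::nat. {}) \<omega>\<bar>"
    proof (rule AE_I2)
      fix \<omega>
      have "(\<Sum>i<n. \<mu> {} \<omega>) - \<mu> (\<Union>i::nat. {}) \<omega> = (real n - 1) * \<mu> {} \<omega>"
        by (simp add: algebra_simps)
      then have "\<bar>(\<Sum>i<n. \<mu> {} \<omega>) - \<mu> (\<Union>i::nat. {}) \<omega>\<bar> = (real n - 1) * \<bar>\<mu> {} \<omega>\<bar>"
        using that by (simp add: abs_mult)
      moreover have "1 * \<bar>\<mu> {} \<omega>\<bar> \<le> (real n - 1) * \<bar>\<mu> {} \<omega>\<bar>" using that by (intro mult_right_mono) auto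
      ultimately show "\<bar>\<mu> {} \<omega>\<bar> \<le> \<bar>(\<Sum>i<n. \<mu> {} \<omega>) - \<mu> (\<Union>i::nat. {}) \<omega>\<bar>" by simp
    qed
  qed auto
  then have "l0norm M (\<mu> {}) \<le> 0"
    by (intro LIMSEQ_le_const[OF L] exI[of _ 2]) simp
  then show ?thesis by (intro l0norm_eq_0_AE antisym) auto
qed

text \<open>Countable additivity padded with empty sets. Each such identity holds only almost
  surely, with a null set that depends on the sets involved.\<close>

lemma mu_Un:
  assumes [measurable]: "A \<in> sets B" "C \<in> sets B" and d: "A \<inter> C = {}"
  shows "AE \<omega> in M. \<mu> (A \<union> C) \<omega> = \<mu> A \<omega> + \<mu> C \<omega>"
proof -
  define D where "D n = (if n = 0 then A else if n = 1 then C else {})" for n :: nat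
  have U: "(\<Union>i. D i) = A \<union> C"
  proof
    show "A \<union> C \<subseteq> (\<Union>i. D i)"
    proof
      fix x assume "x \<in> A \<union> C"
      then have "x \<in> D 0 \<or> x \<in> D 1" by (auto simp: D_def)
      then show "x \<in> (\<Union>i. D i)" by blast
    qed
  qed (auto simp: D_def split: if_splits)
  have L: "(\<lambda>n. l0norm M (\<lambda>\<omega>. (\<Sum>i<n. \<mu> (D i) \<omega>) - \<mu> (\<Union>i. D i) \<omega>)) \<longlonglongrightarrow> 0"
    using d by (intro mu_sigma) (auto simp: disjoint_family_on_def D_def)
  have "l0norm M (\<lambda>\<omega>. \<mu> A \<omega> + \<mu> C \<omega> - \<mu> (A \<union> C) \<omega>) = l0norm M (\<lambda>\<omega>. (\<Sum>i<n. \<mu> (D i) \<omega>) - \<mu> (\<Union>i. D i) \<omega>)"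
    if "n \<ge> 2" for n
  proof (rule l0norm_cong_AE)
    have [measurable]: "D i \<in> sets B" for i by (simp add: D_def)
    show "(\<lambda>\<omega>. (\<Sum>i<n. \<mu> (D i) \<omega>) - \<mu> (\<Union>i. D i) \<omega>) \<in> borel_measurable M" by auto
    show "AE \<omega> in M. \<mu> A \<omega> + \<mu> C \<omega> - \<mu> (A \<union> C) \<omega> = (\<Sum>i<n. \<mu> (D i) \<omega>) - \<mu> (\<Union>i. D i) \<omega>"
      using mu_empty
    proof eventually_elim
      case (elim \<omega>)
      have "{..<n} = {0,1} \<union> {2..<n}" using that by auto
      then have "(\<Sum>i<n. \<mu> (D i) \<omega>) = (\<Sum>i\<in>{0,1}. \<mu> (D i) \<omega>) + (\<Sum>i\<in>{2..<n}. \<mu> (D i) \<omega>)"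
        by (simp add: sum.union_disjoint)
      also have "(\<Sum>i\<in>{2..<n}. \<mu> (D i) \<omega>) = 0" using elim by (intro sum.neutral) (auto simp: D_def)
      finally show ?case using U by (simp add: D_def)
    qed
  qed auto
  then have "l0norm M (\<lambda>\<omega>. \<mu> A \<omega> + \<mu> C \<omega> - \<mu> (A \<union> C) \<omega>) \<le> 0"
    by (intro LIMSEQ_le_const[OF L] exI[of _ 2]) simp
  then have "AE \<omega> in M. \<mu> A \<omega> + \<mu> C \<omega> - \<mu> (A \<union> C) \<omega> = 0" by (intro l0norm_eq_0_AE antisym) auto
  then show ?thesis by eventually_elim simp
qed

lemma mu_Diff:
  assumes [measurable]: "A \<in> sets B" "C \<in> sets B"
  shows "AE \<omega> in M. \<mu> A \<omega> = \<mu> (A \<inter> C) \<omega> + \<mu> (A - C) \<omega>"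
proof -
  have "A = (A \<inter> C) \<union> (A - C)" by auto
  then show ?thesis using mu_Un[of "A \<inter> C" "A - C"] by auto
qed

lemma mu_UN:
  assumes "finite I" "\<And>i. i \<in> I \<Longrightarrow> C i \<in> sets B" "disjoint_family_on C I"
  shows "AE \<omega> in M. \<mu> (\<Union>i\<in>I. C i) \<omega> = (\<Sum>i\<in>I. \<mu> (C i) \<omega>)"
  using assms
proof (induction I)
  case empty then show ?case using mu_empty by simp
next
  case (insert i I)
  have "AE \<omega> in M. \<mu> (\<Union>i\<in>I. C i) \<omega> = (\<Sum>i\<in>I. \<mu> (C i) \<omega>)"
    using insert by (intro insert.IH) (auto simp: disjoint_family_on_def)
  moreover have "AE \<omega> in M. \<mu> (C i \<union> (\<Union>i\<in>I. C i)) \<omega> = \<mu> (C i) \<omega> + \<mu> (\<Union>i\<in>I. C i) \<omega>"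
    using insert.prems insert.hyps by (intro mu_Un) (auto simp: disjoint_family_on_def)
  ultimately show ?case by eventually_elim (use insert.hyps in simp)
qed

text \<open>A single value is the difference of two consecutive errors of the partial sums. This is
  the source of the contradictions below: disjoint sets cannot all have values bounded away from 0
  in probability.\<close>

lemma mu_disjoint_null:
  assumes "range A \<subseteq> sets B" "disjoint_family A"
  shows "(\<lambda>n. l0norm M (\<mu> (A n))) \<longlonglongrightarrow> 0"
proof -
  have m[measurable]: "A i \<in> sets B" for i using assms by auto
  let ?e = "\<lambda>n. l0norm M (\<lambda>\<omega>. (\<Sum>i<n. \<mu> (A i) \<omega>) - \<mu> (\<Union>i. A i) \<omega>)"
  have "(\<lambda>n. ?e (Suc n) + ?e n) \<longlonglongrightarrow> 0"
    using tendsto_add[OF LIMSEQ_Suc[OF mu_sigma[OF assms]] mu_sigma[OF assms]] by simp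
  then show ?thesis
  proof (rule tendsto_sandwich[OF _ _ tendsto_const, rotated 2])
    show "\<forall>\<^sub>F n in sequentially. l0norm M (\<mu> (A n)) \<le> ?e (Suc n) + ?e n"
      by (intro always_eventually allI l0norm_triangle_AE) auto
  qed auto
qed

text \<open>\<open>A n\<close> carries exactly the remainder of the series over the differences
  \<open>A i - A (Suc i)\<close>, so its value is minus the error in \<sigma>-additivity.\<close>

lemma mu_decseq_null:
  assumes "range A \<subseteq> sets B" "decseq A" "(\<Inter>i. A i) = {}"
  shows "(\<lambda>n. l0norm M (\<mu> (A n))) \<longlonglongrightarrow> 0"
proof -
  have m[measurable]: "A i \<in> sets B" for i using assms by auto
  define D where "D n = A n - A (Suc n)" for n
  have Dm[measurable]: "D i \<in> sets B" for i by (simp add: D_def)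
  have dis: "disjoint_family D"
    unfolding disjoint_family_on_def
  proof (intro ballI impI)
    have "D m \<inter> D n = {}" if "m < n" for m n
      using decseqD[OF assms(2), of "Suc m" n] that by (auto simp: D_def)
    then show "D m \<inter> D n = {}" if "m \<noteq> n" for m n
      using that by (metis Int_commute linorder_neqE_nat)
  qed
  have part: "A 0 = (\<Union>i<n. D i) \<union> A n" for n
  proof (induction n)
    case (Suc n)
    have "A n = D n \<union> A (Suc n)" using decseqD[OF assms(2), of n "Suc n"] by (auto simp: D_def)
    then show ?case using Suc by (auto simp: lessThan_Suc)
  qed simp
  have U: "(\<Union>i. D i) = A 0"
  proof
    show "(\<Union>i. D i) \<subseteq> A 0" using decseqD[OF assms(2), of 0] by (auto simp: D_def)
    show "A 0 \<subseteq> (\<Union>i. D i)"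
    proof
      fix x assume "x \<in> A 0"
      obtain n where "x \<notin> A n" using assms(3) by auto
      then show "x \<in> (\<Union>i. D i)" using part[of n] \<open>x \<in> A 0\<close> by auto
    qed
  qed
  have "l0norm M (\<mu> (A n)) = l0norm M (\<lambda>\<omega>. (\<Sum>i<n. \<mu> (D i) \<omega>) - \<mu> (\<Union>i. D i) \<omega>)" for n
  proof -
    have d2: "(\<Union>i<n. D i) \<inter> A n = {}"
    proof -
      have "D i \<inter> A n = {}" if "i < n" for i
        using decseqD[OF assms(2), of "Suc i" n] that by (auto simp: D_def)
      then show ?thesis by auto
    qed
    have "AE \<omega> in M. \<mu> (A 0) \<omega> = \<mu> (\<Union>i<n. D i) \<omega> + \<mu> (A n) \<omega>"
      using mu_Un[of "\<Union>i<n. D i" "A n"] d2 part[of n] by auto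
    moreover have "AE \<omega> in M. \<mu> (\<Union>i<n. D i) \<omega> = (\<Sum>i<n. \<mu> (D i) \<omega>)"
      using dis by (intro mu_UN) (auto simp: disjoint_family_on_def)
    ultimately have "AE \<omega> in M. - \<mu> (A n) \<omega> = (\<Sum>i<n. \<mu> (D i) \<omega>) - \<mu> (\<Union>i. D i) \<omega>"
      by eventually_elim (simp add: U)
    then show ?thesis by (subst l0norm_minus[symmetric]) (rule l0norm_cong_AE, auto)
  qed
  moreover have "range D \<subseteq> sets B" by auto
  ultimately show ?thesis using mu_sigma[OF _ dis] by simp
qed

end

section \<open>Random signs\<close>

text \<open>Expectation of \<open>f\<close> over a random subset of \<open>I\<close> that contains
  each \<open>i\<close> independently with probability \<open>p i\<close>. A finite sum takes the
  place of a product probability space, so exchanging it with the expectation over \<omega> is mere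
  linearity.\<close>

definition bsum :: "'i set \<Rightarrow> ('i \<Rightarrow> real) \<Rightarrow> ('i set \<Rightarrow> real) \<Rightarrow> real" where
  "bsum I p f = (\<Sum>S\<in>Pow I. (\<Prod>i\<in>I. if i \<in> S then p i else 1 - p i) * f S)"

text \<open>Membership in \<open>S\<close> encodes the sign +1. Under \<open>bsum\<close> with
  weights \<open>p\<close> the signs are independent with mean \<open>2 * p i - 1\<close>.\<close>

definition signsum :: "'i set \<Rightarrow> 'i set \<Rightarrow> ('i \<Rightarrow> real) \<Rightarrow> real" where
  "signsum I S x = (\<Sum>i\<in>I. if i \<in> S then x i else - x i)"

lemma bsum_empty [simp]: "bsum {} p f = f {}"
  by (simp add: bsum_def)

text \<open>Conditioning on the membership of \<open>i\<close>; the moment computations below are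
  inductions along this recursion.\<close>

lemma bsum_insert:
  assumes "finite I" "i \<notin> I"
  shows "bsum (insert i I) p f = p i * bsum I p (\<lambda>S. f (insert i S)) + (1 - p i) * bsum I p f"
proof -
  let ?w = "\<lambda>I S. \<Prod>i\<in>I. if i \<in> S then p i else 1 - p i"
  have inj: "inj_on (insert i) (Pow I)" using assms by (auto simp: inj_on_def)
  have "bsum (insert i I) p f = (\<Sum>S\<in>Pow I. ?w (insert i I) S * f S) + (\<Sum>S\<in>insert i ` Pow I. ?w (insert i I) S * f S)"
    unfolding bsum_def Pow_insert using assms by (intro sum.union_disjoint) auto
  also have "(\<Sum>S\<in>insert i ` Pow I. ?w (insert i I) S * f S) = (\<Sum>S\<in>Pow I. p i * (?w I S * f (insert i S)))"
    unfolding sum.reindex[OF inj] o_def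
  proof (intro sum.cong refl)
    fix S assume "S \<in> Pow I"
    have "?w I (insert i S) = ?w I S" using assms by (intro prod.cong) auto
    then show "?w (insert i I) (insert i S) * f (insert i S) = p i * (?w I S * f (insert i S))"
      using assms by simp
  qed
  also have "(\<Sum>S\<in>Pow I. ?w (insert i I) S * f S) = (\<Sum>S\<in>Pow I. (1 - p i) * (?w I S * f S))"
    using assms by (intro sum.cong) auto
  finally show ?thesis by (simp add: bsum_def sum_distrib_left)
qed

lemma bsum_add: "bsum I p (\<lambda>S. f S + g S) = bsum I p f + bsum I p g"
  by (simp add: bsum_def distrib_left sum.distrib)

lemma bsum_cmult: "bsum I p (\<lambda>S. c * f S) = c * bsum I p f"
  by (simp add: bsum_def sum_distrib_left mult_ac)

lemma bsum_const [simp]: "finite I \<Longrightarrow> bsum I p (\<lambda>S. c) = c"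
  by (induction I rule: finite_induct) (auto simp: bsum_insert algebra_simps)

lemma bsum_nonneg:
  assumes p: "\<And>i. i \<in> I \<Longrightarrow> 0 \<le> p i \<and> p i \<le> 1" and f: "\<And>S. S \<subseteq> I \<Longrightarrow> 0 \<le> f S"
  shows "0 \<le> bsum I p f"
  unfolding bsum_def
proof (rule sum_nonneg)
  fix S assume "S \<in> Pow I"
  have "0 \<le> (\<Prod>i\<in>I. if i \<in> S then p i else 1 - p i)" using p by (intro prod_nonneg) simp
  then show "0 \<le> (\<Prod>i\<in>I. if i \<in> S then p i else 1 - p i) * f S"
    using f \<open>S \<in> Pow I\<close> by simp
qed

lemma bsum_mono:
  assumes p: "\<And>i. i \<in> I \<Longrightarrow> 0 \<le> p i \<and> p i \<le> 1" and f: "\<And>S. S \<subseteq> I \<Longrightarrow> f S \<le> g S"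
  shows "bsum I p f \<le> bsum I p g"
proof -
  have "0 \<le> bsum I p (\<lambda>S. g S + (-1) * f S)" by (rule bsum_nonneg[OF p]) (use f in auto)
  then show ?thesis by (simp only: bsum_add bsum_cmult)
qed

lemma bsum_cong: "(\<And>S. S \<subseteq> I \<Longrightarrow> f S = g S) \<Longrightarrow> bsum I p f = bsum I p g"
  unfolding bsum_def by (intro sum.cong) auto

lemma bsum_ge_exists:
  assumes "finite I" "\<And>i. i \<in> I \<Longrightarrow> 0 \<le> p i \<and> p i \<le> 1" "c \<le> bsum I p f"
  shows "\<exists>S\<subseteq>I. c \<le> f S"
proof (rule ccontr)
  assume "\<not> ?thesis"
  then have *: "f S < c" if "S \<subseteq> I" for S using that by (simp add: not_le)
  define d where "d = Max (f ` Pow I)"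
  have dI: "d \<in> f ` Pow I" unfolding d_def using assms(1) by (intro Max_in) auto
  then obtain S where "S \<subseteq> I" "d = f S" by auto
  then have "d < c" using *[of S] by simp
  have "bsum I p f \<le> bsum I p (\<lambda>_. d)"
    by (rule bsum_mono[OF assms(2)]) (use assms(1) in \<open>auto simp: d_def intro!: Max_ge\<close>)
  then show False using assms(1,3) \<open>d < c\<close> by simp
qed

lemma bsum_member: "finite I \<Longrightarrow> i0 \<in> I \<Longrightarrow> bsum I p (\<lambda>S. if i0 \<in> S then 1 else 0) = p i0"
proof (induction I rule: finite_induct)
  case (insert i I)
  show ?case
  proof (cases "i0 = i")
    case True
    have "bsum I p (\<lambda>S. if i0 \<in> S then 1 else 0) = bsum I p (\<lambda>S. 0)"
      using True insert by (intro bsum_cong) auto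
    then show ?thesis using True insert by (simp add: bsum_insert)
  next
    case False
    then have "i0 \<in> I" using insert by auto
    then show ?thesis using False insert by (simp add: bsum_insert algebra_simps)
  qed
qed simp

lemma signsum_insert:
  assumes "finite I" "i \<notin> I" "S \<subseteq> I"
  shows "signsum (insert i I) (insert i S) x = x i + signsum I S x"
    "signsum (insert i I) S x = - x i + signsum I S x"
proof -
  have "(\<Sum>j\<in>I. if j = i \<or> j \<in> S then x j else - x j) = signsum I S x"
    unfolding signsum_def using assms by (intro sum.cong) auto
  then show "signsum (insert i I) (insert i S) x = x i + signsum I S x"
    using assms by (simp add: signsum_def)
  show "signsum (insert i I) S x = - x i + signsum I S x"
    using assms by (auto simp: signsum_def)
qed

text \<open>Squared mean plus variance: a sign with mean \<open>2 * p i - 1\<close> has variance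
  \<open>4 * p i * (1 - p i)\<close>. The shift \<open>a\<close> is free so that the induction can
  absorb one more term into it.\<close>

lemma bsum_variance:
  assumes "finite I"
  shows "bsum I p (\<lambda>S. (a + signsum I S x)\<^sup>2) =
     (a + (\<Sum>i\<in>I. (2 * p i - 1) * x i))\<^sup>2 + (\<Sum>i\<in>I. 4 * p i * (1 - p i) * (x i)\<^sup>2)"
  using assms
proof (induction I arbitrary: a rule: finite_induct)
  case empty then show ?case by (simp add: signsum_def)
next
  case (insert i I)
  have 1: "bsum I p (\<lambda>S. (a + signsum (insert i I) (insert i S) x)\<^sup>2) = bsum I p (\<lambda>S. ((a + x i) + signsum I S x)\<^sup>2)"
    using insert by (intro bsum_cong) (auto simp: signsum_insert algebra_simps)
  have 2: "bsum I p (\<lambda>S. (a + signsum (insert i I) S x)\<^sup>2) = bsum I p (\<lambda>S. ((a - x i) + signsum I S x)\<^sup>2)"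
    using insert by (intro bsum_cong) (auto simp: signsum_insert algebra_simps)
  show ?case
    unfolding bsum_insert[OF insert.hyps(1,2)] 1 2 insert.IH
    using insert.hyps by (simp add: algebra_simps power2_eq_square)
qed

text \<open>The bound is the fourth moment of \<open>a\<close> plus a centred Gaussian variable of
  the same variance. This form is stable under one more sign, up to the negative term
  \<open>- 2 * (x i)^4\<close>.\<close>

lemma bsum_fourth_moment:
  assumes "finite I"
  shows "bsum I (\<lambda>_. 1/2) (\<lambda>S. (a + signsum I S x)^4) \<le>
     a^4 + 6 * a\<^sup>2 * (\<Sum>i\<in>I. (x i)\<^sup>2) + 3 * (\<Sum>i\<in>I. (x i)\<^sup>2)\<^sup>2"
  using assms
proof (induction I arbitrary: a rule: finite_induct)
  case empty then show ?case by (simp add: signsum_def)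
next
  case (insert i I)
  define V where "V = (\<Sum>i\<in>I. (x i)\<^sup>2)"
  have "V \<ge> 0" unfolding V_def by (intro sum_nonneg) auto
  have 1: "bsum I (\<lambda>_. 1/2) (\<lambda>S. (a + signsum (insert i I) (insert i S) x)^4) = bsum I (\<lambda>_. 1/2) (\<lambda>S. ((a + x i) + signsum I S x)^4)"
    using insert by (intro bsum_cong) (auto simp: signsum_insert algebra_simps)
  have 2: "bsum I (\<lambda>_. 1/2) (\<lambda>S. (a + signsum (insert i I) S x)^4) = bsum I (\<lambda>_. 1/2) (\<lambda>S. ((a - x i) + signsum I S x)^4)"
    using insert by (intro bsum_cong) (auto simp: signsum_insert algebra_simps)
  have "bsum (insert i I) (\<lambda>_. 1/2) (\<lambda>S. (a + signsum (insert i I) S x)^4) \<le>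
    1/2 * ((a + x i)^4 + 6 * (a + x i)\<^sup>2 * V + 3 * V\<^sup>2) + (1 - 1/2) * ((a - x i)^4 + 6 * (a - x i)\<^sup>2 * V + 3 * V\<^sup>2)"
    unfolding bsum_insert[OF insert.hyps(1,2)] 1 2 V_def
    by (intro add_mono mult_left_mono insert.IH) auto
  also have "\<dots> = a^4 + 6 * a\<^sup>2 * ((x i)\<^sup>2 + V) + 3 * ((x i)\<^sup>2 + V)\<^sup>2 - 2 * (x i)^4"
    by (simp add: algebra_simps power2_eq_square power4_eq_xxxx)
  also have "\<dots> \<le> a^4 + 6 * a\<^sup>2 * ((x i)\<^sup>2 + V) + 3 * ((x i)\<^sup>2 + V)\<^sup>2" by simp
  finally show ?case using insert.hyps by (simp add: V_def)
qed

text \<open>Paley--Zygmund: the fourth moment is at most three times the squared variance.\<close>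

lemma rademacher_large:
  assumes "finite I" "0 \<le> L" "2 * L\<^sup>2 \<le> (\<Sum>i\<in>I. (x i)\<^sup>2)" "0 < (\<Sum>i\<in>I. (x i)\<^sup>2)"
  shows "1/12 \<le> bsum I (\<lambda>_. 1/2) (\<lambda>S. if \<bar>signsum I S x\<bar> > L then 1 else 0)"
proof -
  define V where "V = (\<Sum>i\<in>I. (x i)\<^sup>2)"
  have V: "V > 0" "2 * L\<^sup>2 \<le> V" using assms by (auto simp: V_def)
  let ?P = "bsum I (\<lambda>_. 1/2) (\<lambda>S. if \<bar>signsum I S x\<bar> > L then 1 else 0)"
  have "V = bsum I (\<lambda>_. 1/2) (\<lambda>S. (0 + signsum I S x)\<^sup>2)"
    using bsum_variance[OF assms(1), of "\<lambda>_. 1/2" 0 x] by (simp add: V_def)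
  \<comment> \<open>Where \<open>\<bar>Y\<bar> > L\<close>, the square is at most
    \<open>Y^4 / (12 * V) + 3 * V\<close>; elsewhere it is at most
    \<open>L\<^sup>2 \<le> V / 2\<close>. The factor 1/12 turns the fourth moment bound
    \<open>3 * V\<^sup>2\<close> into \<open>V / 4\<close>, which leaves \<open>V / 4\<close> to the
    probability term.\<close>
  also have "\<dots> \<le> bsum I (\<lambda>_. 1/2) (\<lambda>S. V/2 + ((1/(12*V)) * (0 + signsum I S x)^4 + 3 * V * (if \<bar>signsum I S x\<bar> > L then 1 else 0)))"
  proof (rule bsum_mono)
    fix S
    define Y where "Y = signsum I S x"
    show "(0 + signsum I S x)\<^sup>2 \<le> V/2 + ((1/(12*V)) * (0 + signsum I S x)^4 + 3 * V * (if \<bar>signsum I S x\<bar> > L then 1 else 0))"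
    proof (cases "\<bar>Y\<bar> > L")
      case True
      have "0 \<le> (Y\<^sup>2 - 6 * V)\<^sup>2" by simp
      then have "12 * V * Y\<^sup>2 \<le> Y^4 + 36 * V\<^sup>2"
        by (simp add: power2_diff power2_eq_square power4_eq_xxxx algebra_simps)
      then have "Y\<^sup>2 \<le> (Y^4 + 36 * V\<^sup>2) / (12 * V)" using V by (simp add: field_simps)
      also have "\<dots> = Y^4 / (12 * V) + 3 * V" using V by (simp add: field_simps power2_eq_square)
      finally show ?thesis using V True by (simp add: Y_def)
    next
      case False
      then have "Y\<^sup>2 \<le> L\<^sup>2" using abs_le_square_iff[of Y L] assms(2) by simp
      moreover have "0 \<le> Y ^ 4 / (12 * V)" using V by simp
      moreover have "Y\<^sup>2 \<le> V/2 + Y ^ 4 / (12 * V)" using calculation V by linarith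
      ultimately show ?thesis using False by (simp add: Y_def)
    qed
  qed auto
  also have "\<dots> = V/2 + ((1/(12*V)) * bsum I (\<lambda>_. 1/2) (\<lambda>S. (0 + signsum I S x)^4) + 3 * V * ?P)"
    using assms(1) by (simp only: bsum_add bsum_cmult bsum_const)
  also have "\<dots> \<le> V/2 + ((1/(12*V)) * (3 * V\<^sup>2) + 3 * V * ?P)"
    using bsum_fourth_moment[OF assms(1), of 0 x] V
    by (intro add_mono mult_left_mono order_refl) (auto simp: V_def)
  also have "(1/(12*V)) * (3 * V\<^sup>2) = V/4" using V by (simp add: power2_eq_square field_simps)
  finally have "V/4 \<le> V * (3 * ?P)" by (simp add: field_simps)
  then have "1/4 \<le> 3 * ?P" using V by (simp add: field_simps)
  then show ?thesis by linarith
qed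

text \<open>Chebyshev's inequality read backwards. If the mean exceeded \<open>3 * L\<close>, then
  on the event that the signed sum is at most \<open>L\<close>, of probability above 1/2, the
  deviation from the mean would exceed \<open>2 * L\<close>, and the variance would exceed
  \<open>2 * L\<^sup>2\<close>.\<close>

lemma mean_le_of_signsums:
  assumes I: "finite I" and p: "\<And>i. i \<in> I \<Longrightarrow> 0 \<le> p i \<and> p i \<le> 1" and "0 \<le> L"
    and V: "(\<Sum>i\<in>I. (x i)\<^sup>2) \<le> 2 * L\<^sup>2"
    and half: "bsum I p (\<lambda>S. if \<bar>signsum I S x\<bar> > L then 1 else 0) < 1/2"
  shows "\<bar>\<Sum>i\<in>I. (2 * p i - 1) * x i\<bar> \<le> 3 * L"
proof (rule ccontr)
  assume c: "\<not> ?thesis"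
  define m where "m = (\<Sum>i\<in>I. (2 * p i - 1) * x i)"
  have m: "\<bar>m\<bar> > 3 * L" using c by (simp add: m_def)
  define d where "d = (\<bar>m\<bar> - L)\<^sup>2"
  have d: "d > 4 * L\<^sup>2"
  proof -
    have "(2*L)\<^sup>2 < (\<bar>m\<bar> - L)\<^sup>2" using m \<open>0 \<le> L\<close> by (intro power_strict_mono) auto
    then show ?thesis by (simp add: d_def power_mult_distrib)
  qed
  have "d * (1 + (-1) * (if \<bar>signsum I S x\<bar> > L then 1 else 0)) \<le> (- m + signsum I S x)\<^sup>2" for S
  proof (cases "\<bar>signsum I S x\<bar> > L")
    case False
    have "(\<bar>m\<bar> - L)\<^sup>2 \<le> \<bar>- m + signsum I S x\<bar>\<^sup>2" using False m \<open>0 \<le> L\<close> by (intro power_mono) auto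
    then show ?thesis using False by (simp add: d_def)
  qed simp
  then have "bsum I p (\<lambda>S. d * (1 + (-1) * (if \<bar>signsum I S x\<bar> > L then 1 else 0))) \<le> bsum I p (\<lambda>S. (- m + signsum I S x)\<^sup>2)"
    using p by (intro bsum_mono) auto
  also have "\<dots> = (\<Sum>i\<in>I. 4 * p i * (1 - p i) * (x i)\<^sup>2)"
    using bsum_variance[OF I, of p "-m" x] by (simp add: m_def)
  also have "\<dots> \<le> (\<Sum>i\<in>I. (x i)\<^sup>2)"
  proof (rule sum_mono)
    fix i assume "i \<in> I"
    have "0 \<le> (2 * p i - 1)\<^sup>2" by simp
    then have "4 * p i * (1 - p i) \<le> 1" by (simp add: power2_eq_square algebra_simps)
    then show "4 * p i * (1 - p i) * (x i)\<^sup>2 \<le> (x i)\<^sup>2"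
      using mult_right_mono[of "4 * p i * (1 - p i)" 1 "(x i)\<^sup>2"] by simp
  qed
  finally have "d * (1 + (-1) * bsum I p (\<lambda>S. if \<bar>signsum I S x\<bar> > L then 1 else 0)) \<le> 2 * L\<^sup>2"
    using I V by (simp only: bsum_add bsum_cmult bsum_const)
  moreover have "d * (1/2) \<le> d * (1 + (-1) * bsum I p (\<lambda>S. if \<bar>signsum I S x\<bar> > L then 1 else 0))"
    using half d by (intro mult_left_mono) (auto simp: d_def)
  ultimately show False using d by simp
qed

text \<open>Inclusion with probability \<open>q\<close> is a mixture: with probability
  \<open>2 * q\<close> toss a fair coin, otherwise exclude. If the coin is tossed for an index with
  \<open>\<bar>x i\<bar> > 2\<close>, one of its two outcomes puts the sum outside
  \<open>[-1, 1]\<close>; the bound is half the probability that some such index gets a coin. The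
  free \<open>a\<close> collects the indices already decided.\<close>

lemma random_subset_large:
  assumes "finite I" "0 \<le> q" "q \<le> 1/2"
  shows "(1 - (1 - 2 * q) ^ card {i\<in>I. \<bar>x i\<bar> > 2}) / 2 \<le>
    bsum I (\<lambda>_. q) (\<lambda>S. if \<bar>a + (\<Sum>i\<in>S. x i)\<bar> > (1::real) then 1 else 0)"
  using assms(1)
proof (induction I arbitrary: a rule: finite_induct)
  case empty then show ?case by simp
next
  case (insert i I)
  let ?f = "\<lambda>a S. if \<bar>a + (\<Sum>i\<in>S. x i)\<bar> > (1::real) then 1 else 0 :: real"
  let ?r = "\<lambda>I. (1 - (1 - 2 * q) ^ card {i\<in>I. \<bar>x i\<bar> > 2}) / 2"
  have 1: "bsum I (\<lambda>_. q) (\<lambda>S. ?f a (insert i S)) = bsum I (\<lambda>_. q) (?f (a + x i))"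
  proof (rule bsum_cong)
    fix S assume "S \<subseteq> I"
    then have "finite S" "i \<notin> S" using insert finite_subset by auto
    then show "?f a (insert i S) = ?f (a + x i) S" by (simp add: add.assoc)
  qed
  have eq: "bsum (insert i I) (\<lambda>_. q) (?f a) = q * bsum I (\<lambda>_. q) (?f (a + x i)) + (1 - q) * bsum I (\<lambda>_. q) (?f a)"
    unfolding bsum_insert[OF insert.hyps(1,2)] 1 by simp
  show ?case
  proof (cases "\<bar>x i\<bar> > 2")
    case False
    then have "{j\<in>insert i I. \<bar>x j\<bar> > 2} = {j\<in>I. \<bar>x j\<bar> > 2}" by auto
    moreover have "q * ?r I + (1 - q) * ?r I \<le> bsum (insert i I) (\<lambda>_. q) (?f a)"
      unfolding eq using assms by (intro add_mono mult_left_mono insert.IH) auto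
    moreover have "q * ?r I + (1 - q) * ?r I = ?r I" by (simp only: distrib_right[symmetric]) simp
    ultimately show ?thesis by simp
  next
    case True
    then have "{j\<in>insert i I. \<bar>x j\<bar> > 2} = insert i {j\<in>I. \<bar>x j\<bar> > 2}" by auto
    then have c: "card {j\<in>insert i I. \<bar>x j\<bar> > 2} = Suc (card {j\<in>I. \<bar>x j\<bar> > 2})"
      using insert by simp
    have "1 = bsum I (\<lambda>_. q) (\<lambda>_. 1)" using insert by simp
    also have "\<dots> \<le> bsum I (\<lambda>_. q) (\<lambda>S. ?f (a + x i) S + ?f a S)"
      using True assms by (intro bsum_mono) auto
    also have "\<dots> = bsum I (\<lambda>_. q) (?f (a + x i)) + bsum I (\<lambda>_. q) (?f a)" by (rule bsum_add)
    finally have s: "1 \<le> bsum I (\<lambda>_. q) (?f (a + x i)) + bsum I (\<lambda>_. q) (?f a)" .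
    have "?r (insert i I) = q * 1 + (1 - 2 * q) * ?r I" unfolding c by (simp add: field_simps)
    also have "\<dots> \<le> q * (bsum I (\<lambda>_. q) (?f (a + x i)) + bsum I (\<lambda>_. q) (?f a)) + (1 - 2 * q) * bsum I (\<lambda>_. q) (?f a)"
      using s assms by (intro add_mono mult_left_mono insert.IH) auto
    also have "\<dots> = bsum (insert i I) (\<lambda>_. q) (?f a)" unfolding eq by (simp add: algebra_simps)
    finally show ?thesis .
  qed
qed

section \<open>Exchanging random subsets with the underlying probability\<close>

context prob_space
begin

lemma expectation_bsum:
  assumes "\<And>S. S \<subseteq> I \<Longrightarrow> A S \<in> events"
  shows "expectation (\<lambda>\<omega>. bsum I p (\<lambda>S. indicator (A S) \<omega>)) = bsum I p (\<lambda>S. prob (A S))"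
    "integrable M (\<lambda>\<omega>. bsum I p (\<lambda>S. indicator (A S) \<omega>))"
proof -
  have i: "integrable M (\<lambda>\<omega>. (\<Prod>i\<in>I. if i \<in> S then p i else 1 - p i) * indicator (A S) \<omega>)" if "S \<in> Pow I" for S
    using assms that by (intro integrable_mult_right integrable_real_indicator) (auto simp: less_top[symmetric])
  show "integrable M (\<lambda>\<omega>. bsum I p (\<lambda>S. indicator (A S) \<omega>))"
    unfolding bsum_def using i by (intro Bochner_Integration.integrable_sum) auto
  show "expectation (\<lambda>\<omega>. bsum I p (\<lambda>S. indicator (A S) \<omega>)) = bsum I p (\<lambda>S. prob (A S))"
    unfolding bsum_def using i assms
    by (subst Bochner_Integration.integral_sum) (auto intro!: sum.cong)
qed

text \<open>A lower bound for random subsets that holds separately for each \<omega> in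
  \<open>F\<close> passes, by exchanging the two averages, to the averaged probabilities of the
  events \<open>A S\<close>, in which \<open>S\<close> is deterministic.\<close>

lemma bsum_prob_ge:
  assumes A: "\<And>S. S \<subseteq> I \<Longrightarrow> A S \<in> events" and F: "F \<in> events"
    and p: "\<And>i. i \<in> I \<Longrightarrow> 0 \<le> p i \<and> p i \<le> 1"
    and ae: "AE \<omega> in M. \<omega> \<in> F \<longrightarrow> c \<le> bsum I p (\<lambda>S. indicator (A S) \<omega>)"
  shows "c * prob F \<le> bsum I p (\<lambda>S. prob (A S))"
proof -
  have "c * prob F = expectation (\<lambda>\<omega>. c * indicator F \<omega>)" using F by simp
  also have "\<dots> \<le> expectation (\<lambda>\<omega>. bsum I p (\<lambda>S. indicator (A S) \<omega>))"
  proof (rule integral_mono_AE)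
    show "AE \<omega> in M. c * indicator F \<omega> \<le> bsum I p (\<lambda>S. indicator (A S) \<omega>)"
      using ae by eventually_elim (use p in \<open>auto split: split_indicator intro!: bsum_nonneg\<close>)
  qed (use expectation_bsum[OF A] F in \<open>auto simp: less_top[symmetric] intro!: integrable_mult_right integrable_real_indicator\<close>)
  also have "\<dots> = bsum I p (\<lambda>S. prob (A S))" using A by (rule expectation_bsum)
  finally show ?thesis .
qed

lemma bsum_prob_le:
  assumes A: "\<And>S. S \<subseteq> I \<Longrightarrow> A S \<in> events"
    and ae: "AE \<omega> in M. bsum I p (\<lambda>S. indicator (A S) \<omega>) \<le> c"
  shows "bsum I p (\<lambda>S. prob (A S)) \<le> c"
proof -
  have "bsum I p (\<lambda>S. prob (A S)) = expectation (\<lambda>\<omega>. bsum I p (\<lambda>S. indicator (A S) \<omega>))"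
    by (rule expectation_bsum(1)[symmetric]) (rule A)
  also have "\<dots> \<le> expectation (\<lambda>\<omega>. c)"
    using ae expectation_bsum[OF A] by (intro integral_mono_AE) auto
  finally show ?thesis by (simp add: prob_space)
qed

end

section \<open>Integrals of simple functions\<close>

context prob_space
begin

text \<open>The truncation destroys homogeneity; a factor \<open>max 1 \<bar>c\<bar>\<close>
  remains, which is enough for limits.\<close>

lemma l0norm_cmult_le:
  assumes [measurable]: "X \<in> borel_measurable M"
  shows "l0norm M (\<lambda>\<omega>. c * X \<omega>) \<le> max 1 \<bar>c\<bar> * l0norm M X"
proof -
  have "l0norm M (\<lambda>\<omega>. c * X \<omega>) \<le> (LINT \<omega>|M. max 1 \<bar>c\<bar> * min 1 \<bar>X \<omega>\<bar>)"
    unfolding l0norm_def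
  proof (rule integral_mono)
    fix \<omega>
    have "\<bar>c\<bar> * \<bar>X \<omega>\<bar> \<le> max 1 \<bar>c\<bar> * \<bar>X \<omega>\<bar>" by (intro mult_right_mono) auto
    moreover have "1 \<le> max 1 \<bar>c\<bar>" by simp
    ultimately show "min 1 \<bar>c * X \<omega>\<bar> \<le> max 1 \<bar>c\<bar> * min 1 \<bar>X \<omega>\<bar>"
      unfolding abs_mult min_def[of 1 "\<bar>X \<omega>\<bar>"] by (cases "1 \<le> \<bar>X \<omega>\<bar>") (auto simp: min_le_iff_disj)
  qed auto
  then show ?thesis by (simp add: l0norm_def)
qed

lemma l0norm_cmult_tendsto:
  assumes [measurable]: "\<And>n. X n \<in> borel_measurable M"
    and "(\<lambda>n. l0norm M (X n)) \<longlonglongrightarrow> 0"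
  shows "(\<lambda>n. l0norm M (\<lambda>\<omega>. c * X n \<omega>)) \<longlonglongrightarrow> 0"
proof (rule tendsto_sandwich[OF _ _ tendsto_const])
  show "(\<lambda>n. max 1 \<bar>c\<bar> * l0norm M (X n)) \<longlonglongrightarrow> 0"
    using tendsto_mult_right_zero[OF assms(2)] by simp
  show "\<forall>\<^sub>F n in sequentially. l0norm M (\<lambda>\<omega>. c * X n \<omega>) \<le> max 1 \<bar>c\<bar> * l0norm M (X n)"
    by (intro always_eventually allI l0norm_cmult_le) auto
qed auto

lemma l0norm_sum_tendsto:
  assumes "finite I" "\<And>i n. i \<in> I \<Longrightarrow> X i n \<in> borel_measurable M"
    and "\<And>i. i \<in> I \<Longrightarrow> (\<lambda>n. l0norm M (X i n)) \<longlonglongrightarrow> 0"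
  shows "(\<lambda>n. l0norm M (\<lambda>\<omega>. \<Sum>i\<in>I. X i n \<omega>)) \<longlonglongrightarrow> 0"
  using assms
proof (induction I rule: finite_induct)
  case empty then show ?case by (simp add: l0norm_def)
next
  case (insert i I)
  have [measurable]: "X j n \<in> borel_measurable M" if "j \<in> insert i I" for j n using insert that by blast
  have "(\<lambda>n. l0norm M (X i n) + l0norm M (\<lambda>\<omega>. \<Sum>i\<in>I. X i n \<omega>)) \<longlonglongrightarrow> 0"
    using insert by (intro tendsto_add_zero insert.IH) auto
  then show ?case
  proof (rule tendsto_sandwich[OF _ _ tendsto_const, rotated 2])
    show "\<forall>\<^sub>F n in sequentially. l0norm M (\<lambda>\<omega>. \<Sum>i\<in>insert i I. X i n \<omega>) \<le> l0norm M (X i n) + l0norm M (\<lambda>\<omega>. \<Sum>i\<in>I. X i n \<omega>)"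
      using insert by (intro always_eventually allI l0norm_triangle_AE) auto
  qed auto
qed

end

section \<open>Linearity of the simple integral\<close>

context stoch_measure
begin

abbreviation SI :: "'a set \<Rightarrow> ('a \<Rightarrow> real) \<Rightarrow> 'w \<Rightarrow> real" where
  "SI A g \<equiv> simple_stochastic_integral B \<mu> A g"

text \<open>The defining sum groups points by value, and these groups do not match for two
  integrands. Summing over the level sets of any \<open>k\<close> through which the integrand
  factors repairs this: with \<open>k\<close> the pair of two simple functions, linearity becomes
  termwise. Values in \<open>V\<close> that are not attained contribute empty cells.\<close>

lemma SI_image:
  assumes k: "simple_function B k" and V: "finite V" "k ` space B \<subseteq> V" and A[measurable]: "A \<in> sets B"
  shows "AE \<omega> in M. SI A (\<lambda>s. \<phi> (k s)) \<omega> = (\<Sum>v\<in>V. \<phi> v * \<mu> (A \<inter> (k -` {v} \<inter> space B)) \<omega>)"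
proof -
  have km: "k -` X \<inter> space B \<in> sets B" for X using simple_functionD(2)[OF k] .
  let ?im = "(\<lambda>s. \<phi> (k s)) ` space B"
  have fin: "finite ?im" using simple_functionD(1)[OF k] by (simp add: image_image[symmetric])
  have "AE \<omega> in M. \<mu> (A \<inter> ((\<lambda>s. \<phi> (k s)) -` {c} \<inter> space B)) \<omega> =
     (\<Sum>v\<in>{v\<in>V. \<phi> v = c}. \<mu> (A \<inter> (k -` {v} \<inter> space B)) \<omega>)" for c
  proof -
    have "A \<inter> ((\<lambda>s. \<phi> (k s)) -` {c} \<inter> space B) = (\<Union>v\<in>{v\<in>V. \<phi> v = c}. A \<inter> (k -` {v} \<inter> space B))"
      using V(2) by auto
    then show ?thesis
      using V(1) km by (simp only:) (rule mu_UN, auto simp: disjoint_family_on_def)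
  qed
  then have "AE \<omega> in M. \<forall>c\<in>?im. \<mu> (A \<inter> ((\<lambda>s. \<phi> (k s)) -` {c} \<inter> space B)) \<omega> =
     (\<Sum>v\<in>{v\<in>V. \<phi> v = c}. \<mu> (A \<inter> (k -` {v} \<inter> space B)) \<omega>)"
    using fin by (intro AE_finite_allI) auto
  then show ?thesis using mu_empty
  proof eventually_elim
    case (elim \<omega>)
    have "SI A (\<lambda>s. \<phi> (k s)) \<omega> = (\<Sum>c\<in>?im. \<Sum>v\<in>{v\<in>{v\<in>V. \<phi> v \<in> ?im}. \<phi> v = c}. \<phi> v * \<mu> (A \<inter> (k -` {v} \<inter> space B)) \<omega>)"
      unfolding simple_stochastic_integral_def
    proof (rule sum.cong[OF refl])
      fix c assume c: "c \<in> ?im"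
      have "c * \<mu> (A \<inter> ((\<lambda>s. \<phi> (k s)) -` {c} \<inter> space B)) \<omega> = (\<Sum>v\<in>{v\<in>V. \<phi> v = c}. \<phi> v * \<mu> (A \<inter> (k -` {v} \<inter> space B)) \<omega>)"
        using elim(1) c by (auto simp: sum_distrib_left intro!: sum.cong)
      also have "{v\<in>V. \<phi> v = c} = {v\<in>{v\<in>V. \<phi> v \<in> ?im}. \<phi> v = c}" using c by auto
      finally show "c * \<mu> (A \<inter> ((\<lambda>s. \<phi> (k s)) -` {c} \<inter> space B)) \<omega> = (\<Sum>v\<in>{v\<in>{v\<in>V. \<phi> v \<in> ?im}. \<phi> v = c}. \<phi> v * \<mu> (A \<inter> (k -` {v} \<inter> space B)) \<omega>)" .
    qed
    also have "\<dots> = (\<Sum>v\<in>{v\<in>V. \<phi> v \<in> ?im}. \<phi> v * \<mu> (A \<inter> (k -` {v} \<inter> space B)) \<omega>)"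
      using V(1) fin by (intro sum.group) auto
    also have "\<dots> = (\<Sum>v\<in>V. \<phi> v * \<mu> (A \<inter> (k -` {v} \<inter> space B)) \<omega>)"
    proof (rule sum.mono_neutral_left)
      show "\<forall>v\<in>V - {v \<in> V. \<phi> v \<in> ?im}. \<phi> v * \<mu> (A \<inter> (k -` {v} \<inter> space B)) \<omega> = 0"
      proof
        fix v assume "v \<in> V - {v \<in> V. \<phi> v \<in> ?im}"
        then have "A \<inter> (k -` {v} \<inter> space B) = {}" by auto
        then show "\<phi> v * \<mu> (A \<inter> (k -` {v} \<inter> space B)) \<omega> = 0" using elim(2) by simp
      qed
    qed (use V in auto)
    finally show ?case .
  qed
qed

lemma SI_measurable [measurable (raw), simp]:
  assumes "simple_function B g" "A \<in> sets B"
  shows "SI A g \<in> borel_measurable M"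
proof -
  have "A \<inter> (g -` {c} \<inter> space B) \<in> sets B" for c
    using simple_functionD(2)[OF assms(1)] assms(2) by auto
  then show ?thesis unfolding simple_stochastic_integral_def[abs_def] by measurable
qed

lemma SI_cong: "(\<And>s. s \<in> space B \<Longrightarrow> g s = h s) \<Longrightarrow> SI A g = SI A h"
proof -
  assume *: "\<And>s. s \<in> space B \<Longrightarrow> g s = h s"
  then have "g ` space B = h ` space B" "\<And>c. g -` {c} \<inter> space B = h -` {c} \<inter> space B" by (auto simp: image_def)
  then show ?thesis unfolding simple_stochastic_integral_def[abs_def] by simp
qed

lemma SI_add:
  assumes "simple_function B g" "simple_function B h" "A \<in> sets B"
  shows "AE \<omega> in M. SI A (\<lambda>s. g s + h s) \<omega> = SI A g \<omega> + SI A h \<omega>"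
proof -
  let ?k = "\<lambda>s. (g s, h s)"
  have k: "simple_function B ?k" using assms by (intro simple_function_Pair)
  note im = SI_image[OF k simple_functionD(1)[OF k] order_refl assms(3)]
  show ?thesis
    using im[of "\<lambda>v. fst v + snd v"] im[of fst] im[of snd]
    by eventually_elim (simp add: sum.distrib distrib_right)
qed

lemma SI_cmult:
  assumes g: "simple_function B g" and "A \<in> sets B"
  shows "AE \<omega> in M. SI A (\<lambda>s. c * g s) \<omega> = c * SI A g \<omega>"
proof -
  note im = SI_image[OF g simple_functionD(1)[OF g] order_refl assms(2)]
  show ?thesis
    using im[of "\<lambda>v. c * v"] im[of "\<lambda>v. v"]
    by eventually_elim (simp add: sum_distrib_left mult_ac)
qed

lemma SI_diff:
  assumes "simple_function B g" "simple_function B h" "A \<in> sets B"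
  shows "AE \<omega> in M. SI A (\<lambda>s. g s - h s) \<omega> = SI A g \<omega> - SI A h \<omega>"
proof -
  let ?k = "\<lambda>s. (g s, h s)"
  have k: "simple_function B ?k" using assms by (intro simple_function_Pair)
  note im = SI_image[OF k simple_functionD(1)[OF k] order_refl assms(3)]
  show ?thesis
    using im[of "\<lambda>v. fst v - snd v"] im[of fst] im[of snd]
    by eventually_elim (simp add: sum_subtractf left_diff_distrib)
qed

lemma SI_zero: "AE \<omega> in M. SI A (\<lambda>s. 0) \<omega> = 0"
  unfolding simple_stochastic_integral_def by (intro AE_I2 sum.neutral) auto

lemma SI_sum:
  assumes "finite I" "\<And>i. i \<in> I \<Longrightarrow> simple_function B (g i)" "A \<in> sets B"
  shows "AE \<omega> in M. SI A (\<lambda>s. \<Sum>i\<in>I. g i s) \<omega> = (\<Sum>i\<in>I. SI A (g i) \<omega>)"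
  using assms
proof (induction I rule: finite_induct)
  case empty then show ?case using SI_zero by simp
next
  case (insert i I)
  have "AE \<omega> in M. SI A (\<lambda>s. g i s + (\<Sum>i\<in>I. g i s)) \<omega> = SI A (g i) \<omega> + SI A (\<lambda>s. \<Sum>i\<in>I. g i s) \<omega>"
    using insert by (intro SI_add simple_function_sum) auto
  moreover have "AE \<omega> in M. SI A (\<lambda>s. \<Sum>i\<in>I. g i s) \<omega> = (\<Sum>i\<in>I. SI A (g i) \<omega>)"
    using insert by auto
  ultimately show ?case by eventually_elim (use insert.hyps in simp)
qed

text \<open>The level sets of the pair of \<open>g\<close> and \<open>indicator C\<close> lie
  entirely inside or entirely outside \<open>C\<close>.\<close>

lemma SI_restrict:
  assumes g: "simple_function B g" and A[measurable]: "A \<in> sets B" and C[measurable]: "C \<in> sets B"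
  shows "AE \<omega> in M. SI (A \<inter> C) g \<omega> = SI A (\<lambda>s. indicator C s * g s) \<omega>"
proof -
  let ?k = "\<lambda>s. (g s, indicator C s :: real)"
  have k: "simple_function B ?k" using assms by (intro simple_function_Pair simple_function_indicator)
  have AC: "A \<inter> C \<in> sets B" by simp
  show ?thesis
    using SI_image[OF k simple_functionD(1)[OF k] order_refl AC, of fst]
      SI_image[OF k simple_functionD(1)[OF k] order_refl A, of "\<lambda>v. snd v * fst v"] mu_empty
  proof eventually_elim
    case (elim \<omega>)
    have "(\<Sum>v\<in>?k ` space B. fst v * \<mu> ((A \<inter> C) \<inter> (?k -` {v} \<inter> space B)) \<omega>)
        = (\<Sum>v\<in>?k ` space B. (snd v * fst v) * \<mu> (A \<inter> (?k -` {v} \<inter> space B)) \<omega>)"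
    proof (rule sum.cong[OF refl])
      fix v assume v: "v \<in> ?k ` space B"
      then have "snd v = 0 \<or> snd v = 1" by (auto simp: indicator_def)
      then show "fst v * \<mu> ((A \<inter> C) \<inter> (?k -` {v} \<inter> space B)) \<omega> = (snd v * fst v) * \<mu> (A \<inter> (?k -` {v} \<inter> space B)) \<omega>"
      proof
        assume "snd v = 0"
        then have "(A \<inter> C) \<inter> (?k -` {v} \<inter> space B) = {}" by (auto simp: indicator_def)
        then show ?thesis using elim \<open>snd v = 0\<close> by simp
      next
        assume "snd v = 1"
        then have "(A \<inter> C) \<inter> (?k -` {v} \<inter> space B) = A \<inter> (?k -` {v} \<inter> space B)"
          by (auto simp: indicator_def split: if_splits)
        then show ?thesis using \<open>snd v = 1\<close> by simp
      qed
    qed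
    then show ?case using elim by simp
  qed
qed

lemma SI_indicator:
  assumes A[measurable]: "A \<in> sets B" and C[measurable]: "C \<in> sets B"
  shows "AE \<omega> in M. SI A (indicator C) \<omega> = \<mu> (A \<inter> C) \<omega>"
proof -
  have k: "simple_function B (indicator C :: 'a \<Rightarrow> real)" using C by (rule simple_function_indicator)
  have "C \<inter> space B = C" using sets.sets_into_space[OF C] by auto
  moreover have "(indicator C :: 'a \<Rightarrow> real) -` {1} = C" by (auto simp: indicator_def)
  ultimately have e: "A \<inter> (indicator C -` {1::real} \<inter> space B) = A \<inter> C" by simp
  have "AE \<omega> in M. SI A (\<lambda>s. (\<lambda>v. v) (indicator C s)) \<omega> = (\<Sum>v\<in>{0,1}. v * \<mu> (A \<inter> (indicator C -` {v} \<inter> space B)) \<omega>)"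
    by (rule SI_image[OF k _ _ A]) (auto simp: indicator_def)
  then show ?thesis by eventually_elim (simp add: e)
qed

text \<open>Makes everything proved about \<open>\<mu>\<close> applicable to an indefinite integral;
  the Nikodym argument for sequences of integrals rests on this.\<close>

lemma SI_stochastic_measure:
  assumes g: "simple_function B g"
  shows "stochastic_measure M B (\<lambda>A. SI A g)"
  unfolding stochastic_measure_def
proof (intro conjI ballI allI impI)
  fix A assume "A \<in> sets B" then show "SI A g \<in> borel_measurable M" using g by simp
next
  fix A :: "nat \<Rightarrow> 'a set" assume A: "range A \<subseteq> sets B" "disjoint_family A"
  have [measurable]: "A i \<in> sets B" for i using A by auto
  have gm[measurable]: "g -` {c} \<inter> space B \<in> sets B" for c using simple_functionD(2)[OF g] .
  let ?D = "\<lambda>c i. A i \<inter> (g -` {c} \<inter> space B)"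
  have U: "(\<Union>i. A i) \<inter> (g -` {c} \<inter> space B) = (\<Union>i. ?D c i)" for c by auto
  have "(\<lambda>n. l0norm M (\<lambda>\<omega>. \<Sum>c\<in>g ` space B. c * ((\<Sum>i<n. \<mu> (?D c i) \<omega>) - \<mu> (\<Union>i. ?D c i) \<omega>))) \<longlonglongrightarrow> 0"
  proof (rule l0norm_sum_tendsto)
    show "finite (g ` space B)" using g by (rule simple_functionD)
    fix c
    show "(\<lambda>n. l0norm M (\<lambda>\<omega>. c * ((\<Sum>i<n. \<mu> (?D c i) \<omega>) - \<mu> (\<Union>i. ?D c i) \<omega>))) \<longlonglongrightarrow> 0"
    proof (rule l0norm_cmult_tendsto)
      show "(\<lambda>n. l0norm M (\<lambda>\<omega>. (\<Sum>i<n. \<mu> (?D c i) \<omega>) - \<mu> (\<Union>i. ?D c i) \<omega>)) \<longlonglongrightarrow> 0"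
        using A by (intro mu_sigma) (auto simp: disjoint_family_on_def)
    qed measurable
  qed measurable
  moreover have "(\<Sum>c\<in>g ` space B. c * ((\<Sum>i<n. \<mu> (?D c i) \<omega>) - \<mu> (\<Union>i. ?D c i) \<omega>))
     = (\<Sum>i<n. SI (A i) g \<omega>) - SI (\<Union>i. A i) g \<omega>" for n \<omega>
    unfolding simple_stochastic_integral_def U
    by (subst sum.swap) (simp add: sum_distrib_left right_diff_distrib sum_subtractf)
  moreover have "(\<lambda>\<omega>. \<Sum>i<n. SI (A i) g \<omega>) \<in> borel_measurable M" for n
    using g by (intro borel_measurable_sum) auto
  moreover have "SI (\<Union>i. A i) g \<in> borel_measurable M" using g by (intro SI_measurable) auto
  ultimately show "tendsto_in_probability M (\<lambda>n \<omega>. \<Sum>i<n. SI (A i) g \<omega>) (SI (\<Union>i. A i) g)"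
    by (subst tendsto_in_probability_iff_l0norm) auto
qed

end

section \<open>Boundedness of the range\<close>

lemma (in prob_space) tail_small:
  assumes [measurable]: "X \<in> borel_measurable M" and "e > 0"
  shows "\<exists>K\<ge>(0::real). prob {\<omega>\<in>space M. \<bar>X \<omega>\<bar> > K} < e"
proof -
  let ?A = "\<lambda>n::nat. {\<omega>\<in>space M. \<bar>X \<omega>\<bar> > real n}"
  have "(\<lambda>n. prob (?A n)) \<longlonglongrightarrow> prob (\<Inter>n. ?A n)"
    by (rule finite_Lim_measure_decseq) (auto simp: decseq_def)
  moreover have "(\<Inter>n. ?A n) = {}"
  proof -
    have "\<exists>n. \<omega> \<notin> ?A n" for \<omega>
      using reals_Archimedean2[of "\<bar>X \<omega>\<bar>"] by (metis (mono_tags, lifting) less_asym mem_Collect_eq)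
    then show ?thesis by blast
  qed
  ultimately have "(\<lambda>n. prob (?A n)) \<longlonglongrightarrow> 0" by simp
  from order_tendstoD(2)[OF this \<open>e > 0\<close>] obtain n where "prob (?A n) < e"
    by (auto simp: eventually_sequentially)
  then show ?thesis by (intro exI[of _ "real n"]) auto
qed

context stoch_measure
begin

definition disjoint_cells :: "nat set \<Rightarrow> (nat \<Rightarrow> 'a set) \<Rightarrow> bool" where
  "disjoint_cells I C \<longleftrightarrow> finite I \<and> (\<forall>i\<in>I. C i \<in> sets B) \<and> disjoint_family_on C I"

text \<open>Which cell carries the large value may depend on \<omega>. This keeps the probability
  \<open>d\<close> intact under refinement; asking for one fixed large cell would lose probability
  at each split.\<close>

definition unbounded_on :: "nat set \<Rightarrow> (nat \<Rightarrow> 'a set) \<Rightarrow> real \<Rightarrow> bool" where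
  "unbounded_on I C d \<longleftrightarrow>
     (\<forall>K. \<exists>D\<in>sets B. d \<le> prob {\<omega>\<in>space M. \<exists>i\<in>I. \<bar>\<mu> (C i \<inter> D) \<omega>\<bar> > K})"

definition split_index :: "nat set \<Rightarrow> nat set" where
  "split_index I = (\<lambda>i. 2 * i) ` I \<union> (\<lambda>i. 2 * i + 1) ` I"

definition split_cells :: "(nat \<Rightarrow> 'a set) \<Rightarrow> 'a set \<Rightarrow> nat \<Rightarrow> 'a set" where
  "split_cells C D j = (if even j then C (j div 2) \<inter> D else C (j div 2) - D)"

definition large_cells :: "nat set \<Rightarrow> (nat \<Rightarrow> 'a set) \<Rightarrow> real \<Rightarrow> 'w \<Rightarrow> real" where
  "large_cells I C K \<omega> = (\<Sum>i\<in>I. of_bool (\<bar>\<mu> (C i) \<omega>\<bar> > K))"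

lemma split_cells_simps [simp]:
  "split_cells C D (2 * i) = C i \<inter> D" "split_cells C D (Suc (2 * i)) = C i - D"
  by (auto simp: split_cells_def)

lemma sum_split_index:
  assumes "finite I"
  shows "(\<Sum>j\<in>split_index I. h j) = (\<Sum>i\<in>I. h (2 * i) + h (2 * i + 1))"
proof -
  have "(\<Sum>j\<in>split_index I. h j) = (\<Sum>j\<in>(\<lambda>i. 2 * i) ` I. h j) + (\<Sum>j\<in>(\<lambda>i. 2 * i + 1) ` I. h j)"
    unfolding split_index_def using assms
    by (intro sum.union_disjoint) (auto, presburger)
  then show ?thesis by (simp add: sum.reindex inj_on_def sum.distrib)
qed

lemma disjoint_cells_split:
  assumes "disjoint_cells I C" and D: "D \<in> sets B"
  shows "disjoint_cells (split_index I) (split_cells C D)"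
    "(\<Union>j\<in>split_index I. split_cells C D j) = (\<Union>i\<in>I. C i)"
proof -
  show "disjoint_cells (split_index I) (split_cells C D)"
    unfolding disjoint_cells_def disjoint_family_on_def
  proof (intro conjI ballI impI)
    show "finite (split_index I)" using assms by (auto simp: disjoint_cells_def split_index_def)
    show "split_cells C D j \<in> sets B" if "j \<in> split_index I" for j
      using assms that by (auto simp: disjoint_cells_def split_index_def)
    show "split_cells C D j \<inter> split_cells C D k = {}"
      if "j \<in> split_index I" "k \<in> split_index I" "j \<noteq> k" for j k
    proof (cases "j div 2 = k div 2")
      case True
      then have "even j \<noteq> even k" using \<open>j \<noteq> k\<close> by presburger
      then show ?thesis using True by (auto simp: split_cells_def)
    next
      case False
      have "j div 2 \<in> I" "k div 2 \<in> I" using that by (auto simp: split_index_def)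
      then have "C (j div 2) \<inter> C (k div 2) = {}"
        using False assms by (auto simp: disjoint_cells_def disjoint_family_on_def)
      then show ?thesis by (auto simp: split_cells_def)
    qed
  qed
  show "(\<Union>j\<in>split_index I. split_cells C D j) = (\<Union>i\<in>I. C i)"
    unfolding split_index_def by auto
qed

text \<open>For each \<omega>, a value above \<open>2 * \<bar>K\<bar>\<close> on a cell leaves a
  value above \<open>K\<close> on one of its halves.\<close>

lemma unbounded_on_split:
  assumes IC: "disjoint_cells I C" and u: "unbounded_on I C d" and D[measurable]: "D \<in> sets B"
  shows "unbounded_on (split_index I) (split_cells C D) d"
  unfolding unbounded_on_def
proof
  fix K
  have C[measurable]: "C i \<in> sets B" if "i \<in> I" for i using IC that by (auto simp: disjoint_cells_def)
  have fin: "finite I" using IC by (auto simp: disjoint_cells_def)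
  obtain E where E[measurable]: "E \<in> sets B" and dE: "d \<le> prob {\<omega>\<in>space M. \<exists>i\<in>I. \<bar>\<mu> (C i \<inter> E) \<omega>\<bar> > 2 * \<bar>K\<bar>}"
    using u unfolding unbounded_on_def by blast
  have "AE \<omega> in M. \<mu> (C i \<inter> E) \<omega> = \<mu> (C i \<inter> E \<inter> D) \<omega> + \<mu> (C i \<inter> E - D) \<omega>" if "i \<in> I" for i
    using that by (intro mu_Diff) auto
  then have ae: "AE \<omega> in M. \<forall>i\<in>I. \<mu> (C i \<inter> E) \<omega> = \<mu> (C i \<inter> E \<inter> D) \<omega> + \<mu> (C i \<inter> E - D) \<omega>"
    using fin by (intro AE_finite_allI) auto
  note dE
  also have "prob {\<omega>\<in>space M. \<exists>i\<in>I. \<bar>\<mu> (C i \<inter> E) \<omega>\<bar> > 2 * \<bar>K\<bar>} \<le>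
    prob {\<omega>\<in>space M. \<exists>j\<in>split_index I. \<bar>\<mu> (split_cells C D j \<inter> E) \<omega>\<bar> > K}"
  proof (rule finite_measure_mono_AE)
    show "AE \<omega> in M. \<omega> \<in> {\<omega>\<in>space M. \<exists>i\<in>I. \<bar>\<mu> (C i \<inter> E) \<omega>\<bar> > 2 * \<bar>K\<bar>} \<longrightarrow>
      \<omega> \<in> {\<omega>\<in>space M. \<exists>j\<in>split_index I. \<bar>\<mu> (split_cells C D j \<inter> E) \<omega>\<bar> > K}"
      using ae
    proof eventually_elim
      case (elim \<omega>)
      show ?case
      proof
        assume "\<omega> \<in> {\<omega>\<in>space M. \<exists>i\<in>I. \<bar>\<mu> (C i \<inter> E) \<omega>\<bar> > 2 * \<bar>K\<bar>}"
        then obtain i where i: "i \<in> I" "\<bar>\<mu> (C i \<inter> E) \<omega>\<bar> > 2 * \<bar>K\<bar>" "\<omega> \<in> space M" by auto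
        have e1: "split_cells C D (2 * i) \<inter> E = C i \<inter> E \<inter> D" by auto
        have e2: "split_cells C D (Suc (2 * i)) \<inter> E = C i \<inter> E - D" by auto
        have "\<bar>\<mu> (C i \<inter> E \<inter> D) \<omega>\<bar> > K \<or> \<bar>\<mu> (C i \<inter> E - D) \<omega>\<bar> > K"
          using i elim by fastforce
        then have "\<bar>\<mu> (split_cells C D (2 * i) \<inter> E) \<omega>\<bar> > K \<or> \<bar>\<mu> (split_cells C D (Suc (2 * i)) \<inter> E) \<omega>\<bar> > K"
          unfolding e1 e2 .
        moreover have "2 * i \<in> split_index I" "Suc (2 * i) \<in> split_index I"
          using i by (auto simp: split_index_def)
        ultimately have "\<exists>j\<in>split_index I. \<bar>\<mu> (split_cells C D j \<inter> E) \<omega>\<bar> > K" by blast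
        then show "\<omega> \<in> {\<omega>\<in>space M. \<exists>j\<in>split_index I. \<bar>\<mu> (split_cells C D j \<inter> E) \<omega>\<bar> > K}"
          using i by simp
      qed
    qed
    have "split_cells C D j \<in> sets B" if "j \<in> split_index I" for j
      using that D by (auto simp: split_index_def)
    moreover have "finite (split_index I)" using fin by (simp add: split_index_def)
    ultimately show "{\<omega>\<in>space M. \<exists>j\<in>split_index I. \<bar>\<mu> (split_cells C D j \<inter> E) \<omega>\<bar> > K} \<in> events"
      by measurable
  qed
  finally show "\<exists>D'\<in>sets B. d \<le> prob {\<omega>\<in>space M. \<exists>j\<in>split_index I. \<bar>\<mu> (split_cells C D j \<inter> D') \<omega>\<bar> > K}"
    using E by blast
qed

text \<open>The finitely many values \<open>\<mu> (C i)\<close> are bounded by some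
  \<open>K1\<close> outside an event of probability below \<open>e\<close>. Where one half of a cell
  exceeds \<open>\<bar>K\<bar> + K1\<close>, additivity then forces the other half above
  \<open>K\<close>.\<close>

lemma unbounded_on_split_large:
  assumes IC: "disjoint_cells I C" and u: "unbounded_on I C d" and "e > 0"
  shows "\<exists>D\<in>sets B. d - e \<le> prob {\<omega>\<in>space M. \<exists>i\<in>I. \<bar>\<mu> (C i \<inter> D) \<omega>\<bar> > K \<and> \<bar>\<mu> (C i - D) \<omega>\<bar> > K}"
proof -
  have C[measurable]: "C i \<in> sets B" if "i \<in> I" for i using IC that by (auto simp: disjoint_cells_def)
  have fin: "finite I" using IC by (auto simp: disjoint_cells_def)
  define X where "X \<omega> = (\<Sum>i\<in>I. \<bar>\<mu> (C i) \<omega>\<bar>)" for \<omega>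
  have [measurable]: "X \<in> borel_measurable M" unfolding X_def by measurable
  obtain K1 where K1: "K1 \<ge> 0" "prob {\<omega>\<in>space M. \<bar>X \<omega>\<bar> > K1} < e"
    using tail_small[of X e] \<open>e > 0\<close> by auto
  obtain D where D[measurable]: "D \<in> sets B" and dD: "d \<le> prob {\<omega>\<in>space M. \<exists>i\<in>I. \<bar>\<mu> (C i \<inter> D) \<omega>\<bar> > \<bar>K\<bar> + K1}"
    using u unfolding unbounded_on_def by blast
  let ?F = "{\<omega>\<in>space M. \<exists>i\<in>I. \<bar>\<mu> (C i \<inter> D) \<omega>\<bar> > K \<and> \<bar>\<mu> (C i - D) \<omega>\<bar> > K}"
  let ?X = "{\<omega>\<in>space M. \<bar>X \<omega>\<bar> > K1}"
  have Fm: "?F \<in> events" using fin by measurable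
  have "AE \<omega> in M. \<mu> (C i) \<omega> = \<mu> (C i \<inter> D) \<omega> + \<mu> (C i - D) \<omega>" if "i \<in> I" for i
    using that by (intro mu_Diff) auto
  then have ae: "AE \<omega> in M. \<forall>i\<in>I. \<mu> (C i) \<omega> = \<mu> (C i \<inter> D) \<omega> + \<mu> (C i - D) \<omega>"
    using fin by (intro AE_finite_allI) auto
  note dD
  also have "prob {\<omega>\<in>space M. \<exists>i\<in>I. \<bar>\<mu> (C i \<inter> D) \<omega>\<bar> > \<bar>K\<bar> + K1} \<le> prob (?F \<union> ?X)"
  proof (rule finite_measure_mono_AE)
    show "AE \<omega> in M. \<omega> \<in> {\<omega>\<in>space M. \<exists>i\<in>I. \<bar>\<mu> (C i \<inter> D) \<omega>\<bar> > \<bar>K\<bar> + K1} \<longrightarrow> \<omega> \<in> ?F \<union> ?X"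
      using ae
    proof eventually_elim
      case (elim \<omega>)
      show ?case
      proof
        assume "\<omega> \<in> {\<omega>\<in>space M. \<exists>i\<in>I. \<bar>\<mu> (C i \<inter> D) \<omega>\<bar> > \<bar>K\<bar> + K1}"
        then obtain i where i: "i \<in> I" "\<bar>\<mu> (C i \<inter> D) \<omega>\<bar> > \<bar>K\<bar> + K1" "\<omega> \<in> space M" by auto
        have "\<bar>\<mu> (C i) \<omega>\<bar> \<le> X \<omega>" unfolding X_def using i fin
          by (intro member_le_sum[of i I "\<lambda>i. \<bar>\<mu> (C i) \<omega>\<bar>"]) auto
        moreover have "\<mu> (C i) \<omega> = \<mu> (C i \<inter> D) \<omega> + \<mu> (C i - D) \<omega>" using elim i by auto
        ultimately have "\<bar>X \<omega>\<bar> > K1 \<or> (\<bar>\<mu> (C i \<inter> D) \<omega>\<bar> > K \<and> \<bar>\<mu> (C i - D) \<omega>\<bar> > K)"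
          using i K1 by linarith
        then show "\<omega> \<in> ?F \<union> ?X" using i by blast
      qed
    qed
    show "?F \<union> ?X \<in> events" using Fm by (intro sets.Un) measurable
  qed
  also have "\<dots> \<le> prob ?F + prob ?X" using Fm by (intro measure_Un_le) measurable
  finally have "d - e \<le> prob ?F" using K1 by linarith
  then show ?thesis using D by blast
qed

lemma large_cells_measurable [measurable]:
  assumes "disjoint_cells I C"
  shows "large_cells I C K \<in> borel_measurable M"
proof -
  have [measurable]: "C i \<in> sets B" if "i \<in> I" for i using assms that by (auto simp: disjoint_cells_def)
  show ?thesis unfolding large_cells_def[abs_def] by measurable
qed

text \<open>A cell above \<open>2 * K\<close> has a half above \<open>K\<close>, so halving the
  threshold loses no large cell, and a cell with both halves above \<open>K\<close> adds
  one.\<close>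

lemma large_cells_split:
  assumes IC: "disjoint_cells I C" and D[measurable]: "D \<in> sets B"
  shows "AE \<omega> in M. large_cells I C (2 * K) \<omega> + of_bool (\<exists>i\<in>I. \<bar>\<mu> (C i \<inter> D) \<omega>\<bar> > K \<and> \<bar>\<mu> (C i - D) \<omega>\<bar> > K)
     \<le> large_cells (split_index I) (split_cells C D) K \<omega>"
proof -
  have C[measurable]: "C i \<in> sets B" if "i \<in> I" for i using IC that by (auto simp: disjoint_cells_def)
  have fin: "finite I" using IC by (auto simp: disjoint_cells_def)
  have "AE \<omega> in M. \<mu> (C i) \<omega> = \<mu> (C i \<inter> D) \<omega> + \<mu> (C i - D) \<omega>" if "i \<in> I" for i
    using that by (intro mu_Diff) auto
  then have "AE \<omega> in M. \<forall>i\<in>I. \<mu> (C i) \<omega> = \<mu> (C i \<inter> D) \<omega> + \<mu> (C i - D) \<omega>"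
    using fin by (intro AE_finite_allI) auto
  then show ?thesis
  proof eventually_elim
    case (elim \<omega>)
    let ?b = "\<lambda>i. \<bar>\<mu> (C i \<inter> D) \<omega>\<bar> > K \<and> \<bar>\<mu> (C i - D) \<omega>\<bar> > K"
    have "(of_bool (\<exists>i\<in>I. ?b i) :: real) \<le> (\<Sum>i\<in>I. of_bool (?b i))"
    proof (cases "\<exists>i\<in>I. ?b i")
      case True
      then obtain i where i: "i \<in> I" "?b i" by blast
      have "of_bool (?b i) \<le> (\<Sum>i\<in>I. of_bool (?b i) :: real)" using i fin by (intro member_le_sum) auto
      then show ?thesis using i by auto
    next
      case False
      then have z: "(of_bool (\<exists>i\<in>I. ?b i) :: real) = 0" by (subst of_bool_eq_0_iff)
      show ?thesis unfolding z by (intro sum_nonneg) simp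
    qed
    moreover have "(\<Sum>i\<in>I. of_bool (\<bar>\<mu> (C i) \<omega>\<bar> > 2 * K) + of_bool (?b i) :: real) \<le>
      (\<Sum>i\<in>I. of_bool (\<bar>\<mu> (C i \<inter> D) \<omega>\<bar> > K) + of_bool (\<bar>\<mu> (C i - D) \<omega>\<bar> > K))"
    proof (rule sum_mono)
      fix i assume "i \<in> I"
      then have "\<mu> (C i) \<omega> = \<mu> (C i \<inter> D) \<omega> + \<mu> (C i - D) \<omega>" using elim by auto
      then show "(of_bool (\<bar>\<mu> (C i) \<omega>\<bar> > 2 * K) + of_bool (?b i) :: real) \<le> of_bool (\<bar>\<mu> (C i \<inter> D) \<omega>\<bar> > K) + of_bool (\<bar>\<mu> (C i - D) \<omega>\<bar> > K)"
        by (cases "\<bar>\<mu> (C i \<inter> D) \<omega>\<bar> > K"; cases "\<bar>\<mu> (C i - D) \<omega>\<bar> > K") auto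
    qed
    ultimately show ?case unfolding large_cells_def sum_split_index[OF fin] by (simp add: sum.distrib)
  qed
qed

text \<open>Each split adds a large cell with probability at least \<open>d - e\<close>. The
  threshold halves at each split, so the induction on \<open>m\<close> must range over all
  \<open>K\<close>. The truncation at \<open>m\<close> allows the expectation to be turned into a
  probability afterwards.\<close>

lemma many_large_cells_expectation:
  assumes "disjoint_cells I C" "unbounded_on I C d" "e > 0" "K \<ge> 0"
  shows "\<exists>I' C'. disjoint_cells I' C' \<and> (\<Union>i\<in>I'. C' i) = (\<Union>i\<in>I. C i) \<and> unbounded_on I' C' d \<and>
     real m * (d - e) \<le> expectation (\<lambda>\<omega>. min (real m) (large_cells I' C' K \<omega>))"
  using assms(4)
proof (induction m arbitrary: K)
  case 0
  have "expectation (\<lambda>\<omega>. min 0 (large_cells I C K \<omega>)) = expectation (\<lambda>\<omega>. 0)"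
    by (intro Bochner_Integration.integral_cong refl) (auto simp: large_cells_def min_def intro: sum_nonneg antisym)
  then show ?case using assms by (intro exI[of _ I] exI[of _ C]) simp
next
  case (Suc m)
  obtain I' C' where IH: "disjoint_cells I' C'" "(\<Union>i\<in>I'. C' i) = (\<Union>i\<in>I. C i)" "unbounded_on I' C' d"
    "real m * (d - e) \<le> expectation (\<lambda>\<omega>. min (real m) (large_cells I' C' (2 * K) \<omega>))"
    using Suc.IH[of "2 * K"] Suc.prems by auto
  obtain D where D[measurable]: "D \<in> sets B" and
    pD: "d - e \<le> prob {\<omega>\<in>space M. \<exists>i\<in>I'. \<bar>\<mu> (C' i \<inter> D) \<omega>\<bar> > K \<and> \<bar>\<mu> (C' i - D) \<omega>\<bar> > K}" (is "_ \<le> prob ?F")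
    using unbounded_on_split_large[OF IH(1,3) assms(3), of K] by blast
  have C[measurable]: "C' i \<in> sets B" if "i \<in> I'" for i using IH that by (auto simp: disjoint_cells_def)
  have fin: "finite I'" using IH by (auto simp: disjoint_cells_def)
  have Fm: "?F \<in> events" using fin by measurable
  let ?I = "split_index I'" and ?C = "split_cells C' D"
  have fam: "disjoint_cells ?I ?C" using IH(1) D by (rule disjoint_cells_split)
  have int: "integrable M (\<lambda>\<omega>. min (real n) (large_cells J E L \<omega>))" if "disjoint_cells J E" for n J E L
  proof (rule integrable_const_bound[of _ "real n"])
    show "(\<lambda>\<omega>. min (real n) (large_cells J E L \<omega>)) \<in> borel_measurable M"
      using large_cells_measurable[OF that] by measurable
    have "0 \<le> large_cells J E L \<omega>" for \<omega> unfolding large_cells_def by (intro sum_nonneg) auto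
    then show "AE \<omega> in M. norm (min (real n) (large_cells J E L \<omega>)) \<le> real n" by (intro AE_I2) (simp add: abs_of_nonneg)
  qed
  have intF: "integrable M (indicator ?F :: _ \<Rightarrow> real)" using Fm by (intro integrable_real_indicator) (auto simp: less_top[symmetric])
  have "real (Suc m) * (d - e) \<le> expectation (\<lambda>\<omega>. min (real m) (large_cells I' C' (2 * K) \<omega>)) + expectation (indicator ?F)"
    using IH(4) pD Fm by (simp add: algebra_simps)
  also have "\<dots> = expectation (\<lambda>\<omega>. min (real m) (large_cells I' C' (2 * K) \<omega>) + indicator ?F \<omega>)"
    using int[OF IH(1)] intF by simp
  also have "\<dots> \<le> expectation (\<lambda>\<omega>. min (real (Suc m)) (large_cells ?I ?C K \<omega>))"
  proof (rule integral_mono_AE)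
    show "AE \<omega> in M. min (real m) (large_cells I' C' (2 * K) \<omega>) + indicator ?F \<omega> \<le> min (real (Suc m)) (large_cells ?I ?C K \<omega>)"
      using large_cells_split[OF IH(1) D, of K] AE_space
      by eventually_elim (auto simp: indicator_def min_def)
  qed (use int[OF fam, of "Suc m" K] int[OF IH(1), of m "2 * K"] intF in auto)
  finally show ?case
    using fam disjoint_cells_split(2)[OF IH(1) D] IH unbounded_on_split[OF IH(1,3) D]
    by (intro exI[of _ ?I] exI[of _ ?C]) auto
qed

text \<open>A variable bounded by \<open>m\<close> with expectation at least
  \<open>m * d / 2\<close> exceeds or equals \<open>m * d / 4\<close> with probability at least
  \<open>d / 4\<close>.\<close>

lemma many_large_cells:
  assumes "disjoint_cells I C" "unbounded_on I C d" "d > 0" "K \<ge> 0" "m > 0"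
  shows "\<exists>I' C'. disjoint_cells I' C' \<and> (\<Union>i\<in>I'. C' i) = (\<Union>i\<in>I. C i) \<and> unbounded_on I' C' d \<and>
     d / 4 \<le> prob {\<omega>\<in>space M. real m * d / 4 \<le> large_cells I' C' K \<omega>}"
proof -
  obtain I' C' where *: "disjoint_cells I' C'" "(\<Union>i\<in>I'. C' i) = (\<Union>i\<in>I. C i)" "unbounded_on I' C' d"
    "real m * (d - d/2) \<le> expectation (\<lambda>\<omega>. min (real m) (large_cells I' C' K \<omega>))"
    using many_large_cells_expectation[OF assms(1,2), of "d/2" K m] assms by auto
  note [measurable] = large_cells_measurable[OF *(1)]
  let ?F = "{\<omega>\<in>space M. real m * d / 4 \<le> large_cells I' C' K \<omega>}"
  have Fm: "?F \<in> events" by measurable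
  have int: "integrable M (\<lambda>\<omega>. min (real m) (large_cells I' C' K \<omega>))"
  proof (rule integrable_const_bound[of _ "real m"])
    have "0 \<le> large_cells I' C' K \<omega>" for \<omega> unfolding large_cells_def by (intro sum_nonneg) auto
    then show "AE \<omega> in M. norm (min (real m) (large_cells I' C' K \<omega>)) \<le> real m" by (intro AE_I2) (simp add: abs_of_nonneg)
  qed measurable
  have intF: "integrable M (\<lambda>\<omega>. real m * indicator ?F \<omega>)" using Fm by (intro integrable_mult_right integrable_real_indicator) (auto simp: less_top[symmetric])
  have "expectation (\<lambda>\<omega>. min (real m) (large_cells I' C' K \<omega>)) \<le> expectation (\<lambda>\<omega>. real m * d / 4 + real m * indicator ?F \<omega>)"
  proof (rule integral_mono[OF int])
    show "integrable M (\<lambda>\<omega>. real m * d / 4 + real m * indicator ?F \<omega>)" using intF by auto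
    fix \<omega> assume "\<omega> \<in> space M"
    have "0 \<le> real m * d / 4" using assms by simp
    then show "min (real m) (large_cells I' C' K \<omega>) \<le> real m * d / 4 + real m * indicator ?F \<omega>"
      using \<open>\<omega> \<in> space M\<close> by (cases "\<omega> \<in> ?F") (simp_all add: min_le_iff_disj)
  qed
  also have "\<dots> = real m * d / 4 + real m * prob ?F"
    using intF Fm by (subst Bochner_Integration.integral_add) (auto simp: prob_space)
  finally have "real m * (d / 4) \<le> real m * prob ?F" using *(4) by (simp add: algebra_simps)
  then have "d / 4 \<le> prob ?F" using assms(5) by simp
  then show ?thesis using * by blast
qed

text \<open>Remove a random selection of cells from a partition with many large ones, each cell with
  small probability \<open>q\<close>. The union \<open>G\<close> of the selection has a value above
  1 with probability bounded below, because many cells are large; yet a cell that is large at level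
  \<open>K\<close> for a given \<omega> is removed with probability only \<open>q\<close>. Averaging
  over the selections yields a deterministic one with both properties.\<close>

lemma unbounded_on_remove:
  assumes IC: "disjoint_cells I C" and u: "unbounded_on I C d" and "d > 0" and "\<kappa> > 0"
  shows "\<exists>G I' C'. G \<in> sets B \<and> G \<subseteq> (\<Union>i\<in>I. C i) \<and> d / 32 \<le> prob {\<omega>\<in>space M. \<bar>\<mu> G \<omega>\<bar> > 1} \<and>
     disjoint_cells I' C' \<and> (\<Union>i\<in>I'. C' i) \<subseteq> (\<Union>i\<in>I. C i) - G \<and> unbounded_on I' C' (d - \<kappa>)"
proof -
  \<comment> \<open>The bound \<open>\<kappa> * d / 32\<close> keeps the penalty
    \<open>q / \<kappa>\<close> for lost cells at most half of the gain \<open>d / 16\<close>; the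
    bound 1/4 keeps the base \<open>1 - 2 * q\<close> in \<open>[1/2, 1)\<close>.\<close>
  define q where "q = min (1/4) (\<kappa> * d / 32)"
  have q: "0 < q" "q \<le> 1/4" "q \<le> \<kappa> * d / 32" using assms by (auto simp: q_def)
  \<comment> \<open>With \<open>N\<close> large cells the random selection has a sum above 1 with
    probability at least 1/4.\<close>
  obtain N where N: "(1 - 2 * q) ^ N < 1/2" using real_arch_pow_inv[of "1/2" "1 - 2 * q"] q by auto
  obtain m where m: "4 * real N / d < real m" using reals_Archimedean2 by blast
  have m0: "m > 0" using m \<open>d > 0\<close> by (cases m) (auto simp: field_simps)
  have mN: "real N \<le> real m * d / 4" using m \<open>d > 0\<close> by (simp add: field_simps)
  obtain J E where J: "disjoint_cells J E" and UE: "(\<Union>i\<in>J. E i) = (\<Union>i\<in>I. C i)" and uE: "unbounded_on J E d"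
    and pE: "d / 4 \<le> prob {\<omega>\<in>space M. real m * d / 4 \<le> large_cells J E 2 \<omega>}" (is "_ \<le> prob ?F")
    using many_large_cells[OF IC u assms(3), of 2 m] m0 by auto
  have E[measurable]: "E i \<in> sets B" if "i \<in> J" for i using J that by (auto simp: disjoint_cells_def)
  have fin: "finite J" and disj: "disjoint_family_on E J" using J by (auto simp: disjoint_cells_def)
  note [measurable] = large_cells_measurable[OF J]
  define A where "A S = {\<omega>\<in>space M. \<bar>0 + (\<Sum>i\<in>S. \<mu> (E i) \<omega>)\<bar> > 1}" for S
  have Am: "A S \<in> events" if "S \<subseteq> J" for S
  proof -
    have "E i \<in> sets B" if "i \<in> S" for i using that \<open>S \<subseteq> J\<close> E by auto
    then show ?thesis unfolding A_def by measurable
  qed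
  have big: "d / 16 \<le> bsum J (\<lambda>_. q) (\<lambda>S. prob (A S))"
  proof -
    have "1/4 * prob ?F \<le> bsum J (\<lambda>_. q) (\<lambda>S. prob (A S))"
    proof (rule bsum_prob_ge[OF Am])
      show "AE \<omega> in M. \<omega> \<in> ?F \<longrightarrow> 1/4 \<le> bsum J (\<lambda>_. q) (\<lambda>S. indicator (A S) \<omega>)"
      proof (intro AE_I2 impI)
        fix \<omega> assume w: "\<omega> \<in> ?F"
        have "large_cells J E 2 \<omega> = real (card {i\<in>J. \<bar>\<mu> (E i) \<omega>\<bar> > 2})"
          unfolding large_cells_def using fin by (simp add: sum_of_bool_eq Int_def Collect_conj_eq[symmetric] flip: Collect_conj_eq) 
        then have "N \<le> card {i\<in>J. \<bar>\<mu> (E i) \<omega>\<bar> > 2}" using w mN by simp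
        then have "(1 - 2 * q) ^ card {i\<in>J. \<bar>\<mu> (E i) \<omega>\<bar> > 2} \<le> (1 - 2 * q) ^ N"
          using q by (intro power_decreasing) auto
        then have "1/4 \<le> (1 - (1 - 2 * q) ^ card {i\<in>J. \<bar>\<mu> (E i) \<omega>\<bar> > 2}) / 2" using N by simp
        also have "\<dots> \<le> bsum J (\<lambda>_. q) (\<lambda>S. if \<bar>0 + (\<Sum>i\<in>S. \<mu> (E i) \<omega>)\<bar> > (1::real) then 1 else 0)"
          using q by (intro random_subset_large fin) auto
        also have "\<dots> = bsum J (\<lambda>_. q) (\<lambda>S. indicator (A S) \<omega>)"
          using w by (intro bsum_cong) (auto simp: A_def indicator_def)
        finally show "1/4 \<le> bsum J (\<lambda>_. q) (\<lambda>S. indicator (A S) \<omega>)" .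
      qed
    qed (use q in auto)
    then show ?thesis using pE by linarith
  qed
  have "\<exists>S D. S \<subseteq> J \<and> D \<in> sets B \<and> d / 32 \<le> prob (A S) \<and>
    d - \<kappa> \<le> prob {\<omega>\<in>space M. \<exists>i\<in>J - S. \<bar>\<mu> (E i \<inter> D) \<omega>\<bar> > real K}" for K :: nat
  proof -
    obtain D where D[measurable]: "D \<in> sets B" and dD: "d \<le> prob {\<omega>\<in>space M. \<exists>i\<in>J. \<bar>\<mu> (E i \<inter> D) \<omega>\<bar> > real K}" (is "_ \<le> prob ?FK")
      using uE unfolding unbounded_on_def by blast
    \<comment> \<open>Some cell is large at level \<open>K\<close>, but every large one is selected
      for removal. Already a single large cell is selected only with probability
      \<open>q\<close>.\<close>
    define Lost where "Lost S = {\<omega>\<in>space M. (\<exists>i\<in>J. \<bar>\<mu> (E i \<inter> D) \<omega>\<bar> > real K) \<and> (\<forall>i\<in>J. \<bar>\<mu> (E i \<inter> D) \<omega>\<bar> > real K \<longrightarrow> i \<in> S)}" for S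
    have Lm: "Lost S \<in> events" for S unfolding Lost_def using fin by measurable
    have lost: "bsum J (\<lambda>_. q) (\<lambda>S. prob (Lost S)) \<le> q"
    proof (rule bsum_prob_le[OF Lm])
      show "AE \<omega> in M. bsum J (\<lambda>_. q) (\<lambda>S. indicator (Lost S) \<omega>) \<le> q"
      proof (rule AE_I2)
        fix \<omega>
        show "bsum J (\<lambda>_. q) (\<lambda>S. indicator (Lost S) \<omega>) \<le> q"
        proof (cases "\<exists>i\<in>J. \<bar>\<mu> (E i \<inter> D) \<omega>\<bar> > real K")
          case True
          then obtain i0 where i0: "i0 \<in> J" "\<bar>\<mu> (E i0 \<inter> D) \<omega>\<bar> > real K" by blast
          have "bsum J (\<lambda>_. q) (\<lambda>S. indicator (Lost S) \<omega>) \<le> bsum J (\<lambda>_. q) (\<lambda>S. if i0 \<in> S then 1 else 0)"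
            using q i0 by (intro bsum_mono) (auto simp: Lost_def indicator_def)
          then show ?thesis using bsum_member[OF fin i0(1)] by simp
        next
          case False
          then have "indicator (Lost S) \<omega> = (0::real)" for S by (auto simp: Lost_def)
          then show ?thesis using fin q by simp
        qed
      qed
    qed
    \<comment> \<open>Gain minus weighted penalty is maximised. As the gain is at most 1, the weight
      \<open>1 / \<kappa>\<close> forces the penalty of the chosen \<open>S\<close> to be at most
      \<open>\<kappa>\<close>.\<close>
    have "d / 32 \<le> d / 16 - q / \<kappa>" using q \<open>\<kappa> > 0\<close> by (simp add: field_simps)
    also have "\<dots> \<le> bsum J (\<lambda>_. q) (\<lambda>S. prob (A S)) + (- 1 / \<kappa>) * bsum J (\<lambda>_. q) (\<lambda>S. prob (Lost S))"
      using big lost \<open>\<kappa> > 0\<close> by (simp add: divide_right_mono diff_mono)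
    also have "\<dots> = bsum J (\<lambda>_. q) (\<lambda>S. prob (A S) + (- 1 / \<kappa>) * prob (Lost S))"
      by (simp only: bsum_add bsum_cmult)
    finally obtain S where S: "S \<subseteq> J" "d / 32 \<le> prob (A S) + (- 1 / \<kappa>) * prob (Lost S)"
      using bsum_ge_exists[OF fin, of "\<lambda>_. q" "d/32" "\<lambda>S. prob (A S) + (- 1 / \<kappa>) * prob (Lost S)"] q by auto
    have nn: "0 \<le> prob (Lost S) / \<kappa>" using \<open>\<kappa> > 0\<close> by simp
    have "prob (A S) \<le> 1" by simp
    moreover have "(- 1 / \<kappa>) * prob (Lost S) = - (prob (Lost S) / \<kappa>)" by simp
    ultimately have "prob (Lost S) / \<kappa> \<le> 1" using S \<open>d > 0\<close> by linarith
    then have L: "prob (Lost S) \<le> \<kappa>" using \<open>\<kappa> > 0\<close> by (simp add: field_simps)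
    let ?G = "{\<omega>\<in>space M. \<exists>i\<in>J - S. \<bar>\<mu> (E i \<inter> D) \<omega>\<bar> > real K}"
    have Gm: "?G \<in> events" using fin by measurable
    have "prob ?FK \<le> prob (?G \<union> Lost S)"
      using Lm Gm by (intro finite_measure_mono sets.Un) (auto simp: Lost_def)
    also have "\<dots> \<le> prob ?G + prob (Lost S)" using Lm Gm by (intro measure_Un_le)
    finally have "d - \<kappa> \<le> prob ?G" using dD L by linarith
    moreover have "d / 32 \<le> prob (A S)" using S nn by simp
    ultimately show ?thesis using S D by blast
  qed
  then have "\<forall>K::nat. \<exists>S. S \<subseteq> J \<and> (\<exists>D\<in>sets B. d / 32 \<le> prob (A S) \<and>
    d - \<kappa> \<le> prob {\<omega>\<in>space M. \<exists>i\<in>J - S. \<bar>\<mu> (E i \<inter> D) \<omega>\<bar> > real K})"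
    by blast
  from choice[OF this] obtain SS where SS: "\<And>K::nat. SS K \<subseteq> J \<and> (\<exists>D\<in>sets B. d / 32 \<le> prob (A (SS K)) \<and>
    d - \<kappa> \<le> prob {\<omega>\<in>space M. \<exists>i\<in>J - SS K. \<bar>\<mu> (E i \<inter> D) \<omega>\<bar> > real K})"
    by blast
  have "range SS \<subseteq> Pow J" using SS by auto
  then have "finite (range SS)" by (rule finite_subset) (use fin in auto)
  \<comment> \<open>The selection found depends on \<open>K\<close>, but \<open>J\<close> has only
    finitely many subsets. One of them serves infinitely many levels, hence all, since the condition
    at a high level implies that at lower ones.\<close>
  then obtain K0 where inf: "infinite {K. SS K = SS K0}"
    using pigeonhole_infinite[of "UNIV::nat set" SS] by auto
  define S where "S = SS K0"
  have S: "S \<subseteq> J" "d / 32 \<le> prob (A S)" using SS[of K0] by (auto simp: S_def)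
  define G where "G = (\<Union>i\<in>S. E i)"
  have finS: "finite S" using S fin finite_subset by auto
  have "G \<in> sets B" unfolding G_def using finS S by (intro sets.finite_UN) auto
  moreover have "G \<subseteq> (\<Union>i\<in>I. C i)" unfolding G_def UE[symmetric] using S by auto
  moreover have "d / 32 \<le> prob {\<omega>\<in>space M. \<bar>\<mu> G \<omega>\<bar> > 1}"
  proof -
    have "AE \<omega> in M. \<mu> G \<omega> = (\<Sum>i\<in>S. \<mu> (E i) \<omega>)" unfolding G_def
      using finS S disj by (intro mu_UN) (auto simp: disjoint_family_on_def)
    then have "prob (A S) \<le> prob {\<omega>\<in>space M. \<bar>\<mu> G \<omega>\<bar> > 1}"
      using \<open>G \<in> sets B\<close> by (intro finite_measure_mono_AE) (auto simp: A_def elim!: eventually_mono)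
    then show ?thesis using S by linarith
  qed
  moreover have "disjoint_cells (J - S) E" using J by (auto simp: disjoint_cells_def disjoint_family_on_def)
  moreover have "(\<Union>i\<in>J - S. E i) \<subseteq> (\<Union>i\<in>I. C i) - G"
  proof
    fix x assume "x \<in> (\<Union>i\<in>J - S. E i)"
    then obtain i where i: "i \<in> J" "i \<notin> S" "x \<in> E i" by auto
    have "x \<notin> E j" if "j \<in> S" for j
    proof -
      have "j \<in> J" "j \<noteq> i" using that S i by auto
      then have "E i \<inter> E j = {}" using disj i(1) unfolding disjoint_family_on_def by simp
      then show ?thesis using i(3) by blast
    qed
    then show "x \<in> (\<Union>i\<in>I. C i) - G" using i unfolding G_def UE[symmetric] by blast
  qed
  moreover have "unbounded_on (J - S) E (d - \<kappa>)"
    unfolding unbounded_on_def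
  proof
    fix K :: real
    obtain n0 where n0: "K < real n0" using reals_Archimedean2 by blast
    obtain n where n: "n \<ge> n0" "SS n = S"
      using inf unfolding infinite_nat_iff_unbounded_le S_def by blast
    obtain D where D[measurable]: "D \<in> sets B" and p: "d - \<kappa> \<le> prob {\<omega>\<in>space M. \<exists>i\<in>J - S. \<bar>\<mu> (E i \<inter> D) \<omega>\<bar> > real n}"
      using SS[of n] n by auto
    note p
    also have "prob {\<omega>\<in>space M. \<exists>i\<in>J - S. \<bar>\<mu> (E i \<inter> D) \<omega>\<bar> > real n} \<le> prob {\<omega>\<in>space M. \<exists>i\<in>J - S. \<bar>\<mu> (E i \<inter> D) \<omega>\<bar> > K}"
    proof (rule finite_measure_mono)
      show "{\<omega>\<in>space M. \<exists>i\<in>J - S. \<bar>\<mu> (E i \<inter> D) \<omega>\<bar> > K} \<in> events" using fin by measurable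
      have "K < real n" using n n0 by simp
      then show "{\<omega>\<in>space M. \<exists>i\<in>J - S. \<bar>\<mu> (E i \<inter> D) \<omega>\<bar> > real n} \<subseteq> {\<omega>\<in>space M. \<exists>i\<in>J - S. \<bar>\<mu> (E i \<inter> D) \<omega>\<bar> > K}"
        by (auto intro: less_trans)
    qed
    finally show "\<exists>D\<in>sets B. d - \<kappa> \<le> prob {\<omega>\<in>space M. \<exists>i\<in>J - S. \<bar>\<mu> (E i \<inter> D) \<omega>\<bar> > K}"
      using D by blast
  qed
  ultimately show ?thesis by blast
qed

text \<open>Otherwise repeated removal produces disjoint sets \<open>G k\<close>, each with a value
  above 1 with probability at least \<open>e / 64\<close>, against
  \<open>mu_disjoint_null\<close>.\<close>

theorem range_bounded_in_probability:
  assumes "e > 0"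
  shows "\<exists>K. \<forall>D\<in>sets B. prob {\<omega>\<in>space M. \<bar>\<mu> D \<omega>\<bar> > K} < e"
proof (rule ccontr)
  assume "\<not> ?thesis"
  then have H: "\<exists>D\<in>sets B. e \<le> prob {\<omega>\<in>space M. \<bar>\<mu> D \<omega>\<bar> > K}" for K by (simp add: not_less)
  \<comment> \<open>The probability starts at \<open>e\<close> and loses
    \<open>e * (1/2)^Suc (Suc k)\<close> at step \<open>k\<close>, so it stays above
    \<open>e / 2\<close>; divided by 32 this gives the constant in \<open>Q\<close>.\<close>
  define P where "P k x = (disjoint_cells (fst x) (snd x) \<and> unbounded_on (fst x) (snd x) (e * (1/2 + (1/2)^Suc k)))" for k and x :: "nat set \<times> (nat \<Rightarrow> 'a set)"
  define U where "U x = (\<Union>i\<in>fst x. snd x i)" for x :: "nat set \<times> (nat \<Rightarrow> 'a set)"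
  define Q where "Q x y = (\<exists>G. G \<in> sets B \<and> G \<subseteq> U x \<and> e / 64 \<le> prob {\<omega>\<in>space M. \<bar>\<mu> G \<omega>\<bar> > 1} \<and> U y \<subseteq> U x - G)" for x y
  have "\<exists>f. \<forall>k. P k (f k) \<and> Q (f k) (f (Suc k))"
  proof (rule dependent_nat_choice)
    have "unbounded_on {0} (\<lambda>_. space B) e"
      unfolding unbounded_on_def
    proof
      fix K
      obtain D where D: "D \<in> sets B" "e \<le> prob {\<omega>\<in>space M. \<bar>\<mu> D \<omega>\<bar> > K}" using H by blast
      have "space B \<inter> D = D" using sets.sets_into_space[OF D(1)] by auto
      then show "\<exists>D\<in>sets B. e \<le> prob {\<omega>\<in>space M. \<exists>i\<in>{0::nat}. \<bar>\<mu> (space B \<inter> D) \<omega>\<bar> > K}"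
        using D by (intro bexI[of _ D]) auto
    qed
    then show "\<exists>x. P 0 x"
      by (intro exI[of _ "({0}, \<lambda>_. space B)"]) (auto simp: P_def disjoint_cells_def disjoint_family_on_def)
  next
    fix x k assume "P k x"
    let ?d = "e * (1/2 + (1/2)^Suc k)"
    have x: "disjoint_cells (fst x) (snd x)" "unbounded_on (fst x) (snd x) ?d" using \<open>P k x\<close> by (auto simp: P_def)
    have d0: "?d > 0" "?d \<ge> e/2" using \<open>e > 0\<close> by (auto simp: algebra_simps add_pos_pos)
    obtain G I' C' where G: "G \<in> sets B" "G \<subseteq> U x" "?d / 32 \<le> prob {\<omega>\<in>space M. \<bar>\<mu> G \<omega>\<bar> > 1}"
      "disjoint_cells I' C'" "(\<Union>i\<in>I'. C' i) \<subseteq> U x - G" "unbounded_on I' C' (?d - e * (1/2)^Suc (Suc k))"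
      using unbounded_on_remove[OF x d0(1), of "e * (1/2)^Suc (Suc k)"] \<open>e > 0\<close> unfolding U_def by (auto simp del: power_Suc)
    have "?d - e * (1/2)^Suc (Suc k) = e * (1/2 + (1/2)^Suc (Suc k))" by (simp add: algebra_simps)
    then have "P (Suc k) (I', C')" using G by (simp add: P_def)
    moreover have "Q x (I', C')" unfolding Q_def using G d0
      by (intro exI[of _ G]) (auto simp: U_def)
    ultimately show "\<exists>y. P (Suc k) y \<and> Q x y" by blast
  qed
  then obtain f where f: "\<And>k. Q (f k) (f (Suc k))" by blast
  then have "\<forall>k. \<exists>G. G \<in> sets B \<and> G \<subseteq> U (f k) \<and> e / 64 \<le> prob {\<omega>\<in>space M. \<bar>\<mu> G \<omega>\<bar> > 1} \<and> U (f (Suc k)) \<subseteq> U (f k) - G"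
    by (simp add: Q_def)
  from choice[OF this] obtain G where G: "\<And>k. G k \<in> sets B" "\<And>k. G k \<subseteq> U (f k)" "\<And>k. e / 64 \<le> prob {\<omega>\<in>space M. \<bar>\<mu> (G k) \<omega>\<bar> > 1}"
    "\<And>k. U (f (Suc k)) \<subseteq> U (f k) - G k"
    by blast
  have dec: "U (f n) \<subseteq> U (f m)" if "m \<le> n" for m n
    by (rule lift_Suc_antimono_le[of "\<lambda>n. U (f n)", OF _ that]) (use G(4) in blast)
  have "G m \<inter> G n = {}" if "m < n" for m n
  proof -
    have "G n \<subseteq> U (f (Suc m))" using G(2)[of n] dec[of "Suc m" n] that by auto
    then show ?thesis using G(4)[of m] by auto
  qed
  then have "disjoint_family G" unfolding disjoint_family_on_def
    by (metis inf_commute linorder_neqE_nat)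
  then have "(\<lambda>n. l0norm M (\<mu> (G n))) \<longlonglongrightarrow> 0" using G(1) by (intro mu_disjoint_null) auto
  moreover have "e / 64 \<le> l0norm M (\<mu> (G n))" for n
    using prob_le_l0norm[of "\<mu> (G n)" 1] G(1,3)[of n] by auto
  ultimately have "e / 64 \<le> 0" by (intro LIMSEQ_le_const) auto
  then show False using \<open>e > 0\<close> by simp
qed

end

section \<open>Bounds for simple integrals\<close>

context prob_space
begin

text \<open>Where the square sum exceeds \<open>2 * L\<^sup>2\<close>, at least the share 1/12 of
  all sign patterns gives a sum above \<open>L\<close>; averaging over the patterns costs the factor
  12.\<close>

lemma rademacher_square_sum:
  assumes I: "finite I" and X: "\<And>i. i \<in> I \<Longrightarrow> X i \<in> borel_measurable M" and "0 \<le> L"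
    and s: "\<And>S. S \<subseteq> I \<Longrightarrow> prob {\<omega>\<in>space M. \<bar>signsum I S (\<lambda>i. X i \<omega>)\<bar> > L} \<le> \<delta>"
  shows "prob {\<omega>\<in>space M. (\<Sum>i\<in>I. (X i \<omega>)\<^sup>2) > 2 * L\<^sup>2} \<le> 12 * \<delta>"
proof -
  note [measurable] = X
  define A where "A S = {\<omega>\<in>space M. \<bar>signsum I S (\<lambda>i. X i \<omega>)\<bar> > L}" for S
  have Am: "A S \<in> events" for S unfolding A_def signsum_def by measurable
  let ?F = "{\<omega>\<in>space M. (\<Sum>i\<in>I. (X i \<omega>)\<^sup>2) > 2 * L\<^sup>2}"
  have Fm: "?F \<in> events" by measurable
  have "1/12 * prob ?F \<le> bsum I (\<lambda>_. 1/2) (\<lambda>S. prob (A S))"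
  proof (rule bsum_prob_ge[OF Am Fm])
    show "AE \<omega> in M. \<omega> \<in> ?F \<longrightarrow> 1/12 \<le> bsum I (\<lambda>_. 1/2) (\<lambda>S. indicator (A S) \<omega>)"
    proof (intro AE_I2 impI)
      fix \<omega> assume w: "\<omega> \<in> ?F"
      have "0 \<le> 2 * L\<^sup>2" "2 * L\<^sup>2 < (\<Sum>i\<in>I. (X i \<omega>)\<^sup>2)" using w by auto
      then have "1/12 \<le> bsum I (\<lambda>_. 1/2) (\<lambda>S. if \<bar>signsum I S (\<lambda>i. X i \<omega>)\<bar> > L then 1 else 0)"
        using assms(3) by (intro rademacher_large I) linarith+
      also have "\<dots> = bsum I (\<lambda>_. 1/2) (\<lambda>S. indicator (A S) \<omega>)"
        using w by (intro bsum_cong) (auto simp: A_def indicator_def)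
      finally show "1/12 \<le> bsum I (\<lambda>_. 1/2) (\<lambda>S. indicator (A S) \<omega>)" .
    qed
  qed auto
  also have "\<dots> \<le> bsum I (\<lambda>_. 1/2) (\<lambda>_. \<delta>)"
    using s by (intro bsum_mono) (auto simp: A_def)
  finally show ?thesis using I by simp
qed

text \<open>A coefficient \<open>l i\<close> in \<open>[-1, 1]\<close> is the mean of a random sign
  that is +1 with probability \<open>(1 + l i) / 2\<close>. Either the square sum is large, at cost
  \<open>12 * \<delta>\<close>, or a large weighted sum makes at least half of the biased signed
  sums large, at cost \<open>2 * \<delta>\<close>.\<close>

lemma rademacher_contraction:
  assumes I: "finite I" and X: "\<And>i. i \<in> I \<Longrightarrow> X i \<in> borel_measurable M" and "0 \<le> L"
    and s: "\<And>S. S \<subseteq> I \<Longrightarrow> prob {\<omega>\<in>space M. \<bar>signsum I S (\<lambda>i. X i \<omega>)\<bar> > L} \<le> \<delta>"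
    and l: "\<And>i. i \<in> I \<Longrightarrow> \<bar>l i\<bar> \<le> 1"
  shows "prob {\<omega>\<in>space M. \<bar>\<Sum>i\<in>I. l i * X i \<omega>\<bar> > 3 * L} \<le> 14 * \<delta>"
proof -
  note [measurable] = X
  define A where "A S = {\<omega>\<in>space M. \<bar>signsum I S (\<lambda>i. X i \<omega>)\<bar> > L}" for S
  have Am: "A S \<in> events" for S unfolding A_def signsum_def by measurable
  let ?F = "{\<omega>\<in>space M. (\<Sum>i\<in>I. (X i \<omega>)\<^sup>2) > 2 * L\<^sup>2}"
  let ?H = "{\<omega>\<in>space M. \<bar>\<Sum>i\<in>I. l i * X i \<omega>\<bar> > 3 * L}"
  define p where "p i = (1 + l i) / 2" for i
  have p: "0 \<le> p i \<and> p i \<le> 1" if "i \<in> I" for i using l[OF that] by (auto simp: p_def)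
  have lp: "2 * p i - 1 = l i" for i by (simp add: p_def field_simps)
  have Fm: "?F \<in> events" and Hm: "?H \<in> events" by measurable
  have "1/2 * prob (?H - ?F) \<le> bsum I p (\<lambda>S. prob (A S))"
  proof (rule bsum_prob_ge[OF Am])
    show "?H - ?F \<in> events" using Fm Hm by auto
    show "AE \<omega> in M. \<omega> \<in> ?H - ?F \<longrightarrow> 1/2 \<le> bsum I p (\<lambda>S. indicator (A S) \<omega>)"
    proof (intro AE_I2 impI)
      fix \<omega> assume w: "\<omega> \<in> ?H - ?F"
      have "1/2 \<le> bsum I p (\<lambda>S. if \<bar>signsum I S (\<lambda>i. X i \<omega>)\<bar> > L then 1 else 0)"
      proof (rule ccontr)
        assume "\<not> ?thesis"
        then have "\<bar>\<Sum>i\<in>I. (2 * p i - 1) * X i \<omega>\<bar> \<le> 3 * L"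
          using w assms(3) by (intro mean_le_of_signsums I p) auto
        then show False using w by (simp add: lp)
      qed
      also have "\<dots> = bsum I p (\<lambda>S. indicator (A S) \<omega>)"
        using w by (intro bsum_cong) (auto simp: A_def indicator_def)
      finally show "1/2 \<le> bsum I p (\<lambda>S. indicator (A S) \<omega>)" .
    qed
  qed (rule p)
  also have "\<dots> \<le> bsum I p (\<lambda>_. \<delta>)"
    using s by (intro bsum_mono p) (auto simp: A_def)
  finally have "prob (?H - ?F) \<le> 2 * \<delta>" using I by simp
  moreover have "prob ?F \<le> 12 * \<delta>" by (rule rademacher_square_sum[OF I X assms(3) s])
  moreover have "prob ?H \<le> prob ((?H - ?F) \<union> ?F)" using Fm Hm by (intro finite_measure_mono) auto
  moreover have "prob ((?H - ?F) \<union> ?F) \<le> prob (?H - ?F) + prob ?F" using Fm Hm by (intro measure_Un_le) auto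
  ultimately show ?thesis by linarith
qed

end

context stoch_measure
begin

text \<open>A signed sum over the level sets is a difference of two values of \<open>\<mu>\<close>,
  so the bounded range controls all sign patterns at once, and contraction replaces the signs by the
  values of \<open>g\<close>.\<close>

lemma SI_bounded_by_1:
  assumes "e > 0"
  shows "\<exists>K>0. \<forall>g A. simple_function B g \<longrightarrow> (\<forall>s\<in>space B. \<bar>g s\<bar> \<le> 1) \<longrightarrow> A \<in> sets B \<longrightarrow>
     prob {\<omega>\<in>space M. \<bar>SI A g \<omega>\<bar> > K} < e"
proof -
  \<comment> \<open>29 exceeds the factor \<open>14 * 2\<close> lost in the contraction and in the
    splitting into two values of \<open>\<mu>\<close>, so the final inequality is strict.\<close>
  obtain K0 where K0: "\<And>D. D \<in> sets B \<Longrightarrow> prob {\<omega>\<in>space M. \<bar>\<mu> D \<omega>\<bar> > K0} < e / 29"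
    using range_bounded_in_probability[of "e / 29"] assms by auto
  define K where "K = max K0 1"
  have K: "K > 0" by (simp add: K_def)
  have Kp: "prob {\<omega>\<in>space M. \<bar>\<mu> D \<omega>\<bar> > K} \<le> e / 29" if D: "D \<in> sets B" for D
  proof -
    have "prob {\<omega>\<in>space M. \<bar>\<mu> D \<omega>\<bar> > K} \<le> prob {\<omega>\<in>space M. \<bar>\<mu> D \<omega>\<bar> > K0}"
      using D by (intro finite_measure_mono) (auto simp: K_def)
    then show ?thesis using K0[OF D] by simp
  qed
  show ?thesis
  proof (intro exI[of _ "3 * (2 * K)"] conjI allI impI)
    show "3 * (2 * K) > 0" using K by simp
    fix g :: "'a \<Rightarrow> real" and A assume g: "simple_function B g" and g1: "\<forall>s\<in>space B. \<bar>g s\<bar> \<le> 1" and A: "A \<in> sets B"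
    define I where "I = g ` space B"
    define C where "C c = A \<inter> (g -` {c} \<inter> space B)" for c
    have I: "finite I" unfolding I_def using g by (rule simple_functionD)
    have Cm[measurable]: "C c \<in> sets B" for c unfolding C_def using simple_functionD(2)[OF g] A by auto
    have Cd: "disjoint_family_on C J" for J by (auto simp: disjoint_family_on_def C_def)
    have "prob {\<omega>\<in>space M. \<bar>\<Sum>c\<in>I. c * \<mu> (C c) \<omega>\<bar> > 3 * (2 * K)} \<le> 14 * (2 * (e / 29))"
    proof (rule rademacher_contraction[OF I])
      fix S assume S: "S \<subseteq> I"
      then have fS: "finite S" using I finite_subset by auto
      have "AE \<omega> in M. \<mu> (\<Union>c\<in>S. C c) \<omega> = (\<Sum>c\<in>S. \<mu> (C c) \<omega>)" using fS Cd by (intro mu_UN) auto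
      moreover have "AE \<omega> in M. \<mu> (\<Union>c\<in>I-S. C c) \<omega> = (\<Sum>c\<in>I-S. \<mu> (C c) \<omega>)" using I Cd by (intro mu_UN) auto
      ultimately have ae: "AE \<omega> in M. signsum I S (\<lambda>c. \<mu> (C c) \<omega>) = \<mu> (\<Union>c\<in>S. C c) \<omega> - \<mu> (\<Union>c\<in>I-S. C c) \<omega>"
      proof eventually_elim
        case (elim \<omega>)
        have "signsum I S (\<lambda>c. \<mu> (C c) \<omega>) = (\<Sum>c\<in>S. \<mu> (C c) \<omega>) + (\<Sum>c\<in>I-S. - \<mu> (C c) \<omega>)"
          unfolding signsum_def using I S
          by (subst sum.If_cases) (auto simp: Int_absorb1 Diff_eq intro!: sum.cong)
        then show ?case using elim by (simp add: sum_negf)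
      qed
      have m: "(\<Union>c\<in>S. C c) \<in> sets B" "(\<Union>c\<in>I-S. C c) \<in> sets B" using fS I by auto
      have m2: "{\<omega>\<in>space M. \<bar>\<mu> D \<omega>\<bar> > K} \<in> events" if "D \<in> sets B" for D using that by measurable
      have "prob {\<omega>\<in>space M. \<bar>signsum I S (\<lambda>c. \<mu> (C c) \<omega>)\<bar> > 2 * K} \<le>
        prob ({\<omega>\<in>space M. \<bar>\<mu> (\<Union>c\<in>S. C c) \<omega>\<bar> > K} \<union> {\<omega>\<in>space M. \<bar>\<mu> (\<Union>c\<in>I-S. C c) \<omega>\<bar> > K})"
        using ae m2[OF m(1)] m2[OF m(2)] by (intro finite_measure_mono_AE) (auto elim!: eventually_mono)
      also have "\<dots> \<le> e/29 + e/29"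
        using measure_Un_le[OF m2[OF m(1)] m2[OF m(2)]] Kp[OF m(1)] Kp[OF m(2)] by linarith
      finally show "prob {\<omega>\<in>space M. \<bar>signsum I S (\<lambda>c. \<mu> (C c) \<omega>)\<bar> > 2 * K} \<le> 2 * (e/29)" by simp
    qed (use K g1 in \<open>auto simp: I_def\<close>)
    also have "\<dots> < e" using assms by simp
    finally show "prob {\<omega>\<in>space M. \<bar>SI A g \<omega>\<bar> > 3 * (2 * K)} < e"
      unfolding simple_stochastic_integral_def I_def C_def .
  qed
qed

lemma SI_bounded:
  assumes "e > 0"
  shows "\<exists>K>0. \<forall>c\<ge>0. \<forall>g A. simple_function B g \<longrightarrow> (\<forall>s\<in>space B. \<bar>g s\<bar> \<le> c) \<longrightarrow> A \<in> sets B \<longrightarrow>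
     prob {\<omega>\<in>space M. \<bar>SI A g \<omega>\<bar> > c * K} < e"
proof -
  obtain K where K: "K > 0" and Kp: "\<And>g A. simple_function B g \<Longrightarrow> (\<forall>s\<in>space B. \<bar>g s\<bar> \<le> 1) \<Longrightarrow> A \<in> sets B \<Longrightarrow>
     prob {\<omega>\<in>space M. \<bar>SI A g \<omega>\<bar> > K} < e" using SI_bounded_by_1[OF assms] by blast
  show ?thesis
  proof (intro exI[of _ K] conjI allI impI K)
    fix c :: real and g :: "'a \<Rightarrow> real" and A assume c: "0 \<le> c" and g: "simple_function B g" "\<forall>s\<in>space B. \<bar>g s\<bar> \<le> c" and A: "A \<in> sets B"
    have gc: "simple_function B (\<lambda>s. g s / c)" using g by (intro simple_function_compose1[of B g "\<lambda>x. x / c", unfolded o_def]) auto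
    \<comment> \<open>This covers \<open>c = 0\<close> as well: then \<open>g\<close> vanishes on
      the space, and so does the right integrand.\<close>
    have "SI A g = SI A (\<lambda>s. c * (g s / c))" using g by (intro SI_cong) auto
    then have ae: "AE \<omega> in M. SI A g \<omega> = c * SI A (\<lambda>s. g s / c) \<omega>" using SI_cmult[OF gc A, of c] by simp
    have "prob {\<omega>\<in>space M. \<bar>SI A g \<omega>\<bar> > c * K} \<le> prob {\<omega>\<in>space M. \<bar>SI A (\<lambda>s. g s / c) \<omega>\<bar> > K}"
    proof (rule finite_measure_mono_AE)
      show "AE \<omega> in M. \<omega> \<in> {\<omega>\<in>space M. \<bar>SI A g \<omega>\<bar> > c * K} \<longrightarrow> \<omega> \<in> {\<omega>\<in>space M. \<bar>SI A (\<lambda>s. g s / c) \<omega>\<bar> > K}"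
        using ae
      proof eventually_elim
        case (elim \<omega>)
        show ?case
        proof
          assume w: "\<omega> \<in> {\<omega>\<in>space M. \<bar>SI A g \<omega>\<bar> > c * K}"
          then have "c * K < c * \<bar>SI A (\<lambda>s. g s / c) \<omega>\<bar>" using elim c by (simp add: abs_mult)
          then have "K < \<bar>SI A (\<lambda>s. g s / c) \<omega>\<bar>" using c by (rule mult_left_less_imp_less)
          then show "\<omega> \<in> {\<omega>\<in>space M. \<bar>SI A (\<lambda>s. g s / c) \<omega>\<bar> > K}" using w by simp
        qed
      qed
      show "{\<omega>\<in>space M. \<bar>SI A (\<lambda>s. g s / c) \<omega>\<bar> > K} \<in> events" using SI_measurable[OF gc A] by measurable
    qed
    also have "\<dots> < e"
    proof (rule Kp[OF gc _ A], rule ballI)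
      fix s assume "s \<in> space B"
      then show "\<bar>g s / c\<bar> \<le> 1" using g(2) c by (cases "c = 0") (auto simp: divide_le_eq)
    qed
    finally show "prob {\<omega>\<in>space M. \<bar>SI A g \<omega>\<bar> > c * K} < e" .
  qed
qed

lemma SI_small:
  assumes "e > 0"
  shows "\<exists>\<eta>>0. \<forall>g A. simple_function B g \<longrightarrow> (\<forall>s\<in>space B. \<bar>g s\<bar> \<le> \<eta>) \<longrightarrow> A \<in> sets B \<longrightarrow>
     l0norm M (SI A g) < e"
proof -
  obtain K where K: "K > 0" and Kp: "\<And>c g A. c \<ge> 0 \<Longrightarrow> simple_function B g \<Longrightarrow> (\<forall>s\<in>space B. \<bar>g s\<bar> \<le> c) \<Longrightarrow> A \<in> sets B \<Longrightarrow>
     prob {\<omega>\<in>space M. \<bar>SI A g \<omega>\<bar> > c * K} < e/2" using SI_bounded[of "e/2"] assms by auto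
  show ?thesis
  proof (intro exI[of _ "e / 2 / K"] conjI allI impI)
    show "e / 2 / K > 0" using K assms by simp
    fix g :: "'a \<Rightarrow> real" and A assume *: "simple_function B g" "\<forall>s\<in>space B. \<bar>g s\<bar> \<le> e / 2 / K" "A \<in> sets B"
    have "l0norm M (SI A g) \<le> e/2 + prob {\<omega>\<in>space M. \<bar>SI A g \<omega>\<bar> > e/2}"
      using * assms by (intro l0norm_le_prob) auto
    also have "\<dots> < e" using Kp[OF _ *] K assms by simp
    finally show "l0norm M (SI A g) < e" .
  qed
qed

text \<open>Otherwise successive finite blocks of indices, each with norm above
  \<open>e / 2\<close>, give disjoint unions that contradict \<open>mu_disjoint_null\<close>. An
  infinite \<open>S\<close> is cut down to a finite block by \<sigma>-additivity.\<close>

lemma uniformly_small_tail: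
  assumes D: "\<And>j::nat. D j \<in> sets B" "disjoint_family D" and "e > 0"
  shows "\<exists>p. \<forall>S\<subseteq>{p..}. l0norm M (\<mu> (\<Union>j\<in>S. D j)) \<le> e"
proof (rule ccontr)
  assume "\<not> ?thesis"
  then have H: "\<exists>S\<subseteq>{p..}. l0norm M (\<mu> (\<Union>j\<in>S. D j)) > e" for p by (simp add: not_le)
  have Um[measurable]: "(\<Union>j\<in>S. D j) \<in> sets B" for S :: "nat set" using D(1) by (intro sets.countable_UN'') auto
  have F: "\<exists>q S. S \<subseteq> {p..<q} \<and> l0norm M (\<mu> (\<Union>j\<in>S. D j)) > e/2" for p
  proof -
    obtain S where S: "S \<subseteq> {p..}" "l0norm M (\<mu> (\<Union>j\<in>S. D j)) > e" using H by blast
    define D' where "D' j = (if j \<in> S then D j else {})" for j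
    have D'm[measurable]: "D' j \<in> sets B" for j using D by (simp add: D'_def)
    have U: "(\<Union>j. D' j) = (\<Union>j\<in>S. D j)" by (auto simp: D'_def split: if_splits)
    have "(\<lambda>n. l0norm M (\<lambda>\<omega>. (\<Sum>i<n. \<mu> (D' i) \<omega>) - \<mu> (\<Union>j\<in>S. D j) \<omega>)) \<longlonglongrightarrow> 0"
    proof -
      have "range D' \<subseteq> sets B" using D'm by auto
      moreover have "disjoint_family D'" using D(2) by (auto simp: D'_def disjoint_family_on_def)
      ultimately show ?thesis using mu_sigma[of D'] U by simp
    qed
    from order_tendstoD(2)[OF this, of "e/2"] \<open>e > 0\<close> obtain n where
      n: "l0norm M (\<lambda>\<omega>. (\<Sum>i<n. \<mu> (D' i) \<omega>) - \<mu> (\<Union>j\<in>S. D j) \<omega>) < e/2" by (auto simp: eventually_sequentially)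
    have "(\<Union>i<n. D' i) = (\<Union>j\<in>S \<inter> {..<n}. D j)" by (auto simp: D'_def split: if_splits)
    moreover have "AE \<omega> in M. \<mu> (\<Union>i<n. D' i) \<omega> = (\<Sum>i<n. \<mu> (D' i) \<omega>)"
      using D by (intro mu_UN) (auto simp: D'_def disjoint_family_on_def)
    ultimately have ae: "AE \<omega> in M. \<mu> (\<Union>j\<in>S \<inter> {..<n}. D j) \<omega> = (\<Sum>i<n. \<mu> (D' i) \<omega>)" by simp
    have "l0norm M (\<mu> (\<Union>j\<in>S. D j)) \<le> l0norm M (\<mu> (\<Union>j\<in>S \<inter> {..<n}. D j)) + l0norm M (\<lambda>\<omega>. (\<Sum>i<n. \<mu> (D' i) \<omega>) - \<mu> (\<Union>j\<in>S. D j) \<omega>)"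
      using ae by (intro l0norm_triangle_AE) (auto elim!: eventually_mono)
    then have "l0norm M (\<mu> (\<Union>j\<in>S \<inter> {..<n}. D j)) > e/2" using S n by linarith
    then show ?thesis using S by (intro exI[of _ n] exI[of _ "S \<inter> {..<n}"]) auto
  qed
  define P where "P x = (snd (snd x) \<subseteq> {fst x..<fst (snd x)} \<and> l0norm M (\<mu> (\<Union>j\<in>snd (snd x). D j)) > e/2)"
    for x :: "nat \<times> nat \<times> nat set"
  have "\<exists>f. \<forall>n. P (f n) \<and> fst (snd (f n)) \<le> fst (f (Suc n))"
  proof (rule dependent_nat_choice)
    show "\<exists>x. P x" using F[of 0] by (auto simp: P_def)
    fix x
    obtain q S where "S \<subseteq> {fst (snd x)..<q}" "l0norm M (\<mu> (\<Union>j\<in>S. D j)) > e/2" using F by blast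
    then show "\<exists>y. P y \<and> fst (snd x) \<le> fst y"
      by (intro exI[of _ "(fst (snd x), q, S)"]) (auto simp: P_def)
  qed
  then obtain f where f: "\<And>n. P (f n)" "\<And>n. fst (snd (f n)) \<le> fst (f (Suc n))" by blast
  define S where "S n = snd (snd (f n))" for n
  have S1: "S n \<subseteq> {fst (f n)..<fst (snd (f n))}" "l0norm M (\<mu> (\<Union>j\<in>S n. D j)) > e/2" for n
    using f(1)[of n] by (auto simp: P_def S_def)
  have le: "fst (f n) \<le> fst (snd (f n))" for n
  proof (rule ccontr)
    assume "\<not> ?thesis"
    then have "S n = {}" using S1(1)[of n] by auto
    then have "l0norm M (\<mu> {}) > e/2" using S1(2)[of n] by simp
    then show False using l0norm_0_AE[OF mu_empty] \<open>e > 0\<close> by simp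
  qed
  have mono: "fst (f m) \<le> fst (f n)" if "m \<le> n" for m n
    by (rule lift_Suc_mono_le[of "\<lambda>n. fst (f n)", OF _ that]) (use le f(2) order_trans in blast)
  have dS: "S m \<inter> S n = {}" if "m < n" for m n
  proof -
    have "fst (snd (f m)) \<le> fst (f n)" using f(2)[of m] mono[of "Suc m" n] that by simp
    then show ?thesis using S1(1)[of m] S1(1)[of n] by fastforce
  qed
  have "(\<Union>j\<in>S m. D j) \<inter> (\<Union>j\<in>S n. D j) = {}" if "m < n" for m n
  proof -
    have "D i \<inter> D j = {}" if "i \<in> S m" "j \<in> S n" for i j
    proof -
      have "i \<noteq> j" using dS[OF \<open>m < n\<close>] that by auto
      then show ?thesis using D(2) by (auto simp: disjoint_family_on_def)
    qed
    then show ?thesis by blast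
  qed
  then have "disjoint_family (\<lambda>n. \<Union>j\<in>S n. D j)" unfolding disjoint_family_on_def
    by (metis inf_commute linorder_neqE_nat)
  then have "(\<lambda>n. l0norm M (\<mu> (\<Union>j\<in>S n. D j))) \<longlonglongrightarrow> 0" by (intro mu_disjoint_null) auto
  then have "e/2 \<le> 0" using S1(2) by (intro LIMSEQ_le_const) (auto intro: less_imp_le)
  then show False using \<open>e > 0\<close> by simp
qed

end

context prob_space
begin

text \<open>A Nikodym convergence theorem: the Baire category argument on the Cantor space of subsets of
  the naturals is carried out by hand.\<close>

lemma nikodym_uniform_tail:
  fixes B :: "'b measure" and \<nu> :: "nat \<Rightarrow> 'b set \<Rightarrow> 'a \<Rightarrow> real"
  assumes \<nu>: "\<And>n. stochastic_measure M B (\<nu> n)"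
    and D: "\<And>j::nat. D j \<in> sets B" "disjoint_family D" and "e > 0"
    and C: "\<And>A e. A \<in> sets B \<Longrightarrow> e > 0 \<Longrightarrow> \<exists>N. \<forall>n\<ge>N. \<forall>m\<ge>N. l0norm M (\<lambda>\<omega>. \<nu> n A \<omega> - \<nu> m A \<omega>) < e"
  shows "\<exists>p. \<forall>n. \<forall>S\<subseteq>{p..}. l0norm M (\<nu> n (\<Union>j\<in>S. D j)) \<le> e"
proof -
  have sm: "stoch_measure M B (\<nu> n)" for n
    using \<nu> by (intro stoch_measure.intro prob_space_axioms stoch_measure_axioms.intro)
  define U where "U S = (\<Union>j\<in>S. D j)" for S :: "nat set"
  have Um: "U S \<in> sets B" for S unfolding U_def using D(1) by (intro sets.countable_UN'') auto
  have \<nu>m[measurable]: "\<nu> n (U S) \<in> borel_measurable M" for n S using stoch_measure.mu_measurable[OF sm Um] .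
  have add: "AE \<omega> in M. \<nu> n (U (S \<union> R)) \<omega> = \<nu> n (U S) \<omega> + \<nu> n (U R) \<omega>" if "S \<inter> R = {}" for n S R
  proof -
    have "D i \<inter> D j = {}" if "i \<in> S" "j \<in> R" for i j
    proof -
      have "i \<noteq> j" using that \<open>S \<inter> R = {}\<close> by auto
      then show ?thesis using D(2) by (auto simp: disjoint_family_on_def)
    qed
    then have "U S \<inter> U R = {}" by (auto simp: U_def)
    moreover have "U (S \<union> R) = U S \<union> U R" by (auto simp: U_def)
    ultimately show ?thesis using stoch_measure.mu_Un[OF sm Um Um] by simp
  qed
  define \<epsilon> where "\<epsilon> = e / 3"
  have \<epsilon>: "\<epsilon> > 0" using \<open>e > 0\<close> by (simp add: \<epsilon>_def)
  let ?d = "\<lambda>n m S. l0norm M (\<lambda>\<omega>. \<nu> n (U S) \<omega> - \<nu> m (U S) \<omega>)"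
  have tail: "\<exists>p. \<forall>S\<subseteq>{p..}. l0norm M (\<nu> n (U S)) \<le> r" if "r > 0" for n r
    using stoch_measure.uniformly_small_tail[OF sm D that] by (simp add: U_def)
  \<comment> \<open>The Baire step: a subset of the naturals is a point of the Cantor space, and
    \<open>(p, S0)\<close> describes a cylinder. The Cauchy condition at each single
    \<open>S\<close> becomes uniform on one whole cylinder for all late indices.\<close>
  have "\<exists>k p S0. S0 \<subseteq> {..<p} \<and> (\<forall>S. S \<inter> {..<p} = S0 \<longrightarrow> (\<forall>n\<ge>k. \<forall>m\<ge>k. ?d n m S \<le> \<epsilon>))"
  proof (rule ccontr)
    assume "\<not> ?thesis"
    then have H: "\<exists>S. S \<inter> {..<p} = S0 \<and> (\<exists>n\<ge>k. \<exists>m\<ge>k. ?d n m S > \<epsilon>)" if "S0 \<subseteq> {..<p}" for k p S0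
      using that by (meson not_le)
    \<comment> \<open>If no such cylinder exists, cylinders can be shrunk so that in stage
      \<open>k\<close> some pair of indices beyond \<open>k\<close> keeps its difference above
      \<open>\<epsilon> / 2\<close> throughout. The common point of all these cylinders violates the
      Cauchy condition.\<close>
    define Q where "Q k x y = (fst x < fst y \<and> snd y \<inter> {..<fst x} = snd x \<and>
       (\<exists>n\<ge>k. \<exists>m\<ge>k. \<forall>S. S \<inter> {..<fst y} = snd y \<longrightarrow> ?d n m S > \<epsilon>/2))" for k :: nat and x y :: "nat \<times> nat set"
    have "\<exists>f. \<forall>k. snd (f k) \<subseteq> {..<fst (f k)} \<and> Q k (f k) (f (Suc k))"
    proof (rule dependent_nat_choice)
      show "\<exists>x :: nat \<times> nat set. snd x \<subseteq> {..<fst x}" by (intro exI[of _ "(0, {})"]) auto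
      fix x :: "nat \<times> nat set" and k assume x: "snd x \<subseteq> {..<fst x}"
      obtain S n m where S: "S \<inter> {..<fst x} = snd x" "n \<ge> k" "m \<ge> k" "?d n m S > \<epsilon>" using H[OF x, of k] by blast
      obtain p1 where p1: "\<And>R. R \<subseteq> {p1..} \<Longrightarrow> l0norm M (\<nu> n (U R)) \<le> \<epsilon>/8" using tail[of "\<epsilon>/8" n] \<epsilon> by auto
      obtain p2 where p2: "\<And>R. R \<subseteq> {p2..} \<Longrightarrow> l0norm M (\<nu> m (U R)) \<le> \<epsilon>/8" using tail[of "\<epsilon>/8" m] \<epsilon> by auto
      define p where "p = max (Suc (fst x)) (max p1 p2)"
      have p: "p1 \<le> p" "p2 \<le> p" "fst x < p" by (auto simp: p_def)
      \<comment> \<open>Beyond \<open>p\<close> both measures are uniformly small, so replacing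
        \<open>S\<close> by a set that agrees with it below \<open>p\<close> costs four terms of at
        most \<open>\<epsilon> / 8\<close>.\<close>
      have big: "?d n m R > \<epsilon>/2" if R: "R \<inter> {..<p} = S \<inter> {..<p}" for R
      proof -
        define S0 where "S0 = S \<inter> {..<p}"
        have sp: "AE \<omega> in M. \<nu> i (U T) \<omega> = \<nu> i (U S0) \<omega> + \<nu> i (U (T \<inter> {p..})) \<omega>" if "T \<inter> {..<p} = S0" for T i
        proof -
          have "T = S0 \<union> (T \<inter> {p..})" using that by auto
          moreover have "S0 \<inter> (T \<inter> {p..}) = {}" by (auto simp: S0_def)
          ultimately show ?thesis using add[of S0 "T \<inter> {p..}" i] by simp
        qed
        have ae: "AE \<omega> in M. \<bar>\<nu> n (U S) \<omega> - \<nu> m (U S) \<omega>\<bar> \<le> \<bar>\<nu> n (U R) \<omega> - \<nu> m (U R) \<omega>\<bar> +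
            \<bar>(\<nu> n (U (S \<inter> {p..})) \<omega> - \<nu> n (U (R \<inter> {p..})) \<omega>) - (\<nu> m (U (S \<inter> {p..})) \<omega> - \<nu> m (U (R \<inter> {p..})) \<omega>)\<bar>"
        proof -
          have RS: "S \<inter> {..<p} = S0" "R \<inter> {..<p} = S0" using R by (auto simp: S0_def)
          show ?thesis
            using sp[OF RS(1), of n] sp[OF RS(1), of m] sp[OF RS(2), of n] sp[OF RS(2), of m]
            by eventually_elim linarith
        qed
        have "?d n m S \<le> ?d n m R + l0norm M (\<lambda>\<omega>. (\<nu> n (U (S \<inter> {p..})) \<omega> - \<nu> n (U (R \<inter> {p..})) \<omega>) - (\<nu> m (U (S \<inter> {p..})) \<omega> - \<nu> m (U (R \<inter> {p..})) \<omega>))"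
          by (rule l0norm_triangle_AE[OF _ _ _ ae]) measurable
        also have "l0norm M (\<lambda>\<omega>. (\<nu> n (U (S \<inter> {p..})) \<omega> - \<nu> n (U (R \<inter> {p..})) \<omega>) - (\<nu> m (U (S \<inter> {p..})) \<omega> - \<nu> m (U (R \<inter> {p..})) \<omega>)) \<le>
            l0norm M (\<lambda>\<omega>. \<nu> n (U (S \<inter> {p..})) \<omega> - \<nu> n (U (R \<inter> {p..})) \<omega>) + l0norm M (\<lambda>\<omega>. \<nu> m (U (S \<inter> {p..})) \<omega> - \<nu> m (U (R \<inter> {p..})) \<omega>)"
          by (rule l0norm_triangle_AE) auto
        also have "l0norm M (\<lambda>\<omega>. \<nu> n (U (S \<inter> {p..})) \<omega> - \<nu> n (U (R \<inter> {p..})) \<omega>) \<le> l0norm M (\<nu> n (U (S \<inter> {p..}))) + l0norm M (\<nu> n (U (R \<inter> {p..})))"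
          by (rule l0norm_triangle_AE) auto
        also have "l0norm M (\<lambda>\<omega>. \<nu> m (U (S \<inter> {p..})) \<omega> - \<nu> m (U (R \<inter> {p..})) \<omega>) \<le> l0norm M (\<nu> m (U (S \<inter> {p..}))) + l0norm M (\<nu> m (U (R \<inter> {p..})))"
          by (rule l0norm_triangle_AE) auto
        finally have "?d n m S \<le> ?d n m R + ((l0norm M (\<nu> n (U (S \<inter> {p..}))) + l0norm M (\<nu> n (U (R \<inter> {p..})))) + (l0norm M (\<nu> m (U (S \<inter> {p..}))) + l0norm M (\<nu> m (U (R \<inter> {p..})))))"
          by simp
        moreover have "l0norm M (\<nu> n (U (S \<inter> {p..}))) \<le> \<epsilon>/8" "l0norm M (\<nu> n (U (R \<inter> {p..}))) \<le> \<epsilon>/8"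
          by (rule p1, use p in force)+
        moreover have "l0norm M (\<nu> m (U (S \<inter> {p..}))) \<le> \<epsilon>/8" "l0norm M (\<nu> m (U (R \<inter> {p..}))) \<le> \<epsilon>/8"
          by (rule p2, use p in force)+
        ultimately show ?thesis using S(4) by linarith
      qed
      have "S \<inter> {..<p} \<inter> {..<fst x} = S \<inter> {..<fst x}" using p(3) by auto
      then have "Q k x (p, S \<inter> {..<p})"
        unfolding Q_def fst_conv snd_conv using S(1-3) p(3) big by blast
      then show "\<exists>y. snd y \<subseteq> {..<fst y} \<and> Q k x y" by (intro exI[of _ "(p, S \<inter> {..<p})"]) auto
    qed
    then obtain f where f: "\<And>k. snd (f k) \<subseteq> {..<fst (f k)}" "\<And>k. Q k (f k) (f (Suc k))" by blast
    define S where "S = (\<Union>k. snd (f k))"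
    have mono: "fst (f j) \<le> fst (f k)" if "j \<le> k" for j k
      by (rule lift_Suc_mono_le[of "\<lambda>n. fst (f n)", OF _ that]) (use f(2) in \<open>auto simp: Q_def less_imp_le\<close>)
    have step: "snd (f (k + j)) \<inter> {..<fst (f k)} = snd (f k)" for k j
    proof (induction j)
      case 0 show ?case using f(1)[of k] by auto
    next
      case (Suc j)
      have 1: "snd (f (Suc (k + j))) \<inter> {..<fst (f (k + j))} = snd (f (k + j))" using f(2)[of "k + j"] by (auto simp: Q_def)
      have 2: "fst (f k) \<le> fst (f (k + j))" using mono[of k "k + j"] by simp
      have "snd (f (Suc (k + j))) \<inter> {..<fst (f k)} =
          (snd (f (Suc (k + j))) \<inter> {..<fst (f (k + j))}) \<inter> {..<fst (f k)}" using 2 by fastforce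
      then show ?case using Suc 1 by simp
    qed
    have Sk: "S \<inter> {..<fst (f k)} = snd (f k)" for k
    proof
      show "snd (f k) \<subseteq> S \<inter> {..<fst (f k)}" using f(1)[of k] by (auto simp: S_def)
      show "S \<inter> {..<fst (f k)} \<subseteq> snd (f k)"
      proof
        fix i assume "i \<in> S \<inter> {..<fst (f k)}"
        then obtain j where j: "i \<in> snd (f j)" "i < fst (f k)" by (auto simp: S_def)
        show "i \<in> snd (f k)"
        proof (cases "j \<le> k")
          case True
          then show ?thesis using step[of j "k - j"] j by auto
        next
          case False
          then show ?thesis using step[of k "j - k"] j by auto
        qed
      qed
    qed
    obtain N where N: "\<And>n m. n \<ge> N \<Longrightarrow> m \<ge> N \<Longrightarrow> ?d n m S < \<epsilon>/2" using C[OF Um, of "\<epsilon>/2" S] \<epsilon> by auto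
    obtain n m where "n \<ge> N" "m \<ge> N" "?d n m S > \<epsilon>/2" using f(2)[of N] Sk[of "Suc N"] unfolding Q_def by blast
    then show False using N[of n m] by simp
  qed
  then obtain k p S0 where S0: "S0 \<subseteq> {..<p}" and kp': "\<forall>S. S \<inter> {..<p} = S0 \<longrightarrow> (\<forall>n\<ge>k. \<forall>m\<ge>k. ?d n m S \<le> \<epsilon>)"
    by (elim exE conjE) (rule that)
  note kp = kp'[rule_format]
  have "\<forall>n. \<exists>p. \<forall>S\<subseteq>{p..}. l0norm M (\<nu> n (U S)) \<le> \<epsilon>" using tail \<epsilon> by blast
  from choice[OF this] obtain pp where pp: "\<And>n S. S \<subseteq> {pp n..} \<Longrightarrow> l0norm M (\<nu> n (U S)) \<le> \<epsilon>" by blast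
  \<comment> \<open>The measures with index up to \<open>k\<close> have their own uniform tails, and
    finitely many of these combine; later ones are compared with \<open>\<nu> k\<close>.\<close>
  define p' where "p' = p + (\<Sum>i\<le>k. pp i)"
  have p'1: "pp i \<le> p'" if "i \<le> k" for i
    using member_le_sum[of i "{..k}" pp] that by (simp add: p'_def)
  have "l0norm M (\<nu> n (U S)) \<le> e" if S: "S \<subseteq> {p'..}" for n S
  proof (cases "n \<le> k")
    case True
    then have "S \<subseteq> {pp n..}" using p'1[of n] S by auto
    then show ?thesis using pp[of S n] \<epsilon> by (simp add: \<epsilon>_def)
  next
    case False
    have "S \<subseteq> {pp k..}" using p'1[of k] S by auto
    then have 1: "l0norm M (\<nu> k (U S)) \<le> \<epsilon>" by (rule pp)
    have Sp: "p \<le> i" if "i \<in> S" for i using subsetD[OF S that] by (simp add: p'_def)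
    have Sp0: "i < p" if "i \<in> S0" for i using subsetD[OF S0 that] by simp
    \<comment> \<open>\<open>S\<close> is the difference of \<open>S \<union> S0\<close> and
      \<open>S0\<close>, both in the good cylinder. Two differences and the tail of
      \<open>\<nu> k\<close> make up \<open>3 * \<epsilon> = e\<close>.\<close>
    have dis: "S \<inter> S0 = {}" using Sp Sp0 by fastforce
    have "(S \<union> S0) \<inter> {..<p} = S0" using Sp Sp0 by fastforce
    then have 2: "?d n k (S \<union> S0) \<le> \<epsilon>" using False by (intro kp) auto
    have 3: "?d n k S0 \<le> \<epsilon>" using False S0 by (intro kp) auto
    have "?d n k S \<le> ?d n k (S \<union> S0) + ?d n k S0"
    proof (rule l0norm_triangle_AE)
      show "AE \<omega> in M. \<bar>\<nu> n (U S) \<omega> - \<nu> k (U S) \<omega>\<bar> \<le> \<bar>\<nu> n (U (S \<union> S0)) \<omega> - \<nu> k (U (S \<union> S0)) \<omega>\<bar> + \<bar>\<nu> n (U S0) \<omega> - \<nu> k (U S0) \<omega>\<bar>"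
        using add[OF dis, of n] add[OF dis, of k] by eventually_elim linarith
    qed auto
    moreover have "l0norm M (\<nu> n (U S)) \<le> ?d n k S + l0norm M (\<nu> k (U S))"
      by (rule l0norm_triangle_AE) auto
    ultimately show ?thesis using 1 2 3 by (simp add: \<epsilon>_def)
  qed
  then show ?thesis by (auto simp: U_def)
qed

end

section \<open>Integrals of measurable functions\<close>

context stoch_measure
begin

text \<open>The difference \<open>\<phi>\<close> of the two sequences tends to 0 pointwise, with
  neither a dominating function nor uniformity given. An Egorov argument replaces domination: off
  \<open>E p\<close> all late \<open>\<phi> n\<close> are at most \<open>\<eta>\<close>, and on
  \<open>E p\<close> the Nikodym lemma makes the integrals small uniformly in
  \<open>n\<close>.\<close>

lemma stochastic_integral_limit_unique:
  assumes gs: "approximates_stochastic_integrand M B \<mu> gs g" and hs: "approximates_stochastic_integrand M B \<mu> hs g"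
    and A[measurable]: "A \<in> sets B"
    and J1[measurable]: "J1 \<in> borel_measurable M" and J2[measurable]: "J2 \<in> borel_measurable M"
    and t1: "tendsto_in_probability M (\<lambda>n. SI A (gs n)) J1"
    and t2: "tendsto_in_probability M (\<lambda>n. SI A (hs n)) J2"
  shows "AE \<omega> in M. J1 \<omega> = J2 \<omega>"
proof -
  have sg: "simple_function B (gs n)" and sh: "simple_function B (hs n)" for n
    using gs hs by (auto simp: approximates_stochastic_integrand_def)
  define \<phi> where "\<phi> n s = gs n s - hs n s" for n s
  have s\<phi>: "simple_function B (\<phi> n)" for n
    using simple_function_compose2[OF sg sh, of "(-)"] by (simp add: \<phi>_def[abs_def])
  have \<phi>m[measurable]: "\<phi> n \<in> borel_measurable B" for n
    using s\<phi> by (rule borel_measurable_simple_function)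
  have \<phi>0: "(\<lambda>n. \<phi> n s) \<longlonglongrightarrow> 0" if "s \<in> space B" for s
  proof -
    have "(\<lambda>n. gs n s) \<longlonglongrightarrow> g s" "(\<lambda>n. hs n s) \<longlonglongrightarrow> g s" using gs hs that by (auto simp: approximates_stochastic_integrand_def)
    from tendsto_diff[OF this] show ?thesis by (simp add: \<phi>_def)
  qed
  have conv: "(\<lambda>n. l0norm M (\<lambda>\<omega>. SI C (\<phi> n) \<omega> - (K1 \<omega> - K2 \<omega>))) \<longlonglongrightarrow> 0"
    if C: "C \<in> sets B" and K[measurable]: "K1 \<in> borel_measurable M" "K2 \<in> borel_measurable M"
      and t: "tendsto_in_probability M (\<lambda>n. SI C (gs n)) K1" "tendsto_in_probability M (\<lambda>n. SI C (hs n)) K2" for C K1 K2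
  proof -
    note [measurable] = SI_measurable[OF sg C] SI_measurable[OF sh C] SI_measurable[OF s\<phi> C]
    have c: "(\<lambda>n. l0norm M (\<lambda>\<omega>. SI C (gs n) \<omega> - K1 \<omega>)) \<longlonglongrightarrow> 0" "(\<lambda>n. l0norm M (\<lambda>\<omega>. SI C (hs n) \<omega> - K2 \<omega>)) \<longlonglongrightarrow> 0"
      using t by (auto simp: tendsto_in_probability_iff_l0norm)
    have c2: "(\<lambda>n. l0norm M (\<lambda>\<omega>. SI C (gs n) \<omega> - K1 \<omega>) + l0norm M (\<lambda>\<omega>. SI C (hs n) \<omega> - K2 \<omega>)) \<longlonglongrightarrow> 0"
      using tendsto_add[OF c] by simp
    show ?thesis
    proof (rule tendsto_sandwich[OF _ _ tendsto_const c2])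
      show "\<forall>\<^sub>F n in sequentially. l0norm M (\<lambda>\<omega>. SI C (\<phi> n) \<omega> - (K1 \<omega> - K2 \<omega>)) \<le>
        l0norm M (\<lambda>\<omega>. SI C (gs n) \<omega> - K1 \<omega>) + l0norm M (\<lambda>\<omega>. SI C (hs n) \<omega> - K2 \<omega>)"
      proof (intro always_eventually allI)
        fix n
        have "AE \<omega> in M. SI C (\<phi> n) \<omega> = SI C (gs n) \<omega> - SI C (hs n) \<omega>"
          using SI_diff[OF sg sh C] by (simp add: \<phi>_def[abs_def])
        then show "l0norm M (\<lambda>\<omega>. SI C (\<phi> n) \<omega> - (K1 \<omega> - K2 \<omega>)) \<le>
          l0norm M (\<lambda>\<omega>. SI C (gs n) \<omega> - K1 \<omega>) + l0norm M (\<lambda>\<omega>. SI C (hs n) \<omega> - K2 \<omega>)"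
          by (intro l0norm_triangle_AE) (auto elim!: eventually_mono)
      qed
    qed auto
  qed
  have small: "l0norm M (\<lambda>\<omega>. J1 \<omega> - J2 \<omega>) \<le> 2 * e" if "e > 0" for e
  proof -
    obtain \<eta> where \<eta>: "\<eta> > 0" "\<And>g A. simple_function B g \<Longrightarrow> (\<forall>s\<in>space B. \<bar>g s\<bar> \<le> \<eta>) \<Longrightarrow> A \<in> sets B \<Longrightarrow> l0norm M (SI A g) < e"
      using SI_small[OF \<open>e > 0\<close>] by blast
    define E where "E m = {s\<in>space B. s \<in> A \<and> (\<exists>n\<ge>m. \<bar>\<phi> n s\<bar> > \<eta>)}" for m
    have Em[measurable]: "E m \<in> sets B" for m unfolding E_def by measurable
    have Edec: "E n \<subseteq> E m" if "m \<le> n" for m n using that unfolding E_def by (auto intro: order_trans)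
    have E0: "\<exists>m. s \<notin> E m" for s
    proof (cases "s \<in> space B")
      case True
      from LIMSEQ_D[OF \<phi>0[OF True] \<eta>(1)] obtain m where "\<And>n. n \<ge> m \<Longrightarrow> \<bar>\<phi> n s\<bar> < \<eta>" by auto
      then have "s \<notin> E m" unfolding E_def by (auto simp: not_less less_imp_le)
      then show ?thesis by blast
    qed (auto simp: E_def)
    \<comment> \<open>The sets \<open>E m\<close> decrease to the empty set, so the disjoint layers
      from \<open>p\<close> on have union \<open>E p\<close>; this is the form in which the Nikodym
      lemma applies.\<close>
    define D where "D j = E j - E (Suc j)" for j
    have Dm: "D j \<in> sets B" for j by (simp add: D_def)
    have Dd: "disjoint_family D"
    proof -
      have "D m \<inter> D n = {}" if "m < n" for m n
        using Edec[of "Suc m" n] that by (auto simp: D_def)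
      then show ?thesis unfolding disjoint_family_on_def by (metis inf_commute linorder_neqE_nat)
    qed
    have EU: "(\<Union>j\<in>{p..}. D j) = E p" for p
    proof
      show "(\<Union>j\<in>{p..}. D j) \<subseteq> E p" using Edec by (fastforce simp: D_def)
      show "E p \<subseteq> (\<Union>j\<in>{p..}. D j)"
      proof
        fix s assume s: "s \<in> E p"
        define m where "m = (LEAST m. s \<notin> E m)"
        have m: "s \<notin> E m" unfolding m_def using E0 by (rule LeastI_ex)
        have "m > p" using m s Edec[of m p] by (meson linorder_not_le subsetD)
        then obtain k where k: "m = Suc k" by (cases m) auto
        have "s \<in> E k" using not_less_Least[of k "\<lambda>m. s \<notin> E m"] k by (auto simp: m_def)
        then show "s \<in> (\<Union>j\<in>{p..}. D j)" using m k \<open>m > p\<close> by (auto simp: D_def)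
      qed
    qed
    have "\<exists>p. \<forall>n. \<forall>S\<subseteq>{p..}. l0norm M (SI (\<Union>j\<in>S. D j) (\<phi> n)) \<le> e"
    proof (rule nikodym_uniform_tail[OF _ Dm Dd \<open>e > 0\<close>])
      show "stochastic_measure M B (\<lambda>A. SI A (\<phi> n))" for n by (rule SI_stochastic_measure[OF s\<phi>])
      fix C and r :: real assume C: "C \<in> sets B" and "r > 0"
      note [measurable] = SI_measurable[OF s\<phi> C]
      obtain K1 K2 where K: "K1 \<in> borel_measurable M" "K2 \<in> borel_measurable M"
        "tendsto_in_probability M (\<lambda>n. SI C (gs n)) K1" "tendsto_in_probability M (\<lambda>n. SI C (hs n)) K2"
        using gs hs C unfolding approximates_stochastic_integrand_def by blast
      note [measurable] = K(1,2)
      obtain N where N: "\<And>n. n \<ge> N \<Longrightarrow> l0norm M (\<lambda>\<omega>. SI C (\<phi> n) \<omega> - (K1 \<omega> - K2 \<omega>)) < r/2"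
        using LIMSEQ_D[OF conv[OF C K], of "r/2"] \<open>r > 0\<close> by auto
      show "\<exists>N. \<forall>n\<ge>N. \<forall>m\<ge>N. l0norm M (\<lambda>\<omega>. SI C (\<phi> n) \<omega> - SI C (\<phi> m) \<omega>) < r"
      proof (intro exI[of _ N] allI impI)
        fix n m assume nm: "N \<le> n" "N \<le> m"
        have "l0norm M (\<lambda>\<omega>. SI C (\<phi> n) \<omega> - SI C (\<phi> m) \<omega>) \<le> l0norm M (\<lambda>\<omega>. SI C (\<phi> n) \<omega> - (K1 \<omega> - K2 \<omega>)) + l0norm M (\<lambda>\<omega>. SI C (\<phi> m) \<omega> - (K1 \<omega> - K2 \<omega>))"
          by (rule l0norm_triangle_AE) auto
        then show "l0norm M (\<lambda>\<omega>. SI C (\<phi> n) \<omega> - SI C (\<phi> m) \<omega>) < r" using N[OF nm(1)] N[OF nm(2)] by simp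
      qed
    qed
    then obtain p where "\<And>n. l0norm M (SI (\<Union>j\<in>{p..}. D j) (\<phi> n)) \<le> e" by blast
    then have p: "l0norm M (SI (E p) (\<phi> n)) \<le> e" for n unfolding EU .
    have b: "l0norm M (SI A (\<phi> n)) \<le> 2 * e" if "n \<ge> p" for n
    proof -
      interpret \<nu>: stoch_measure M B "\<lambda>A. SI A (\<phi> n)"
        by (intro stoch_measure.intro prob_space_axioms stoch_measure_axioms.intro SI_stochastic_measure[OF s\<phi>])
      have AE1: "A \<inter> E p = E p" "A \<inter> (A - E p) = A - E p" by (auto simp: E_def)
      let ?\<psi> = "\<lambda>s. indicator (A - E p) s * \<phi> n s"
      have s\<psi>: "simple_function B ?\<psi>"
        by (intro simple_function_mult s\<phi> simple_function_indicator) auto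
      have 1: "AE \<omega> in M. SI A (\<phi> n) \<omega> = SI (E p) (\<phi> n) \<omega> + SI (A - E p) (\<phi> n) \<omega>"
        using \<nu>.mu_Diff[OF A Em[of p]] by (simp add: AE1)
      have 2: "AE \<omega> in M. SI (A - E p) (\<phi> n) \<omega> = SI A ?\<psi> \<omega>"
        using SI_restrict[OF s\<phi>[of n] A, of "A - E p"] by (simp add: AE1)
      have 3: "l0norm M (SI A ?\<psi>) < e"
      proof (rule \<eta>(2)[OF s\<psi> _ A], rule ballI)
        fix s assume "s \<in> space B"
        then show "\<bar>?\<psi> s\<bar> \<le> \<eta>" using that \<eta>(1) by (auto simp: E_def indicator_def not_less)
      qed
      have "l0norm M (SI A (\<phi> n)) \<le> l0norm M (SI (E p) (\<phi> n)) + l0norm M (SI A ?\<psi>)"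
      proof (rule l0norm_triangle_AE)
        show "AE \<omega> in M. \<bar>SI A (\<phi> n) \<omega>\<bar> \<le> \<bar>SI (E p) (\<phi> n) \<omega>\<bar> + \<bar>SI A ?\<psi> \<omega>\<bar>"
          using 1 2 by eventually_elim linarith
      qed (auto intro!: SI_measurable s\<phi> s\<psi>)
      then show ?thesis using p[of n] 3 by simp
    qed
    note [measurable] = SI_measurable[OF s\<phi> A]
    have "l0norm M (\<lambda>\<omega>. J1 \<omega> - J2 \<omega>) \<le> 2 * e + l0norm M (\<lambda>\<omega>. SI A (\<phi> n) \<omega> - (J1 \<omega> - J2 \<omega>))" if "n \<ge> p" for n
    proof -
      have "l0norm M (\<lambda>\<omega>. J1 \<omega> - J2 \<omega>) \<le> l0norm M (SI A (\<phi> n)) + l0norm M (\<lambda>\<omega>. SI A (\<phi> n) \<omega> - (J1 \<omega> - J2 \<omega>))"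
        by (rule l0norm_triangle_AE) auto
      then show ?thesis using b[OF that] by simp
    qed
    moreover have "(\<lambda>n. 2 * e + l0norm M (\<lambda>\<omega>. SI A (\<phi> n) \<omega> - (J1 \<omega> - J2 \<omega>))) \<longlonglongrightarrow> 2 * e + 0"
      by (intro tendsto_add tendsto_const conv[OF A J1 J2 t1 t2])
    ultimately show ?thesis by (intro LIMSEQ_le_const[of _ "2 * e"]) auto
  qed
  have "l0norm M (\<lambda>\<omega>. J1 \<omega> - J2 \<omega>) \<le> 0"
  proof (rule field_le_epsilon)
    fix e :: real assume "e > 0"
    then show "l0norm M (\<lambda>\<omega>. J1 \<omega> - J2 \<omega>) \<le> 0 + e" using small[of "e/2"] by simp
  qed
  then have "AE \<omega> in M. J1 \<omega> - J2 \<omega> = 0" by (intro l0norm_eq_0_AE antisym) auto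
  then show ?thesis by simp
qed

text \<open>Uniform approximation makes the simple integrals Cauchy by \<open>SI_small\<close>. The
  representative selected by \<open>SOME\<close> may stem from another approximating sequence;
  uniqueness of the limit identifies it almost surely.\<close>

lemma stochastic_integral_uniform_limit:
  assumes gs: "\<And>n. simple_function B (gs n)" and e: "e \<longlonglongrightarrow> 0"
    and u: "\<And>n s. s \<in> space B \<Longrightarrow> \<bar>gs n s - g s\<bar> \<le> e n"
  shows "stochastic_integrable M B \<mu> g"
    and "A \<in> sets B \<Longrightarrow> stochastic_integral M B \<mu> A g \<in> borel_measurable M"
    and "A \<in> sets B \<Longrightarrow> (\<lambda>n. l0norm M (\<lambda>\<omega>. SI A (gs n) \<omega> - stochastic_integral M B \<mu> A g \<omega>)) \<longlonglongrightarrow> 0"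
proof -
  have ptw: "(\<lambda>n. gs n s) \<longlonglongrightarrow> g s" if "s \<in> space B" for s
  proof -
    have "(\<lambda>n. gs n s - g s) \<longlonglongrightarrow> 0"
      by (rule tendsto_0_le[OF e, of _ 1]) (use u[OF that] in \<open>auto intro!: always_eventually order_trans[OF _ abs_ge_self]\<close>)
    from tendsto_add[OF this tendsto_const[of "g s"]] show ?thesis by simp
  qed
  have lim: "\<exists>J\<in>borel_measurable M. tendsto_in_probability M (\<lambda>n. SI A (gs n)) J" if A: "A \<in> sets B" for A
  proof -
    note [measurable] = SI_measurable[OF gs A]
    have "\<exists>J\<in>borel_measurable M. (\<lambda>n. l0norm M (\<lambda>\<omega>. SI A (gs n) \<omega> - J \<omega>)) \<longlonglongrightarrow> 0"
    proof (rule l0norm_complete)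
      fix r :: real assume "r > 0"
      obtain \<eta> where \<eta>: "\<eta> > 0" "\<And>g A. simple_function B g \<Longrightarrow> (\<forall>s\<in>space B. \<bar>g s\<bar> \<le> \<eta>) \<Longrightarrow> A \<in> sets B \<Longrightarrow> l0norm M (SI A g) < r"
        using SI_small[OF \<open>r > 0\<close>] by blast
      obtain N where N: "\<And>n. n \<ge> N \<Longrightarrow> \<bar>e n\<bar> < \<eta>/2" using LIMSEQ_D[OF e, of "\<eta>/2"] \<eta> by auto
      show "\<exists>N. \<forall>n\<ge>N. \<forall>m\<ge>N. l0norm M (\<lambda>\<omega>. SI A (gs n) \<omega> - SI A (gs m) \<omega>) < r"
      proof (intro exI[of _ N] allI impI)
        fix n m assume nm: "N \<le> n" "N \<le> m"
        have s: "simple_function B (\<lambda>s. gs n s - gs m s)" using simple_function_compose2[OF gs[of n] gs[of m], of "(-)"] by simp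
        have "AE \<omega> in M. SI A (gs n) \<omega> - SI A (gs m) \<omega> = SI A (\<lambda>s. gs n s - gs m s) \<omega>"
          using SI_diff[OF gs[of n] gs[of m] A] by eventually_elim simp
        then have "l0norm M (\<lambda>\<omega>. SI A (gs n) \<omega> - SI A (gs m) \<omega>) = l0norm M (SI A (\<lambda>s. gs n s - gs m s))"
          using SI_measurable[OF s A] by (intro l0norm_cong_AE) auto
        also have "\<dots> < r"
        proof (rule \<eta>(2)[OF s _ A], rule ballI)
          fix s assume "s \<in> space B"
          then show "\<bar>gs n s - gs m s\<bar> \<le> \<eta>" using u[of s n] u[of s m] N[OF nm(1)] N[OF nm(2)] by linarith
        qed
        finally show "l0norm M (\<lambda>\<omega>. SI A (gs n) \<omega> - SI A (gs m) \<omega>) < r" .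
      qed
    qed measurable
    then obtain J where J: "J \<in> borel_measurable M" "(\<lambda>n. l0norm M (\<lambda>\<omega>. SI A (gs n) \<omega> - J \<omega>)) \<longlonglongrightarrow> 0" by blast
    note [measurable] = J(1)
    have "tendsto_in_probability M (\<lambda>n. SI A (gs n)) J"
      using J(2) by (subst tendsto_in_probability_iff_l0norm) auto
    then show ?thesis using J by blast
  qed
  have app: "approximates_stochastic_integrand M B \<mu> gs g"
    unfolding approximates_stochastic_integrand_def using gs ptw lim by blast
  have "g \<in> borel_measurable B"
    using gs by (intro borel_measurable_LIMSEQ_real[OF ptw]) (auto intro: borel_measurable_simple_function)
  then show "stochastic_integrable M B \<mu> g" using app unfolding stochastic_integrable_def by blast
  assume A: "A \<in> sets B"
  note [measurable] = SI_measurable[OF gs A]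
  obtain J where J: "J \<in> borel_measurable M" "tendsto_in_probability M (\<lambda>n. SI A (gs n)) J" using lim[OF A] by blast
  let ?P = "\<lambda>J. J \<in> borel_measurable M \<and> (\<exists>gs. approximates_stochastic_integrand M B \<mu> gs g \<and> tendsto_in_probability M (\<lambda>n. SI A (gs n)) J)"
  have "\<exists>J. ?P J" using J app by blast
  from someI_ex[OF this] have P: "?P (stochastic_integral M B \<mu> A g)" unfolding stochastic_integral_def .
  then show m: "stochastic_integral M B \<mu> A g \<in> borel_measurable M" by blast
  note [measurable] = m J(1)
  obtain hs where hs: "approximates_stochastic_integrand M B \<mu> hs g" "tendsto_in_probability M (\<lambda>n. SI A (hs n)) (stochastic_integral M B \<mu> A g)"
    using P by blast
  have "AE \<omega> in M. J \<omega> = stochastic_integral M B \<mu> A g \<omega>"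
    by (rule stochastic_integral_limit_unique[OF app hs(1) A J(1) m J(2) hs(2)])
  then have "l0norm M (\<lambda>\<omega>. SI A (gs n) \<omega> - stochastic_integral M B \<mu> A g \<omega>) = l0norm M (\<lambda>\<omega>. SI A (gs n) \<omega> - J \<omega>)" for n
    by (intro l0norm_cong_AE) auto
  then show "(\<lambda>n. l0norm M (\<lambda>\<omega>. SI A (gs n) \<omega> - stochastic_integral M B \<mu> A g \<omega>)) \<longlonglongrightarrow> 0"
    using J(2) by (simp add: tendsto_in_probability_iff_l0norm)
qed

end

section \<open>Stochastic measures on a time interval\<close>

text \<open>At each \<open>t\<close> a subsequence converges almost surely, and its indices can be
  chosen measurably in \<open>t\<close>; the limit along them is then jointly measurable.\<close>

lemma (in prob_space) measurable_version:
  fixes X :: "nat \<Rightarrow> 't \<Rightarrow> 'a \<Rightarrow> real"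
  assumes X[measurable]: "\<And>n. (\<lambda>(t, \<omega>). X n t \<omega>) \<in> borel_measurable (N \<Otimes>\<^sub>M M)"
    and Y: "\<And>t. t \<in> space N \<Longrightarrow> Y t \<in> borel_measurable M"
    and conv: "\<And>t. t \<in> space N \<Longrightarrow> (\<lambda>n. l0norm M (\<lambda>\<omega>. X n t \<omega> - Y t \<omega>)) \<longlonglongrightarrow> 0"
  shows "\<exists>Z. (\<lambda>(t, \<omega>). Z t \<omega>) \<in> borel_measurable (N \<Otimes>\<^sub>M M) \<and> (\<forall>t\<in>space N. AE \<omega> in M. Z t \<omega> = Y t \<omega>)"
proof -
  have Xt[measurable]: "X n t \<in> borel_measurable M" if "t \<in> space N" for n t
    using measurable_compose[OF measurable_Pair1'[OF that] X[of n]] by simp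
  define e where "e n m t = l0norm M (\<lambda>\<omega>. X n t \<omega> - X m t \<omega>)" for n m t
  have em[measurable]: "e n m \<in> borel_measurable N" for n m
    unfolding e_def[abs_def] l0norm_def by measurable
  \<comment> \<open>The speed is read off the mutual distances \<open>e n m t\<close>, not the
    distance to \<open>Y t\<close>, because nothing is assumed about measurability of
    \<open>Y\<close> in \<open>t\<close>.\<close>
  define ok where "ok k n t \<longleftrightarrow> (\<forall>m\<ge>n. e n m t \<le> (1/2)^k)" for k n t
  have okm[measurable]: "Measurable.pred N (ok k n)" for k n unfolding ok_def[abs_def] by measurable
  have okex: "\<exists>n. ok k n t" if t: "t \<in> space N" for k t
  proof -
    note [measurable] = Y[OF t] Xt[OF t]
    have "(1/2::real)^k/2 > 0" by simp
    from LIMSEQ_D[OF conv[OF t] this] obtain n where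
      n: "\<And>m. m \<ge> n \<Longrightarrow> l0norm M (\<lambda>\<omega>. X m t \<omega> - Y t \<omega>) < (1/2)^k/2" by auto
    have "e n m t \<le> (1/2)^k" if "m \<ge> n" for m
    proof -
      have "e n m t \<le> l0norm M (\<lambda>\<omega>. X n t \<omega> - Y t \<omega>) + l0norm M (\<lambda>\<omega>. X m t \<omega> - Y t \<omega>)"
        unfolding e_def by (rule l0norm_triangle_AE) auto
      then show ?thesis using n[of n] n[OF that] by simp
    qed
    then show ?thesis by (auto simp: ok_def)
  qed
  define r where "r k t = (LEAST n. ok k n t)" for k t
  have rm[measurable]: "r k \<in> measurable N (count_space UNIV)" for k
    unfolding r_def[abs_def] by measurable
  have rok: "ok k (r k t) t" if "t \<in> space N" for k t
    unfolding r_def using okex[OF that] by (rule LeastI_ex)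
  have r_lim: "l0norm M (\<lambda>\<omega>. X (r k t) t \<omega> - Y t \<omega>) \<le> (1/2)^k" if t: "t \<in> space N" for k t
  proof -
    note [measurable] = Y[OF t] Xt[OF t]
    have "l0norm M (\<lambda>\<omega>. X (r k t) t \<omega> - Y t \<omega>) \<le> (1/2)^k + l0norm M (\<lambda>\<omega>. X m t \<omega> - Y t \<omega>)" if "m \<ge> r k t" for m
    proof -
      have "l0norm M (\<lambda>\<omega>. X (r k t) t \<omega> - Y t \<omega>) \<le> e (r k t) m t + l0norm M (\<lambda>\<omega>. X m t \<omega> - Y t \<omega>)"
        unfolding e_def by (rule l0norm_triangle_AE) auto
      then show ?thesis using rok[OF t, of k] that by (auto simp: ok_def)
    qed
    moreover have "(\<lambda>m. (1/2)^k + l0norm M (\<lambda>\<omega>. X m t \<omega> - Y t \<omega>)) \<longlonglongrightarrow> (1/2)^k + 0"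
      by (intro tendsto_add tendsto_const conv t)
    ultimately show ?thesis by (intro LIMSEQ_le_const[of _ "(1/2)^k"]) auto
  qed
  define Z where "Z t \<omega> = lim (\<lambda>k. X (r k t) t \<omega>)" for t \<omega>
  have "(\<lambda>x. X (r k (fst x)) (fst x) (snd x)) \<in> borel_measurable (N \<Otimes>\<^sub>M M)" for k
  proof (rule measurable_compose_countable[where f="\<lambda>n x. X n (fst x) (snd x)" and g="\<lambda>x. r k (fst x)"])
    show "(\<lambda>x. X n (fst x) (snd x)) \<in> borel_measurable (N \<Otimes>\<^sub>M M)" for n
      using X[of n] by (simp add: split_beta')
  qed measurable
  then have "(\<lambda>x. lim (\<lambda>k. X (r k (fst x)) (fst x) (snd x))) \<in> borel_measurable (N \<Otimes>\<^sub>M M)"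
    by (rule borel_measurable_lim_metric)
  then have "(\<lambda>(t, \<omega>). Z t \<omega>) \<in> borel_measurable (N \<Otimes>\<^sub>M M)" by (simp add: Z_def split_beta')
  moreover have "AE \<omega> in M. Z t \<omega> = Y t \<omega>" if t: "t \<in> space N" for t
  proof -
    note [measurable] = Y[OF t] Xt[OF t]
    have "AE \<omega> in M. summable (\<lambda>k. \<bar>X (r k t) t \<omega> - Y t \<omega>\<bar>)"
    proof (rule l0norm_summable_AE)
      show "summable (\<lambda>k. l0norm M (\<lambda>\<omega>. X (r k t) t \<omega> - Y t \<omega>))"
        by (rule summable_comparison_test'[of "\<lambda>k. (1/2)^k"]) (use r_lim[OF t] in \<open>auto intro: summable_geometric\<close>)
    qed measurable
    then show ?thesis
    proof eventually_elim
      case (elim \<omega>)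
      then have "(\<lambda>k. X (r k t) t \<omega> - Y t \<omega>) \<longlonglongrightarrow> 0"
        using summable_LIMSEQ_zero tendsto_rabs_zero_iff by blast
      from tendsto_add[OF this tendsto_const[of "Y t \<omega>"]] have "(\<lambda>k. X (r k t) t \<omega>) \<longlonglongrightarrow> Y t \<omega>" by simp
      then show ?case by (simp add: Z_def limI)
    qed
  qed
  ultimately show ?thesis by blast
qed

section \<open>Dyadic grids and quadratic sums of increments\<close>

definition dyadic :: "real \<Rightarrow> nat \<Rightarrow> nat \<Rightarrow> real" where
  "dyadic H n k = H * real k / 2 ^ n"

text \<open>The grid belongs to \<open>[0, H]\<close> and does not move with \<open>t\<close>;
  \<open>min\<close> cuts the sum off at \<open>t\<close>. The same grid increments of
  \<open>F\<close> thus serve all \<open>t\<close>.\<close>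

definition dyadic_sum :: "real \<Rightarrow> (real \<Rightarrow> real) \<Rightarrow> (real \<Rightarrow> real) \<Rightarrow> real \<Rightarrow> nat \<Rightarrow> real" where
  "dyadic_sum H F q t n =
     (\<Sum>k<2^n. q (dyadic H n k) * (F (min (dyadic H n (Suc k)) t) - F (min (dyadic H n k) t)))"

lemma dyadic_mono: "0 < H \<Longrightarrow> k \<le> l \<Longrightarrow> dyadic H n k \<le> dyadic H n l"
  by (simp add: dyadic_def divide_right_mono)

lemma dyadic_nonneg [simp]: "0 < H \<Longrightarrow> 0 \<le> dyadic H n k"
  by (simp add: dyadic_def)

lemma dyadic_top [simp]: "dyadic H n (2^n) = H"
  by (simp add: dyadic_def)

lemma dyadic_le: "0 < H \<Longrightarrow> k \<le> 2^n \<Longrightarrow> dyadic H n k \<le> H"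
  using dyadic_mono[of H k "2^n" n] by simp

lemma dyadic_Suc: "dyadic H n (Suc k) = dyadic H n k + H / 2^n"
  by (simp add: dyadic_def field_simps)

text \<open>Ceiling minus one, because the cells are open on the left and closed on the right, like
  the sets that carry the increments of \<open>F\<close>.\<close>

definition dyadic_index :: "real \<Rightarrow> nat \<Rightarrow> real \<Rightarrow> nat" where
  "dyadic_index H n s = nat (\<lceil>s * 2^n / H\<rceil> - 1)"

lemma dyadic_index_iff:
  assumes "0 < H" "0 < s"
  shows "dyadic_index H n s = k \<longleftrightarrow> dyadic H n k < s \<and> s \<le> dyadic H n (Suc k)"
proof -
  have "0 < s * 2^n / H" using assms by simp
  then have "0 < \<lceil>s * 2^n / H\<rceil>" by (simp only: zero_less_ceiling)
  then have "dyadic_index H n s = k \<longleftrightarrow> \<lceil>s * 2^n / H\<rceil> = int (Suc k)" unfolding dyadic_index_def by auto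
  also have "\<dots> \<longleftrightarrow> real k < s * 2^n / H \<and> s * 2^n / H \<le> real (Suc k)"
    by (simp add: ceiling_eq_iff)
  also have "\<dots> \<longleftrightarrow> dyadic H n k < s \<and> s \<le> dyadic H n (Suc k)"
    using assms by (simp add: dyadic_def field_simps)
  finally show ?thesis .
qed

lemma dyadic_index_less:
  assumes "0 < H" "0 < s" "s \<le> H"
  shows "dyadic_index H n s < 2^n"
proof (rule ccontr)
  assume "\<not> ?thesis"
  then have "dyadic H n (2^n) \<le> dyadic H n (dyadic_index H n s)" using assms by (intro dyadic_mono) auto
  moreover have "dyadic H n (dyadic_index H n s) < s" using dyadic_index_iff[OF assms(1,2)] by blast
  ultimately show False using assms by simp
qed

locale time_measure = stoch_measure M "restrict_space borel {0..T}" \<mu>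
  for M :: "'w measure" and T :: real and \<mu> :: "real set \<Rightarrow> 'w \<Rightarrow> real" +
  assumes T_pos: "0 < T"
begin

abbreviation BT :: "real measure" where "BT \<equiv> restrict_space borel {0..T}"

lemma interval_sets [simp, measurable]: "0 \<le> a \<Longrightarrow> b \<le> T \<Longrightarrow> {a<..b} \<in> sets BT"
  by (auto simp: sets_restrict_space_iff)

lemma space_BT: "space BT = {0..T}"
  by (simp add: space_restrict_space)

lemma mu_interval_diff:
  assumes "0 \<le> a" "a \<le> b" "b \<le> T"
  shows "AE \<omega> in M. \<mu> {a<..b} \<omega> = \<mu> {0<..b} \<omega> - \<mu> {0<..a} \<omega>"
proof -
  have "{0<..b} = {0<..a} \<union> {a<..b}" using assms by auto
  then have "AE \<omega> in M. \<mu> {0<..b} \<omega> = \<mu> {0<..a} \<omega> + \<mu> {a<..b} \<omega>"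
    using mu_Un[of "{0<..a}" "{a<..b}"] assms by auto
  then show ?thesis by eventually_elim simp
qed

text \<open>All cells of the levels below \<open>N\<close> enter the square sum bound at once, with
  weight \<open>c^n\<close> at level \<open>n\<close>. A sum with arbitrary signs is the integral of
  a function bounded by the geometric series \<open>1 / (1 - c)\<close>, because the cells of one
  level are disjoint; hence the bound does not depend on \<open>N\<close>.\<close>

lemma dyadic_square_summable:
  assumes H: "0 < H" "H \<le> T" and c: "0 < c" "c < 1"
  shows "AE \<omega> in M. summable (\<lambda>n. (c^n)\<^sup>2 * (\<Sum>k<2^n. (\<mu> {dyadic H n k<..dyadic H n (Suc k)} \<omega>)\<^sup>2))"
proof -
  define cell where "cell n k = {dyadic H n k<..dyadic H n (Suc k)}" for n k
  have cellm[measurable]: "cell n k \<in> sets BT" if "k < 2^n" for n k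
    unfolding cell_def using H dyadic_le[of H "Suc k" n] that by (intro interval_sets) auto
  define R where "R N \<omega> = (\<Sum>n<N. (c^n)\<^sup>2 * (\<Sum>k<2^n. (\<mu> (cell n k) \<omega>)\<^sup>2))" for N \<omega>
  have Rm[measurable]: "R N \<in> borel_measurable M" for N unfolding R_def by measurable
  have Rmono: "R m \<omega> \<le> R n \<omega>" if "m \<le> n" for m n \<omega>
    unfolding R_def using that by (intro sum_mono2) (auto intro!: mult_nonneg_nonneg sum_nonneg)
  define F where "F = {\<omega>\<in>space M. \<forall>m::nat. \<exists>N. R N \<omega> > real m}"
  have Fm: "F \<in> events" unfolding F_def by measurable
  have "prob F \<le> 12 * e" if "e > 0" for e
  proof -
    obtain K where K: "K > 0" "\<And>C g A. C \<ge> 0 \<Longrightarrow> simple_function BT g \<Longrightarrow> (\<forall>s\<in>space BT. \<bar>g s\<bar> \<le> C) \<Longrightarrow> A \<in> sets BT \<Longrightarrow>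
      prob {\<omega>\<in>space M. \<bar>SI A g \<omega>\<bar> > C * K} < e" using SI_bounded[OF \<open>e > 0\<close>] by blast
    define L where "L = 1 / (1 - c) * K"
    have L: "0 \<le> L" using K c by (simp add: L_def)
    have RN: "prob {\<omega>\<in>space M. R N \<omega> > 2 * L\<^sup>2} \<le> 12 * e" for N
    proof -
      define I where "I = (SIGMA n:{..<N}. {..<(2::nat)^n})"
      have I: "finite I" by (simp add: I_def)
      define X where "X i \<omega> = c ^ fst i * \<mu> (cell (fst i) (snd i)) \<omega>" for i :: "nat \<times> nat" and \<omega>
      have cellI[measurable]: "cell (fst i) (snd i) \<in> sets BT" if "i \<in> I" for i using that by (auto simp: I_def)
      have Xm: "X i \<in> borel_measurable M" if "i \<in> I" for i unfolding X_def using that by measurable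
      have RX: "R N \<omega> = (\<Sum>i\<in>I. (X i \<omega>)\<^sup>2)" for \<omega>
        unfolding R_def I_def X_def by (simp add: sum.Sigma sum_distrib_left power_mult_distrib split_beta)
      have "prob {\<omega>\<in>space M. (\<Sum>i\<in>I. (X i \<omega>)\<^sup>2) > 2 * L\<^sup>2} \<le> 12 * e"
      proof (rule rademacher_square_sum[OF I Xm L])
        fix S assume "S \<subseteq> I"
        define sg where "sg i = (if i \<in> S then 1 else -1 :: real)" for i
        define g where "g s = (\<Sum>i\<in>I. (sg i * c ^ fst i) * indicator (cell (fst i) (snd i)) s)" for s :: real
        have gi: "simple_function BT (\<lambda>s. (sg i * c ^ fst i) * indicator (cell (fst i) (snd i)) s)" if "i \<in> I" for i
          using that by (intro simple_function_mult simple_function_const simple_function_indicator cellI)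
        have gs: "simple_function BT g" unfolding g_def using gi by (intro simple_function_sum) auto
        have sp: "space BT \<in> sets BT" by (rule sets.top)
        have "AE \<omega> in M. SI (space BT) (\<lambda>s. (sg i * c ^ fst i) * indicator (cell (fst i) (snd i)) s) \<omega> = sg i * X i \<omega>" if i: "i \<in> I" for i
        proof -
          have e1: "space BT \<inter> cell (fst i) (snd i) = cell (fst i) (snd i)"
            using sets.sets_into_space[OF cellI[OF i]] by (rule Int_absorb1)
          have "AE \<omega> in M. SI (space BT) (\<lambda>s. (sg i * c ^ fst i) * indicator (cell (fst i) (snd i)) s) \<omega> =
            (sg i * c ^ fst i) * SI (space BT) (indicator (cell (fst i) (snd i))) \<omega>"
            by (rule SI_cmult[OF simple_function_indicator[OF cellI[OF i]] sp])
          with SI_indicator[OF sp cellI[OF i]] show ?thesis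
            unfolding e1 by eventually_elim (simp add: X_def)
        qed
        then have "AE \<omega> in M. \<forall>i\<in>I. SI (space BT) (\<lambda>s. (sg i * c ^ fst i) * indicator (cell (fst i) (snd i)) s) \<omega> = sg i * X i \<omega>"
          using I by (intro AE_finite_allI) auto
        moreover have "AE \<omega> in M. SI (space BT) (\<lambda>s. \<Sum>i\<in>I. (sg i * c ^ fst i) * indicator (cell (fst i) (snd i)) s) \<omega> =
            (\<Sum>i\<in>I. SI (space BT) (\<lambda>s. (sg i * c ^ fst i) * indicator (cell (fst i) (snd i)) s) \<omega>)"
          by (rule SI_sum[OF I gi sp])
        ultimately have ae: "AE \<omega> in M. SI (space BT) g \<omega> = signsum I S (\<lambda>i. X i \<omega>)"
          unfolding g_def[abs_def] by eventually_elim (auto simp: signsum_def sg_def intro!: sum.cong)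
        have gb: "\<bar>g s\<bar> \<le> 1 / (1 - c)" if "s \<in> space BT" for s
        proof -
          have "\<bar>g s\<bar> \<le> (\<Sum>i\<in>I. \<bar>(sg i * c ^ fst i) * indicator (cell (fst i) (snd i)) s\<bar>)" unfolding g_def by (rule sum_abs)
          also have "\<dots> = (\<Sum>i\<in>I. c ^ fst i * indicator (cell (fst i) (snd i)) s)"
            using c by (intro sum.cong) (auto simp: abs_mult sg_def)
          also have "\<dots> = (\<Sum>n<N. c ^ n * (\<Sum>k<2^n. indicator (cell n k) s))"
          proof -
            have "(\<Sum>n<N. \<Sum>k\<in>{..<2^n}. c ^ n * indicator (cell n k) s) = (\<Sum>(n, k)\<in>I. c ^ n * indicator (cell n k) s)"
              unfolding I_def by (rule sum.Sigma) auto
            then show ?thesis by (simp only: split_beta' sum_distrib_left)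
          qed
          also have "\<dots> \<le> (\<Sum>n<N. c ^ n * 1)"
          proof (intro sum_mono mult_left_mono)
            fix n
            show "(\<Sum>k<2^n. indicator (cell n k) s) \<le> (1::real)"
            proof (cases "s > 0")
              case True
              then have "(\<Sum>k<2^n. indicator (cell n k) s) = (\<Sum>k<2^n. if dyadic_index H n s = k then 1 else 0 :: real)"
                using H by (intro sum.cong) (auto simp: cell_def indicator_def dyadic_index_iff)
              then show ?thesis by simp
            next
              case False
              then have "s \<notin> cell n k" for k using dyadic_nonneg[OF H(1), of n k] by (auto simp: cell_def)
              then show ?thesis by simp
            qed
          qed (use c in auto)
          also have "\<dots> \<le> (\<Sum>n. c ^ n)" using c by (simp, intro sum_le_suminf summable_geometric) auto
          also have "\<dots> = 1 / (1 - c)" using c by (intro suminf_geometric) simp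
          finally show ?thesis .
        qed
        have "prob {\<omega>\<in>space M. \<bar>signsum I S (\<lambda>i. X i \<omega>)\<bar> > L} \<le> prob {\<omega>\<in>space M. \<bar>SI (space BT) g \<omega>\<bar> > L}"
        proof (rule finite_measure_mono_AE)
          show "{\<omega>\<in>space M. \<bar>SI (space BT) g \<omega>\<bar> > L} \<in> events" using SI_measurable[OF gs sp] by measurable
        qed (use ae in \<open>auto elim!: eventually_mono\<close>)
        also have "\<dots> \<le> e" using K(2)[of "1/(1-c)" g "space BT"] gs gb sp c by (auto simp: L_def intro: less_imp_le)
        finally show "prob {\<omega>\<in>space M. \<bar>signsum I S (\<lambda>i. X i \<omega>)\<bar> > L} \<le> e" .
      qed
      then show ?thesis by (simp add: RX)
    qed
    have inc: "incseq (\<lambda>N. {\<omega>\<in>space M. R N \<omega> > 2 * L\<^sup>2})" using Rmono by (force simp: incseq_def intro: less_le_trans)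
    have "(\<lambda>N. prob {\<omega>\<in>space M. R N \<omega> > 2 * L\<^sup>2}) \<longlonglongrightarrow> prob (\<Union>N. {\<omega>\<in>space M. R N \<omega> > 2 * L\<^sup>2})"
      by (rule finite_Lim_measure_incseq[OF _ inc]) auto
    then have "prob (\<Union>N. {\<omega>\<in>space M. R N \<omega> > 2 * L\<^sup>2}) \<le> 12 * e" by (rule LIMSEQ_le_const2) (use RN in auto)
    moreover have "prob F \<le> prob (\<Union>N. {\<omega>\<in>space M. R N \<omega> > 2 * L\<^sup>2})"
    proof (rule finite_measure_mono)
      obtain m where m: "2 * L\<^sup>2 < real m" using reals_Archimedean2 by blast
      show "F \<subseteq> (\<Union>N. {\<omega>\<in>space M. R N \<omega> > 2 * L\<^sup>2})"
      proof
        fix \<omega> assume "\<omega> \<in> F"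
        then obtain N where "\<omega> \<in> space M" "R N \<omega> > real m" by (auto simp: F_def)
        then show "\<omega> \<in> (\<Union>N. {\<omega>\<in>space M. R N \<omega> > 2 * L\<^sup>2})" using m by (auto intro!: exI[of _ N])
      qed
    qed auto
    ultimately show ?thesis by linarith
  qed
  then have "prob F \<le> 0 + e" if "e > 0" for e using that by (metis add_0 divide_pos_pos mult.commute nonzero_eq_divide_eq zero_less_numeral zero_neq_numeral)
  then have "prob F \<le> 0" by (rule field_le_epsilon)
  then have "prob F = 0" using measure_nonneg[of M F] by linarith
  then have "AE \<omega> in M. \<omega> \<notin> F" using Fm by (simp add: AE_iff_measurable[OF Fm] prob_eq_0)
  then show ?thesis using AE_space
  proof eventually_elim
    case (elim \<omega>)
    then obtain m where m: "\<And>N. R N \<omega> \<le> real m" by (auto simp: F_def not_less)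
    show ?case
    proof (rule summableI_nonneg_bounded)
      show "(\<Sum>n<N. (c^n)\<^sup>2 * (\<Sum>k<2^n. (\<mu> {dyadic H n k<..dyadic H n (Suc k)} \<omega>)\<^sup>2)) \<le> real m" for N
        using m[of N] by (simp add: R_def cell_def)
    qed (intro mult_nonneg_nonneg sum_nonneg, auto)
  qed
qed

text \<open>Hoelder continuity makes the step functions with the left grid values of
  \<open>q\<close> converge uniformly. \<open>F\<close> may be any choice of representatives of
  \<open>\<mu> {0<..s}\<close>, since each sum involves finitely many of them.\<close>

lemma stochastic_integral_dyadic_sum:
  assumes H: "0 < H" "H \<le> T" and t: "0 \<le> t" "t \<le> H"
    and F: "\<And>s. 0 \<le> s \<Longrightarrow> s \<le> t \<Longrightarrow> F s \<in> borel_measurable M" "\<And>s. 0 \<le> s \<Longrightarrow> s \<le> t \<Longrightarrow> AE \<omega> in M. F s \<omega> = \<mu> {0<..s} \<omega>"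
    and q: "0 < \<kappa>" "\<And>s s'. 0 \<le> s \<Longrightarrow> s \<le> s' \<Longrightarrow> s' \<le> t \<Longrightarrow> \<bar>q s - q s'\<bar> \<le> C * (s' - s) powr \<kappa>" and C: "0 \<le> C"
  defines "g \<equiv> \<lambda>s. indicator {0<..t} s * q s"
  shows "stochastic_integrable M BT \<mu> g"
    and "stochastic_integral M BT \<mu> {0<..t} g \<in> borel_measurable M"
    and "(\<lambda>n. l0norm M (\<lambda>\<omega>. dyadic_sum H (\<lambda>s. F s \<omega>) q t n - stochastic_integral M BT \<mu> {0<..t} g \<omega>)) \<longlonglongrightarrow> 0"
proof -
  \<comment> \<open>The index \<open>2^n\<close> is a sentinel for points outside
    \<open>(0, t]\<close>; there \<open>q'\<close> takes the value 0.\<close>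
  define ix where "ix n s = (if 0 < s \<and> s \<le> t then dyadic_index H n s else 2^n)" for n s
  define q' where "q' n v = (if v < 2^n then q (dyadic H n v) else 0)" for n v
  define gs where "gs n s = q' n (ix n s)" for n s
  have ixr: "ix n s \<le> 2^n" for n s using dyadic_index_less[OF H(1), of s n] t by (auto simp: ix_def less_imp_le)
  have ixc: "{s. ix n s = k} = {dyadic H n k<..dyadic H n (Suc k)} \<inter> {0<..t}" if "k < 2^n" for n k
    using that H by (auto simp: ix_def dyadic_index_iff intro: le_less_trans[OF dyadic_nonneg] split: if_splits)
  have ixs: "simple_function BT (ix n)" for n
  proof (rule simple_function_borel_measurable)
    show "finite (ix n ` space BT)" by (rule finite_subset[of _ "{..2^n}"]) (use ixr in auto)
    have "ix n \<in> measurable borel (count_space UNIV)"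
      unfolding ix_def[abs_def] dyadic_index_def by measurable
    then have "ix n \<in> measurable BT (count_space UNIV)" by (rule measurable_restrict_space1)
    then show "ix n \<in> borel_measurable BT" by (rule measurable_compose) simp
  qed
  have s: "simple_function BT (gs n)" for n
    unfolding gs_def using simple_function_compose[OF ixs, of "q' n" n] by (simp add: o_def)
  define e where "e n = C * (H / 2^n) powr \<kappa>" for n :: nat
  have e0: "e \<longlonglongrightarrow> 0"
  proof -
    have "(\<lambda>n. H * (1/2)^n) \<longlonglongrightarrow> H * 0" by (intro tendsto_mult tendsto_const LIMSEQ_power_zero) simp
    then have "(\<lambda>n. H / 2^n) \<longlonglongrightarrow> 0" by (simp add: power_divide)
    then have "(\<lambda>n. (H / 2^n) powr \<kappa>) \<longlonglongrightarrow> 0"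
      using H q by (intro tendsto_zero_powrI[of _ _ _ \<kappa>]) auto
    from tendsto_mult[OF tendsto_const[of C] this] show ?thesis by (simp add: e_def[abs_def])
  qed
  have u: "\<bar>gs n s - g s\<bar> \<le> e n" for n s
  proof (cases "0 < s \<and> s \<le> t")
    case True
    define k where "k = dyadic_index H n s"
    have k: "dyadic H n k < s" "s \<le> dyadic H n (Suc k)" using dyadic_index_iff[OF H(1), of s n k] True by (auto simp: k_def)
    have "k < 2^n" unfolding k_def using True H t by (intro dyadic_index_less) auto
    then have "\<bar>gs n s - g s\<bar> = \<bar>q (dyadic H n k) - q s\<bar>" using True by (simp add: gs_def g_def q'_def ix_def k_def)
    also have "\<dots> \<le> C * (s - dyadic H n k) powr \<kappa>" using k True H by (intro q) auto
    also have "\<dots> \<le> C * (H / 2^n) powr \<kappa>"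
      using k C q(1) by (intro mult_left_mono powr_mono2) (auto simp: dyadic_Suc)
    finally show ?thesis by (simp add: e_def)
  next
    case False
    then show ?thesis using C by (auto simp: gs_def g_def q'_def ix_def e_def)
  qed
  have A: "{0<..t} \<in> sets BT" using H t by simp
  show "stochastic_integrable M BT \<mu> g" by (rule stochastic_integral_uniform_limit(1)[OF s e0 u])
  show m: "stochastic_integral M BT \<mu> {0<..t} g \<in> borel_measurable M" by (rule stochastic_integral_uniform_limit(2)[OF s e0 u A])
  have Fd: "(\<lambda>\<omega>. F (min (dyadic H n k) t) \<omega>) \<in> borel_measurable M" for n k
    using t H by (intro F) auto
  have "AE \<omega> in M. dyadic_sum H (\<lambda>s. F s \<omega>) q t n = SI {0<..t} (gs n) \<omega>" for n
  proof -
    have 1: "AE \<omega> in M. SI {0<..t} (gs n) \<omega> = (\<Sum>v\<in>{..2^n}. q' n v * \<mu> ({0<..t} \<inter> (ix n -` {v} \<inter> space BT)) \<omega>)"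
      unfolding gs_def by (rule SI_image[OF ixs _ _ A]) (use ixr in auto)
    have "AE \<omega> in M. F (min (dyadic H n (Suc k)) t) \<omega> - F (min (dyadic H n k) t) \<omega> = \<mu> ({0<..t} \<inter> (ix n -` {k} \<inter> space BT)) \<omega>"
      if k: "k < 2^n" for k
    proof -
      have "ix n -` {k} = {dyadic H n k<..dyadic H n (Suc k)} \<inter> {0<..t}" using ixc[OF k] by (auto simp: vimage_def)
      then have e1: "{0<..t} \<inter> (ix n -` {k} \<inter> space BT) = {min (dyadic H n k) t<..min (dyadic H n (Suc k)) t}"
        using H t by (auto simp: space_BT min_def intro: le_less_trans[OF dyadic_nonneg[OF H(1), of n k]]
          order_trans[OF dyadic_nonneg[OF H(1), of n k] less_imp_le])
      have a1: "AE \<omega> in M. \<mu> {min (dyadic H n k) t<..min (dyadic H n (Suc k)) t} \<omega> = \<mu> {0<..min (dyadic H n (Suc k)) t} \<omega> - \<mu> {0<..min (dyadic H n k) t} \<omega>"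
        using H t dyadic_mono[OF H(1), of k "Suc k" n] by (intro mu_interval_diff) auto
      have a2: "AE \<omega> in M. F (min (dyadic H n (Suc k)) t) \<omega> = \<mu> {0<..min (dyadic H n (Suc k)) t} \<omega>"
        using H t by (intro F(2)) auto
      have a3: "AE \<omega> in M. F (min (dyadic H n k) t) \<omega> = \<mu> {0<..min (dyadic H n k) t} \<omega>"
        using H t by (intro F(2)) auto
      show ?thesis unfolding e1 using a1 a2 a3 by eventually_elim simp
    qed
    then have "AE \<omega> in M. \<forall>k\<in>{..<2^n}. F (min (dyadic H n (Suc k)) t) \<omega> - F (min (dyadic H n k) t) \<omega> = \<mu> ({0<..t} \<inter> (ix n -` {k} \<inter> space BT)) \<omega>"
      by (intro AE_finite_allI) auto
    then show ?thesis using 1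
    proof eventually_elim
      case (elim \<omega>)
      have "(\<Sum>v\<in>{..2^n}. q' n v * \<mu> ({0<..t} \<inter> (ix n -` {v} \<inter> space BT)) \<omega>) = (\<Sum>v<2^n. q' n v * \<mu> ({0<..t} \<inter> (ix n -` {v} \<inter> space BT)) \<omega>)"
        by (simp add: lessThan_Suc_atMost[symmetric] q'_def)
      then show ?case unfolding dyadic_sum_def using elim by (auto simp: q'_def intro!: sum.cong)
    qed
  qed
  moreover have "(\<lambda>\<omega>. dyadic_sum H (\<lambda>s. F s \<omega>) q t n) \<in> borel_measurable M" for n
    unfolding dyadic_sum_def using Fd by measurable
  ultimately have "l0norm M (\<lambda>\<omega>. dyadic_sum H (\<lambda>s. F s \<omega>) q t n - stochastic_integral M BT \<mu> {0<..t} g \<omega>) =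
     l0norm M (\<lambda>\<omega>. SI {0<..t} (gs n) \<omega> - stochastic_integral M BT \<mu> {0<..t} g \<omega>)" for n
    using m SI_measurable[OF s A] by (intro l0norm_cong_AE) (auto elim!: eventually_mono)
  then show "(\<lambda>n. l0norm M (\<lambda>\<omega>. dyadic_sum H (\<lambda>s. F s \<omega>) q t n - stochastic_integral M BT \<mu> {0<..t} g \<omega>)) \<longlonglongrightarrow> 0"
    using stochastic_integral_uniform_limit(3)[OF s e0 u A] by simp
qed

text \<open>\<open>\<mu> {0<..t}\<close> is continuous from the right in probability, so rounding
  \<open>t\<close> up to the grid approximates it by processes that are constant in \<open>t\<close>
  on each cell and therefore jointly measurable.\<close>

lemma measurable_distribution_process:
  "\<exists>F. (\<lambda>(t, \<omega>). F t \<omega>) \<in> borel_measurable (BT \<Otimes>\<^sub>M M) \<and> (\<forall>t\<in>{0..T}. AE \<omega> in M. F t \<omega> = \<mu> {0<..t} \<omega>)"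
proof -
  define d where "d n i = min T (T * real_of_int i / 2^n)" for n :: nat and i :: int
  define X where "X n t = \<mu> {0<..d n \<lceil>t * 2^n / T\<rceil>}" for n t
  have dT: "d n i \<le> T" for n i by (simp add: d_def)
  have "\<exists>Z. (\<lambda>(t, \<omega>). Z t \<omega>) \<in> borel_measurable (BT \<Otimes>\<^sub>M M) \<and> (\<forall>t\<in>space BT. AE \<omega> in M. Z t \<omega> = \<mu> {0<..t} \<omega>)"
  proof (rule measurable_version[where X=X])
    fix n
    have "(\<lambda>x. \<mu> {0<..d n \<lceil>fst x * 2^n / T\<rceil>} (snd x)) \<in> borel_measurable (BT \<Otimes>\<^sub>M M)"
    proof (rule measurable_compose_countable[where f="\<lambda>i x. \<mu> {0<..d n i} (snd x)" and g="\<lambda>x. \<lceil>fst x * 2^n / T\<rceil>"])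
      show "(\<lambda>x. \<mu> {0<..d n i} (snd x)) \<in> borel_measurable (BT \<Otimes>\<^sub>M M)" for i
        using mu_measurable[OF interval_sets[OF order_refl dT[of n i]]] by measurable
      have "(\<lambda>t. \<lceil>t * 2^n / T\<rceil>) \<in> measurable borel (count_space UNIV)" by measurable
      then have "(\<lambda>t. \<lceil>t * 2^n / T\<rceil>) \<in> measurable BT (count_space UNIV)" by (rule measurable_restrict_space1)
      then show "(\<lambda>x. \<lceil>fst x * 2^n / T\<rceil>) \<in> measurable (BT \<Otimes>\<^sub>M M) (count_space UNIV)"
        by (rule measurable_compose[OF measurable_fst])
    qed
    then show "(\<lambda>(t, \<omega>). X n t \<omega>) \<in> borel_measurable (BT \<Otimes>\<^sub>M M)" by (simp add: X_def split_beta')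
  next
    fix t assume "t \<in> space BT"
    then have t: "0 \<le> t" "t \<le> T" by (auto simp: space_BT)
    then show tm: "\<mu> {0<..t} \<in> borel_measurable M" by simp
    define D where "D n = d n \<lceil>t * 2^n / T\<rceil>" for n
    have D1: "t \<le> D n" "D n \<le> T" for n
    proof -
      define c where "c = real_of_int \<lceil>t * 2^n / T\<rceil>"
      have "t * 2^n / T \<le> c" by (simp add: c_def)
      then have "t \<le> T * c / 2^n" using T_pos by (simp add: field_simps)
      then have "t \<le> T * real_of_int \<lceil>t * 2^n / T\<rceil> / 2^n" by (simp add: c_def)
      then show "t \<le> D n" "D n \<le> T" using t by (auto simp: D_def d_def)
    qed
    have D2: "D n \<le> t + T / 2^n" for n
    proof -
      have "real_of_int \<lceil>t * 2^n / T\<rceil> \<le> t * 2^n / T + 1" by linarith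
      then have "T * real_of_int \<lceil>t * 2^n / T\<rceil> / 2^n \<le> t + T / 2^n" using T_pos by (simp add: field_simps)
      then show ?thesis by (auto simp: D_def d_def)
    qed
    have D3: "D (Suc n) \<le> D n" for n
    proof -
      have "t * 2^Suc n / T = 2 * (t * 2^n / T)" by simp
      also have "\<dots> \<le> 2 * real_of_int \<lceil>t * 2^n / T\<rceil>"
        by (intro mult_left_mono le_of_int_ceiling) simp
      finally have "t * 2^Suc n / T \<le> real_of_int (2 * \<lceil>t * 2^n / T\<rceil>)" by simp
      then have "\<lceil>t * 2^Suc n / T\<rceil> \<le> 2 * \<lceil>t * 2^n / T\<rceil>" by (simp only: ceiling_le_iff)
      then have "real_of_int \<lceil>t * 2^Suc n / T\<rceil> \<le> 2 * real_of_int \<lceil>t * 2^n / T\<rceil>"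
        by (metis of_int_le_iff of_int_mult of_int_numeral)
      then have "T * real_of_int \<lceil>t * 2^Suc n / T\<rceil> / 2^Suc n \<le> T * real_of_int \<lceil>t * 2^n / T\<rceil> / 2^n"
        using T_pos by (simp add: field_simps del: power_Suc) (simp add: mult.assoc mult_left_mono)
      then show ?thesis unfolding D_def d_def by (intro min.mono) auto
    qed
    have lim: "(\<lambda>n. l0norm M (\<mu> {t<..D n})) \<longlonglongrightarrow> 0"
    proof (rule mu_decseq_null)
      show "range (\<lambda>n. {t<..D n}) \<subseteq> sets BT" using t D1 by auto
      show "decseq (\<lambda>n. {t<..D n})" unfolding decseq_Suc_iff
      proof (intro allI subsetI)
        show "x \<in> {t<..D n}" if "x \<in> {t<..D (Suc n)}" for n x using that D3[of n] by auto
      qed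
      show "(\<Inter>n. {t<..D n}) = {}"
      proof (rule ccontr)
        assume "(\<Inter>n. {t<..D n}) \<noteq> {}"
        then obtain s where s: "t < s" "\<forall>n. s \<le> D n" by auto
        have "(s - t) / T > 0" using s T_pos by simp
        then obtain n where "(1/2)^n < (s - t) / T" using real_arch_pow_inv[of "(s-t)/T" "1/2"] by auto
        then have "T / 2^n < s - t" using T_pos by (simp add: field_simps power_divide)
        then show False using s(2)[rule_format, of n] D2[of n] by simp
      qed
    qed
    have "l0norm M (\<lambda>\<omega>. X n t \<omega> - \<mu> {0<..t} \<omega>) = l0norm M (\<mu> {t<..D n})" for n
    proof (rule l0norm_cong_AE)
      show "AE \<omega> in M. X n t \<omega> - \<mu> {0<..t} \<omega> = \<mu> {t<..D n} \<omega>"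
        using mu_interval_diff[OF t(1) D1(1)[of n] D1(2)[of n]] unfolding X_def D_def by eventually_elim simp
      show "(\<lambda>\<omega>. X n t \<omega> - \<mu> {0<..t} \<omega>) \<in> borel_measurable M" unfolding X_def using t dT by measurable
    qed (use t D1 in auto)
    then show "(\<lambda>n. l0norm M (\<lambda>\<omega>. X n t \<omega> - \<mu> {0<..t} \<omega>)) \<longlonglongrightarrow> 0" using lim by simp
  qed
  then show ?thesis by (simp add: space_BT)
qed

end

section \<open>Gaussian averages\<close>

lemma powr_ge_self: "0 \<le> (x::real) \<Longrightarrow> x \<le> 1 \<Longrightarrow> 0 < \<beta> \<Longrightarrow> \<beta> \<le> 1 \<Longrightarrow> x \<le> x powr \<beta>"
  using powr_mono'[of \<beta> 1 x] by (cases "x = 0") auto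

text \<open>After division by \<open>a + b\<close> this is \<open>x \<le> x powr \<beta>\<close> on
  the unit interval, applied to the two fractions.\<close>

lemma powr_add_le:
  fixes a b :: real
  assumes "0 \<le> a" "0 \<le> b" "0 < \<beta>" "\<beta> \<le> 1"
  shows "(a + b) powr \<beta> \<le> a powr \<beta> + b powr \<beta>"
proof (cases "a + b = 0")
  case True
  then show ?thesis by simp
next
  case False
  then have p: "a + b > 0" using assms by simp
  have "1 = a / (a + b) + b / (a + b)" using p by (simp add: add_divide_distrib[symmetric])
  also have "\<dots> \<le> (a / (a + b)) powr \<beta> + (b / (a + b)) powr \<beta>"
    using assms p by (intro add_mono powr_ge_self) auto
  also have "\<dots> = (a powr \<beta> + b powr \<beta>) / (a + b) powr \<beta>"
    using assms p by (simp add: powr_divide add_divide_distrib)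
  finally show ?thesis using p by (simp add: field_simps)
qed

lemma min_le_interpolate:
  fixes X a b :: real
  assumes "X \<le> a" "X \<le> b" "0 \<le> X" "0 \<le> \<theta>" "\<theta> \<le> 1"
  shows "X \<le> a powr \<theta> * b powr (1 - \<theta>)"
proof (cases "X = 0")
  case False
  then have "X > 0" using assms by simp
  then have "X = X powr \<theta> * X powr (1 - \<theta>)" by (simp add: powr_add[symmetric])
  also have "\<dots> \<le> a powr \<theta> * b powr (1 - \<theta>)" using assms by (intro mult_mono powr_mono2) auto
  finally show ?thesis .
qed simp

lemma powr_integral_bound:
  fixes \<kappa> t :: real
  assumes "0 \<le> \<kappa>" "\<kappa> < 1" "0 \<le> t"
  shows "set_integrable lborel {0..t} (\<lambda>s. (t - s) powr (-\<kappa>))"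
    "(LINT s:{0..t}|lborel. (t - s) powr (-\<kappa>)) = t powr (1 - \<kappa>) / (1 - \<kappa>)"
proof -
  have hi: "((\<lambda>x. x powr (-\<kappa>)) has_integral (t powr (1 - \<kappa>) / (1 - \<kappa>))) {0..t}"
    using has_integral_powr_from_0[of "-\<kappa>" t] assms by (simp add: add.commute)
  have nn: "integral\<^sup>N lborel (\<lambda>x. indicator {0..t} x * x powr (-\<kappa>)) = ennreal (t powr (1 - \<kappa>) / (1 - \<kappa>))"
    by (rule nn_integral_has_integral_lebesgue[OF _ hi]) simp
  have "has_bochner_integral lborel (\<lambda>x. indicator {0..t} x * x powr (-\<kappa>)) (t powr (1 - \<kappa>) / (1 - \<kappa>))"
    by (rule has_bochner_integral_nn_integral[OF _ _ _ nn]) (use assms in auto)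
  then have "has_bochner_integral lborel (\<lambda>x. indicator {0..t} (t + -1 * x) * (t + -1 * x) powr (-\<kappa>)) ((t powr (1 - \<kappa>) / (1 - \<kappa>)) /\<^sub>R \<bar>-1\<bar>)"
    by (subst lborel_has_bochner_integral_real_affine_iff[of "-1" _ _ t, symmetric]) auto
  moreover have e: "(\<lambda>x. indicator {0..t} (t + -1 * x) * (t + -1 * x) powr (-\<kappa>)) = (\<lambda>x. indicator {0..t} x * (t - x) powr (-\<kappa>))"
    by (rule ext) (auto simp: indicator_def)
  ultimately have h: "has_bochner_integral lborel (\<lambda>x. indicator {0..t} x * (t - x) powr (-\<kappa>)) (t powr (1 - \<kappa>) / (1 - \<kappa>))"
    unfolding e by simp
  show "set_integrable lborel {0..t} (\<lambda>s. (t - s) powr (-\<kappa>))"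
    using h unfolding set_integrable_def by (auto simp: has_bochner_integral_iff)
  show "(LINT s:{0..t}|lborel. (t - s) powr (-\<kappa>)) = t powr (1 - \<kappa>) / (1 - \<kappa>)"
    using h unfolding set_lebesgue_integral_def by (auto simp: has_bochner_integral_iff)
qed

text \<open>Writing the heat semigroup as a Gaussian average covers the time \<open>0\<close> and makes the dependence
  on \<open>(t, x)\<close> explicit.\<close>

definition gauss_avg :: "real \<Rightarrow> real \<Rightarrow> (real \<Rightarrow> real) \<Rightarrow> real" where
  "gauss_avg c x g = (LINT z|lborel. std_normal_density z * g (x + c * z))"

lemma integrable_std: "integrable lborel std_normal_density"
  by (rule integrable_normal_density) simp

lemma integral_std: "(LINT z|lborel. std_normal_density z) = 1"
  by (rule integral_normal_density) simp

lemma gauss_avg_integrable: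
  assumes [measurable]: "g \<in> borel_measurable borel" and b: "\<And>y. \<bar>g y\<bar> \<le> K"
  shows "integrable lborel (\<lambda>z. std_normal_density z * g (x + c * z))"
proof (rule Bochner_Integration.integrable_bound)
  show "integrable lborel (\<lambda>z. K * std_normal_density z)" using integrable_std by simp
  show "AE z in lborel. norm (std_normal_density z * g (x + c * z)) \<le> norm (K * std_normal_density z)"
  proof (rule AE_I2)
    fix z
    have "\<bar>g (x + c * z)\<bar> \<le> \<bar>K\<bar>" using b[of "x + c * z"] by linarith
    then show "norm (std_normal_density z * g (x + c * z)) \<le> norm (K * std_normal_density z)"
      using mult_right_mono[of "\<bar>g (x + c * z)\<bar>" "\<bar>K\<bar>" "std_normal_density z"]
      by (simp add: abs_mult mult.commute)
  qed
qed measurable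

lemma gauss_avg_bounded:
  assumes "g \<in> borel_measurable borel" "\<And>y. \<bar>g y\<bar> \<le> K"
  shows "\<bar>gauss_avg c x g\<bar> \<le> K"
proof -
  have "\<bar>gauss_avg c x g\<bar> \<le> (LINT z|lborel. \<bar>std_normal_density z * g (x + c * z)\<bar>)"
    unfolding gauss_avg_def by (rule integral_abs_bound)
  also have "\<dots> \<le> (LINT z|lborel. K * std_normal_density z)"
  proof (rule integral_mono)
    show "integrable lborel (\<lambda>z. \<bar>std_normal_density z * g (x + c * z)\<bar>)"
      by (intro integrable_abs gauss_avg_integrable[OF assms])
    show "\<bar>std_normal_density z * g (x + c * z)\<bar> \<le> K * std_normal_density z" for z
      using mult_right_mono[OF assms(2)[of "x + c * z"], of "std_normal_density z"] by (simp add: abs_mult mult.commute)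
  qed (use integrable_std in simp)
  also have "\<dots> = K" by (simp add: integral_std)
  finally show ?thesis .
qed

lemma heat_convolution_eq_gauss_avg:
  assumes "a \<noteq> 0" "0 \<le> t"
  shows "heat_convolution a t x g = gauss_avg (\<bar>a\<bar> * sqrt (2 * t)) x g"
proof (cases "t = 0")
  case True
  then show ?thesis by (simp add: heat_convolution_def gauss_avg_def integral_std)
next
  case False
  then have t: "t > 0" using assms by simp
  define c where "c = \<bar>a\<bar> * sqrt (2 * t)"
  have c: "c > 0" using assms t by (simp add: c_def)
  have "heat_convolution a t x g = (LINT y|lborel. heat_kernel a t (x - y) * g y)"
    using False by (simp add: heat_convolution_def)
  also have "\<dots> = \<bar>c\<bar> *\<^sub>R (LINT z|lborel. heat_kernel a t (x - (x + c * z)) * g (x + c * z))"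
    using c by (intro lborel_integral_real_affine) simp
  also have "\<dots> = (LINT z|lborel. c * (heat_kernel a t (x - (x + c * z)) * g (x + c * z)))"
    using c by simp
  also have "\<dots> = gauss_avg c x g"
    unfolding gauss_avg_def
  proof (rule Bochner_Integration.integral_cong[OF refl])
    fix z
    have "c\<^sup>2 = 2 * a\<^sup>2 * t" using t by (simp add: c_def power_mult_distrib)
    then have e: "(c * z)\<^sup>2 / (4 * a\<^sup>2 * t) = z\<^sup>2 / 2" using assms t by (simp add: power_mult_distrib field_simps)
    have "c / (2 * \<bar>a\<bar> * sqrt (pi * t)) = 1 / sqrt (2 * pi)"
      using assms t by (simp add: c_def real_sqrt_mult field_simps)
    then have k: "c / (2 * \<bar>a\<bar> * sqrt (pi * t)) * exp (- ((c * z)\<^sup>2 / (4 * a\<^sup>2 * t))) = 1 / sqrt (2 * pi) * exp (- (z\<^sup>2 / 2))"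
      by (simp only: e)
    have "c * heat_kernel a t (x - (x + c * z)) = c / (2 * \<bar>a\<bar> * sqrt (pi * t)) * exp (- ((c * z)\<^sup>2 / (4 * a\<^sup>2 * t)))"
      by (simp add: heat_kernel_def)
    also have "\<dots> = std_normal_density z" unfolding k by (simp add: std_normal_density_def)
    finally have "c * heat_kernel a t (x - (x + c * z)) = std_normal_density z" .
    then show "c * (heat_kernel a t (x - (x + c * z)) * g (x + c * z)) = std_normal_density z * g (x + c * z)"
      by (simp add: mult.assoc[symmetric])
  qed
  finally show ?thesis by (simp add: c_def)
qed

text \<open>\<open>1 + \<bar>z\<bar>\<close> dominates \<open>\<bar>z\<bar> powr \<beta>\<close> for
  every \<open>\<beta>\<close> in \<open>(0, 1]\<close>, so one constant serves all Hoelder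
  exponents.\<close>

definition gauss_moment :: real where
  "gauss_moment = (LINT z|lborel. std_normal_density z * (1 + \<bar>z\<bar>))"

lemma gauss_moment_integrable: "integrable lborel (\<lambda>z. std_normal_density z * (1 + \<bar>z\<bar>))"
  using integrable_std integrable_std_normal_moment_abs[of 1] by (simp add: distrib_left)

lemma gauss_moment_nonneg: "0 \<le> gauss_moment"
  unfolding gauss_moment_def by (intro integral_nonneg_AE) auto

text \<open>Both averages are coupled through the same Gaussian variable \<open>z\<close>, so their
  arguments differ by \<open>(x1 - x2) + (c1 - c2) * z\<close>. The term \<open>D\<close> leaves
  room for a change of the function itself, such as the time argument of the coefficient.\<close>

lemma gauss_avg_holder:
  assumes g: "g1 \<in> borel_measurable borel" "\<And>y. \<bar>g1 y\<bar> \<le> K" "g2 \<in> borel_measurable borel" "\<And>y. \<bar>g2 y\<bar> \<le> K"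
    and h: "\<And>y1 y2. \<bar>g1 y1 - g2 y2\<bar> \<le> D + C * \<bar>y1 - y2\<bar> powr \<beta>" and "0 \<le> C" "0 < \<beta>" "\<beta> \<le> 1"
  shows "\<bar>gauss_avg c1 x1 g1 - gauss_avg c2 x2 g2\<bar> \<le> D + C * (\<bar>x1 - x2\<bar> powr \<beta> + gauss_moment * \<bar>c1 - c2\<bar> powr \<beta>)"
proof -
  let ?\<phi> = std_normal_density
  note i = gauss_avg_integrable[OF g(1,2), of x1 c1] gauss_avg_integrable[OF g(3,4), of x2 c2]
  have e: "gauss_avg c1 x1 g1 - gauss_avg c2 x2 g2 = (LINT z|lborel. ?\<phi> z * g1 (x1 + c1 * z) - ?\<phi> z * g2 (x2 + c2 * z))"
    unfolding gauss_avg_def using i by simp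
  have "\<bar>gauss_avg c1 x1 g1 - gauss_avg c2 x2 g2\<bar> \<le> (LINT z|lborel. \<bar>?\<phi> z * g1 (x1 + c1 * z) - ?\<phi> z * g2 (x2 + c2 * z)\<bar>)"
    unfolding e by (rule integral_abs_bound)
  also have "\<dots> \<le> (LINT z|lborel. (D + C * \<bar>x1 - x2\<bar> powr \<beta>) * ?\<phi> z + (C * \<bar>c1 - c2\<bar> powr \<beta>) * (?\<phi> z * (1 + \<bar>z\<bar>)))"
  proof (rule integral_mono)
    fix z
    have "\<bar>g1 (x1 + c1 * z) - g2 (x2 + c2 * z)\<bar> \<le> D + C * \<bar>(x1 - x2) + (c1 - c2) * z\<bar> powr \<beta>"
      using h[of "x1 + c1 * z" "x2 + c2 * z"] by (simp add: algebra_simps)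
    note h1 = this
    have "\<bar>(x1 - x2) + (c1 - c2) * z\<bar> powr \<beta> \<le> (\<bar>x1 - x2\<bar> + \<bar>c1 - c2\<bar> * \<bar>z\<bar>) powr \<beta>"
      using assms by (intro powr_mono2) (auto simp: abs_mult[symmetric])
    also have "\<dots> \<le> \<bar>x1 - x2\<bar> powr \<beta> + (\<bar>c1 - c2\<bar> * \<bar>z\<bar>) powr \<beta>"
      using assms by (intro powr_add_le) auto
    also have "\<dots> = \<bar>x1 - x2\<bar> powr \<beta> + \<bar>c1 - c2\<bar> powr \<beta> * \<bar>z\<bar> powr \<beta>" by (simp add: powr_mult)
    finally have h2: "\<bar>(x1 - x2) + (c1 - c2) * z\<bar> powr \<beta> \<le> \<bar>x1 - x2\<bar> powr \<beta> + \<bar>c1 - c2\<bar> powr \<beta> * \<bar>z\<bar> powr \<beta>" .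
    have "\<bar>z\<bar> powr \<beta> \<le> 1 + \<bar>z\<bar>"
    proof (cases "\<bar>z\<bar> \<le> 1")
      case True
      then have "\<bar>z\<bar> powr \<beta> \<le> 1" using assms by (intro powr_le1) auto
      then show ?thesis by simp
    next
      case False
      then have "\<bar>z\<bar> powr \<beta> \<le> \<bar>z\<bar> powr 1" using assms by (intro powr_mono) auto
      then show ?thesis using False by simp
    qed
    then have "\<bar>c1 - c2\<bar> powr \<beta> * \<bar>z\<bar> powr \<beta> \<le> \<bar>c1 - c2\<bar> powr \<beta> * (1 + \<bar>z\<bar>)" by (intro mult_left_mono) auto
    then have "C * \<bar>(x1 - x2) + (c1 - c2) * z\<bar> powr \<beta> \<le> C * (\<bar>x1 - x2\<bar> powr \<beta> + \<bar>c1 - c2\<bar> powr \<beta> * (1 + \<bar>z\<bar>))"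
      using h2 \<open>0 \<le> C\<close> by (intro mult_left_mono) auto
    with h1 have b: "\<bar>g1 (x1 + c1 * z) - g2 (x2 + c2 * z)\<bar> \<le> (D + C * \<bar>x1 - x2\<bar> powr \<beta>) + (C * \<bar>c1 - c2\<bar> powr \<beta>) * (1 + \<bar>z\<bar>)"
      by (simp add: algebra_simps)
    have "\<bar>?\<phi> z * g1 (x1 + c1 * z) - ?\<phi> z * g2 (x2 + c2 * z)\<bar> = ?\<phi> z * \<bar>g1 (x1 + c1 * z) - g2 (x2 + c2 * z)\<bar>"
      by (simp add: right_diff_distrib[symmetric] abs_mult)
    also have "\<dots> \<le> ?\<phi> z * ((D + C * \<bar>x1 - x2\<bar> powr \<beta>) + (C * \<bar>c1 - c2\<bar> powr \<beta>) * (1 + \<bar>z\<bar>))"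
      by (intro mult_left_mono b) simp
    finally show "\<bar>?\<phi> z * g1 (x1 + c1 * z) - ?\<phi> z * g2 (x2 + c2 * z)\<bar> \<le>
      (D + C * \<bar>x1 - x2\<bar> powr \<beta>) * ?\<phi> z + (C * \<bar>c1 - c2\<bar> powr \<beta>) * (?\<phi> z * (1 + \<bar>z\<bar>))"
      by (simp add: algebra_simps)
  next
    show "integrable lborel (\<lambda>z. \<bar>?\<phi> z * g1 (x1 + c1 * z) - ?\<phi> z * g2 (x2 + c2 * z)\<bar>)"
      using i by (intro integrable_abs Bochner_Integration.integrable_diff)
    show "integrable lborel (\<lambda>z. (D + C * \<bar>x1 - x2\<bar> powr \<beta>) * ?\<phi> z + (C * \<bar>c1 - c2\<bar> powr \<beta>) * (?\<phi> z * (1 + \<bar>z\<bar>)))"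
      by (intro Bochner_Integration.integrable_add integrable_mult_right integrable_std gauss_moment_integrable)
  qed
  also have "\<dots> = (D + C * \<bar>x1 - x2\<bar> powr \<beta>) * (LINT z|lborel. ?\<phi> z) + (C * \<bar>c1 - c2\<bar> powr \<beta>) * gauss_moment"
  proof -
    have i1: "integrable lborel (\<lambda>z. (D + C * \<bar>x1 - x2\<bar> powr \<beta>) * ?\<phi> z)" using integrable_std by simp
    have i2: "integrable lborel (\<lambda>z. (C * \<bar>c1 - c2\<bar> powr \<beta>) * (?\<phi> z * (1 + \<bar>z\<bar>)))"
      by (intro integrable_mult_right gauss_moment_integrable)
    show ?thesis unfolding gauss_moment_def
      by (subst Bochner_Integration.integral_add[OF i1 i2]) (simp only: integral_mult_right_zero)
  qed
  finally show ?thesis by (simp add: integral_std algebra_simps)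
qed

text \<open>\<open>\<delta>\<close> is the chi-square distance of \<open>p\<close> from
  \<open>q\<close>, and \<open>r\<close> is the quotient \<open>p^2 / q\<close>. The pointwise
  inequality \<open>2 * \<bar>p - q\<bar> \<le> b * q + (p - q)^2 / (b * q)\<close> replaces
  Cauchy--Schwarz, with \<open>b\<close> left free. In the Gaussian cases below \<open>r\<close> is
  a multiple of a Gaussian density, so its integral is explicit.\<close>

lemma L1_distance_chi_square:
  fixes p q r :: "real \<Rightarrow> real"
  assumes p: "integrable lborel p" "(LINT z|lborel. p z) = 1" "\<And>z. 0 \<le> p z"
    and q: "integrable lborel q" "(LINT z|lborel. q z) = 1" "\<And>z. 0 < q z"
    and r: "integrable lborel r" "(LINT z|lborel. r z) = 1 + \<delta>" "\<And>z. (p z)\<^sup>2 = r z * q z" and "b > 0"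
  shows "(LINT z|lborel. \<bar>p z - q z\<bar>) \<le> (b + \<delta> / b) / 2"
proof -
  have "(LINT z|lborel. \<bar>p z - q z\<bar>) \<le> (LINT z|lborel. (b * q z + (r z - 2 * p z + q z) / b) / 2)"
  proof (rule integral_mono)
    fix z
    have "0 \<le> (\<bar>p z - q z\<bar> - b * q z)\<^sup>2" by simp
    then have "2 * b * q z * \<bar>p z - q z\<bar> \<le> (p z - q z)\<^sup>2 + (b * q z)\<^sup>2" by (simp add: power2_diff mult_ac)
    also have "(p z - q z)\<^sup>2 = q z * (r z - 2 * p z + q z)"
      using r(3)[of z] by (simp add: power2_eq_square algebra_simps)
    finally have "q z * (2 * b * \<bar>p z - q z\<bar>) \<le> q z * (b\<^sup>2 * q z + (r z - 2 * p z + q z))"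
      by (simp add: power2_eq_square algebra_simps)
    then have "2 * b * \<bar>p z - q z\<bar> \<le> b\<^sup>2 * q z + (r z - 2 * p z + q z)" using q(3)[of z] by simp
    then show "\<bar>p z - q z\<bar> \<le> (b * q z + (r z - 2 * p z + q z) / b) / 2"
      using \<open>b > 0\<close> by (simp add: field_simps power2_eq_square)
  qed (use p q r in auto)
  also have "\<dots> = (b + \<delta> / b) / 2" using p q r by simp
  finally show ?thesis .
qed

lemma L1_distance_le_2:
  fixes p q :: "real \<Rightarrow> real"
  assumes p: "integrable lborel p" "(LINT z|lborel. p z) = 1" "\<And>z. 0 \<le> p z"
    and q: "integrable lborel q" "(LINT z|lborel. q z) = 1" "\<And>z. 0 \<le> q z"
  shows "(LINT z|lborel. \<bar>p z - q z\<bar>) \<le> 2"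
proof -
  have "(LINT z|lborel. \<bar>p z - q z\<bar>) \<le> (LINT z|lborel. p z + q z)"
  proof (rule integral_mono)
    show "\<bar>p z - q z\<bar> \<le> p z + q z" for z using p(3)[of z] q(3)[of z] by linarith
  qed (use p q in auto)
  then show ?thesis using p q by simp
qed

lemma normal_L1_shift: "(LINT z|lborel. \<bar>normal_density d 1 z - std_normal_density z\<bar>) \<le> 2 * \<bar>d\<bar>"
proof (cases "d = 0")
  case True then show ?thesis by simp
next
  case False
  show ?thesis
  proof (cases "\<bar>d\<bar> \<le> 1")
    case True
    \<comment> \<open>The quotient is \<open>exp (d\<^sup>2)\<close> times the density with mean
      \<open>2 * d\<close>; the free parameter is \<open>b = 2 * \<bar>d\<bar>\<close>.\<close>
    have A: "(LINT z|lborel. \<bar>normal_density d 1 z - std_normal_density z\<bar>) \<le> (2 * \<bar>d\<bar> + (exp (d\<^sup>2) - 1) / (2 * \<bar>d\<bar>)) / 2"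
    proof (rule L1_distance_chi_square[where r="\<lambda>z. exp (d\<^sup>2) * normal_density (2 * d) 1 z"])
      fix z
      show "(normal_density d 1 z)\<^sup>2 = exp (d\<^sup>2) * normal_density (2 * d) 1 z * std_normal_density z"
      proof -
        have "-(z - d)\<^sup>2 / 2 + -(z - d)\<^sup>2 / 2 = d\<^sup>2 + (-(z - 2 * d)\<^sup>2 / 2 + - z\<^sup>2 / 2)"
          by (simp add: power2_eq_square field_simps)
        then have "exp (-(z - d)\<^sup>2 / 2) * exp (-(z - d)\<^sup>2 / 2) = exp (d\<^sup>2) * (exp (-(z - 2 * d)\<^sup>2 / 2) * exp (- z\<^sup>2 / 2))"
          by (simp only: exp_add[symmetric])
        then show ?thesis by (simp add: normal_density_def power2_eq_square)
      qed
    qed (use False in \<open>auto intro!: integrable_normal_density normal_density_pos simp: integral_normal_density\<close>)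
    have "exp (d\<^sup>2) - 1 \<le> 2 * d\<^sup>2"
    proof -
      have "d\<^sup>2 \<le> 1" using True by (simp add: abs_square_le_1)
      then have "exp (d\<^sup>2) \<le> 1 + d\<^sup>2 + (d\<^sup>2)\<^sup>2" by (intro exp_bound) auto
      moreover have "(d\<^sup>2)\<^sup>2 \<le> d\<^sup>2" using \<open>d\<^sup>2 \<le> 1\<close> by (simp add: power2_eq_square mult_left_le)
      ultimately show ?thesis by simp
    qed
    then have "(exp (d\<^sup>2) - 1) / (2 * \<bar>d\<bar>) \<le> (2 * d\<^sup>2) / (2 * \<bar>d\<bar>)" using False by (intro divide_right_mono) auto
    also have "(2 * d\<^sup>2) / (2 * \<bar>d\<bar>) = \<bar>d\<bar>" using False by (simp add: power2_eq_square abs_if)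
    finally have "(2 * \<bar>d\<bar> + (exp (d\<^sup>2) - 1) / (2 * \<bar>d\<bar>)) / 2 \<le> (2 * \<bar>d\<bar> + \<bar>d\<bar>) / 2"
      by (intro divide_right_mono add_left_mono) auto
    from order_trans[OF A this] show ?thesis by simp
  next
    case False
    have "(LINT z|lborel. \<bar>normal_density d 1 z - std_normal_density z\<bar>) \<le> 2"
      by (rule L1_distance_le_2) (auto intro!: integrable_normal_density simp: integral_normal_density)
    then show ?thesis using False by linarith
  qed
qed

text \<open>With \<open>r = 1 - s\<^sup>2\<close> the quotient of the squared density by the
  standard one is \<open>k\<close> times the Gaussian density of deviation \<open>w\<close>, and
  \<open>k - 1 \<le> r\<^sup>2\<close> for \<open>r \<le> 1/2\<close>; so \<open>b = r\<close> gives
  a bound of order \<open>r\<close>. The factor 4 also covers \<open>r > 1/2\<close>, where the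
  trivial bound 2 is used.\<close>

lemma normal_L1_scale:
  assumes s: "0 < s" "s \<le> 1"
  shows "(LINT z|lborel. \<bar>normal_density 0 s z - std_normal_density z\<bar>) \<le> 4 * (1 - s\<^sup>2)"
proof -
  define r where "r = 1 - s\<^sup>2"
  have r0: "0 \<le> r" "r < 1" using s by (auto simp: r_def power_le_one)
  consider "r = 0" | "0 < r" "r \<le> 1/2" | "r > 1/2" using r0 by linarith
  then show ?thesis
  proof cases
    case 1
    then have "s = 1" using s by (simp add: r_def power2_eq_1_iff)
    then show ?thesis by simp
  next
    case 2
    define w where "w = s / sqrt (2 - s\<^sup>2)"
    have s2: "2 - s\<^sup>2 = 1 + r" by (simp add: r_def)
    have w: "w > 0" using s r0 by (simp add: w_def s2)
    define k where "k = 1 / sqrt (1 - r\<^sup>2)"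
    have r2: "r\<^sup>2 \<le> 1/4" using 2 power_mono[of r "1/2" 2] by (simp add: power2_eq_square)
    have kw: "k = w / s\<^sup>2"
    proof -
      have "1 - r\<^sup>2 = s\<^sup>2 * (1 + r)" by (simp add: r_def power2_eq_square algebra_simps)
      then have "sqrt (1 - r\<^sup>2) = s * sqrt (1 + r)" using s by (simp add: real_sqrt_mult)
      then have e: "k = 1 / (s * sqrt (1 + r))" by (simp add: k_def)
      have "w = s / sqrt (1 + r)" by (simp add: w_def s2)
      then show ?thesis using s unfolding e by (simp add: power2_eq_square)
    qed
    have A: "(LINT z|lborel. \<bar>normal_density 0 s z - std_normal_density z\<bar>) \<le> (r + (k - 1) / r) / 2"
    proof (rule L1_distance_chi_square[where r="\<lambda>z. k * normal_density 0 w z"])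
      fix z
      show "(normal_density 0 s z)\<^sup>2 = k * normal_density 0 w z * std_normal_density z"
      proof -
        have w2: "1 / w\<^sup>2 = (1 + r) / s\<^sup>2" using r0 by (simp add: w_def s2 power_divide)
        have "- z\<^sup>2 / (2 * w\<^sup>2) + - z\<^sup>2 / 2 = - z\<^sup>2 / 2 * (1 / w\<^sup>2 + 1)" by (simp add: field_simps)
        also have "1 / w\<^sup>2 + 1 = 2 / s\<^sup>2" unfolding w2 using s by (simp add: r_def field_simps)
        finally have "exp (- z\<^sup>2 / (2 * w\<^sup>2)) * exp (- z\<^sup>2 / 2) = exp (- z\<^sup>2 / (2 * s\<^sup>2)) * exp (- z\<^sup>2 / (2 * s\<^sup>2))"
          by (simp add: exp_add[symmetric])
        then show ?thesis
          using w s by (simp add: normal_density_def kw real_sqrt_mult power2_eq_square field_simps)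
      qed
    qed (use 2 s w in \<open>auto intro!: integrable_normal_density normal_density_pos simp: integral_normal_density\<close>)
    have "k - 1 \<le> r\<^sup>2"
    proof -
      have "0 \<le> r\<^sup>2 * (1 - r\<^sup>2 - (r\<^sup>2)\<^sup>2)"
        using r2 power_mono[OF r2, of 2] by (intro mult_nonneg_nonneg) (auto simp: power2_eq_square)
      then have "1 \<le> (1 + r\<^sup>2)\<^sup>2 * (1 - r\<^sup>2)" by (simp add: power2_eq_square algebra_simps)
      then have "sqrt 1 \<le> sqrt ((1 + r\<^sup>2)\<^sup>2 * (1 - r\<^sup>2))" by (rule real_sqrt_le_mono)
      then have "1 \<le> (1 + r\<^sup>2) * sqrt (1 - r\<^sup>2)" by (simp add: real_sqrt_mult)
      moreover have "sqrt (1 - r\<^sup>2) > 0" using r2 by simp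
      ultimately show ?thesis by (simp add: k_def field_simps)
    qed
    then have "(k - 1) / r \<le> r\<^sup>2 / r" using 2 by (intro divide_right_mono) auto
    also have "r\<^sup>2 / r = r" by (simp add: power2_eq_square)
    finally have "(r + (k - 1) / r) / 2 \<le> (r + r) / 2" by (intro divide_right_mono add_left_mono) auto
    from order_trans[OF A this] show ?thesis using r0 by (simp add: r_def)
  next
    case 3
    have "(LINT z|lborel. \<bar>normal_density 0 s z - std_normal_density z\<bar>) \<le> 2"
      by (rule L1_distance_le_2) (use s in \<open>auto intro!: integrable_normal_density simp: integral_normal_density\<close>)
    then show ?thesis using 3 by (simp add: r_def)
  qed
qed

lemma weighted_diff_le:
  fixes p q g :: "real \<Rightarrow> real"
  assumes [measurable]: "g \<in> borel_measurable borel" and b: "\<And>y. \<bar>g y\<bar> \<le> K"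
    and p: "integrable lborel p" and q: "integrable lborel q"
  shows "\<bar>(LINT z|lborel. p z * g (x + c * z)) - (LINT z|lborel. q z * g (x + c * z))\<bar> \<le> K * (LINT z|lborel. \<bar>p z - q z\<bar>)"
proof -
  have i: "integrable lborel (\<lambda>z. f z * g (x + c * z))" if f: "integrable lborel f" for f :: "real \<Rightarrow> real"
  proof (rule Bochner_Integration.integrable_bound)
    show "integrable lborel (\<lambda>z. K * f z)" using f by simp
    have [measurable]: "f \<in> borel_measurable borel" using borel_measurable_integrable[OF f] by simp
    show "(\<lambda>z. f z * g (x + c * z)) \<in> borel_measurable lborel" by measurable
    show "AE z in lborel. norm (f z * g (x + c * z)) \<le> norm (K * f z)"
    proof (rule AE_I2)
      fix z
      have "\<bar>g (x + c * z)\<bar> \<le> \<bar>K\<bar>" using b[of "x + c * z"] by linarith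
      then show "norm (f z * g (x + c * z)) \<le> norm (K * f z)"
        using mult_right_mono[of "\<bar>g (x + c * z)\<bar>" "\<bar>K\<bar>" "\<bar>f z\<bar>"] by (simp add: abs_mult mult.commute)
    qed
  qed
  have e: "(LINT z|lborel. p z * g (x + c * z)) - (LINT z|lborel. q z * g (x + c * z)) = (LINT z|lborel. (p z - q z) * g (x + c * z))"
    using i[OF p] i[OF q] by (simp add: left_diff_distrib)
  have "\<bar>(LINT z|lborel. p z * g (x + c * z)) - (LINT z|lborel. q z * g (x + c * z))\<bar> \<le> (LINT z|lborel. \<bar>(p z - q z) * g (x + c * z)\<bar>)"
    unfolding e by (rule integral_abs_bound)
  also have "\<dots> \<le> (LINT z|lborel. K * \<bar>p z - q z\<bar>)"
  proof (rule integral_mono)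
    show "integrable lborel (\<lambda>z. \<bar>(p z - q z) * g (x + c * z)\<bar>)" using i[of "\<lambda>z. p z - q z"] p q by auto
    show "integrable lborel (\<lambda>z. K * \<bar>p z - q z\<bar>)" using p q by auto
    show "\<bar>(p z - q z) * g (x + c * z)\<bar> \<le> K * \<bar>p z - q z\<bar>" for z
      using mult_right_mono[OF b[of "x + c * z"], of "\<bar>p z - q z\<bar>"] by (simp add: abs_mult mult.commute)
  qed
  finally show ?thesis by simp
qed

text \<open>The shift is moved from \<open>g\<close> to the density, so no regularity of
  \<open>g\<close> enters. The drift needs exactly this: there \<open>y\<close> enters through the
  solution, whose regularity is not yet known.\<close>

lemma gauss_avg_shift:
  assumes g: "g \<in> borel_measurable borel" "\<And>y. \<bar>g y\<bar> \<le> K" and "0 < c"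
  shows "\<bar>gauss_avg c x1 g - gauss_avg c x2 g\<bar> \<le> 2 * K * (\<bar>x1 - x2\<bar> / c)"
proof -
  have K: "0 \<le> K" using g(2)[of 0] by linarith
  define d where "d = (x2 - x1) / c"
  have "gauss_avg c x2 g = (LINT z|lborel. std_normal_density z * g (x2 + c * z))" by (simp add: gauss_avg_def)
  also have "\<dots> = \<bar>1\<bar> *\<^sub>R (LINT z|lborel. std_normal_density (- d + 1 * z) * g (x2 + c * (- d + 1 * z)))"
    by (intro lborel_integral_real_affine) simp
  also have "\<dots> = (LINT z|lborel. normal_density d 1 z * g (x1 + c * z))"
  proof -
    have "x2 + c * (- d + 1 * z) = x1 + c * z" for z using \<open>0 < c\<close> by (simp add: d_def field_simps)
    moreover have "std_normal_density (- d + 1 * z) = normal_density d 1 z" for z by (simp add: normal_density_def)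
    ultimately show ?thesis by simp
  qed
  finally have "\<bar>gauss_avg c x1 g - gauss_avg c x2 g\<bar> \<le> K * (LINT z|lborel. \<bar>normal_density d 1 z - std_normal_density z\<bar>)"
    using weighted_diff_le[OF g, of "normal_density d 1" std_normal_density x1 c] integrable_std
    by (simp add: gauss_avg_def abs_minus_commute)
  also have "\<dots> \<le> K * (2 * \<bar>d\<bar>)" by (intro mult_left_mono normal_L1_shift K)
  also have "\<dots> = 2 * K * (\<bar>x1 - x2\<bar> / c)" using \<open>0 < c\<close> by (simp add: d_def abs_minus_commute)
  finally show ?thesis .
qed

text \<open>Again the change is moved to the density. For widths proportional to the square root of
  time, \<open>1 - (c1 / c2)^2\<close> is a ratio of time differences.\<close>

lemma gauss_avg_scale:
  assumes g: "g \<in> borel_measurable borel" "\<And>y. \<bar>g y\<bar> \<le> K" and c: "0 < c1" "c1 \<le> c2"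
  shows "\<bar>gauss_avg c1 x g - gauss_avg c2 x g\<bar> \<le> 4 * K * (1 - (c1 / c2)\<^sup>2)"
proof -
  have K: "0 \<le> K" using g(2)[of 0] by linarith
  define s where "s = c1 / c2"
  have s: "0 < s" "s \<le> 1" using c by (auto simp: s_def)
  have "gauss_avg c1 x g = (LINT z|lborel. std_normal_density z * g (x + c1 * z))" by (simp add: gauss_avg_def)
  also have "\<dots> = \<bar>1 / s\<bar> *\<^sub>R (LINT z|lborel. std_normal_density (0 + 1 / s * z) * g (x + c1 * (0 + 1 / s * z)))"
    using s by (intro lborel_integral_real_affine) simp
  also have "\<dots> = (LINT z|lborel. (1 / s) * (std_normal_density (1 / s * z) * g (x + c2 * z)))"
    using s c by (simp add: s_def)
  also have "\<dots> = (LINT z|lborel. normal_density 0 s z * g (x + c2 * z))"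
  proof (rule Bochner_Integration.integral_cong[OF refl])
    fix z
    have "(1 / s) * std_normal_density (1 / s * z) = normal_density 0 s z"
      using s by (simp add: normal_density_def real_sqrt_mult power_divide power_mult_distrib field_simps)
    then show "(1 / s) * (std_normal_density (1 / s * z) * g (x + c2 * z)) = normal_density 0 s z * g (x + c2 * z)"
      by (simp only: mult.assoc[symmetric])
  qed
  finally have "\<bar>gauss_avg c1 x g - gauss_avg c2 x g\<bar> \<le> K * (LINT z|lborel. \<bar>normal_density 0 s z - std_normal_density z\<bar>)"
    using weighted_diff_le[OF g, of "normal_density 0 s" std_normal_density x c2] integrable_std s
    by (simp add: gauss_avg_def integrable_normal_density)
  also have "\<dots> \<le> K * (4 * (1 - s\<^sup>2))" using s by (intro mult_left_mono normal_L1_scale K)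
  also have "\<dots> = 4 * K * (1 - (c1 / c2)\<^sup>2)" by (simp only: s_def mult_ac)
  finally show ?thesis .
qed

section \<open>The drift term\<close>

definition heat_sd :: "real \<Rightarrow> real \<Rightarrow> real" where
  "heat_sd a r = \<bar>a\<bar> * sqrt (2 * r)"

text \<open>\<open>h s y\<close> stands for \<open>f s y (u s y \<omega>)\<close> at a fixed
  \<omega>, so the estimates below are pathwise and need only boundedness and measurability of
  \<open>h\<close>.\<close>

definition drift :: "real \<Rightarrow> (real \<Rightarrow> real \<Rightarrow> real) \<Rightarrow> real \<Rightarrow> real \<Rightarrow> real" where
  "drift a h t x = (LINT s:{0..t}|lborel. gauss_avg (heat_sd a (t - s)) x (h s))"

lemma heat_sd_measurable [measurable]: "heat_sd a \<in> borel_measurable borel"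
  unfolding heat_sd_def[abs_def] by measurable

lemma gauss_avg_measurable:
  assumes [measurable]: "(\<lambda>(p, y). h p y) \<in> borel_measurable (P \<Otimes>\<^sub>M borel)"
    "c \<in> borel_measurable P" "x \<in> borel_measurable P"
  shows "(\<lambda>p. gauss_avg (c p) (x p) (h p)) \<in> borel_measurable P"
proof -
  have "(\<lambda>(p, z). std_normal_density z * h p (x p + c p * z)) \<in> borel_measurable (P \<Otimes>\<^sub>M lborel)"
    by measurable
  then show ?thesis unfolding gauss_avg_def by (rule lborel.borel_measurable_lebesgue_integral)
qed

lemma drift_measurable:
  assumes h[measurable]: "(\<lambda>(p, s, y). h p s y) \<in> borel_measurable (P \<Otimes>\<^sub>M borel \<Otimes>\<^sub>M borel)"
    and [measurable]: "t \<in> borel_measurable P" "x \<in> borel_measurable P"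
  shows "(\<lambda>p. drift a (h p) (t p) (x p)) \<in> borel_measurable P"
proof -
  have "(\<lambda>q. gauss_avg (heat_sd a (t (fst q) - snd q)) (x (fst q)) (h (fst q) (snd q))) \<in> borel_measurable (P \<Otimes>\<^sub>M borel)"
  proof (rule gauss_avg_measurable)
    have "(\<lambda>q. (fst (fst q), snd (fst q), snd q)) \<in> measurable ((P \<Otimes>\<^sub>M borel) \<Otimes>\<^sub>M borel) (P \<Otimes>\<^sub>M borel \<Otimes>\<^sub>M borel)"
      by measurable
    from measurable_compose[OF this h]
    show "(\<lambda>(q, y). h (fst q) (snd q) y) \<in> borel_measurable ((P \<Otimes>\<^sub>M borel) \<Otimes>\<^sub>M borel)"
      by (simp add: split_beta')
  qed measurable
  then have "(\<lambda>(p, s). indicator {0..t p} s *\<^sub>R gauss_avg (heat_sd a (t p - s)) (x p) (h p s)) \<in> borel_measurable (P \<Otimes>\<^sub>M lborel)"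
    by (simp add: split_beta') (intro borel_measurable_times, auto simp: indicator_def)
  then show ?thesis unfolding drift_def set_lebesgue_integral_def
    by (rule lborel.borel_measurable_lebesgue_integral)
qed

locale bounded_field =
  fixes h :: "real \<Rightarrow> real \<Rightarrow> real" and K :: real
  assumes h_meas: "(\<lambda>(s, y). h s y) \<in> borel_measurable (borel \<Otimes>\<^sub>M borel)"
    and h_bound: "\<And>s y. \<bar>h s y\<bar> \<le> K"
begin

lemma K_nonneg: "0 \<le> K" using h_bound[of 0 0] by linarith

lemma section_meas [measurable]: "h s \<in> borel_measurable borel"
  using measurable_compose[OF measurable_Pair1'[of s borel borel] h_meas] by simp

lemma kernel_meas: "(\<lambda>s. gauss_avg (heat_sd a (t - s)) x (h s)) \<in> borel_measurable borel"
  by (rule gauss_avg_measurable) (use h_meas in measurable)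

lemma kernel_bound: "\<bar>gauss_avg c x (h s)\<bar> \<le> K"
  by (rule gauss_avg_bounded[OF section_meas h_bound])

lemma kernel_integrable: "set_integrable lborel {u..v} (\<lambda>s. gauss_avg (heat_sd a (t - s)) x (h s))"
  unfolding set_integrable_def
proof (rule integrableI_bounded_set_indicator[where B=K])
  show "(\<lambda>s. gauss_avg (heat_sd a (t - s)) x (h s)) \<in> borel_measurable lborel" using kernel_meas by simp
qed (auto simp: kernel_bound emeasure_lborel_Icc_eq ennreal_less_top)

end

lemma set_integrable_const_Icc: "set_integrable lborel {u..v::real} (\<lambda>_. K::real)"
  unfolding set_integrable_def
  by (rule integrableI_bounded_set_indicator[where B="\<bar>K\<bar>"]) (auto simp: emeasure_lborel_Icc_eq ennreal_less_top)

lemma set_integral_abs_le: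
  fixes f D :: "real \<Rightarrow> real"
  assumes "set_integrable lborel A f" "set_integrable lborel A D" "\<And>s. s \<in> A \<Longrightarrow> \<bar>f s\<bar> \<le> D s"
  shows "\<bar>LINT s:A|lborel. f s\<bar> \<le> (LINT s:A|lborel. D s)"
proof -
  have "\<bar>LINT s:A|lborel. f s\<bar> \<le> (LINT s|lborel. \<bar>indicator A s *\<^sub>R f s\<bar>)"
    unfolding set_lebesgue_integral_def by (rule integral_abs_bound)
  also have "\<dots> \<le> (LINT s:A|lborel. D s)"
    unfolding set_lebesgue_integral_def
  proof (rule integral_mono)
    show "integrable lborel (\<lambda>s. \<bar>indicator A s *\<^sub>R f s\<bar>)"
      using assms(1) unfolding set_integrable_def by (rule integrable_abs)
    show "integrable lborel (\<lambda>s. indicator A s *\<^sub>R D s)" using assms(2) unfolding set_integrable_def .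
    show "\<bar>indicator A s *\<^sub>R f s\<bar> \<le> indicator A s *\<^sub>R D s" for s using assms(3)[of s] by (auto simp: indicator_def)
  qed
  finally show ?thesis .
qed

lemma drift_bound:
  assumes "bounded_field h K" "0 \<le> t"
  shows "\<bar>drift a h t x\<bar> \<le> K * t"
proof -
  interpret bounded_field h K by fact
  have "\<bar>drift a h t x\<bar> \<le> (LINT s:{0..t}|lborel. K)"
    unfolding drift_def by (intro set_integral_abs_le kernel_integrable kernel_bound set_integrable_const_Icc)
  also have "\<dots> = K * t" using assms(2) by (simp add: set_lebesgue_integral_def)
  finally show ?thesis .
qed

lemma drift_diff_bound:
  assumes "bounded_field h1 K" "bounded_field h2 K"
    and D: "set_integrable lborel {0..t} D" and d: "\<And>s y. 0 \<le> s \<Longrightarrow> s \<le> t \<Longrightarrow> \<bar>h1 s y - h2 s y\<bar> \<le> D s"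
  shows "\<bar>drift a h1 t x - drift a h2 t x\<bar> \<le> (LINT s:{0..t}|lborel. D s)"
proof -
  interpret h1: bounded_field h1 K by fact
  interpret h2: bounded_field h2 K by fact
  have "drift a h1 t x - drift a h2 t x =
    (LINT s:{0..t}|lborel. gauss_avg (heat_sd a (t - s)) x (h1 s) - gauss_avg (heat_sd a (t - s)) x (h2 s))"
    unfolding drift_def by (intro set_integral_diff(2)[symmetric] h1.kernel_integrable h2.kernel_integrable)
  moreover have "\<bar>LINT s:{0..t}|lborel. gauss_avg (heat_sd a (t - s)) x (h1 s) - gauss_avg (heat_sd a (t - s)) x (h2 s)\<bar> \<le> (LINT s:{0..t}|lborel. D s)"
  proof (rule set_integral_abs_le[OF _ D])
    show "set_integrable lborel {0..t} (\<lambda>s. gauss_avg (heat_sd a (t - s)) x (h1 s) - gauss_avg (heat_sd a (t - s)) x (h2 s))"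
      by (intro set_integral_diff(1) h1.kernel_integrable h2.kernel_integrable)
    fix s assume s: "s \<in> {0..t}"
    have "\<bar>gauss_avg (heat_sd a (t - s)) x (h1 s) - gauss_avg (heat_sd a (t - s)) x (h2 s)\<bar> = \<bar>gauss_avg (heat_sd a (t - s)) x (\<lambda>y. h1 s y - h2 s y)\<bar>"
      using gauss_avg_integrable[OF h1.section_meas h1.h_bound] gauss_avg_integrable[OF h2.section_meas h2.h_bound]
      unfolding gauss_avg_def by (simp add: right_diff_distrib)
    also have "\<dots> \<le> D s" using d s by (intro gauss_avg_bounded) auto
    finally show "\<bar>gauss_avg (heat_sd a (t - s)) x (h1 s) - gauss_avg (heat_sd a (t - s)) x (h2 s)\<bar> \<le> D s" .
  qed
  ultimately show ?thesis by simp
qed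

lemma drift_tendsto:
  assumes h: "\<And>n. bounded_field (h n) K" "bounded_field h' K"
    and lim: "\<And>s y. 0 \<le> s \<Longrightarrow> s \<le> t \<Longrightarrow> (\<lambda>n. h n s y) \<longlonglongrightarrow> h' s y"
  shows "(\<lambda>n. drift a (h n) t x) \<longlonglongrightarrow> drift a h' t x"
  unfolding drift_def set_lebesgue_integral_def
proof (rule integral_dominated_convergence[where w="\<lambda>s. indicator {0..t} s *\<^sub>R K"])
  interpret h': bounded_field h' K by fact
  show "(\<lambda>s. indicator {0..t} s *\<^sub>R gauss_avg (heat_sd a (t - s)) x (h' s)) \<in> borel_measurable lborel"
    using h'.kernel_meas by measurable
  show "(\<lambda>s. indicator {0..t} s *\<^sub>R gauss_avg (heat_sd a (t - s)) x (h n s)) \<in> borel_measurable lborel" for n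
    using bounded_field.kernel_meas[OF h(1)] by measurable
  show "integrable lborel (\<lambda>s. indicator {0..t} s *\<^sub>R K)"
    using set_integrable_const_Icc unfolding set_integrable_def .
  show "AE s in lborel. norm (indicator {0..t} s *\<^sub>R gauss_avg (heat_sd a (t - s)) x (h n s)) \<le> indicator {0..t} s *\<^sub>R K" for n
    using bounded_field.kernel_bound[OF h(1)] by (intro AE_I2) (auto simp: indicator_def)
  show "AE s in lborel. (\<lambda>n. indicator {0..t} s *\<^sub>R gauss_avg (heat_sd a (t - s)) x (h n s)) \<longlonglongrightarrow> indicator {0..t} s *\<^sub>R gauss_avg (heat_sd a (t - s)) x (h' s)"
  proof (rule AE_I2)
    fix s
    show "(\<lambda>n. indicator {0..t} s *\<^sub>R gauss_avg (heat_sd a (t - s)) x (h n s)) \<longlonglongrightarrow> indicator {0..t} s *\<^sub>R gauss_avg (heat_sd a (t - s)) x (h' s)"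
    proof (cases "s \<in> {0..t}")
      case True
      have "(\<lambda>n. gauss_avg (heat_sd a (t - s)) x (h n s)) \<longlonglongrightarrow> gauss_avg (heat_sd a (t - s)) x (h' s)"
        unfolding gauss_avg_def
      proof (rule integral_dominated_convergence[where w="\<lambda>z. K * std_normal_density z"])
        show "(\<lambda>z. std_normal_density z * h' s (x + heat_sd a (t - s) * z)) \<in> borel_measurable lborel"
          using h'.section_meas[of s] by measurable
        show "(\<lambda>z. std_normal_density z * h n s (x + heat_sd a (t - s) * z)) \<in> borel_measurable lborel" for n
          using bounded_field.section_meas[OF h(1), of n s] by measurable
        show "integrable lborel (\<lambda>z. K * std_normal_density z)" using integrable_std by simp
        show "AE z in lborel. (\<lambda>n. std_normal_density z * h n s (x + heat_sd a (t - s) * z)) \<longlonglongrightarrow> std_normal_density z * h' s (x + heat_sd a (t - s) * z)"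
          using lim True by (intro AE_I2 tendsto_mult tendsto_const) auto
        show "AE z in lborel. norm (std_normal_density z * h n s (x + heat_sd a (t - s) * z)) \<le> K * std_normal_density z" for n
        proof (rule AE_I2)
          fix z
          show "norm (std_normal_density z * h n s (x + heat_sd a (t - s) * z)) \<le> K * std_normal_density z"
            using mult_right_mono[OF bounded_field.h_bound[OF h(1), of n s "x + heat_sd a (t - s) * z"], of "std_normal_density z"]
            by (simp add: abs_mult mult.commute)
        qed
      qed
      then show ?thesis using True by simp
    qed simp
  qed
qed

text \<open>Meant for uniqueness, where the equation holds only almost surely at each point: the
  estimate has to be integrated over \<omega> and reordered, which nonnegative integrals allow
  without integrability conditions.\<close>

lemma drift_diff_nn:
  assumes "bounded_field h1 K" "bounded_field h2 K"
  shows "ennreal \<bar>drift a h1 t x - drift a h2 t x\<bar> \<le>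
    (\<integral>\<^sup>+s. indicator {0..t} s * (\<integral>\<^sup>+z. ennreal (std_normal_density z * \<bar>h1 s (x + heat_sd a (t - s) * z) - h2 s (x + heat_sd a (t - s) * z)\<bar>) \<partial>lborel) \<partial>lborel)"
proof -
  interpret h1: bounded_field h1 K by fact
  interpret h2: bounded_field h2 K by fact
  let ?G = "\<lambda>s. gauss_avg (heat_sd a (t - s)) x (h1 s) - gauss_avg (heat_sd a (t - s)) x (h2 s)"
  have "drift a h1 t x - drift a h2 t x = (LINT s:{0..t}|lborel. ?G s)"
    unfolding drift_def by (intro set_integral_diff(2)[symmetric] h1.kernel_integrable h2.kernel_integrable)
  then have "ennreal \<bar>drift a h1 t x - drift a h2 t x\<bar> = ennreal (norm (LINT s|lborel. indicator {0..t} s *\<^sub>R ?G s))"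
    by (simp add: set_lebesgue_integral_def)
  also have "\<dots> \<le> (\<integral>\<^sup>+s. ennreal (norm (indicator {0..t} s *\<^sub>R ?G s)) \<partial>lborel)"
  proof (rule integral_norm_bound_ennreal)
    show "integrable lborel (\<lambda>s. indicator {0..t} s *\<^sub>R ?G s)"
      using set_integral_diff(1)[OF h1.kernel_integrable h2.kernel_integrable] unfolding set_integrable_def .
  qed
  also have "\<dots> \<le> (\<integral>\<^sup>+s. indicator {0..t} s * (\<integral>\<^sup>+z. ennreal (std_normal_density z * \<bar>h1 s (x + heat_sd a (t - s) * z) - h2 s (x + heat_sd a (t - s) * z)\<bar>) \<partial>lborel) \<partial>lborel)"
  proof (rule nn_integral_mono)
    fix s
    note i1 = gauss_avg_integrable[OF h1.section_meas h1.h_bound, of s x "heat_sd a (t - s)"]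
    note i2 = gauss_avg_integrable[OF h2.section_meas h2.h_bound, of s x "heat_sd a (t - s)"]
    have e: "?G s = (LINT z|lborel. std_normal_density z * (h1 s (x + heat_sd a (t - s) * z) - h2 s (x + heat_sd a (t - s) * z)))"
      unfolding gauss_avg_def using i1 i2 by (simp add: right_diff_distrib)
    have "ennreal (norm (?G s)) \<le> (\<integral>\<^sup>+z. ennreal (norm (std_normal_density z * (h1 s (x + heat_sd a (t - s) * z) - h2 s (x + heat_sd a (t - s) * z)))) \<partial>lborel)"
      unfolding e by (rule integral_norm_bound_ennreal) (use i1 i2 in \<open>simp add: right_diff_distrib\<close>)
    then show "ennreal (norm (indicator {0..t} s *\<^sub>R ?G s)) \<le> indicator {0..t} s * (\<integral>\<^sup>+z. ennreal (std_normal_density z * \<bar>h1 s (x + heat_sd a (t - s) * z) - h2 s (x + heat_sd a (t - s) * z)\<bar>) \<partial>lborel)"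
      by (cases "s \<in> {0..t}") (simp_all add: abs_mult)
  qed
  finally show ?thesis .
qed

text \<open>The width \<open>c\<close> is of order \<open>sqrt (t - s)\<close>. Interpolating the
  smoothing bound \<open>d / c\<close> with the trivial one gives
  \<open>(d / c) powr \<gamma>\<close>, whose singularity
  \<open>(t - s) powr (-(\<gamma>/2))\<close> is integrable.\<close>

lemma drift_holder_space:
  assumes "bounded_field h K" and a: "a \<noteq> 0" and t: "0 \<le> t" "t \<le> T" and \<gamma>: "0 < \<gamma>" "\<gamma> \<le> 1"
  shows "\<bar>drift a h t x1 - drift a h t x2\<bar> \<le>
    (2 * K * (\<bar>a\<bar> * sqrt 2) powr (-\<gamma>) * (T powr (1 - \<gamma>/2) / (1 - \<gamma>/2))) * \<bar>x1 - x2\<bar> powr \<gamma>"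
proof -
  interpret bounded_field h K by fact
  define d where "d = \<bar>x1 - x2\<bar>"
  define b where "b = 2 * K * (\<bar>a\<bar> * sqrt 2) powr (-\<gamma>) * d powr \<gamma>"
  have b0: "0 \<le> b" using K_nonneg by (simp add: b_def)
  have g2: "0 \<le> \<gamma>/2" "\<gamma>/2 < 1" using \<gamma> by auto
  let ?G = "\<lambda>s. gauss_avg (heat_sd a (t - s)) x1 (h s) - gauss_avg (heat_sd a (t - s)) x2 (h s)"
  have "drift a h t x1 - drift a h t x2 = (LINT s:{0..t}|lborel. ?G s)"
    unfolding drift_def by (intro set_integral_diff(2)[symmetric] kernel_integrable)
  \<comment> \<open>At \<open>s = t\<close> the width is 0 and nothing is smoothed; the point is
    dropped as a null set.\<close>
  moreover have "\<bar>LINT s:{0..t}|lborel. ?G s\<bar> = \<bar>LINT s:{0..<t}|lborel. ?G s\<bar>"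
  proof -
    have "(LINT s:{0..t}|lborel. ?G s) = (LINT s:{0..<t}|lborel. ?G s)"
      unfolding set_lebesgue_integral_def
    proof (rule integral_cong_AE)
      show "AE s in lborel. indicator {0..t} s *\<^sub>R ?G s = indicator {0..<t} s *\<^sub>R ?G s"
        using AE_lborel_singleton[of t] by eventually_elim (auto simp: indicator_def)
      show "(\<lambda>s. indicator {0..t} s *\<^sub>R ?G s) \<in> borel_measurable lborel" using kernel_meas by measurable
      show "(\<lambda>s. indicator {0..<t} s *\<^sub>R ?G s) \<in> borel_measurable lborel" using kernel_meas by measurable
    qed
    then show ?thesis by simp
  qed
  moreover have "\<bar>LINT s:{0..<t}|lborel. ?G s\<bar> \<le> (LINT s:{0..<t}|lborel. b * (t - s) powr (-(\<gamma>/2)))"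
  proof (rule set_integral_abs_le)
    show "set_integrable lborel {0..<t} ?G"
      by (rule set_integrable_subset[OF set_integral_diff(1)[OF kernel_integrable[of 0 t] kernel_integrable[of 0 t]]]) auto
    show "set_integrable lborel {0..<t} (\<lambda>s. b * (t - s) powr (-(\<gamma>/2)))"
      by (rule set_integrable_subset[OF set_integrable_mult_right[OF powr_integral_bound(1)[OF g2 t(1)]]]) auto
    fix s assume s: "s \<in> {0..<t}"
    define c where "c = heat_sd a (t - s)"
    have c: "c > 0" using a s by (simp add: c_def heat_sd_def)
    have dc: "0 \<le> d / c" using c by (simp add: d_def)
    have "\<bar>?G s\<bar> \<le> 2 * K * (d / c) powr \<gamma>"
    proof (cases "d / c \<le> 1")
      case True
      have "\<bar>?G s\<bar> \<le> 2 * K * (d / c)" using gauss_avg_shift[OF section_meas[of s] h_bound c, of x1 x2] by (simp add: c_def d_def)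
      also have "\<dots> \<le> 2 * K * (d / c) powr \<gamma>" using True dc \<gamma> K_nonneg by (intro mult_left_mono powr_ge_self) auto
      finally show ?thesis .
    next
      case False
      have "\<bar>?G s\<bar> \<le> 2 * K * 1" using kernel_bound[of "heat_sd a (t - s)" x1 s] kernel_bound[of "heat_sd a (t - s)" x2 s] by linarith
      also have "\<dots> \<le> 2 * K * (d / c) powr \<gamma>" using False \<gamma> K_nonneg by (intro mult_left_mono ge_one_powr_ge_zero) auto
      finally show ?thesis .
    qed
    also have "\<dots> = b * (t - s) powr (-(\<gamma>/2))"
    proof -
      have "c = (\<bar>a\<bar> * sqrt 2) * (t - s) powr (1/2)" using s by (simp add: c_def heat_sd_def real_sqrt_mult powr_half_sqrt del: right_diff_distrib_numeral)
      then have "c powr \<gamma> = (\<bar>a\<bar> * sqrt 2) powr \<gamma> * (t - s) powr (\<gamma>/2)" by (simp add: powr_mult powr_powr)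
      then have "(d / c) powr \<gamma> = d powr \<gamma> * ((\<bar>a\<bar> * sqrt 2) powr (-\<gamma>) * (t - s) powr (-(\<gamma>/2)))"
        using c dc by (simp add: powr_divide d_def powr_minus field_simps)
      then show ?thesis by (simp add: b_def)
    qed
    finally show "\<bar>?G s\<bar> \<le> b * (t - s) powr (-(\<gamma>/2))" .
  qed
  moreover have "(LINT s:{0..<t}|lborel. b * (t - s) powr (-(\<gamma>/2))) = (LINT s:{0..t}|lborel. b * (t - s) powr (-(\<gamma>/2)))"
    unfolding set_lebesgue_integral_def
  proof (rule integral_cong_AE)
    show "AE s in lborel. indicator {0..<t} s *\<^sub>R (b * (t - s) powr (-(\<gamma>/2))) = indicator {0..t} s *\<^sub>R (b * (t - s) powr (-(\<gamma>/2)))"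
      using AE_lborel_singleton[of t] by eventually_elim (auto simp: indicator_def)
  qed measurable
  moreover have "(LINT s:{0..t}|lborel. b * (t - s) powr (-(\<gamma>/2))) = b * (t powr (1 - \<gamma>/2) / (1 - \<gamma>/2))"
    using powr_integral_bound(2)[OF g2 t(1)] by simp
  moreover have "b * (t powr (1 - \<gamma>/2) / (1 - \<gamma>/2)) \<le> b * (T powr (1 - \<gamma>/2) / (1 - \<gamma>/2))"
    using b0 t g2 by (intro mult_left_mono divide_right_mono powr_mono2) auto
  ultimately have "\<bar>drift a h t x1 - drift a h t x2\<bar> \<le> b * (T powr (1 - \<gamma>/2) / (1 - \<gamma>/2))" by linarith
  then show ?thesis by (simp add: b_def d_def mult_ac)
qed

text \<open>On \<open>[t1, t2]\<close> boundedness suffices. On \<open>[0, t1)\<close> the widths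
  satisfy \<open>1 - (c1 / c2)^2 = (t2 - t1) / (t2 - s)\<close>, which is at most
  \<open>(t2 - t1) powr \<gamma> * (t1 - s) powr (-\<gamma>)\<close>; integrability of this weight
  is the reason for \<open>\<gamma> < 1\<close>.\<close>

lemma drift_holder_time:
  assumes "bounded_field h K" and a: "a \<noteq> 0" and t: "0 \<le> t1" "t1 \<le> t2" "t2 \<le> T" and \<gamma>: "0 < \<gamma>" "\<gamma> < 1"
  shows "\<bar>drift a h t2 x - drift a h t1 x\<bar> \<le>
    (K * T powr (1 - \<gamma>) + 4 * K * (T powr (1 - \<gamma>) / (1 - \<gamma>))) * (t2 - t1) powr \<gamma>"
proof -
  interpret bounded_field h K by fact
  let ?g = "\<lambda>t s. gauss_avg (heat_sd a (t - s)) x (h s)"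
  define d where "d = t2 - t1"
  have d0: "0 \<le> d" using t by (simp add: d_def)
  define b where "b = 4 * K * d powr \<gamma>"
  have b0: "0 \<le> b" using K_nonneg by (simp add: b_def)
  have g2: "0 \<le> \<gamma>" "\<gamma> < 1" using \<gamma> by auto
  have meas: "?g t \<in> borel_measurable lborel" for t using kernel_meas by simp
  have ioc: "set_integrable lborel {t1<..t2} (?g t2)"
    by (rule set_integrable_subset[OF kernel_integrable[of t1 t2]]) auto
  have "{0..t2} = {0..t1} \<union> {t1<..t2}" using t by auto
  then have "drift a h t2 x = (LINT s:{0..t1} \<union> {t1<..t2}|lborel. ?g t2 s)" by (simp add: drift_def)
  also have "\<dots> = (LINT s:{0..t1}|lborel. ?g t2 s) + (LINT s:{t1<..t2}|lborel. ?g t2 s)"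
    by (rule set_integral_Un) (use kernel_integrable ioc in auto)
  finally have "drift a h t2 x - drift a h t1 x = (LINT s:{t1<..t2}|lborel. ?g t2 s) + ((LINT s:{0..t1}|lborel. ?g t2 s) - (LINT s:{0..t1}|lborel. ?g t1 s))"
    by (simp add: drift_def)
  also have "(LINT s:{0..t1}|lborel. ?g t2 s) - (LINT s:{0..t1}|lborel. ?g t1 s) = (LINT s:{0..t1}|lborel. ?g t2 s - ?g t1 s)"
    by (intro set_integral_diff(2)[symmetric] kernel_integrable)
  also have "\<dots> = (LINT s:{0..<t1}|lborel. ?g t2 s - ?g t1 s)"
    unfolding set_lebesgue_integral_def
  proof (rule integral_cong_AE)
    show "AE s in lborel. indicator {0..t1} s *\<^sub>R (?g t2 s - ?g t1 s) = indicator {0..<t1} s *\<^sub>R (?g t2 s - ?g t1 s)"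
      using AE_lborel_singleton[of t1] by eventually_elim (auto simp: indicator_def)
  qed (use meas in measurable)
  finally have eq: "drift a h t2 x - drift a h t1 x = (LINT s:{t1<..t2}|lborel. ?g t2 s) + (LINT s:{0..<t1}|lborel. ?g t2 s - ?g t1 s)" .
  have "\<bar>LINT s:{t1<..t2}|lborel. ?g t2 s\<bar> \<le> (LINT s:{t1<..t2}|lborel. K)"
    by (intro set_integral_abs_le ioc kernel_bound set_integrable_subset[OF set_integrable_const_Icc[of t1 t2]]) auto
  also have "\<dots> = K * d" using t by (simp add: set_lebesgue_integral_def d_def)
  also have "\<dots> \<le> K * (T powr (1 - \<gamma>) * d powr \<gamma>)"
  proof (intro mult_left_mono K_nonneg)
    have "d = d powr (1 - \<gamma>) * d powr \<gamma>" using d0 by (cases "d = 0") (simp_all add: powr_add[symmetric])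
    also have "\<dots> \<le> T powr (1 - \<gamma>) * d powr \<gamma>" using t d0 \<gamma> by (intro mult_right_mono powr_mono2) (auto simp: d_def)
    finally show "d \<le> T powr (1 - \<gamma>) * d powr \<gamma>" .
  qed
  finally have A: "\<bar>LINT s:{t1<..t2}|lborel. ?g t2 s\<bar> \<le> K * (T powr (1 - \<gamma>) * d powr \<gamma>)" .
  have "\<bar>LINT s:{0..<t1}|lborel. ?g t2 s - ?g t1 s\<bar> \<le> (LINT s:{0..<t1}|lborel. b * (t1 - s) powr (-\<gamma>))"
  proof (rule set_integral_abs_le)
    show "set_integrable lborel {0..<t1} (\<lambda>s. ?g t2 s - ?g t1 s)"
      by (rule set_integrable_subset[OF set_integral_diff(1)[OF kernel_integrable[of 0 t1] kernel_integrable[of 0 t1]]]) auto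
    show "set_integrable lborel {0..<t1} (\<lambda>s. b * (t1 - s) powr (-\<gamma>))"
      by (rule set_integrable_subset[OF set_integrable_mult_right[OF powr_integral_bound(1)[OF g2 t(1)]]]) auto
    fix s assume s: "s \<in> {0..<t1}"
    define r where "r = d / (t2 - s)"
    have r: "0 \<le> r" "r \<le> 1" using s t d0 by (auto simp: r_def d_def)
    have "(heat_sd a (t1 - s) / heat_sd a (t2 - s))\<^sup>2 = (t1 - s) / (t2 - s)"
      using a s t by (simp add: heat_sd_def power_divide power_mult_distrib del: right_diff_distrib_numeral)
    also have "\<dots> = 1 - r" using s t by (simp add: r_def d_def field_simps)
    finally have e: "1 - (heat_sd a (t1 - s) / heat_sd a (t2 - s))\<^sup>2 = r" by simp
    have "\<bar>?g t1 s - ?g t2 s\<bar> \<le> 4 * K * (1 - (heat_sd a (t1 - s) / heat_sd a (t2 - s))\<^sup>2)"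
    proof (rule gauss_avg_scale[OF section_meas h_bound])
      show "0 < heat_sd a (t1 - s)" using a s by (simp add: heat_sd_def)
      show "heat_sd a (t1 - s) \<le> heat_sd a (t2 - s)" unfolding heat_sd_def using t by (intro mult_left_mono) auto
    qed
    also have "\<dots> = 4 * K * r" by (simp only: e)
    also have "\<dots> \<le> 4 * K * r powr \<gamma>" using r \<gamma> K_nonneg by (intro mult_left_mono powr_ge_self) auto
    also have "\<dots> \<le> 4 * K * (d powr \<gamma> * (t1 - s) powr (-\<gamma>))"
    proof (intro mult_left_mono)
      have "r powr \<gamma> = d powr \<gamma> * (t2 - s) powr (-\<gamma>)" using s t d0 by (simp add: r_def powr_divide powr_minus field_simps)
      also have "\<dots> \<le> d powr \<gamma> * (t1 - s) powr (-\<gamma>)"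
        using s t \<gamma> by (intro mult_left_mono powr_mono2') auto
      finally show "r powr \<gamma> \<le> d powr \<gamma> * (t1 - s) powr (-\<gamma>)" .
    qed (use K_nonneg in auto)
    finally show "\<bar>?g t2 s - ?g t1 s\<bar> \<le> b * (t1 - s) powr (-\<gamma>)" by (simp add: b_def abs_minus_commute mult_ac)
  qed
  also have "(LINT s:{0..<t1}|lborel. b * (t1 - s) powr (-\<gamma>)) = (LINT s:{0..t1}|lborel. b * (t1 - s) powr (-\<gamma>))"
    unfolding set_lebesgue_integral_def
  proof (rule integral_cong_AE)
    show "AE s in lborel. indicator {0..<t1} s *\<^sub>R (b * (t1 - s) powr (-\<gamma>)) = indicator {0..t1} s *\<^sub>R (b * (t1 - s) powr (-\<gamma>))"
      using AE_lborel_singleton[of t1] by eventually_elim (auto simp: indicator_def)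
  qed measurable
  also have "\<dots> = b * (t1 powr (1 - \<gamma>) / (1 - \<gamma>))" using powr_integral_bound(2)[OF g2 t(1)] by simp
  also have "\<dots> \<le> b * (T powr (1 - \<gamma>) / (1 - \<gamma>))"
    using b0 t g2 by (intro mult_left_mono divide_right_mono powr_mono2) auto
  finally have Bd: "\<bar>LINT s:{0..<t1}|lborel. ?g t2 s - ?g t1 s\<bar> \<le> b * (T powr (1 - \<gamma>) / (1 - \<gamma>))" .
  have "\<bar>drift a h t2 x - drift a h t1 x\<bar> \<le> K * (T powr (1 - \<gamma>) * d powr \<gamma>) + b * (T powr (1 - \<gamma>) / (1 - \<gamma>))"
    unfolding eq using A Bd by linarith
  also have "\<dots> = (K * T powr (1 - \<gamma>) + 4 * K * (T powr (1 - \<gamma>) / (1 - \<gamma>))) * d powr \<gamma>"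
    by (simp add: b_def algebra_simps)
  finally show ?thesis by (simp add: d_def)
qed

section \<open>Picard iteration\<close>

lemma nn_integral_power_Icc:
  fixes c t :: real
  assumes "0 \<le> t" "0 \<le> c"
  shows "(\<integral>\<^sup>+s. indicator {0..t} s * ennreal (c * s ^ n) \<partial>lborel) = ennreal (c * t ^ Suc n / Suc n)"
proof -
  have "(\<integral>\<^sup>+s. ennreal (c * s ^ n) * indicator {0..t} s \<partial>lborel) = ennreal (c * t ^ Suc n / Suc n - c * 0 ^ Suc n / Suc n)"
  proof (rule nn_integral_FTC_Icc)
    fix s :: real
    show "((\<lambda>s. c * s ^ Suc n / Suc n) has_real_derivative c * s ^ n) (at s)"
      by (rule DERIV_cong[OF DERIV_cdivide[OF DERIV_cmult[OF DERIV_pow]]]) simp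
  qed (use assms in auto)
  then show ?thesis by (simp add: mult.commute)
qed

lemma power_Icc_integral:
  fixes c t :: real
  assumes "0 \<le> t" "0 \<le> c"
  shows "set_integrable lborel {0..t} (\<lambda>s. c * s ^ n)"
    "(LINT s:{0..t}|lborel. c * s ^ n) = c * t ^ Suc n / Suc n"
proof -
  have "has_bochner_integral lborel (\<lambda>s. indicator {0..t} s * (c * s ^ n)) (c * t ^ Suc n / Suc n)"
  proof (rule has_bochner_integral_nn_integral)
    have "ennreal (indicator {0..t} s * (c * s ^ n)) = indicator {0..t} s * ennreal (c * s ^ n)" for s
      by (auto simp: indicator_def)
    then show "(\<integral>\<^sup>+s. ennreal (indicator {0..t} s * (c * s ^ n)) \<partial>lborel) = ennreal (c * t ^ Suc n / Suc n)"
      using nn_integral_power_Icc[OF assms, of n] by simp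
  qed (use assms in \<open>auto simp: indicator_def\<close>)
  then show "set_integrable lborel {0..t} (\<lambda>s. c * s ^ n)" "(LINT s:{0..t}|lborel. c * s ^ n) = c * t ^ Suc n / Suc n"
    unfolding set_integrable_def set_lebesgue_integral_def by (auto simp: has_bochner_integral_iff)
qed

text \<open>\<open>V\<close> collects the initial and the stochastic term, which do not involve the
  unknown.\<close>

primrec picard :: "real \<Rightarrow> (real \<Rightarrow> real \<Rightarrow> real \<Rightarrow> real) \<Rightarrow> (real \<Rightarrow> real \<Rightarrow> 'w \<Rightarrow> real) \<Rightarrow> nat \<Rightarrow> real \<Rightarrow> real \<Rightarrow> 'w \<Rightarrow> real" where
  "picard a f V 0 = V"
| "picard a f V (Suc n) = (\<lambda>t x \<omega>. V t x \<omega> + drift a (\<lambda>s y. f s y (picard a f V n s y \<omega>)) t x)"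

locale nonlinearity =
  fixes f :: "real \<Rightarrow> real \<Rightarrow> real \<Rightarrow> real" and K L :: real
  assumes f_meas: "(\<lambda>(s, y, v). f s y v) \<in> borel_measurable (borel \<Otimes>\<^sub>M borel \<Otimes>\<^sub>M borel)"
    and f_bound: "\<And>s y v. \<bar>f s y v\<bar> \<le> K"
    and f_lip: "\<And>s y v w. \<bar>f s y v - f s y w\<bar> \<le> L * \<bar>v - w\<bar>"
begin

lemma L_nonneg: "0 \<le> L"
  using f_lip[of 0 0 0 1] abs_ge_zero[of "f 0 0 0 - f 0 0 1"] by simp

lemma K_nonneg: "0 \<le> K"
  using f_bound[of 0 0 0] by linarith

lemma compose_meas:
  assumes u: "(\<lambda>(t, x, \<omega>). u t x \<omega>) \<in> borel_measurable (borel \<Otimes>\<^sub>M borel \<Otimes>\<^sub>M M)"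
    and w[measurable]: "w \<in> measurable P M"
  shows "(\<lambda>(p, s, y). f s y (u s y (w p))) \<in> borel_measurable (P \<Otimes>\<^sub>M borel \<Otimes>\<^sub>M borel)"
proof -
  have "(\<lambda>q. (fst (snd q), snd (snd q), w (fst q))) \<in> measurable (P \<Otimes>\<^sub>M borel \<Otimes>\<^sub>M borel) (borel \<Otimes>\<^sub>M borel \<Otimes>\<^sub>M M)" by measurable
  from measurable_compose[OF this u]
  have [measurable]: "(\<lambda>q. u (fst (snd q)) (snd (snd q)) (w (fst q))) \<in> borel_measurable (P \<Otimes>\<^sub>M borel \<Otimes>\<^sub>M borel)" by simp
  have "(\<lambda>q. (fst (snd q), snd (snd q), u (fst (snd q)) (snd (snd q)) (w (fst q)))) \<in> measurable (P \<Otimes>\<^sub>M borel \<Otimes>\<^sub>M borel) (borel \<Otimes>\<^sub>M borel \<Otimes>\<^sub>M borel)" by measurable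
  from measurable_compose[OF this f_meas] show ?thesis by (simp add: split_beta')
qed

lemma field:
  assumes u: "(\<lambda>(t, x, \<omega>). u t x \<omega>) \<in> borel_measurable (borel \<Otimes>\<^sub>M borel \<Otimes>\<^sub>M M)" and w: "\<omega> \<in> space M"
  shows "bounded_field (\<lambda>s y. f s y (u s y \<omega>)) K"
proof
  have "(\<lambda>(p::real, s, y). f s y (u s y \<omega>)) \<in> borel_measurable (borel \<Otimes>\<^sub>M borel \<Otimes>\<^sub>M borel)"
    by (rule compose_meas[OF u]) (use w in simp)
  from measurable_compose[OF _ this, of "\<lambda>q. (0, q)"]
  show "(\<lambda>(s, y). f s y (u s y \<omega>)) \<in> borel_measurable (borel \<Otimes>\<^sub>M borel)" by (simp add: split_beta')
qed (rule f_bound)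

lemma drift_process_measurable:
  assumes u: "(\<lambda>(t, x, \<omega>). u t x \<omega>) \<in> borel_measurable (borel \<Otimes>\<^sub>M borel \<Otimes>\<^sub>M M)"
  shows "(\<lambda>(t, x, \<omega>). drift a (\<lambda>s y. f s y (u s y \<omega>)) t x) \<in> borel_measurable (borel \<Otimes>\<^sub>M borel \<Otimes>\<^sub>M M)"
proof -
  have "(\<lambda>p. drift a (\<lambda>s y. f s y (u s y (snd (snd p)))) (fst p) (fst (snd p))) \<in> borel_measurable (borel \<Otimes>\<^sub>M borel \<Otimes>\<^sub>M M)"
    by (rule drift_measurable) (use compose_meas[OF u, of "\<lambda>p. snd (snd p)"] in measurable)
  then show ?thesis by (simp add: split_beta')
qed

lemma picard_measurable:
  assumes V: "(\<lambda>(t, x, \<omega>). V t x \<omega>) \<in> borel_measurable (borel \<Otimes>\<^sub>M borel \<Otimes>\<^sub>M M)"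
  shows "(\<lambda>(t, x, \<omega>). picard a f V n t x \<omega>) \<in> borel_measurable (borel \<Otimes>\<^sub>M borel \<Otimes>\<^sub>M M)"
proof (induction n)
  case 0 then show ?case using V by simp
next
  case (Suc n)
  from borel_measurable_add[OF V drift_process_measurable[OF Suc, of a]] show ?case by (simp add: split_beta')
qed

text \<open>Boundedness of \<open>f\<close> bounds the first increment by \<open>K * t\<close>
  whatever the size of \<open>V\<close>; each further step brings a factor \<open>L\<close> and one
  more integration of a power of \<open>s\<close>.\<close>

lemma picard_step:
  assumes V: "(\<lambda>(t, x, \<omega>). V t x \<omega>) \<in> borel_measurable (borel \<Otimes>\<^sub>M borel \<Otimes>\<^sub>M M)" and w: "\<omega> \<in> space M" and t: "0 \<le> t"
  shows "\<bar>picard a f V (Suc n) t x \<omega> - picard a f V n t x \<omega>\<bar> \<le> K * L ^ n / fact (Suc n) * t ^ Suc n"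
  using t
proof (induction n arbitrary: t x)
  case 0
  then show ?case using drift_bound[OF field[OF V w], of t a x] by simp
next
  case (Suc n)
  let ?h = "\<lambda>n s y. f s y (picard a f V n s y \<omega>)"
  define c where "c = L * (K * L ^ n / fact (Suc n))"
  have c: "0 \<le> c" using L_nonneg K_nonneg by (simp add: c_def)
  have "\<bar>picard a f V (Suc (Suc n)) t x \<omega> - picard a f V (Suc n) t x \<omega>\<bar> = \<bar>drift a (?h (Suc n)) t x - drift a (?h n) t x\<bar>"
    by simp
  also have "\<dots> \<le> (LINT s:{0..t}|lborel. c * s ^ Suc n)"
  proof (rule drift_diff_bound[OF field[OF picard_measurable[OF V] w] field[OF picard_measurable[OF V] w] power_Icc_integral(1)[OF Suc.prems c]])
    fix s y assume s: "0 \<le> s" "s \<le> t"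
    have "\<bar>?h (Suc n) s y - ?h n s y\<bar> \<le> L * \<bar>picard a f V (Suc n) s y \<omega> - picard a f V n s y \<omega>\<bar>" by (rule f_lip)
    also have "\<dots> \<le> L * (K * L ^ n / fact (Suc n) * s ^ Suc n)" by (intro mult_left_mono Suc.IH s L_nonneg)
    finally show "\<bar>?h (Suc n) s y - ?h n s y\<bar> \<le> c * s ^ Suc n" by (simp add: c_def)
  qed
  also have "\<dots> = c * t ^ Suc (Suc n) / Suc (Suc n)" by (rule power_Icc_integral(2)[OF Suc.prems c])
  also have "\<dots> = K * L ^ Suc n / fact (Suc (Suc n)) * t ^ Suc (Suc n)"
    unfolding c_def fact_Suc[of "Suc n"] of_nat_mult of_nat_fact by (simp add: field_simps del: of_nat_Suc fact_Suc)
  finally show ?case .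
qed

lemma drift_neg: "t < 0 \<Longrightarrow> drift a h t x = 0"
  by (simp add: drift_def set_lebesgue_integral_def)

theorem mild_equation_solvable:
  assumes V: "(\<lambda>(t, x, \<omega>). V t x \<omega>) \<in> borel_measurable (borel \<Otimes>\<^sub>M borel \<Otimes>\<^sub>M M)"
  shows "\<exists>u. (\<lambda>(t, x, \<omega>). u t x \<omega>) \<in> borel_measurable (borel \<Otimes>\<^sub>M borel \<Otimes>\<^sub>M M) \<and>
    (\<forall>\<omega>\<in>space M. \<forall>t x. u t x \<omega> = V t x \<omega> + drift a (\<lambda>s y. f s y (u s y \<omega>)) t x)"
proof -
  define u where "u t x \<omega> = lim (\<lambda>n. picard a f V n t x \<omega>)" for t x \<omega>
  have "(\<lambda>p. lim (\<lambda>n. picard a f V n (fst p) (fst (snd p)) (snd (snd p)))) \<in> borel_measurable (borel \<Otimes>\<^sub>M borel \<Otimes>\<^sub>M M)"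
    by (rule borel_measurable_lim_metric) (use picard_measurable[OF V] in \<open>simp add: split_beta'\<close>)
  then have um: "(\<lambda>(t, x, \<omega>). u t x \<omega>) \<in> borel_measurable (borel \<Otimes>\<^sub>M borel \<Otimes>\<^sub>M M)" by (simp add: u_def split_beta')
  have conv: "(\<lambda>n. picard a f V n t x \<omega>) \<longlonglongrightarrow> u t x \<omega>" if w: "\<omega> \<in> space M" for t x \<omega>
  proof -
    have "convergent (\<lambda>n. picard a f V n t x \<omega>)"
    proof (cases "0 \<le> t")
      case True
      have "summable (\<lambda>n. picard a f V (Suc n) t x \<omega> - picard a f V n t x \<omega>)"
      proof (rule summable_comparison_test')
        show "summable (\<lambda>n. (K * t) * (inverse (fact n) * (L * t) ^ n))"
          by (intro summable_mult summable_exp)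
        fix n
        have "norm (picard a f V (Suc n) t x \<omega> - picard a f V n t x \<omega>) \<le> K * L ^ n / fact (Suc n) * t ^ Suc n"
          using picard_step[OF V w True, of a n x] by simp
        also have "\<dots> = (K * t * (L * t) ^ n) / fact (Suc n)" by (simp add: power_mult_distrib field_simps del: fact_Suc)
        also have "\<dots> \<le> (K * t * (L * t) ^ n) / fact n"
          using K_nonneg L_nonneg True by (intro divide_left_mono fact_mono) auto
        finally show "norm (picard a f V (Suc n) t x \<omega> - picard a f V n t x \<omega>) \<le> (K * t) * (inverse (fact n) * (L * t) ^ n)"
          by (simp add: field_simps)
      qed
      then have "(\<lambda>n. \<Sum>i<n. picard a f V (Suc i) t x \<omega> - picard a f V i t x \<omega>) \<longlonglongrightarrow> (\<Sum>n. picard a f V (Suc n) t x \<omega> - picard a f V n t x \<omega>)"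
        by (rule summable_LIMSEQ)
      then have "(\<lambda>n. picard a f V n t x \<omega> - picard a f V 0 t x \<omega>) \<longlonglongrightarrow> (\<Sum>n. picard a f V (Suc n) t x \<omega> - picard a f V n t x \<omega>)"
        using sum_lessThan_telescope[of "\<lambda>n. picard a f V n t x \<omega>"] by (simp del: picard.simps)
      from tendsto_add[OF this tendsto_const[of "picard a f V 0 t x \<omega>"]]
      show ?thesis unfolding convergent_def by (auto simp del: picard.simps)
    next
      case False
      \<comment> \<open>At negative times the interval of the drift is empty, so all iterates equal
        \<open>V\<close>.\<close>
      then have "picard a f V n t x \<omega> = V t x \<omega>" for n by (cases n) (auto simp: drift_neg)
      then show ?thesis by (simp add: convergent_const)
    qed
    then show ?thesis by (simp add: u_def convergent_LIMSEQ_iff)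
  qed
  have "u t x \<omega> = V t x \<omega> + drift a (\<lambda>s y. f s y (u s y \<omega>)) t x" if w: "\<omega> \<in> space M" for t x \<omega>
  proof -
    have "(\<lambda>n. drift a (\<lambda>s y. f s y (picard a f V n s y \<omega>)) t x) \<longlonglongrightarrow> drift a (\<lambda>s y. f s y (u s y \<omega>)) t x"
    proof (rule drift_tendsto[OF field[OF picard_measurable[OF V] w] field[OF um w]])
      fix s y
      have "(\<lambda>n. L * \<bar>picard a f V n s y \<omega> - u s y \<omega>\<bar>) \<longlonglongrightarrow> L * \<bar>u s y \<omega> - u s y \<omega>\<bar>"
        by (intro tendsto_intros conv w)
      then have z: "(\<lambda>n. L * \<bar>picard a f V n s y \<omega> - u s y \<omega>\<bar>) \<longlonglongrightarrow> 0" by simp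
      show "(\<lambda>n. f s y (picard a f V n s y \<omega>)) \<longlonglongrightarrow> f s y (u s y \<omega>)"
        by (rule LIM_zero_cancel, rule tendsto_rabs_zero_cancel, rule tendsto_sandwich[OF _ _ tendsto_const z])
          (auto intro!: always_eventually f_lip)
    qed
    then have "(\<lambda>n. picard a f V (Suc n) t x \<omega>) \<longlonglongrightarrow> V t x \<omega> + drift a (\<lambda>s y. f s y (u s y \<omega>)) t x"
      by (simp add: tendsto_add)
    moreover have "(\<lambda>n. picard a f V (Suc n) t x \<omega>) \<longlonglongrightarrow> u t x \<omega>" by (rule LIMSEQ_Suc[OF conv[OF w]])
    ultimately show ?thesis using LIMSEQ_unique by blast
  qed
  then show ?thesis using um by blast
qed

theorem mild_equation_unique:
  assumes "prob_space M"
    and u: "(\<lambda>(t, x, \<omega>). u t x \<omega>) \<in> borel_measurable (borel \<Otimes>\<^sub>M borel \<Otimes>\<^sub>M M)"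
    and v: "(\<lambda>(t, x, \<omega>). v t x \<omega>) \<in> borel_measurable (borel \<Otimes>\<^sub>M borel \<Otimes>\<^sub>M M)"
    and eq: "\<And>t x. 0 \<le> t \<Longrightarrow> t \<le> T \<Longrightarrow> AE \<omega> in M. u t x \<omega> - v t x \<omega> =
       drift a (\<lambda>s y. f s y (u s y \<omega>)) t x - drift a (\<lambda>s y. f s y (v s y \<omega>)) t x"
    and t: "0 \<le> t" "t \<le> T"
  shows "AE \<omega> in M. u t x \<omega> = v t x \<omega>"
proof -
  interpret prob_space M by fact
  interpret lM: pair_sigma_finite M "lborel :: real measure" ..
  have T: "0 \<le> T" using t by simp
  define w where "w t x = (\<integral>\<^sup>+\<omega>. ennreal \<bar>u t x \<omega> - v t x \<omega>\<bar> \<partial>M)" for t x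
  define W where "W = 2 * K * T"
  have W: "0 \<le> W" using K_nonneg T by (simp add: W_def)
  have uv: "(\<lambda>p. ennreal \<bar>u (g1 p) (g2 p) (g3 p) - v (g1 p) (g2 p) (g3 p)\<bar>) \<in> borel_measurable P"
    if g[measurable]: "g1 \<in> borel_measurable P" "g2 \<in> borel_measurable P" "g3 \<in> measurable P M" for g1 g2 g3 and P :: "'x measure"
  proof -
    have "(\<lambda>p. (g1 p, g2 p, g3 p)) \<in> measurable P (borel \<Otimes>\<^sub>M borel \<Otimes>\<^sub>M M)" by measurable
    from measurable_compose[OF this u] measurable_compose[OF this v]
    have [measurable]: "(\<lambda>p. u (g1 p) (g2 p) (g3 p)) \<in> borel_measurable P" "(\<lambda>p. v (g1 p) (g2 p) (g3 p)) \<in> borel_measurable P" by simp_all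
    show ?thesis by measurable
  qed
  have wm: "(\<lambda>p. w (g1 p) (g2 p)) \<in> borel_measurable P"
    if [measurable]: "g1 \<in> borel_measurable P" "g2 \<in> borel_measurable P" for g1 g2 and P :: "'x measure"
    unfolding w_def by (rule borel_measurable_nn_integral) (unfold split_beta', rule uv, measurable)
  have bound: "w t x \<le> ennreal (W * (L * t) ^ n / fact n)" if "0 \<le> t" "t \<le> T" for n t x
    using that
  proof (induction n arbitrary: t x)
    case 0
    have "w t x \<le> (\<integral>\<^sup>+\<omega>. ennreal W \<partial>M)"
      unfolding w_def
    proof (rule nn_integral_mono_AE)
      show "AE \<omega> in M. ennreal \<bar>u t x \<omega> - v t x \<omega>\<bar> \<le> ennreal W"
        using eq[OF 0, of x] AE_space
      proof eventually_elim
        case (elim \<omega>)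
        have "K * t \<le> K * T" using 0 K_nonneg by (intro mult_left_mono) auto
        then have "\<bar>u t x \<omega> - v t x \<omega>\<bar> \<le> W"
          using elim(1) drift_bound[OF field[OF u elim(2)] 0(1), of a x] drift_bound[OF field[OF v elim(2)] 0(1), of a x]
          by (simp add: W_def)
        then show ?case by (rule ennreal_leI)
      qed
    qed
    then show ?case by (simp add: emeasure_space_1)
  next
    case (Suc n)
    let ?d = "\<lambda>s y \<omega>. \<bar>u s y \<omega> - v s y \<omega>\<bar>"
    let ?y = "\<lambda>s z. x + heat_sd a (t - s) * z"
    have "w t x \<le> (\<integral>\<^sup>+\<omega>. (\<integral>\<^sup>+s. indicator {0..t} s * (\<integral>\<^sup>+z. ennreal (L * std_normal_density z) * ennreal (?d s (?y s z) \<omega>) \<partial>lborel) \<partial>lborel) \<partial>M)"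
      unfolding w_def
    proof (rule nn_integral_mono_AE)
      show "AE \<omega> in M. ennreal \<bar>u t x \<omega> - v t x \<omega>\<bar> \<le> (\<integral>\<^sup>+s. indicator {0..t} s * (\<integral>\<^sup>+z. ennreal (L * std_normal_density z) * ennreal (?d s (?y s z) \<omega>) \<partial>lborel) \<partial>lborel)"
        using eq[OF Suc.prems, of x] AE_space
      proof eventually_elim
        case (elim \<omega>)
        have "ennreal \<bar>u t x \<omega> - v t x \<omega>\<bar> \<le> (\<integral>\<^sup>+s. indicator {0..t} s * (\<integral>\<^sup>+z. ennreal (std_normal_density z * \<bar>f s (?y s z) (u s (?y s z) \<omega>) - f s (?y s z) (v s (?y s z) \<omega>)\<bar>) \<partial>lborel) \<partial>lborel)"
          unfolding elim(1) by (rule drift_diff_nn[OF field[OF u elim(2)] field[OF v elim(2)]])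
        also have "\<dots> \<le> (\<integral>\<^sup>+s. indicator {0..t} s * (\<integral>\<^sup>+z. ennreal (L * std_normal_density z) * ennreal (?d s (?y s z) \<omega>) \<partial>lborel) \<partial>lborel)"
        proof (intro nn_integral_mono mult_left_mono)
          fix s z
          have "std_normal_density z * \<bar>f s (?y s z) (u s (?y s z) \<omega>) - f s (?y s z) (v s (?y s z) \<omega>)\<bar> \<le> std_normal_density z * (L * ?d s (?y s z) \<omega>)"
            by (intro mult_left_mono f_lip) simp
          also have "\<dots> = (L * std_normal_density z) * ?d s (?y s z) \<omega>" by simp
          finally show "ennreal (std_normal_density z * \<bar>f s (?y s z) (u s (?y s z) \<omega>) - f s (?y s z) (v s (?y s z) \<omega>)\<bar>) \<le> ennreal (L * std_normal_density z) * ennreal (?d s (?y s z) \<omega>)"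
            using L_nonneg by (subst ennreal_mult'[symmetric]) (auto intro!: ennreal_leI)
        qed auto
        finally show ?case .
      qed
    qed
    also have "\<dots> = (\<integral>\<^sup>+s. (\<integral>\<^sup>+\<omega>. indicator {0..t} s * (\<integral>\<^sup>+z. ennreal (L * std_normal_density z) * ennreal (?d s (?y s z) \<omega>) \<partial>lborel) \<partial>M) \<partial>lborel)"
    proof (rule lM.Fubini'[symmetric])
      have "(\<lambda>p. \<integral>\<^sup>+z. ennreal (L * std_normal_density z) * ennreal (?d (snd p) (?y (snd p) z) (fst p)) \<partial>lborel) \<in> borel_measurable (M \<Otimes>\<^sub>M lborel)"
      proof (rule lborel.borel_measurable_nn_integral)
        have d: "(\<lambda>q. ennreal (?d (snd (fst q)) (?y (snd (fst q)) (snd q)) (fst (fst q)))) \<in> borel_measurable ((M \<Otimes>\<^sub>M lborel) \<Otimes>\<^sub>M lborel)"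
          by (rule uv) measurable
        show "(\<lambda>(p, z). ennreal (L * std_normal_density z) * ennreal (?d (snd p) (?y (snd p) z) (fst p))) \<in> borel_measurable ((M \<Otimes>\<^sub>M lborel) \<Otimes>\<^sub>M lborel)"
          unfolding split_beta' by (rule borel_measurable_times_ennreal[OF _ d]) measurable
      qed
      note d2 = this
      show "(\<lambda>(\<omega>, s). indicator {0..t} s * (\<integral>\<^sup>+z. ennreal (L * std_normal_density z) * ennreal (?d s (?y s z) \<omega>) \<partial>lborel)) \<in> borel_measurable (M \<Otimes>\<^sub>M lborel)"
        unfolding split_beta' by (rule borel_measurable_times_ennreal[OF _ d2]) measurable
    qed
    also have "\<dots> = (\<integral>\<^sup>+s. indicator {0..t} s * (\<integral>\<^sup>+z. ennreal (L * std_normal_density z) * w s (?y s z) \<partial>lborel) \<partial>lborel)"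
    proof (intro nn_integral_cong)
      fix s :: real
      have m1: "(\<lambda>(\<omega>, z). ennreal (L * std_normal_density z) * ennreal (?d s (?y s z) \<omega>)) \<in> borel_measurable (M \<Otimes>\<^sub>M lborel)"
        unfolding split_beta' by (intro borel_measurable_times_ennreal uv) measurable
      have m2: "(\<lambda>\<omega>. \<integral>\<^sup>+z. ennreal (L * std_normal_density z) * ennreal (?d s (?y s z) \<omega>) \<partial>lborel) \<in> borel_measurable M"
        using m1 by (rule lborel.borel_measurable_nn_integral)
      have "(\<integral>\<^sup>+\<omega>. indicator {0..t} s * (\<integral>\<^sup>+z. ennreal (L * std_normal_density z) * ennreal (?d s (?y s z) \<omega>) \<partial>lborel) \<partial>M) =
        indicator {0..t} s * (\<integral>\<^sup>+\<omega>. (\<integral>\<^sup>+z. ennreal (L * std_normal_density z) * ennreal (?d s (?y s z) \<omega>) \<partial>lborel) \<partial>M)"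
        using m2 by (rule nn_integral_cmult)
      also have "(\<integral>\<^sup>+\<omega>. (\<integral>\<^sup>+z. ennreal (L * std_normal_density z) * ennreal (?d s (?y s z) \<omega>) \<partial>lborel) \<partial>M) =
        (\<integral>\<^sup>+z. (\<integral>\<^sup>+\<omega>. ennreal (L * std_normal_density z) * ennreal (?d s (?y s z) \<omega>) \<partial>M) \<partial>lborel)"
        by (rule lM.Fubini'[symmetric, OF m1])
      also have "\<dots> = (\<integral>\<^sup>+z. ennreal (L * std_normal_density z) * w s (?y s z) \<partial>lborel)"
        unfolding w_def by (intro nn_integral_cong nn_integral_cmult uv) measurable
      finally show "(\<integral>\<^sup>+\<omega>. indicator {0..t} s * (\<integral>\<^sup>+z. ennreal (L * std_normal_density z) * ennreal (?d s (?y s z) \<omega>) \<partial>lborel) \<partial>M) =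
        indicator {0..t} s * (\<integral>\<^sup>+z. ennreal (L * std_normal_density z) * w s (?y s z) \<partial>lborel)" .
    qed
    also have "\<dots> \<le> (\<integral>\<^sup>+s. indicator {0..t} s * ennreal ((L * (W * L ^ n / fact n)) * s ^ n) \<partial>lborel)"
    proof (intro nn_integral_mono)
      fix s :: real
      show "indicator {0..t} s * (\<integral>\<^sup>+z. ennreal (L * std_normal_density z) * w s (?y s z) \<partial>lborel) \<le> indicator {0..t} s * ennreal ((L * (W * L ^ n / fact n)) * s ^ n)"
      proof (cases "s \<in> {0..t}")
        case True
        then have s: "0 \<le> s" "s \<le> T" using Suc.prems by auto
        define b where "b = W * (L * s) ^ n / fact n"
        have b: "0 \<le> b" using W L_nonneg s by (simp add: b_def)
        have "(\<integral>\<^sup>+z. ennreal (L * std_normal_density z) * w s (?y s z) \<partial>lborel) \<le> (\<integral>\<^sup>+z. ennreal (L * std_normal_density z) * ennreal b \<partial>lborel)"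
          unfolding b_def by (intro nn_integral_mono mult_left_mono Suc.IH s) auto
        also have "\<dots> = (\<integral>\<^sup>+z. ennreal (L * b * std_normal_density z) \<partial>lborel)"
          using L_nonneg b by (intro nn_integral_cong) (simp add: ennreal_mult'[symmetric] mult_ac)
        also have "\<dots> = ennreal (LINT z|lborel. L * b * std_normal_density z)"
          using L_nonneg b integrable_std by (intro nn_integral_eq_integral) auto
        also have "\<dots> = ennreal (L * b)" by (simp add: integral_std)
        finally show ?thesis using True by (simp add: b_def power_mult_distrib mult_ac)
      qed simp
    qed
    also have "\<dots> = ennreal ((L * (W * L ^ n / fact n)) * t ^ Suc n / Suc n)"
      using Suc.prems W L_nonneg by (intro nn_integral_power_Icc) auto
    also have "(L * (W * L ^ n / fact n)) * t ^ Suc n / Suc n = W * (L * t) ^ Suc n / fact (Suc n)"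
      unfolding fact_Suc of_nat_mult by (simp add: power_mult_distrib field_simps del: of_nat_Suc)
    finally show ?case .
  qed
  have "w t x \<le> 0"
  proof (rule LIMSEQ_le_const)
    have "(\<lambda>n. W * (inverse (fact n) * (L * t) ^ n)) \<longlonglongrightarrow> W * 0"
      by (intro tendsto_mult tendsto_const summable_LIMSEQ_zero summable_exp)
    then have "(\<lambda>n. W * (L * t) ^ n / fact n) \<longlonglongrightarrow> 0" by (simp add: field_simps)
    then show "(\<lambda>n. ennreal (W * (L * t) ^ n / fact n)) \<longlonglongrightarrow> 0"
      by (simp add: tendsto_ennrealI[of _ 0, simplified])
    show "\<exists>N. \<forall>n\<ge>N. w t x \<le> ennreal (W * (L * t) ^ n / fact n)" using bound[OF t] by blast
  qed
  then have "w t x = 0" by simp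
  moreover have "(\<lambda>\<omega>. ennreal \<bar>u t x \<omega> - v t x \<omega>\<bar>) \<in> borel_measurable M" by (rule uv) measurable
  ultimately have "AE \<omega> in M. ennreal \<bar>u t x \<omega> - v t x \<omega>\<bar> = 0"
    unfolding w_def by (subst (asm) nn_integral_0_iff_AE) auto
  then show ?thesis by eventually_elim simp
qed

end

section \<open>Riemann--Stieltjes sums on dyadic grids\<close>

definition clamp_to :: "real \<Rightarrow> real \<Rightarrow> real \<Rightarrow> real" where
  "clamp_to t1 t2 s = max t1 (min s t2)"

text \<open>Grid points outside \<open>[t1, t2]\<close> are moved to its ends, where the increments
  of \<open>F\<close> vanish, while \<open>q\<close> is still evaluated at the original grid point.
  Sums over adjacent intervals therefore add up exactly, and only cells cut by \<open>t1\<close> or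
  \<open>t2\<close> need special care.\<close>

definition interval_sum :: "real \<Rightarrow> (real \<Rightarrow> real) \<Rightarrow> (real \<Rightarrow> real) \<Rightarrow> real \<Rightarrow> real \<Rightarrow> nat \<Rightarrow> real" where
  "interval_sum H F q t1 t2 n = (\<Sum>k<2^n. q (dyadic H n k) *
     (F (clamp_to t1 t2 (dyadic H n (Suc k))) - F (clamp_to t1 t2 (dyadic H n k))))"

lemma dyadic_sum_eq_interval_sum:
  "0 < H \<Longrightarrow> 0 \<le> t \<Longrightarrow> dyadic_sum H F q t n = interval_sum H F q 0 t n"
  unfolding dyadic_sum_def interval_sum_def clamp_to_def by (intro sum.cong) (auto simp: max_def)

lemma interval_sum_diff:
  "interval_sum H F (\<lambda>s. q1 s - q2 s) t1 t2 n = interval_sum H F q1 t1 t2 n - interval_sum H F q2 t1 t2 n"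
  by (simp add: interval_sum_def left_diff_distrib sum_subtractf)

lemma interval_sum_split:
  assumes "t0 \<le> t1" "t1 \<le> t2"
  shows "interval_sum H F q t0 t2 n = interval_sum H F q t0 t1 n + interval_sum H F q t1 t2 n"
proof -
  have e: "F (clamp_to t0 t2 s) = F (clamp_to t0 t1 s) + F (clamp_to t1 t2 s) - F t1" for s
    using assms by (auto simp: clamp_to_def max_def min_def)
  show ?thesis
    unfolding interval_sum_def sum.distrib[symmetric] e by (intro sum.cong refl) (simp add: algebra_simps)
qed

lemma sum_even_odd: "(\<Sum>j<2 * m. f j) = (\<Sum>k<m. f (2 * k) + f (Suc (2 * k)) :: real)" for m :: nat
  by (induction m) auto

text \<open>Halving a cell changes the value of \<open>q\<close> only on its right half, from that
  at the left end to that at the midpoint.\<close>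

lemma interval_sum_step:
  "interval_sum H F q t1 t2 (Suc n) - interval_sum H F q t1 t2 n =
    (\<Sum>k<2^n. (q (dyadic H (Suc n) (Suc (2 * k))) - q (dyadic H (Suc n) (2 * k))) *
      (F (clamp_to t1 t2 (dyadic H (Suc n) (Suc (Suc (2 * k))))) - F (clamp_to t1 t2 (dyadic H (Suc n) (Suc (2 * k))))))"
proof -
  let ?F = "\<lambda>j. F (clamp_to t1 t2 (dyadic H (Suc n) j))"
  let ?q = "\<lambda>j. q (dyadic H (Suc n) j)"
  have "interval_sum H F q t1 t2 (Suc n) = (\<Sum>k<2^n. ?q (2 * k) * (?F (Suc (2 * k)) - ?F (2 * k)) + ?q (Suc (2 * k)) * (?F (Suc (Suc (2 * k))) - ?F (Suc (2 * k))))"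
    unfolding interval_sum_def power_Suc sum_even_odd ..
  moreover have "interval_sum H F q t1 t2 n = (\<Sum>k<2^n. ?q (2 * k) * (?F (Suc (Suc (2 * k))) - ?F (2 * k)))"
  proof -
    have "dyadic H n (Suc k) = dyadic H (Suc n) (Suc (Suc (2 * k)))" "dyadic H n k = dyadic H (Suc n) (2 * k)" for k
      by (simp_all add: dyadic_def field_simps)
    then show ?thesis unfolding interval_sum_def by simp
  qed
  ultimately have "interval_sum H F q t1 t2 (Suc n) - interval_sum H F q t1 t2 n =
      (\<Sum>k<2^n. (?q (2 * k) * (?F (Suc (2 * k)) - ?F (2 * k)) + ?q (Suc (2 * k)) * (?F (Suc (Suc (2 * k))) - ?F (Suc (2 * k))))
        - ?q (2 * k) * (?F (Suc (Suc (2 * k))) - ?F (2 * k)))"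
    by (simp only: sum_subtractf)
  also have "\<dots> = (\<Sum>k<2^n. (?q (Suc (2 * k)) - ?q (2 * k)) * (?F (Suc (Suc (2 * k))) - ?F (Suc (2 * k))))"
  proof -
    have alg: "(A * (Y - X) + C * (Z - Y)) - A * (Z - X) = (C - A) * (Z - Y)" for A C X Y Z :: real
      by (simp add: algebra_simps)
    show ?thesis by (rule sum.cong[OF refl alg])
  qed
  finally show ?thesis .
qed

text \<open>Each dyadic block of the harmonic sum is at most 1.\<close>

lemma harmonic_dyadic: "(\<Sum>j<2^n. 1 / real (Suc j)) \<le> real n + 1"
proof (induction n)
  case (Suc n)
  have e: "{..<2^Suc n} = {..<2^n} \<union> {2^n..<2^Suc n::nat}" by auto
  have "(\<Sum>j<2^Suc n. 1 / real (Suc j)) = (\<Sum>j<2^n. 1 / real (Suc j)) + (\<Sum>j\<in>{2^n..<2^Suc n}. 1 / real (Suc j))"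
    unfolding e by (rule sum.union_disjoint) auto
  also have "(\<Sum>j\<in>{2^n..<2^Suc n}. 1 / real (Suc j)) \<le> (\<Sum>j\<in>{2^n..<2^Suc n::nat}. 1 / 2^n)"
  proof (rule sum_mono)
    fix j :: nat assume "j \<in> {2^n..<2^Suc n}"
    then have "2^n \<le> Suc j" by auto
    then have "real (2^n) \<le> real (Suc j)" by (rule of_nat_mono)
    then show "1 / real (Suc j) \<le> 1 / 2^n" by (intro divide_left_mono) auto
  qed
  also have "\<dots> = 1" by simp
  finally show ?case using Suc by simp
qed simp

text \<open>Counted back from the last cell, the \<open>j\<close>-th midpoint has distance at least
  \<open>j * h\<close> from \<open>t\<close>. Writing \<open>j powr (-\<beta>)\<close> as
  \<open>j powr (1 - \<beta>) / j\<close> reduces the sum to a harmonic one; the factor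
  \<open>n + 1\<close> is the price for treating \<open>\<beta> = 1\<close> along with
  \<open>\<beta> < 1\<close>.\<close>

lemma grid_weight_sum:
  assumes A: "A \<subseteq> {..<2^n}" and h: "0 < h" and t: "\<And>k. k \<in> A \<Longrightarrow> (2 * real k + 2) * h \<le> t" and \<beta>: "0 < \<beta>" "\<beta> \<le> 1"
  shows "(\<Sum>k\<in>A. (t - (2 * real k + 1) * h) powr (-\<beta>)) \<le> h powr (-\<beta>) * (2^n) powr (1 - \<beta>) * (real n + 1)"
proof (cases "A = {}")
  case True
  then show ?thesis by simp
next
  case False
  have fin: "finite A" using A finite_subset by blast
  define m where "m = Max A"
  have m: "m \<in> A" "\<And>k. k \<in> A \<Longrightarrow> k \<le> m" using False fin by (auto simp: m_def)
  have m2: "m < 2^n" using m A by auto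
  let ?c = "h powr (-\<beta>) * (2^n) powr (1 - \<beta>)"
  have "(\<Sum>k\<in>A. (t - (2 * real k + 1) * h) powr (-\<beta>)) \<le> (\<Sum>k\<in>A. ?c * (1 / real (Suc (m - k))))"
  proof (rule sum_mono)
    fix k assume k: "k \<in> A"
    define j where "j = real (Suc (m - k))"
    have j: "1 \<le> j" "j \<le> 2^n" using m2 by (auto simp: j_def) (metis Suc_leI le_less_trans diff_le_self of_nat_le_iff of_nat_power of_nat_numeral of_nat_Suc)
    have jm: "j = real m - real k + 1" using m(2)[OF k] by (simp add: j_def of_nat_diff)
    have "j * h \<le> (2 * (real m - real k) + 1) * h" using h m(2)[OF k] by (intro mult_right_mono) (auto simp: jm)
    also have "\<dots> = (2 * real m + 2) * h - (2 * real k + 1) * h" by (simp add: algebra_simps)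
    also have "\<dots> \<le> t - (2 * real k + 1) * h" using t[OF m(1)] by simp
    finally have "(t - (2 * real k + 1) * h) powr (-\<beta>) \<le> (j * h) powr (-\<beta>)"
      using h j \<beta> by (intro powr_mono2') auto
    also have "\<dots> = h powr (-\<beta>) * j powr (-\<beta>)" using h j by (simp add: powr_mult mult.commute)
    also have "j powr (-\<beta>) = j powr (1 - \<beta>) * (1 / j)" using j by (simp add: powr_diff powr_minus field_simps)
    also have "h powr (-\<beta>) * (j powr (1 - \<beta>) * (1 / j)) \<le> h powr (-\<beta>) * ((2^n) powr (1 - \<beta>) * (1 / j))"
      using j \<beta> by (intro mult_left_mono mult_right_mono powr_mono2) auto
    finally show "(t - (2 * real k + 1) * h) powr (-\<beta>) \<le> ?c * (1 / real (Suc (m - k)))" by (simp add: j_def mult.assoc)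
  qed
  also have "\<dots> = ?c * (\<Sum>k\<in>A. 1 / real (Suc (m - k)))" by (simp only: sum_distrib_left)
  also have "\<dots> \<le> ?c * (\<Sum>k\<in>{..m}. 1 / real (Suc (m - k)))"
    using m by (intro mult_left_mono sum_mono2) auto
  also have "(\<Sum>k\<in>{..m}. 1 / real (Suc (m - k))) = (\<Sum>j\<in>{..m}. 1 / real (Suc j))"
    by (rule sum.reindex_bij_witness[of _ "\<lambda>j. m - j" "\<lambda>j. m - j"]) auto
  also have "?c * (\<Sum>j\<in>{..m}. 1 / real (Suc j)) \<le> ?c * (\<Sum>j<2^n. 1 / real (Suc j))"
    using m2 by (intro mult_left_mono sum_mono2) auto
  also have "\<dots> \<le> ?c * (real n + 1)" by (intro mult_left_mono harmonic_dyadic) auto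
  finally show ?thesis .
qed

text \<open>The bound for the full cells in \<open>interval_sum_increments\<close>, summed over all
  levels, without the factors \<open>W\<close> and \<open>R\<close>.\<close>

definition level_const :: "real \<Rightarrow> real \<Rightarrow> real \<Rightarrow> real" where
  "level_const H \<alpha> \<beta> = H powr (\<alpha> - \<beta>/2) * 2 powr ((\<alpha> - 1/2)/2) *
     (\<Sum>n. (real n + 1) * (2 powr (-(\<alpha> - 1/2)/2)) ^ n)"

lemma summable_linear_geometric:
  assumes "0 \<le> r" "r < (1::real)"
  shows "summable (\<lambda>n. (real n + 1) * r ^ n)"
proof -
  have "summable (\<lambda>n. diffs (\<lambda>_. 1) n * r ^ n)"
  proof (rule termdiff_converges[of r 1])
    show "summable (\<lambda>n. 1 * x ^ n)" if "norm x < 1" for x :: real using that by (simp add: summable_geometric)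
  qed (use assms in simp)
  then show ?thesis by (simp add: diffs_def add.commute)
qed

text \<open>Cells inside \<open>[t1, t2]\<close> are treated by Cauchy--Schwarz: the increments of
  \<open>q\<close> have a square sum of order
  \<open>(n + 1) * 2 powr (-n * (2 * \<alpha> - 1))\<close>, those of \<open>F\<close> one of order
  \<open>2 powr (n * (\<alpha> - 1/2))\<close>. The root of the product decays at the rate
  \<open>2 powr (-n * (\<alpha> - 1/2) / 2)\<close>, up to a factor of at most \<open>n + 1\<close>.
  The cells cut by the end points contribute \<open>2 * P\<close>.\<close>

lemma interval_sum_increments:
  fixes H t1 t2 \<alpha> \<beta> W R P :: real
  assumes H: "0 < H" and t: "0 \<le> t1" "t1 \<le> t2" "t2 \<le> H"
    and \<beta>: "0 < \<beta>" "\<beta> \<le> 1" and \<alpha>: "1/2 < \<alpha>" and W: "0 \<le> W" and R: "0 \<le> R" and P: "0 \<le> P"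
    and Q: "(\<Sum>k<2^Suc n. (F (dyadic H (Suc n) (Suc k)) - F (dyadic H (Suc n) k))\<^sup>2) \<le> (R * (2 powr ((\<alpha> - 1/2)/2)) ^ Suc n)\<^sup>2"
  defines "h \<equiv> H / 2^Suc n"
  assumes full: "\<And>p. t1 \<le> p \<Longrightarrow> h \<le> p \<Longrightarrow> p + h \<le> t2 \<Longrightarrow> \<bar>q p - q (p - h)\<bar> \<le> W * h powr \<alpha> * (t2 - p) powr (-(\<beta>/2))"
    and part: "\<And>p. h \<le> p \<Longrightarrow> p < t2 \<Longrightarrow> t1 < p + h \<Longrightarrow> p + h \<le> H \<Longrightarrow> p < t1 \<or> t2 < p + h \<Longrightarrow>
      \<bar>q p - q (p - h)\<bar> * \<bar>F (clamp_to t1 t2 (p + h)) - F (clamp_to t1 t2 p)\<bar> \<le> P"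
  shows "\<bar>interval_sum H F q t1 t2 (Suc n) - interval_sum H F q t1 t2 n\<bar> \<le>
    W * R * (H powr (\<alpha> - \<beta>/2) * 2 powr ((\<alpha> - 1/2)/2) * ((real n + 1) * (2 powr (-(\<alpha> - 1/2)/2)) ^ n)) + 2 * P"
proof -
  \<comment> \<open>The midpoint of the \<open>k\<close>-th coarse cell, which has the ends
    \<open>p k - h\<close> and \<open>p k + h\<close>.\<close>
  define p where "p k = dyadic H (Suc n) (Suc (2 * k))" for k
  have h: "h > 0" using H by (simp add: h_def)
  have p_eq: "p k = (2 * real k + 1) * h" for k by (simp add: p_def dyadic_def h_def field_simps)
  have p1: "dyadic H (Suc n) (2 * k) = p k - h" for k by (simp add: p_def dyadic_def h_def field_simps)
  have p2: "dyadic H (Suc n) (Suc (Suc (2 * k))) = p k + h" for k by (simp add: p_def dyadic_def h_def field_simps)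
  have p3: "h \<le> p k" for k using h by (simp add: p_eq)
  have p4: "p k + h \<le> H" if "k < 2^n" for k
    using dyadic_le[OF H, of "Suc (Suc (2 * k))" "Suc n"] that by (simp add: p2)
  define dq where "dq k = q (p k) - q (p k - h)" for k
  define dF where "dF k = F (clamp_to t1 t2 (p k + h)) - F (clamp_to t1 t2 (p k))" for k
  \<comment> \<open>Only the right half of a cell has to lie in \<open>[t1, t2]\<close>, because the
    left half does not enter the difference of consecutive sums.\<close>
  define Full where "Full = {k. k < 2^n \<and> t1 \<le> p k \<and> p k + h \<le> t2}"
  define Part where "Part = {k. k < 2^n \<and> p k < t2 \<and> t1 < p k + h \<and> (p k < t1 \<or> t2 < p k + h)}"
  have finF: "finite Full" unfolding Full_def by (rule finite_subset[of _ "{..<2^n}"]) auto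
  have finP: "finite Part" unfolding Part_def by (rule finite_subset[of _ "{..<2^n}"]) auto
  have "interval_sum H F q t1 t2 (Suc n) - interval_sum H F q t1 t2 n = (\<Sum>k<2^n. dq k * dF k)"
    unfolding interval_sum_step dq_def dF_def p1 p2 p_def[symmetric] ..
  also have "\<dots> = (\<Sum>k\<in>Full \<union> Part. dq k * dF k)"
  proof (rule sum.mono_neutral_right)
    show "\<forall>k\<in>{..<2^n} - (Full \<union> Part). dq k * dF k = 0"
    proof
      fix k assume k: "k \<in> {..<2^n} - (Full \<union> Part)"
      then have "p k \<ge> t2 \<or> p k + h \<le> t1" by (auto simp: Full_def Part_def)
      then have "clamp_to t1 t2 (p k + h) = clamp_to t1 t2 (p k)" using h t by (auto simp: clamp_to_def)
      then show "dq k * dF k = 0" by (simp add: dF_def)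
    qed
  qed (auto simp: Full_def Part_def)
  also have "\<dots> = (\<Sum>k\<in>Full. dq k * dF k) + (\<Sum>k\<in>Part. dq k * dF k)"
    using finF finP by (intro sum.union_disjoint) (auto simp: Full_def Part_def)
  finally have eq: "interval_sum H F q t1 t2 (Suc n) - interval_sum H F q t1 t2 n = (\<Sum>k\<in>Full. dq k * dF k) + (\<Sum>k\<in>Part. dq k * dF k)" .
  \<comment> \<open>A cut cell has \<open>t1\<close> or \<open>t2\<close> strictly inside its right
    half, and the right halves of different cells are disjoint.\<close>
  have cardP: "card Part \<le> 2"
  proof -
    let ?A = "{k. p k < t1 \<and> t1 < p k + h}" and ?B = "{k. p k < t2 \<and> t2 < p k + h}"
    have un: "k = l" if "p k < r" "r < p k + h" "p l < r" "r < p l + h" for k l r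
    proof -
      have "\<bar>p k - p l\<bar> < h" using that by auto
      moreover have "p k - p l = (real k - real l) * (2 * h)" by (simp add: p_eq algebra_simps)
      ultimately have "\<bar>real k - real l\<bar> * (2 * h) < 1 * (2 * h)" using h by (simp add: abs_mult)
      then have "\<bar>real k - real l\<bar> < 1" using h by (simp only: mult_less_cancel_right_pos)
      then show ?thesis by linarith
    qed
    have c1: "finite S \<and> card S \<le> 1" if S: "\<And>k l. k \<in> S \<Longrightarrow> l \<in> S \<Longrightarrow> k = l" for S :: "nat set"
    proof (cases "S = {}")
      case False
      then obtain k where "k \<in> S" by auto
      then have "S = {k}" using S by auto
      then show ?thesis by simp
    qed simp
    have A: "finite ?A \<and> card ?A \<le> 1" by (rule c1) (use un in blast)
    have B: "finite ?B \<and> card ?B \<le> 1" by (rule c1) (use un in blast)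
    have "Part \<subseteq> ?A \<union> ?B" by (auto simp: Part_def)
    then have "card Part \<le> card (?A \<union> ?B)" using A B by (intro card_mono) auto
    also have "\<dots> \<le> card ?A + card ?B" by (rule card_Un_le)
    finally show ?thesis using A B by linarith
  qed
  have "\<bar>\<Sum>k\<in>Part. dq k * dF k\<bar> \<le> (\<Sum>k\<in>Part. \<bar>dq k * dF k\<bar>)" by (rule sum_abs)
  also have "\<dots> \<le> (\<Sum>k\<in>Part. P)"
    unfolding abs_mult dq_def dF_def using p3 p4 by (intro sum_mono part) (auto simp: Part_def)
  also have "\<dots> \<le> 2 * P" using cardP P by (simp add: mult_right_mono)
  finally have PB: "\<bar>\<Sum>k\<in>Part. dq k * dF k\<bar> \<le> 2 * P" .
  \<comment> \<open>Clamping leaves full cells unchanged, and their right halves are cells of odd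
    index in the finer grid, so these squares are part of the sum bounded in
    \<open>Q\<close>.\<close>
  have SF: "(\<Sum>k\<in>Full. (dF k)\<^sup>2) \<le> (R * (2 powr ((\<alpha> - 1/2)/2)) ^ Suc n)\<^sup>2"
  proof -
    let ?g = "\<lambda>j. (F (dyadic H (Suc n) (Suc j)) - F (dyadic H (Suc n) j))\<^sup>2"
    have "(\<Sum>k\<in>Full. (dF k)\<^sup>2) = (\<Sum>k\<in>Full. ?g (Suc (2 * k)))"
    proof (rule sum.cong[OF refl])
      fix k assume "k \<in> Full"
      then have "clamp_to t1 t2 (p k + h) = p k + h" "clamp_to t1 t2 (p k) = p k"
        using h by (auto simp: Full_def clamp_to_def)
      then show "(dF k)\<^sup>2 = ?g (Suc (2 * k))" by (simp add: dF_def p2 p_def)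
    qed
    also have "\<dots> = (\<Sum>j\<in>(\<lambda>k. Suc (2 * k)) ` Full. ?g j)" by (subst sum.reindex) (auto simp: inj_on_def)
    also have "\<dots> \<le> (\<Sum>j<2^Suc n. ?g j)"
      by (rule sum_mono2) (auto simp: Full_def)
    finally show ?thesis using Q by linarith
  qed
  let ?\<rho> = "2 powr ((\<alpha> - 1/2)/2)"
  define Z where "Z = h powr (-\<beta>) * (2^n) powr (1 - \<beta>) * (real n + 1)"
  have Z0: "0 \<le> Z" by (simp add: Z_def)
  have SQ: "(\<Sum>k\<in>Full. (dq k)\<^sup>2) \<le> (W * h powr \<alpha>)\<^sup>2 * Z"
  proof -
    have "(\<Sum>k\<in>Full. (dq k)\<^sup>2) \<le> (\<Sum>k\<in>Full. (W * h powr \<alpha>)\<^sup>2 * (t2 - (2 * real k + 1) * h) powr (-\<beta>))"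
    proof (rule sum_mono)
      fix k assume k: "k \<in> Full"
      have "\<bar>dq k\<bar> \<le> W * h powr \<alpha> * (t2 - p k) powr (-(\<beta>/2))"
        unfolding dq_def using k p3 by (intro full) (auto simp: Full_def)
      then have "(dq k)\<^sup>2 \<le> (W * h powr \<alpha> * (t2 - p k) powr (-(\<beta>/2)))\<^sup>2"
        using abs_le_square_iff[of "dq k" "W * h powr \<alpha> * (t2 - p k) powr (-(\<beta>/2))"] W by (simp add: abs_mult)
      also have "\<dots> = (W * h powr \<alpha>)\<^sup>2 * (t2 - p k) powr (-\<beta>)"
        by (simp add: power_mult_distrib power2_eq_square powr_add[symmetric])
      finally show "(dq k)\<^sup>2 \<le> (W * h powr \<alpha>)\<^sup>2 * (t2 - (2 * real k + 1) * h) powr (-\<beta>)" by (simp add: p_eq)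
    qed
    also have "\<dots> = (W * h powr \<alpha>)\<^sup>2 * (\<Sum>k\<in>Full. (t2 - (2 * real k + 1) * h) powr (-\<beta>))" by (simp only: sum_distrib_left)
    also have "\<dots> \<le> (W * h powr \<alpha>)\<^sup>2 * Z"
      unfolding Z_def
    proof (intro mult_left_mono grid_weight_sum)
      fix k assume "k \<in> Full"
      then have "p k + h \<le> t2" by (simp add: Full_def)
      then show "(2 * real k + 2) * h \<le> t2" by (simp add: p_eq algebra_simps)
    qed (use h \<beta> in \<open>auto simp: Full_def\<close>)
    finally show ?thesis .
  qed
  have "\<bar>\<Sum>k\<in>Full. dq k * dF k\<bar> \<le> (W * h powr \<alpha>) * sqrt Z * (R * ?\<rho> ^ Suc n)"
  proof -
    have "(\<Sum>k\<in>Full. dq k * dF k)\<^sup>2 \<le> (\<Sum>k\<in>Full. (dq k)\<^sup>2) * (\<Sum>k\<in>Full. (dF k)\<^sup>2)"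
      by (rule Cauchy_Schwarz_ineq_sum)
    also have "\<dots> \<le> ((W * h powr \<alpha>)\<^sup>2 * Z) * (R * ?\<rho> ^ Suc n)\<^sup>2"
      using SQ SF Z0 by (intro mult_mono) (auto intro: sum_nonneg)
    also have "\<dots> = ((W * h powr \<alpha>) * sqrt Z * (R * ?\<rho> ^ Suc n))\<^sup>2" using Z0 by (simp add: power_mult_distrib)
    finally have "\<bar>\<Sum>k\<in>Full. dq k * dF k\<bar> \<le> \<bar>(W * h powr \<alpha>) * sqrt Z * (R * ?\<rho> ^ Suc n)\<bar>"
      by (simp only: abs_le_square_iff)
    also have "\<dots> = (W * h powr \<alpha>) * sqrt Z * (R * ?\<rho> ^ Suc n)"
      using W R Z0 by (intro abs_of_nonneg mult_nonneg_nonneg) auto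
    finally show ?thesis .
  qed
  also have "\<dots> = W * R * ((h powr \<alpha> * sqrt Z) * ?\<rho> ^ Suc n)" by (simp only: mult_ac)
  also have "\<dots> \<le> W * R * (H powr (\<alpha> - \<beta>/2) * ?\<rho> * ((real n + 1) * (2 powr (-(\<alpha> - 1/2)/2)) ^ n))"
  proof (intro mult_left_mono)
    have sq: "sqrt Z = h powr (-(\<beta>/2)) * (2^n) powr ((1 - \<beta>)/2) * sqrt (real n + 1)"
    proof -
      have "sqrt (x powr y) = x powr (y / 2)" if "0 \<le> x" for x y :: real
        using that by (simp add: powr_half_sqrt[symmetric] powr_powr)
      then show ?thesis using h unfolding Z_def by (simp add: real_sqrt_mult)
    qed
    have "sqrt (real n + 1) \<le> real n + 1" by (rule real_le_lsqrt) (auto simp: power2_eq_square algebra_simps)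
    then have "h powr \<alpha> * sqrt Z \<le> h powr \<alpha> * (h powr (-(\<beta>/2)) * (2^n) powr ((1 - \<beta>)/2) * (real n + 1))"
      unfolding sq by (intro mult_left_mono) auto
    also have "\<dots> = h powr (\<alpha> - \<beta>/2) * (2^n) powr ((1 - \<beta>)/2) * (real n + 1)"
    proof -
      have e: "h powr (\<alpha> - \<beta>/2) = h powr \<alpha> * h powr (-(\<beta>/2))" by (simp add: powr_add[symmetric])
      show ?thesis unfolding e by (simp only: mult.assoc)
    qed
    also have "\<dots> \<le> (H powr (\<alpha> - \<beta>/2) * (2^n) powr (-(\<alpha> - \<beta>/2))) * (2^n) powr ((1 - \<beta>)/2) * (real n + 1)"
    proof (intro mult_right_mono)
      have "h powr (\<alpha> - \<beta>/2) \<le> (H / 2^n) powr (\<alpha> - \<beta>/2)"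
        using H \<alpha> \<beta> unfolding h_def by (intro powr_mono2 divide_left_mono) auto
      also have "(H / 2^n) powr (\<alpha> - \<beta>/2) = H powr (\<alpha> - \<beta>/2) * (2^n) powr (-(\<alpha> - \<beta>/2))"
        unfolding powr_minus_divide using H by (subst powr_divide) auto
      finally show "h powr (\<alpha> - \<beta>/2) \<le> H powr (\<alpha> - \<beta>/2) * (2^n) powr (-(\<alpha> - \<beta>/2))" .
    qed auto
    also have "\<dots> = H powr (\<alpha> - \<beta>/2) * ((2^n) powr (-(\<alpha> - 1/2)) * (real n + 1))"
    proof -
      have "((2::real)^n) powr (-(\<alpha> - \<beta>/2)) * (2^n) powr ((1 - \<beta>)/2) = (2^n) powr (-(\<alpha> - \<beta>/2) + (1 - \<beta>)/2)"
        by (rule powr_add[symmetric])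
      also have "-(\<alpha> - \<beta>/2) + (1 - \<beta>)/2 = -(\<alpha> - 1/2)" by (simp add: field_simps)
      finally have "((2::real)^n) powr (-(\<alpha> - \<beta>/2)) * (2^n) powr ((1 - \<beta>)/2) = (2^n) powr (-(\<alpha> - 1/2))" .
      then show ?thesis by (simp only: mult.assoc)
    qed
    finally have b: "h powr \<alpha> * sqrt Z \<le> H powr (\<alpha> - \<beta>/2) * ((2^n) powr (-(\<alpha> - 1/2)) * (real n + 1))" .
    have r: "((2::real)^n) powr (-(\<alpha> - 1/2)) * ?\<rho> ^ Suc n = ?\<rho> * (2 powr (-(\<alpha> - 1/2)/2)) ^ n"
    proof -
      have 1: "((2::real)^n) powr (-(\<alpha> - 1/2)) = (2 powr (-(\<alpha> - 1/2)/2)) ^ n * (2 powr (-(\<alpha> - 1/2)/2)) ^ n"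
        by (simp add: powr_realpow[symmetric] powr_powr powr_add[symmetric] mult.commute)
      have 2: "(2 powr (-(\<alpha> - 1/2)/2)) ^ n * ?\<rho> ^ n = 1"
      proof -
        have e: "-(\<alpha> - 1/2)/2 + (\<alpha> - 1/2)/2 = 0" by (simp add: field_simps)
        show ?thesis unfolding power_mult_distrib[symmetric] powr_add[symmetric] e by simp
      qed
      have "((2::real)^n) powr (-(\<alpha> - 1/2)) * ?\<rho> ^ Suc n = ?\<rho> * (2 powr (-(\<alpha> - 1/2)/2)) ^ n * ((2 powr (-(\<alpha> - 1/2)/2)) ^ n * ?\<rho> ^ n)"
        unfolding 1 power_Suc by (simp only: mult_ac)
      then show ?thesis unfolding 2 by simp
    qed
    have "(h powr \<alpha> * sqrt Z) * ?\<rho> ^ Suc n \<le> (H powr (\<alpha> - \<beta>/2) * ((2^n) powr (-(\<alpha> - 1/2)) * (real n + 1))) * ?\<rho> ^ Suc n"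
      using b by (intro mult_right_mono) auto
    also have "\<dots> = H powr (\<alpha> - \<beta>/2) * (real n + 1) * ((2^n) powr (-(\<alpha> - 1/2)) * ?\<rho> ^ Suc n)" by (simp only: mult_ac)
    also have "\<dots> = H powr (\<alpha> - \<beta>/2) * ?\<rho> * ((real n + 1) * (2 powr (-(\<alpha> - 1/2)/2)) ^ n)" unfolding r by (simp only: mult_ac)
    finally show "(h powr \<alpha> * sqrt Z) * ?\<rho> ^ Suc n \<le> H powr (\<alpha> - \<beta>/2) * ?\<rho> * ((real n + 1) * (2 powr (-(\<alpha> - 1/2)/2)) ^ n)" .
  qed (use W R in auto)
  finally show ?thesis unfolding eq using PB by linarith
qed

text \<open>The level bounds are summable. The sum at level 0 has the single cell
  \<open>[0, H]\<close>, which accounts for the term \<open>q 0 * (F t2 - F t1)\<close>.\<close>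

lemma interval_sum_convergent:
  fixes H t1 t2 \<alpha> \<beta> W R V \<theta> :: real
  assumes H: "0 < H" and t: "0 \<le> t1" "t1 \<le> t2" "t2 \<le> H"
    and \<beta>: "0 < \<beta>" "\<beta> \<le> 1" and \<alpha>: "1/2 < \<alpha>" and W: "0 \<le> W" and R: "0 \<le> R" and V: "0 \<le> V" and \<theta>: "0 \<le> \<theta>" "\<theta> < 1"
    and Q: "\<And>n. (\<Sum>k<2^n. (F (dyadic H n (Suc k)) - F (dyadic H n k))\<^sup>2) \<le> (R * (2 powr ((\<alpha> - 1/2)/2)) ^ n)\<^sup>2"
    and full: "\<And>h p. 0 < h \<Longrightarrow> h \<le> H \<Longrightarrow> t1 \<le> p \<Longrightarrow> h \<le> p \<Longrightarrow> p + h \<le> t2 \<Longrightarrow>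
      \<bar>q p - q (p - h)\<bar> \<le> W * h powr \<alpha> * (t2 - p) powr (-(\<beta>/2))"
    and part: "\<And>n h p. h = H / 2^Suc n \<Longrightarrow> h \<le> p \<Longrightarrow> p < t2 \<Longrightarrow> t1 < p + h \<Longrightarrow> p + h \<le> H \<Longrightarrow> p < t1 \<or> t2 < p + h \<Longrightarrow>
      \<bar>q p - q (p - h)\<bar> * \<bar>F (clamp_to t1 t2 (p + h)) - F (clamp_to t1 t2 p)\<bar> \<le> V * \<theta> ^ n"
  shows "convergent (interval_sum H F q t1 t2)"
    and "\<bar>lim (interval_sum H F q t1 t2)\<bar> \<le> \<bar>q 0 * (F t2 - F t1)\<bar> + W * R * level_const H \<alpha> \<beta> + V * (2 / (1 - \<theta>))"
proof -
  let ?J = "interval_sum H F q t1 t2"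
  let ?\<tau> = "2 powr (-(\<alpha> - 1/2)/2)"
  define c where "c = W * R * (H powr (\<alpha> - \<beta>/2) * 2 powr ((\<alpha> - 1/2)/2))"
  define b where "b n = c * ((real n + 1) * ?\<tau> ^ n) + 2 * (V * \<theta> ^ n)" for n
  have step: "\<bar>?J (Suc n) - ?J n\<bar> \<le> b n" for n
  proof -
    have "\<bar>?J (Suc n) - ?J n\<bar> \<le> W * R * (H powr (\<alpha> - \<beta>/2) * 2 powr ((\<alpha> - 1/2)/2) * ((real n + 1) * ?\<tau> ^ n)) + 2 * (V * \<theta> ^ n)"
    proof (rule interval_sum_increments[OF H t \<beta> \<alpha> W R _ Q])
      show "0 \<le> V * \<theta> ^ n" using V \<theta> by simp
      have "H / 2 ^ Suc n \<le> H / 1" using H one_le_power[of "2::real" "Suc n"] by (intro divide_left_mono) auto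
      then show "\<bar>q p - q (p - H / 2 ^ Suc n)\<bar> \<le> W * (H / 2 ^ Suc n) powr \<alpha> * (t2 - p) powr (-(\<beta>/2))"
        if "t1 \<le> p" "H / 2 ^ Suc n \<le> p" "p + H / 2 ^ Suc n \<le> t2" for p
        using H that by (intro full) auto
    qed (use part in auto)
    then show ?thesis by (simp add: b_def c_def mult.assoc)
  qed
  have \<tau>: "0 \<le> ?\<tau>" "?\<tau> < 1" using \<alpha> powr_less_mono[of "-(\<alpha> - 1/2)/2" 0 2] by auto
  have s1: "summable (\<lambda>n. (real n + 1) * ?\<tau> ^ n)" by (rule summable_linear_geometric[OF \<tau>])
  have s2: "summable (\<lambda>n. V * \<theta> ^ n)" using \<theta> by (intro summable_mult summable_geometric) simp
  have sb: "summable b" unfolding b_def[abs_def] by (intro summable_add summable_mult s1 s2)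
  have s: "summable (\<lambda>n. ?J (Suc n) - ?J n)" by (rule summable_comparison_test'[OF sb]) (use step in simp)
  have "(\<lambda>n. \<Sum>i<n. ?J (Suc i) - ?J i) \<longlonglongrightarrow> (\<Sum>n. ?J (Suc n) - ?J n)" by (rule summable_LIMSEQ[OF s])
  then have "(\<lambda>n. ?J n - ?J 0) \<longlonglongrightarrow> (\<Sum>n. ?J (Suc n) - ?J n)" using sum_lessThan_telescope[of ?J] by simp
  from tendsto_add[OF this tendsto_const[of "?J 0"]]
  have lim: "?J \<longlonglongrightarrow> (\<Sum>n. ?J (Suc n) - ?J n) + ?J 0" by simp
  then show "convergent ?J" by (auto simp: convergent_def)
  have "lim ?J = (\<Sum>n. ?J (Suc n) - ?J n) + ?J 0" using lim by (rule limI)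
  moreover have "\<bar>\<Sum>n. ?J (Suc n) - ?J n\<bar> \<le> (\<Sum>n. b n)"
  proof -
    have sa: "summable (\<lambda>n. \<bar>?J (Suc n) - ?J n\<bar>)" by (rule summable_comparison_test'[OF sb]) (use step in simp)
    have "\<bar>\<Sum>n. ?J (Suc n) - ?J n\<bar> \<le> (\<Sum>n. \<bar>?J (Suc n) - ?J n\<bar>)" by (rule summable_rabs[OF sa])
    also have "\<dots> \<le> (\<Sum>n. b n)" by (rule suminf_le[OF _ sa sb]) (rule step)
    finally show ?thesis .
  qed
  moreover have "(\<Sum>n. b n) = W * R * level_const H \<alpha> \<beta> + V * (2 / (1 - \<theta>))"
  proof -
    have "(\<Sum>n. b n) = (\<Sum>n. c * ((real n + 1) * ?\<tau> ^ n)) + (\<Sum>n. 2 * (V * \<theta> ^ n))"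
      unfolding b_def by (intro suminf_add[symmetric] summable_mult s1 s2)
    also have "(\<Sum>n. c * ((real n + 1) * ?\<tau> ^ n)) = c * (\<Sum>n. (real n + 1) * ?\<tau> ^ n)" by (rule suminf_mult[OF s1])
    also have "(\<Sum>n. 2 * (V * \<theta> ^ n)) = 2 * (V * (1 / (1 - \<theta>)))"
    proof -
      have g: "summable (\<lambda>n. \<theta> ^ n)" using \<theta> by (intro summable_geometric) simp
      have "(\<Sum>n. 2 * (V * \<theta> ^ n)) = 2 * (\<Sum>n. V * \<theta> ^ n)" by (rule suminf_mult[OF s2])
      also have "(\<Sum>n. V * \<theta> ^ n) = V * (\<Sum>n. \<theta> ^ n)" by (rule suminf_mult[OF g])
      also have "(\<Sum>n. \<theta> ^ n) = 1 / (1 - \<theta>)" using \<theta> by (intro suminf_geometric) simp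
      finally show ?thesis .
    qed
    finally show ?thesis by (simp add: c_def level_const_def mult_ac)
  qed
  moreover have "?J 0 = q 0 * (F t2 - F t1)"
    using t by (simp add: interval_sum_def clamp_to_def dyadic_def max_def min_def)
  ultimately show "\<bar>lim ?J\<bar> \<le> \<bar>q 0 * (F t2 - F t1)\<bar> + W * R * level_const H \<alpha> \<beta> + V * (2 / (1 - \<theta>))" by linarith
qed

section \<open>Integrands built from the heat kernel\<close>

lemma level_const_nonneg:
  assumes "1/2 < \<alpha>"
  shows "0 \<le> level_const H \<alpha> \<beta>"
proof -
  have "2 powr (-(\<alpha> - 1/2)/2) < 1" using assms powr_less_mono[of "-(\<alpha> - 1/2)/2" 0 2] by auto
  then have "summable (\<lambda>n. (real n + 1) * (2 powr (-(\<alpha> - 1/2)/2)) ^ n)" by (intro summable_linear_geometric) auto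
  then have "0 \<le> (\<Sum>n. (real n + 1) * (2 powr (-(\<alpha> - 1/2)/2)) ^ n)" by (intro suminf_nonneg) auto
  then show ?thesis by (simp add: level_const_def)
qed

lemma interpolate_scaled:
  fixes X A d b :: real
  assumes "X \<le> A * d" "X \<le> A * b" "0 \<le> X" "0 \<le> A" "0 \<le> d" "0 \<le> b" "0 \<le> \<theta>" "\<theta> \<le> 1"
  shows "X \<le> A * (d powr \<theta> * b powr (1 - \<theta>))"
proof (cases "A = 0")
  case False
  have "X \<le> (A * d) powr \<theta> * (A * b) powr (1 - \<theta>)" using assms by (intro min_le_interpolate) auto
  also have "\<dots> = (A powr \<theta> * A powr (1 - \<theta>)) * (d powr \<theta> * b powr (1 - \<theta>))" using assms by (simp add: powr_mult)
  also have "A powr \<theta> * A powr (1 - \<theta>) = A" using assms False by (simp add: powr_add[symmetric])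
  finally show ?thesis .
qed (use assms in auto)

text \<open>Two ways to bound a difference of square roots: globally with half the exponent, or with
  the full exponent and a weight that is singular as \<open>r1\<close> tends to 0. Below, the first
  serves the few cut cells and the second the sums over full cells.\<close>

lemma heat_sd_diff:
  assumes "0 \<le> r2" "r2 \<le> r1" "0 < \<beta>"
  shows "\<bar>heat_sd a r1 - heat_sd a r2\<bar> powr \<beta> \<le> (\<bar>a\<bar> * sqrt 2) powr \<beta> * (r1 - r2) powr (\<beta>/2)"
    and "0 < r1 \<Longrightarrow> \<bar>heat_sd a r1 - heat_sd a r2\<bar> powr \<beta> \<le> (\<bar>a\<bar> * sqrt 2) powr \<beta> * ((r1 - r2) powr \<beta> * r1 powr (-(\<beta>/2)))"
proof -
  have s: "sqrt r2 \<le> sqrt r1" using assms by simp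
  have e: "\<bar>heat_sd a r1 - heat_sd a r2\<bar> = (\<bar>a\<bar> * sqrt 2) * (sqrt r1 - sqrt r2)"
  proof -
    have "heat_sd a r1 - heat_sd a r2 = (\<bar>a\<bar> * sqrt 2) * (sqrt r1 - sqrt r2)"
      by (simp add: heat_sd_def real_sqrt_mult algebra_simps)
    then show ?thesis using s by (simp add: abs_mult)
  qed
  have "sqrt r1 - sqrt r2 \<le> sqrt (r1 - r2)"
    using sqrt_add_le_add_sqrt[of "r1 - r2" r2] assms by simp
  then have "\<bar>heat_sd a r1 - heat_sd a r2\<bar> powr \<beta> \<le> ((\<bar>a\<bar> * sqrt 2) * sqrt (r1 - r2)) powr \<beta>"
    unfolding e using s assms by (intro powr_mono2 mult_left_mono) auto
  also have "\<dots> = (\<bar>a\<bar> * sqrt 2) powr \<beta> * (r1 - r2) powr (\<beta>/2)"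
    using assms by (simp add: powr_mult powr_half_sqrt[symmetric] powr_powr)
  finally show "\<bar>heat_sd a r1 - heat_sd a r2\<bar> powr \<beta> \<le> (\<bar>a\<bar> * sqrt 2) powr \<beta> * (r1 - r2) powr (\<beta>/2)" .
  assume r1: "0 < r1"
  have "r2 = sqrt r2 * sqrt r2" using assms by simp
  also have "\<dots> \<le> sqrt r2 * sqrt r1" using s assms by (intro mult_left_mono) auto
  finally have "(sqrt r1 - sqrt r2) * sqrt r1 \<le> r1 - r2" using r1 by (simp add: algebra_simps)
  then have "sqrt r1 - sqrt r2 \<le> (r1 - r2) / sqrt r1" using r1 by (simp add: pos_le_divide_eq)
  then have "\<bar>heat_sd a r1 - heat_sd a r2\<bar> powr \<beta> \<le> ((\<bar>a\<bar> * sqrt 2) * ((r1 - r2) / sqrt r1)) powr \<beta>"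
    unfolding e using s assms by (intro powr_mono2 mult_left_mono) auto
  also have "\<dots> = (\<bar>a\<bar> * sqrt 2) powr \<beta> * ((r1 - r2) powr \<beta> * r1 powr (-(\<beta>/2)))"
  proof -
    have s: "sqrt r1 powr \<beta> = r1 powr (\<beta>/2)" using r1 by (simp add: powr_half_sqrt[symmetric] powr_powr)
    have "((r1 - r2) / sqrt r1) powr \<beta> = (r1 - r2) powr \<beta> / r1 powr (\<beta>/2)"
      using assms r1 by (subst powr_divide) (auto simp: s)
    then show ?thesis unfolding powr_minus_divide by (subst powr_mult) simp
  qed
  finally show "\<bar>heat_sd a r1 - heat_sd a r2\<bar> powr \<beta> \<le> (\<bar>a\<bar> * sqrt 2) powr \<beta> * ((r1 - r2) powr \<beta> * r1 powr (-(\<beta>/2)))" .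
qed

section \<open>Increments and pathwise integrals of the averaged coefficient\<close>

locale heat_coefficient =
  fixes \<sigma> :: "real \<Rightarrow> real \<Rightarrow> real" and a C K \<beta> T :: real
  assumes T_pos: "0 < T" and C_nonneg: "0 \<le> C" and \<beta>: "1/2 < \<beta>" "\<beta> \<le> 1"
    and \<sigma>_meas: "(\<lambda>(s, y). \<sigma> s y) \<in> borel_measurable (borel \<Otimes>\<^sub>M borel)"
    and \<sigma>_bound: "\<And>s y. \<bar>\<sigma> s y\<bar> \<le> K"
    and \<sigma>_holder: "\<And>s1 s2 y1 y2. \<bar>\<sigma> s1 y1 - \<sigma> s2 y2\<bar> \<le> C * (\<bar>s1 - s2\<bar> powr \<beta> + \<bar>y1 - y2\<bar> powr \<beta>)"
begin

definition q :: "real \<Rightarrow> real \<Rightarrow> real \<Rightarrow> real" where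
  "q t x s = gauss_avg (heat_sd a (t - s)) x (\<sigma> s)"

text \<open>The summands stem from the variation of \<open>\<sigma>\<close> in time and from the
  change of the kernel width; \<open>T powr (\<beta>/2)\<close> brings the former to the rate of the
  latter.\<close>

definition A1 :: real where
  "A1 = C * T powr (\<beta>/2) + C * gauss_moment * (\<bar>a\<bar> * sqrt 2) powr \<beta>"

text \<open>One constant for all bounds on \<open>q\<close> below; the factor 2 provides for
  differences of two such terms.\<close>

definition A :: real where
  "A = 2 * (C + A1 + K)"

lemma K_nonneg: "0 \<le> K" using \<sigma>_bound[of 0 0] by linarith

lemma A1_nonneg: "0 \<le> A1"
  using C_nonneg gauss_moment_nonneg by (simp add: A1_def)

lemma A_ge: "0 \<le> A" "2 * A1 \<le> A" "A1 \<le> A" "C \<le> A" "2 * K \<le> A" "K \<le> A"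
  using A1_nonneg C_nonneg K_nonneg by (auto simp: A_def)

lemma \<sigma>_section [measurable]: "\<sigma> s \<in> borel_measurable borel"
  using measurable_compose[OF measurable_Pair1'[of s borel borel] \<sigma>_meas] by simp

lemma q_bound: "\<bar>q t x s\<bar> \<le> K"
  unfolding q_def by (rule gauss_avg_bounded[OF \<sigma>_section \<sigma>_bound])

lemma q_measurable:
  assumes [measurable]: "t \<in> borel_measurable P" "x \<in> borel_measurable P" "s \<in> borel_measurable P"
  shows "(\<lambda>p. q (t p) (x p) (s p)) \<in> borel_measurable P"
  unfolding q_def
proof (rule gauss_avg_measurable)
  have "(\<lambda>z. (s (fst z), snd z)) \<in> measurable (P \<Otimes>\<^sub>M borel) (borel \<Otimes>\<^sub>M borel)" by measurable
  from measurable_compose[OF this \<sigma>_meas]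
  show "(\<lambda>(p, y). \<sigma> (s p) y) \<in> borel_measurable (P \<Otimes>\<^sub>M borel)" by (simp add: split_beta')
qed measurable

lemma q_diff:
  "\<bar>q t1 x1 s1 - q t2 x2 s2\<bar> \<le> C * \<bar>s1 - s2\<bar> powr \<beta> + C * (\<bar>x1 - x2\<bar> powr \<beta> + gauss_moment * \<bar>heat_sd a (t1 - s1) - heat_sd a (t2 - s2)\<bar> powr \<beta>)"
  unfolding q_def
  by (rule gauss_avg_holder[OF \<sigma>_section \<sigma>_bound \<sigma>_section \<sigma>_bound])
    (use \<sigma>_holder \<beta> C_nonneg in \<open>auto simp: distrib_left[symmetric]\<close>)

lemma q_space: "\<bar>q t x1 s - q t x2 s\<bar> \<le> C * \<bar>x1 - x2\<bar> powr \<beta>"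
  using q_diff[of t x1 s t x2 s] by simp

lemma powr_half_le: "0 \<le> r \<Longrightarrow> r \<le> T \<Longrightarrow> r powr \<beta> \<le> T powr (\<beta>/2) * r powr (\<beta>/2)"
proof -
  assume r: "0 \<le> r" "r \<le> T"
  have "r powr \<beta> = r powr (\<beta>/2) * r powr (\<beta>/2)" by (simp add: powr_add[symmetric])
  also have "\<dots> \<le> T powr (\<beta>/2) * r powr (\<beta>/2)" using r \<beta> by (intro mult_right_mono powr_mono2) auto
  finally show ?thesis .
qed

lemma q_s1:
  assumes "0 \<le> s" "s \<le> s'" "s' \<le> t" "t \<le> T"
  shows "\<bar>q t x s - q t x s'\<bar> \<le> A1 * (s' - s) powr (\<beta>/2)"
proof -
  have "\<bar>q t x s - q t x s'\<bar> \<le> C * \<bar>s - s'\<bar> powr \<beta> + C * (gauss_moment * \<bar>heat_sd a (t - s) - heat_sd a (t - s')\<bar> powr \<beta>)"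
    using q_diff[of t x s t x s'] by simp
  also have "\<dots> \<le> C * (T powr (\<beta>/2) * (s' - s) powr (\<beta>/2)) + C * (gauss_moment * ((\<bar>a\<bar> * sqrt 2) powr \<beta> * (s' - s) powr (\<beta>/2)))"
    using assms powr_half_le[of "s' - s"] heat_sd_diff(1)[of "t - s'" "t - s" \<beta> a] C_nonneg gauss_moment_nonneg \<beta>
    by (intro add_mono mult_left_mono) auto
  also have "\<dots> = A1 * (s' - s) powr (\<beta>/2)" by (simp add: A1_def algebra_simps)
  finally show ?thesis .
qed

lemma q_s2:
  assumes "0 \<le> s" "s \<le> s'" "s' \<le> t" "t \<le> T" "s < t"
  shows "\<bar>q t x s - q t x s'\<bar> \<le> A1 * ((s' - s) powr \<beta> * (t - s) powr (-(\<beta>/2)))"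
proof -
  have r: "0 < t - s" "t - s \<le> T" using assms by auto
  have "1 = (t - s) powr (\<beta>/2) * (t - s) powr (-(\<beta>/2))" using r by (simp add: powr_add[symmetric])
  also have "\<dots> \<le> T powr (\<beta>/2) * (t - s) powr (-(\<beta>/2))" using r \<beta> by (intro mult_right_mono powr_mono2) auto
  finally have "(s' - s) powr \<beta> * 1 \<le> (s' - s) powr \<beta> * (T powr (\<beta>/2) * (t - s) powr (-(\<beta>/2)))" by (intro mult_left_mono) auto
  then have p: "\<bar>s - s'\<bar> powr \<beta> \<le> T powr (\<beta>/2) * ((s' - s) powr \<beta> * (t - s) powr (-(\<beta>/2)))" using assms by (simp add: mult_ac abs_minus_commute)
  have "\<bar>q t x s - q t x s'\<bar> \<le> C * \<bar>s - s'\<bar> powr \<beta> + C * (gauss_moment * \<bar>heat_sd a (t - s) - heat_sd a (t - s')\<bar> powr \<beta>)"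
    using q_diff[of t x s t x s'] by simp
  also have "\<dots> \<le> C * (T powr (\<beta>/2) * ((s' - s) powr \<beta> * (t - s) powr (-(\<beta>/2)))) + C * (gauss_moment * ((\<bar>a\<bar> * sqrt 2) powr \<beta> * ((s' - s) powr \<beta> * (t - s) powr (-(\<beta>/2)))))"
    using assms p heat_sd_diff(2)[of "t - s'" "t - s" \<beta> a] C_nonneg gauss_moment_nonneg \<beta>
    by (intro add_mono mult_left_mono) auto
  also have "\<dots> = A1 * ((s' - s) powr \<beta> * (t - s) powr (-(\<beta>/2)))" by (simp add: A1_def algebra_simps)
  finally show ?thesis .
qed

lemma q_t1:
  assumes "s \<le> t1" "t1 \<le> t2"
  shows "\<bar>q t2 x s - q t1 x s\<bar> \<le> A1 * (t2 - t1) powr (\<beta>/2)"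
proof -
  have "\<bar>q t2 x s - q t1 x s\<bar> \<le> C * (gauss_moment * \<bar>heat_sd a (t2 - s) - heat_sd a (t1 - s)\<bar> powr \<beta>)"
    using q_diff[of t2 x s t1 x s] by simp
  also have "\<dots> \<le> C * (gauss_moment * ((\<bar>a\<bar> * sqrt 2) powr \<beta> * (t2 - t1) powr (\<beta>/2)))"
    using assms heat_sd_diff(1)[of "t1 - s" "t2 - s" \<beta> a] C_nonneg gauss_moment_nonneg \<beta>
    by (intro mult_left_mono) auto
  also have "\<dots> \<le> A1 * (t2 - t1) powr (\<beta>/2)" using C_nonneg by (simp add: A1_def algebra_simps)
  finally show ?thesis .
qed

lemma q_t2:
  assumes "s \<le> t1" "t1 \<le> t2" "s < t2"
  shows "\<bar>q t2 x s - q t1 x s\<bar> \<le> A1 * ((t2 - t1) powr \<beta> * (t2 - s) powr (-(\<beta>/2)))"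
proof -
  have "\<bar>q t2 x s - q t1 x s\<bar> \<le> C * (gauss_moment * \<bar>heat_sd a (t2 - s) - heat_sd a (t1 - s)\<bar> powr \<beta>)"
    using q_diff[of t2 x s t1 x s] by simp
  also have "\<dots> \<le> C * (gauss_moment * ((\<bar>a\<bar> * sqrt 2) powr \<beta> * ((t2 - t1) powr \<beta> * (t2 - s) powr (-(\<beta>/2)))))"
    using assms heat_sd_diff(2)[of "t1 - s" "t2 - s" \<beta> a] C_nonneg gauss_moment_nonneg \<beta>
    by (intro mult_left_mono) auto
  also have "\<dots> \<le> A1 * ((t2 - t1) powr \<beta> * (t2 - s) powr (-(\<beta>/2)))" using C_nonneg by (simp add: A1_def algebra_simps)
  finally show ?thesis .
qed

lemma mesh_powr:
  fixes H e :: real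
  assumes "0 < H" "0 < e" "h = H / 2^Suc n"
  shows "h powr e \<le> H powr e * (2 powr (-e)) ^ n"
proof -
  have "h \<le> H / 2^n" using assms by (auto intro!: divide_left_mono)
  then have "h powr e \<le> (H / 2^n) powr e" using assms by (intro powr_mono2) auto
  also have "\<dots> = H powr e * (2 powr (-e)) ^ n"
  proof -
    have "(2 powr (-e)) ^ n = 2 powr (-e * real n)" by (subst powr_realpow[symmetric]) (simp_all add: powr_powr)
    also have "\<dots> = (2^n) powr (-e)" by (subst powr_realpow[of 2 n, symmetric]) (simp_all add: powr_powr mult.commute)
    finally have e: "(2 powr (-e)) ^ n = 1 / (2^n) powr e" unfolding powr_minus_divide .
    show ?thesis unfolding e using assms by (subst powr_divide) auto
  qed
  finally show ?thesis .
qed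

lemma half_powr_less_1: "0 < e \<Longrightarrow> 2 powr (-e) < (1::real)"
  using powr_less_mono[of "-e" 0 "2::real"] by simp

text \<open>The oscillation of \<open>F\<close> over the dyadic grid of \<open>[0, H]\<close> enters only through the growth rate of
  its quadratic sums.\<close>

definition grid_bound :: "real \<Rightarrow> (real \<Rightarrow> real) \<Rightarrow> real \<Rightarrow> real \<Rightarrow> bool" where
  "grid_bound H F \<alpha> R \<longleftrightarrow> 0 \<le> R \<and>
     (\<forall>n. (\<Sum>k<2^n. (F (dyadic H n (Suc k)) - F (dyadic H n k))\<^sup>2) \<le> (R * (2 powr ((\<alpha> - 1/2)/2)) ^ n)\<^sup>2)"

text \<open>A bound on \<open>F\<close> is required only for \<open>t < H\<close>, where
  \<open>t\<close> may cut a cell. For \<open>t = H\<close> the point \<open>t\<close> lies on every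
  grid, all cells are full, and no control of \<open>F\<close> between grid points is
  needed.\<close>

lemma q_integral_convergent:
  assumes H: "0 < H" "H \<le> T" and t: "0 \<le> t" "t \<le> H" and \<gamma>: "0 < \<gamma>" "\<gamma> < \<beta> - 1/2"
    and R: "grid_bound H F (\<beta> - \<gamma>) R" and F: "t < H \<Longrightarrow> \<forall>s\<in>{0..H}. \<bar>F s\<bar> \<le> Fm" and Fm: "0 \<le> Fm"
  shows "convergent (interval_sum H F (q t x) 0 t)"
proof (rule interval_sum_convergent(1)[where \<alpha>="\<beta> - \<gamma>" and \<beta>=\<beta> and W="A1 * H powr \<gamma>" and R=R and V="A1 * H powr (\<beta>/2) * (2 * Fm)" and \<theta>="2 powr (-(\<beta>/2))"])
  fix h p :: real assume p: "0 < h" "h \<le> H" "0 \<le> p" "h \<le> p" "p + h \<le> t"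
  have "\<bar>q t x p - q t x (p - h)\<bar> \<le> A1 * (h powr \<beta> * (t - (p - h)) powr (-(\<beta>/2)))"
    using q_s2[of "p - h" p t x] p t H by (simp add: abs_minus_commute)
  also have "\<dots> \<le> A1 * ((H powr \<gamma> * h powr (\<beta> - \<gamma>)) * (t - p) powr (-(\<beta>/2)))"
  proof (intro mult_left_mono mult_mono A1_nonneg)
    have "h powr \<beta> = h powr \<gamma> * h powr (\<beta> - \<gamma>)" by (simp add: powr_add[symmetric])
    then show "h powr \<beta> \<le> H powr \<gamma> * h powr (\<beta> - \<gamma>)" using p \<gamma> by (simp add: mult_right_mono powr_mono2)
    show "(t - (p - h)) powr (-(\<beta>/2)) \<le> (t - p) powr (-(\<beta>/2))" using p \<beta> by (intro powr_mono2') auto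
  qed auto
  finally show "\<bar>q t x p - q t x (p - h)\<bar> \<le> A1 * H powr \<gamma> * h powr (\<beta> - \<gamma>) * (t - p) powr (-(\<beta>/2))" by (simp only: mult_ac)
next
  fix n and h p :: real assume h: "h = H / 2^Suc n" and p: "h \<le> p" "p < t" "0 < p + h" "p + h \<le> H" "p < 0 \<or> t < p + h"
  have h0: "0 < h" using H h by simp
  have tH: "t < H" using p h0 by linarith
  have "\<bar>q t x p - q t x (p - h)\<bar> \<le> A1 * h powr (\<beta>/2)"
    using q_s1[of "p - h" p t x] p t H h0 by (simp add: abs_minus_commute)
  also have "\<dots> \<le> A1 * (H powr (\<beta>/2) * (2 powr (-(\<beta>/2))) ^ n)" using \<beta> H h by (intro mult_left_mono mesh_powr A1_nonneg) auto
  finally have 1: "\<bar>q t x p - q t x (p - h)\<bar> \<le> A1 * (H powr (\<beta>/2) * (2 powr (-(\<beta>/2))) ^ n)" .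
  have "\<bar>F (clamp_to 0 t (p + h))\<bar> \<le> Fm" "\<bar>F (clamp_to 0 t p)\<bar> \<le> Fm"
    using F[OF tH] t p h0 by (auto simp: clamp_to_def)
  then have 2: "\<bar>F (clamp_to 0 t (p + h)) - F (clamp_to 0 t p)\<bar> \<le> 2 * Fm" by linarith
  have "\<bar>q t x p - q t x (p - h)\<bar> * \<bar>F (clamp_to 0 t (p + h)) - F (clamp_to 0 t p)\<bar> \<le> (A1 * (H powr (\<beta>/2) * (2 powr (-(\<beta>/2))) ^ n)) * (2 * Fm)"
    by (intro mult_mono 1 2) (use A1_nonneg in auto)
  then show "\<bar>q t x p - q t x (p - h)\<bar> * \<bar>F (clamp_to 0 t (p + h)) - F (clamp_to 0 t p)\<bar> \<le> A1 * H powr (\<beta>/2) * (2 * Fm) * (2 powr (-(\<beta>/2))) ^ n"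
    by (simp only: mult_ac)
qed (use H t \<gamma> \<beta> R Fm A1_nonneg half_powr_less_1[of "\<beta>/2"] in \<open>auto simp: grid_bound_def\<close>)

text \<open>The level 0 term, the full cells and the cut cells of
  \<open>interval_sum_convergent\<close>, in this order, with the factor \<open>A\<close> taken
  out.\<close>

definition space_const :: "real \<Rightarrow> real \<Rightarrow> real" where
  "space_const H \<gamma> = A * (1 + T powr (\<gamma>/2) * level_const H (\<beta> - \<gamma>) \<beta> + H powr ((\<beta> - \<gamma>)/2) * (4 / (1 - 2 powr (-((\<beta> - \<gamma>)/2)))))"

text \<open>An increment in \<open>s\<close> of the difference in \<open>x\<close> is bounded by
  \<open>d powr \<beta>\<close> and also by \<open>h powr \<beta>\<close> times a weight;
  interpolation with \<open>\<theta> = \<gamma> / \<beta>\<close> leaves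
  \<open>d powr \<gamma> * h powr (\<beta> - \<gamma>)\<close>. The grid estimate then runs with
  \<open>\<alpha> = \<beta> - \<gamma>\<close>, and \<open>\<alpha> > 1/2\<close> is exactly
  \<open>\<gamma> < \<beta> - 1/2\<close>.\<close>

lemma q_integral_space:
  assumes H: "0 < H" "H \<le> T" and t: "0 \<le> t" "t \<le> H" and \<gamma>: "0 < \<gamma>" "\<gamma> < \<beta> - 1/2"
    and R: "grid_bound H F (\<beta> - \<gamma>) R" and F: "t < H \<Longrightarrow> \<forall>s\<in>{0..H}. \<bar>F s\<bar> \<le> Fm" and Fm: "0 \<le> Fm"
    and D: "\<bar>F t - F 0\<bar> \<le> D"
  shows "\<bar>lim (interval_sum H F (\<lambda>s. q t x1 s - q t x2 s) 0 t)\<bar> \<le> space_const H \<gamma> * (D + R + Fm) * \<bar>x1 - x2\<bar> powr \<gamma>"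
proof -
  define d where "d = \<bar>x1 - x2\<bar>"
  let ?q = "\<lambda>s. q t x1 s - q t x2 s"
  have R0: "0 \<le> R" using R by (simp add: grid_bound_def)
  have D0: "0 \<le> D" using D by linarith
  have \<beta>0: "0 < \<beta>" using \<beta> by simp
  have gb: "0 \<le> \<gamma>/\<beta>" "\<gamma>/\<beta> \<le> 1" using \<gamma> \<beta> by auto
  have dg: "(d powr \<beta>) powr (\<gamma>/\<beta>) = d powr \<gamma>" using \<beta>0 by (simp add: powr_powr)
  have qd: "\<bar>?q s\<bar> \<le> A * d powr \<beta>" for s
    using q_space[of t x1 s x2] mult_right_mono[OF A_ge(4), of "d powr \<beta>"] by (simp add: d_def)
  have qd2: "\<bar>?q s - ?q s'\<bar> \<le> A * d powr \<beta>" for s s'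
  proof -
    have "\<bar>?q s - ?q s'\<bar> \<le> (2 * C) * d powr \<beta>" using q_space[of t x1 s x2] q_space[of t x1 s' x2] by (simp add: d_def)
    also have "\<dots> \<le> A * d powr \<beta>" using A1_nonneg K_nonneg by (intro mult_right_mono) (auto simp: A_def)
    finally show ?thesis .
  qed
  let ?\<theta> = "2 powr (-((\<beta> - \<gamma>)/2))"
  have "\<bar>lim (interval_sum H F ?q 0 t)\<bar> \<le> \<bar>?q 0 * (F t - F 0)\<bar> + (A * T powr (\<gamma>/2) * d powr \<gamma>) * R * level_const H (\<beta> - \<gamma>) \<beta>
      + (A * H powr ((\<beta> - \<gamma>)/2) * (2 * Fm) * d powr \<gamma>) * (2 / (1 - ?\<theta>))"
  proof (rule interval_sum_convergent(2)[where \<alpha>="\<beta> - \<gamma>" and \<beta>=\<beta> and R=R])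
    fix h p :: real assume p: "0 < h" "h \<le> H" "0 \<le> p" "h \<le> p" "p + h \<le> t"
    have b: "\<bar>?q p - ?q (p - h)\<bar> \<le> A * (h powr \<beta> * (t - p) powr (-(\<beta>/2)))"
    proof -
      have 1: "\<bar>q t x p - q t x (p - h)\<bar> \<le> A1 * (h powr \<beta> * (t - p) powr (-(\<beta>/2)))" for x
      proof -
        have "\<bar>q t x p - q t x (p - h)\<bar> \<le> A1 * (h powr \<beta> * (t - (p - h)) powr (-(\<beta>/2)))"
          using q_s2[of "p - h" p t x] p t H by (simp add: abs_minus_commute)
        also have "\<dots> \<le> A1 * (h powr \<beta> * (t - p) powr (-(\<beta>/2)))"
          using p \<beta> by (intro mult_left_mono powr_mono2' A1_nonneg) auto
        finally show ?thesis .
      qed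
      have "\<bar>?q p - ?q (p - h)\<bar> \<le> (2 * A1) * (h powr \<beta> * (t - p) powr (-(\<beta>/2)))" using 1[of x1] 1[of x2] by linarith
      also have "\<dots> \<le> A * (h powr \<beta> * (t - p) powr (-(\<beta>/2)))" by (intro mult_right_mono A_ge) auto
      finally show ?thesis .
    qed
    have "\<bar>?q p - ?q (p - h)\<bar> \<le> A * ((d powr \<beta>) powr (\<gamma>/\<beta>) * (h powr \<beta> * (t - p) powr (-(\<beta>/2))) powr (1 - \<gamma>/\<beta>))"
      by (rule interpolate_scaled[OF qd2 b]) (use A_ge gb in auto)
    also have "(h powr \<beta> * (t - p) powr (-(\<beta>/2))) powr (1 - \<gamma>/\<beta>) = h powr (\<beta> - \<gamma>) * (t - p) powr (-((\<beta> - \<gamma>)/2))"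
    proof -
      have "\<beta> * (1 - \<gamma>/\<beta>) = \<beta> - \<gamma>" "-(\<beta>/2) * (1 - \<gamma>/\<beta>) = -((\<beta> - \<gamma>)/2)" using \<beta>0 by (auto simp: field_simps)
      then show ?thesis by (simp only: powr_mult powr_powr)
    qed
    \<comment> \<open>The interpolated weight is less singular than the one required; the surplus
      \<open>(t - p) powr (\<gamma>/2)\<close> is bounded by
      \<open>T powr (\<gamma>/2)\<close>.\<close>
    also have "(t - p) powr (-((\<beta> - \<gamma>)/2)) = (t - p) powr (\<gamma>/2) * (t - p) powr (-(\<beta>/2))"
    proof -
      have e: "-((\<beta> - \<gamma>)/2) = \<gamma>/2 + -(\<beta>/2)" by (simp add: field_simps)
      show ?thesis unfolding e by (rule powr_add)
    qed
    also have "A * ((d powr \<beta>) powr (\<gamma>/\<beta>) * (h powr (\<beta> - \<gamma>) * ((t - p) powr (\<gamma>/2) * (t - p) powr (-(\<beta>/2))))) \<le>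
        A * (d powr \<gamma> * (h powr (\<beta> - \<gamma>) * (T powr (\<gamma>/2) * (t - p) powr (-(\<beta>/2)))))"
      unfolding dg using p t H \<gamma> A_ge(1) by (intro mult_left_mono mult_right_mono powr_mono2) auto
    finally show "\<bar>?q p - ?q (p - h)\<bar> \<le> A * T powr (\<gamma>/2) * d powr \<gamma> * h powr (\<beta> - \<gamma>) * (t - p) powr (-(\<beta>/2))" by (simp only: mult_ac)
  next
    fix n and h p :: real assume h: "h = H / 2^Suc n" and p: "h \<le> p" "p < t" "0 < p + h" "p + h \<le> H" "p < 0 \<or> t < p + h"
    have h0: "0 < h" using H h by simp
    have tH: "t < H" using p h0 by linarith
    have b: "\<bar>?q p - ?q (p - h)\<bar> \<le> A * h powr (\<beta>/2)"
    proof -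
      have 1: "\<bar>q t x p - q t x (p - h)\<bar> \<le> A1 * h powr (\<beta>/2)" for x
        using q_s1[of "p - h" p t x] p t H h0 by (simp add: abs_minus_commute)
      have "\<bar>?q p - ?q (p - h)\<bar> \<le> (2 * A1) * h powr (\<beta>/2)" using 1[of x1] 1[of x2] by linarith
      also have "\<dots> \<le> A * h powr (\<beta>/2)" by (intro mult_right_mono A_ge) auto
      finally show ?thesis .
    qed
    have "\<bar>?q p - ?q (p - h)\<bar> \<le> A * ((d powr \<beta>) powr (\<gamma>/\<beta>) * (h powr (\<beta>/2)) powr (1 - \<gamma>/\<beta>))"
      by (rule interpolate_scaled[OF qd2 b]) (use A_ge gb in auto)
    also have "(h powr (\<beta>/2)) powr (1 - \<gamma>/\<beta>) = h powr ((\<beta> - \<gamma>)/2)"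
    proof -
      have "\<beta>/2 * (1 - \<gamma>/\<beta>) = (\<beta> - \<gamma>)/2" using \<beta>0 by (auto simp: field_simps)
      then show ?thesis by (simp only: powr_powr)
    qed
    also have "A * ((d powr \<beta>) powr (\<gamma>/\<beta>) * h powr ((\<beta> - \<gamma>)/2)) \<le> A * (d powr \<gamma> * (H powr ((\<beta> - \<gamma>)/2) * ?\<theta> ^ n))"
      unfolding dg using H h \<gamma> by (intro mult_left_mono mesh_powr A_ge) auto
    finally have 1: "\<bar>?q p - ?q (p - h)\<bar> \<le> A * (d powr \<gamma> * (H powr ((\<beta> - \<gamma>)/2) * ?\<theta> ^ n))" .
    have "\<bar>F (clamp_to 0 t (p + h))\<bar> \<le> Fm" "\<bar>F (clamp_to 0 t p)\<bar> \<le> Fm"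
      using F[OF tH] t p h0 by (auto simp: clamp_to_def)
    then have 2: "\<bar>F (clamp_to 0 t (p + h)) - F (clamp_to 0 t p)\<bar> \<le> 2 * Fm" by linarith
    have "\<bar>?q p - ?q (p - h)\<bar> * \<bar>F (clamp_to 0 t (p + h)) - F (clamp_to 0 t p)\<bar> \<le> (A * (d powr \<gamma> * (H powr ((\<beta> - \<gamma>)/2) * ?\<theta> ^ n))) * (2 * Fm)"
      by (intro mult_mono 1 2) (use A_ge in auto)
    then show "\<bar>?q p - ?q (p - h)\<bar> * \<bar>F (clamp_to 0 t (p + h)) - F (clamp_to 0 t p)\<bar> \<le> A * H powr ((\<beta> - \<gamma>)/2) * (2 * Fm) * d powr \<gamma> * ?\<theta> ^ n"
      by (simp only: mult_ac)
  qed (use H t \<gamma> \<beta> R Fm A_ge half_powr_less_1[of "(\<beta> - \<gamma>)/2"] in \<open>auto simp: grid_bound_def\<close>)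
  moreover have "\<bar>?q 0 * (F t - F 0)\<bar> \<le> (A * d powr \<gamma>) * D"
  proof -
    have "\<bar>?q 0\<bar> \<le> A * 1" using q_bound[of t x1 0] q_bound[of t x2 0] A_ge(5) by linarith
    then have "\<bar>?q 0\<bar> \<le> A * ((d powr \<beta>) powr (\<gamma>/\<beta>) * 1 powr (1 - \<gamma>/\<beta>))"
      by (intro interpolate_scaled[OF qd]) (use A_ge gb in auto)
    then have "\<bar>?q 0\<bar> \<le> A * d powr \<gamma>" unfolding dg by simp
    then show ?thesis unfolding abs_mult using D A_ge(1) by (intro mult_mono) auto
  qed
  moreover have "(A * d powr \<gamma>) * D + (A * T powr (\<gamma>/2) * d powr \<gamma>) * R * level_const H (\<beta> - \<gamma>) \<beta>
      + (A * H powr ((\<beta> - \<gamma>)/2) * (2 * Fm) * d powr \<gamma>) * (2 / (1 - ?\<theta>)) \<le> space_const H \<gamma> * (D + R + Fm) * d powr \<gamma>"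
  proof -
    define c1 where "c1 = T powr (\<gamma>/2) * level_const H (\<beta> - \<gamma>) \<beta>"
    define c2 where "c2 = H powr ((\<beta> - \<gamma>)/2) * (4 / (1 - ?\<theta>))"
    have c: "0 \<le> c1" "0 \<le> c2" unfolding c1_def c2_def using level_const_nonneg[of "\<beta> - \<gamma>" H \<beta>] half_powr_less_1[of "(\<beta> - \<gamma>)/2"] \<gamma> by auto
    have s: "D + c1 * R + c2 * Fm \<le> (1 + c1 + c2) * (D + R + Fm)"
      using c D0 R0 Fm by (simp add: algebra_simps)
    have "(A * d powr \<gamma>) * D + (A * T powr (\<gamma>/2) * d powr \<gamma>) * R * level_const H (\<beta> - \<gamma>) \<beta>
      + (A * H powr ((\<beta> - \<gamma>)/2) * (2 * Fm) * d powr \<gamma>) * (2 / (1 - ?\<theta>)) = (A * d powr \<gamma>) * (D + c1 * R + c2 * Fm)"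
      by (simp add: c1_def c2_def algebra_simps)
    also have "\<dots> \<le> (A * d powr \<gamma>) * ((1 + c1 + c2) * (D + R + Fm))" using A_ge(1) s by (intro mult_left_mono) auto
    also have "\<dots> = space_const H \<gamma> * (D + R + Fm) * d powr \<gamma>" by (simp add: space_const_def c1_def c2_def mult_ac)
    finally show ?thesis .
  qed
  ultimately show ?thesis unfolding d_def by linarith
qed

definition time_const :: "real \<Rightarrow> real" where
  "time_const \<gamma> = A * (T powr (\<beta>/2 - \<gamma>) + level_const T (\<beta> - \<gamma>) \<beta> + T powr (\<beta>/2 - \<gamma>) * (4 / (1 - 2 powr (-(\<beta>/2 - \<gamma>)))))"

text \<open>Compares the integrands for \<open>t1\<close> and \<open>t2\<close> on the common
  interval \<open>[0, t1]\<close>. In full cells both bounds carry the same weight, so interpolation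
  acts on \<open>d\<close> and \<open>h\<close> only. In a cut cell the exponent without singularity
  is \<open>\<beta>/2\<close>, and \<open>\<theta> = 2 * \<gamma> / \<beta>\<close> is admissible
  because \<open>\<gamma> < \<beta> - 1/2 \<le> \<beta>/2\<close>.\<close>

lemma q_integral_time:
  assumes t: "0 \<le> t1" "t1 \<le> t2" "t2 \<le> T" and \<gamma>: "0 < \<gamma>" "\<gamma> < \<beta> - 1/2"
    and R: "grid_bound T F (\<beta> - \<gamma>) R" and F: "\<forall>s\<in>{0..T}. \<bar>F s\<bar> \<le> Fm" and Fm: "0 \<le> Fm"
  shows "\<bar>lim (interval_sum T F (\<lambda>s. q t2 x s - q t1 x s) 0 t1)\<bar> \<le> time_const \<gamma> * (2 * Fm + R + Fm) * (t2 - t1) powr \<gamma>"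
    and "convergent (interval_sum T F (\<lambda>s. q t2 x s - q t1 x s) 0 t1)"
proof -
  define d where "d = t2 - t1"
  have d0: "0 \<le> d" "d \<le> T" using t by (auto simp: d_def)
  let ?q = "\<lambda>s. q t2 x s - q t1 x s"
  have R0: "0 \<le> R" using R by (simp add: grid_bound_def)
  have \<beta>0: "0 < \<beta>" using \<beta> by simp
  have g2: "\<gamma> < \<beta>/2" using \<gamma> \<beta> by simp
  have gb: "0 \<le> \<gamma>/\<beta>" "\<gamma>/\<beta> \<le> 1" using \<gamma> \<beta> by auto
  have gb2: "0 \<le> 2 * \<gamma>/\<beta>" "2 * \<gamma>/\<beta> \<le> 1" using \<gamma> g2 \<beta>0 by (auto simp: field_simps)
  let ?\<theta> = "2 powr (-(\<beta>/2 - \<gamma>))"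
  have full: "\<bar>?q p - ?q (p - h)\<bar> \<le> (A * d powr \<gamma>) * h powr (\<beta> - \<gamma>) * (t1 - p) powr (-(\<beta>/2))"
    if p: "0 < h" "h \<le> T" "0 \<le> p" "h \<le> p" "p + h \<le> t1" for h p :: real
  proof -
    define w where "w = (t1 - p) powr (-(\<beta>/2))"
    have w: "0 \<le> w" by (simp add: w_def)
    have wle: "(t - s) powr (-(\<beta>/2)) \<le> w" if "t1 \<le> t" "s \<le> p" for t s
      unfolding w_def using that p \<beta> by (intro powr_mono2') auto
    have b: "\<bar>?q p - ?q (p - h)\<bar> \<le> (A * w) * h powr \<beta>"
    proof -
      have 1: "\<bar>q t x p - q t x (p - h)\<bar> \<le> A1 * (h powr \<beta> * w)" if "t1 \<le> t" "t \<le> T" for t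
      proof -
        have "\<bar>q t x p - q t x (p - h)\<bar> \<le> A1 * (h powr \<beta> * (t - (p - h)) powr (-(\<beta>/2)))"
          using q_s2[of "p - h" p t x] p t that by (simp add: abs_minus_commute)
        also have "\<dots> \<le> A1 * (h powr \<beta> * w)" using wle[of t "p - h"] p that by (intro mult_left_mono A1_nonneg) auto
        finally show ?thesis .
      qed
      have "\<bar>?q p - ?q (p - h)\<bar> \<le> (2 * A1) * (h powr \<beta> * w)" using 1[of t1] 1[of t2] t by linarith
      also have "\<dots> \<le> A * (h powr \<beta> * w)" using w by (intro mult_right_mono A_ge) auto
      finally show ?thesis by (simp add: mult_ac)
    qed
    have e: "\<bar>?q p - ?q (p - h)\<bar> \<le> (A * w) * d powr \<beta>"
    proof -
      have 1: "\<bar>?q s\<bar> \<le> A1 * (d powr \<beta> * w)" if "s \<le> p" for s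
      proof -
        have "\<bar>?q s\<bar> \<le> A1 * (d powr \<beta> * (t2 - s) powr (-(\<beta>/2)))"
          using q_t2[of s t1 t2 x] p t that by (simp add: d_def)
        also have "\<dots> \<le> A1 * (d powr \<beta> * w)" using wle[of t2 s] t that by (intro mult_left_mono A1_nonneg) auto
        finally show ?thesis .
      qed
      have "\<bar>?q p - ?q (p - h)\<bar> \<le> (2 * A1) * (d powr \<beta> * w)" using 1[of p] 1[of "p - h"] p by linarith
      also have "\<dots> \<le> A * (d powr \<beta> * w)" using w by (intro mult_right_mono A_ge) auto
      finally show ?thesis by (simp add: mult_ac)
    qed
    have "\<bar>?q p - ?q (p - h)\<bar> \<le> (A * w) * ((d powr \<beta>) powr (\<gamma>/\<beta>) * (h powr \<beta>) powr (1 - \<gamma>/\<beta>))"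
      by (rule interpolate_scaled[OF e b]) (use A_ge gb w in auto)
    also have "(d powr \<beta>) powr (\<gamma>/\<beta>) = d powr \<gamma>" using \<beta>0 by (simp add: powr_powr)
    also have "(h powr \<beta>) powr (1 - \<gamma>/\<beta>) = h powr (\<beta> - \<gamma>)"
    proof -
      have "\<beta> * (1 - \<gamma>/\<beta>) = \<beta> - \<gamma>" using \<beta>0 by (auto simp: field_simps)
      then show ?thesis by (simp only: powr_powr)
    qed
    finally show ?thesis by (simp add: w_def mult_ac)
  qed
  have part: "\<bar>?q p - ?q (p - h)\<bar> * \<bar>F (clamp_to 0 t1 (p + h)) - F (clamp_to 0 t1 p)\<bar> \<le> (A * T powr (\<beta>/2 - \<gamma>) * (2 * Fm) * d powr \<gamma>) * ?\<theta> ^ n"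
    if h: "h = T / 2^Suc n" and p: "h \<le> p" "p < t1" "0 < p + h" "p + h \<le> T" "p < 0 \<or> t1 < p + h" for n and h p :: real
  proof -
    have h0: "0 < h" using T_pos h by simp
    have b: "\<bar>?q p - ?q (p - h)\<bar> \<le> A * h powr (\<beta>/2)"
    proof -
      have 1: "\<bar>q t x p - q t x (p - h)\<bar> \<le> A1 * h powr (\<beta>/2)" if "t1 \<le> t" "t \<le> T" for t
        using q_s1[of "p - h" p t x] p that h0 by (simp add: abs_minus_commute)
      have "\<bar>?q p - ?q (p - h)\<bar> \<le> (2 * A1) * h powr (\<beta>/2)" using 1[of t1] 1[of t2] t by linarith
      also have "\<dots> \<le> A * h powr (\<beta>/2)" by (intro mult_right_mono A_ge) auto
      finally show ?thesis .
    qed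
    have e: "\<bar>?q p - ?q (p - h)\<bar> \<le> A * d powr (\<beta>/2)"
    proof -
      have "\<bar>?q p - ?q (p - h)\<bar> \<le> (2 * A1) * d powr (\<beta>/2)"
        using q_t1[of p t1 t2 x] q_t1[of "p - h" t1 t2 x] p t h0 by (simp add: d_def)
      also have "\<dots> \<le> A * d powr (\<beta>/2)" by (intro mult_right_mono A_ge) auto
      finally show ?thesis .
    qed
    have "\<bar>?q p - ?q (p - h)\<bar> \<le> A * ((d powr (\<beta>/2)) powr (2 * \<gamma>/\<beta>) * (h powr (\<beta>/2)) powr (1 - 2 * \<gamma>/\<beta>))"
      by (rule interpolate_scaled[OF e b]) (use A_ge gb2 in auto)
    also have "(d powr (\<beta>/2)) powr (2 * \<gamma>/\<beta>) = d powr \<gamma>" using \<beta>0 by (simp add: powr_powr)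
    also have "(h powr (\<beta>/2)) powr (1 - 2 * \<gamma>/\<beta>) = h powr (\<beta>/2 - \<gamma>)"
    proof -
      have "\<beta>/2 * (1 - 2 * \<gamma>/\<beta>) = \<beta>/2 - \<gamma>" using \<beta>0 by (auto simp: field_simps)
      then show ?thesis by (simp only: powr_powr)
    qed
    also have "A * (d powr \<gamma> * h powr (\<beta>/2 - \<gamma>)) \<le> A * (d powr \<gamma> * (T powr (\<beta>/2 - \<gamma>) * ?\<theta> ^ n))"
      using T_pos h g2 by (intro mult_left_mono mesh_powr A_ge) auto
    finally have 1: "\<bar>?q p - ?q (p - h)\<bar> \<le> A * (d powr \<gamma> * (T powr (\<beta>/2 - \<gamma>) * ?\<theta> ^ n))" .
    have "\<bar>F (clamp_to 0 t1 (p + h))\<bar> \<le> Fm" "\<bar>F (clamp_to 0 t1 p)\<bar> \<le> Fm"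
      using F t p h0 by (auto simp: clamp_to_def)
    then have 2: "\<bar>F (clamp_to 0 t1 (p + h)) - F (clamp_to 0 t1 p)\<bar> \<le> 2 * Fm" by linarith
    have "\<bar>?q p - ?q (p - h)\<bar> * \<bar>F (clamp_to 0 t1 (p + h)) - F (clamp_to 0 t1 p)\<bar> \<le> (A * (d powr \<gamma> * (T powr (\<beta>/2 - \<gamma>) * ?\<theta> ^ n))) * (2 * Fm)"
      by (intro mult_mono 1 2) (use A_ge in auto)
    then show ?thesis by (simp only: mult_ac)
  qed
  have side: "1/2 < \<beta> - \<gamma>" "0 \<le> A * d powr \<gamma>" "0 \<le> A * T powr (\<beta>/2 - \<gamma>) * (2 * Fm) * d powr \<gamma>" "0 \<le> ?\<theta>" "?\<theta> < 1"
    "\<And>n. (\<Sum>k<2^n. (F (dyadic T n (Suc k)) - F (dyadic T n k))\<^sup>2) \<le> (R * (2 powr ((\<beta> - \<gamma> - 1/2)/2)) ^ n)\<^sup>2"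
    using \<gamma> A_ge Fm half_powr_less_1[of "\<beta>/2 - \<gamma>"] g2 R by (auto simp: grid_bound_def)
  show "convergent (interval_sum T F ?q 0 t1)" by (rule interval_sum_convergent(1)[OF T_pos order_refl t(1) order_trans[OF t(2,3)] \<beta>0 \<beta>(2) side(1,2) R0 side(3-6)], rule full, assumption+, rule part, assumption+)
  have "\<bar>lim (interval_sum T F ?q 0 t1)\<bar> \<le> \<bar>?q 0 * (F t1 - F 0)\<bar> + (A * d powr \<gamma>) * R * level_const T (\<beta> - \<gamma>) \<beta>
      + (A * T powr (\<beta>/2 - \<gamma>) * (2 * Fm) * d powr \<gamma>) * (2 / (1 - ?\<theta>))" by (rule interval_sum_convergent(2)[OF T_pos order_refl t(1) order_trans[OF t(2,3)] \<beta>0 \<beta>(2) side(1,2) R0 side(3-6)], rule full, assumption+, rule part, assumption+)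
  moreover have "\<bar>?q 0 * (F t1 - F 0)\<bar> \<le> (A * (T powr (\<beta>/2 - \<gamma>) * d powr \<gamma>)) * (2 * Fm)"
  proof -
    have "\<bar>?q 0\<bar> \<le> A1 * d powr (\<beta>/2)" using q_t1[of 0 t1 t2 x] t by (simp add: d_def)
    also have "d powr (\<beta>/2) = d powr (\<beta>/2 - \<gamma>) * d powr \<gamma>" by (simp add: powr_add[symmetric])
    also have "A1 * (d powr (\<beta>/2 - \<gamma>) * d powr \<gamma>) \<le> A * (T powr (\<beta>/2 - \<gamma>) * d powr \<gamma>)"
      using d0 g2 A_ge A1_nonneg by (intro mult_mono mult_right_mono powr_mono2) auto
    finally have 1: "\<bar>?q 0\<bar> \<le> A * (T powr (\<beta>/2 - \<gamma>) * d powr \<gamma>)" .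
    have "\<bar>F t1\<bar> \<le> Fm" "\<bar>F 0\<bar> \<le> Fm" using F t T_pos by auto
    then have 2: "\<bar>F t1 - F 0\<bar> \<le> 2 * Fm" by linarith
    show ?thesis unfolding abs_mult by (intro mult_mono 1 2) (use A_ge in auto)
  qed
  moreover have "(A * (T powr (\<beta>/2 - \<gamma>) * d powr \<gamma>)) * (2 * Fm) + (A * d powr \<gamma>) * R * level_const T (\<beta> - \<gamma>) \<beta>
      + (A * T powr (\<beta>/2 - \<gamma>) * (2 * Fm) * d powr \<gamma>) * (2 / (1 - ?\<theta>)) \<le> time_const \<gamma> * (2 * Fm + R + Fm) * d powr \<gamma>"
  proof -
    define c0 where "c0 = T powr (\<beta>/2 - \<gamma>)"
    define c1 where "c1 = level_const T (\<beta> - \<gamma>) \<beta>"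
    define c2 where "c2 = T powr (\<beta>/2 - \<gamma>) * (4 / (1 - ?\<theta>))"
    have c: "0 \<le> c0" "0 \<le> c1" "0 \<le> c2" unfolding c0_def c1_def c2_def using level_const_nonneg[of "\<beta> - \<gamma>" T \<beta>] half_powr_less_1[of "\<beta>/2 - \<gamma>"] \<gamma> g2 by auto
    have s: "c0 * (2 * Fm) + c1 * R + c2 * Fm \<le> (c0 + c1 + c2) * (2 * Fm + R + Fm)"
      using c R0 Fm by (simp add: algebra_simps)
    have "(A * (T powr (\<beta>/2 - \<gamma>) * d powr \<gamma>)) * (2 * Fm) + (A * d powr \<gamma>) * R * level_const T (\<beta> - \<gamma>) \<beta>
      + (A * T powr (\<beta>/2 - \<gamma>) * (2 * Fm) * d powr \<gamma>) * (2 / (1 - ?\<theta>)) = (A * d powr \<gamma>) * (c0 * (2 * Fm) + c1 * R + c2 * Fm)"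
      by (simp add: c0_def c1_def c2_def algebra_simps)
    also have "\<dots> \<le> (A * d powr \<gamma>) * ((c0 + c1 + c2) * (2 * Fm + R + Fm))" using A_ge(1) s by (intro mult_left_mono) auto
    also have "\<dots> = time_const \<gamma> * (2 * Fm + R + Fm) * d powr \<gamma>" by (simp add: time_const_def c0_def c1_def c2_def mult_ac)
    finally show ?thesis .
  qed
  ultimately show "\<bar>lim (interval_sum T F ?q 0 t1)\<bar> \<le> time_const \<gamma> * (2 * Fm + R + Fm) * (t2 - t1) powr \<gamma>"
    unfolding d_def by linarith
qed

definition tail_const :: "real \<Rightarrow> real \<Rightarrow> real" where
  "tail_const \<gamma> b = A * (T powr (b - \<gamma>) + level_const T (\<beta> - \<gamma>) \<beta> + T powr (\<beta>/2) * T powr (b - \<gamma>) * (2 / (1 - 2 powr (-(\<beta>/2)))))"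

text \<open>The contribution of the new piece \<open>[t1, t2]\<close>. A full cell has
  \<open>h \<le> t2 - t1\<close>, so a part of the power of \<open>h\<close> can be traded for
  \<open>(t2 - t1) powr \<gamma>\<close>. The level 0 term and the cut cells obtain this factor from
  the Hoelder continuity of \<open>F\<close>, which is where \<open>\<gamma> \<le> b\<close>
  enters.\<close>

lemma q_integral_tail:
  assumes t: "0 \<le> t1" "t1 \<le> t2" "t2 \<le> T" and \<gamma>: "0 < \<gamma>" "\<gamma> < \<beta> - 1/2" "\<gamma> \<le> b"
    and R: "grid_bound T F (\<beta> - \<gamma>) R" and Cf: "0 \<le> Cf"
    and F: "\<And>s s'. 0 \<le> s \<Longrightarrow> s \<le> s' \<Longrightarrow> s' \<le> T \<Longrightarrow> \<bar>F s' - F s\<bar> \<le> Cf * (s' - s) powr b"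
  shows "\<bar>lim (interval_sum T F (q t2 x) t1 t2)\<bar> \<le> tail_const \<gamma> b * (Cf + R) * (t2 - t1) powr \<gamma>"
    and "convergent (interval_sum T F (q t2 x) t1 t2)"
proof -
  define d where "d = t2 - t1"
  have d0: "0 \<le> d" "d \<le> T" using t by (auto simp: d_def)
  have R0: "0 \<le> R" using R by (simp add: grid_bound_def)
  have \<beta>0: "0 < \<beta>" using \<beta> by simp
  have b0: "0 < b" using \<gamma> by simp
  let ?\<theta> = "2 powr (-(\<beta>/2))"
  have Fd: "\<bar>F s' - F s\<bar> \<le> Cf * (T powr (b - \<gamma>) * d powr \<gamma>)" if "t1 \<le> s" "s \<le> s'" "s' \<le> t2" for s s'
  proof -
    have "\<bar>F s' - F s\<bar> \<le> Cf * (s' - s) powr b" using that t by (intro F) auto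
    also have "\<dots> \<le> Cf * d powr b" using that b0 Cf by (intro mult_left_mono powr_mono2) (auto simp: d_def)
    also have "d powr b = d powr (b - \<gamma>) * d powr \<gamma>" by (simp add: powr_add[symmetric])
    also have "Cf * (d powr (b - \<gamma>) * d powr \<gamma>) \<le> Cf * (T powr (b - \<gamma>) * d powr \<gamma>)"
      using d0 \<gamma> Cf by (intro mult_left_mono mult_right_mono powr_mono2) auto
    finally show ?thesis .
  qed
  have full: "\<bar>q t2 x p - q t2 x (p - h)\<bar> \<le> (A * d powr \<gamma>) * h powr (\<beta> - \<gamma>) * (t2 - p) powr (-(\<beta>/2))"
    if p: "0 < h" "h \<le> T" "t1 \<le> p" "h \<le> p" "p + h \<le> t2" for h p :: real
  proof -
    have "\<bar>q t2 x p - q t2 x (p - h)\<bar> \<le> A1 * (h powr \<beta> * (t2 - (p - h)) powr (-(\<beta>/2)))"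
      using q_s2[of "p - h" p t2 x] p t by (simp add: abs_minus_commute)
    also have "\<dots> \<le> A * ((d powr \<gamma> * h powr (\<beta> - \<gamma>)) * (t2 - p) powr (-(\<beta>/2)))"
    proof (intro mult_mono A_ge)
      have "h powr \<beta> = h powr \<gamma> * h powr (\<beta> - \<gamma>)" by (simp add: powr_add[symmetric])
      then show "h powr \<beta> \<le> d powr \<gamma> * h powr (\<beta> - \<gamma>)" using p \<gamma> by (simp add: mult_right_mono powr_mono2 d_def)
      show "(t2 - (p - h)) powr (-(\<beta>/2)) \<le> (t2 - p) powr (-(\<beta>/2))" using p \<beta> by (intro powr_mono2') auto
    qed auto
    finally show ?thesis by (simp only: mult_ac)
  qed
  have part: "\<bar>q t2 x p - q t2 x (p - h)\<bar> * \<bar>F (clamp_to t1 t2 (p + h)) - F (clamp_to t1 t2 p)\<bar> \<le> (A * T powr (\<beta>/2) * (Cf * (T powr (b - \<gamma>) * d powr \<gamma>))) * ?\<theta> ^ n"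
    if h: "h = T / 2^Suc n" and p: "h \<le> p" "p < t2" "t1 < p + h" "p + h \<le> T" "p < t1 \<or> t2 < p + h" for n and h p :: real
  proof -
    have h0: "0 < h" using T_pos h by simp
    have "\<bar>q t2 x p - q t2 x (p - h)\<bar> \<le> A1 * h powr (\<beta>/2)"
      using q_s1[of "p - h" p t2 x] p t h0 by (simp add: abs_minus_commute)
    also have "\<dots> \<le> A * (T powr (\<beta>/2) * ?\<theta> ^ n)" using \<beta> T_pos h by (intro mult_mono mesh_powr A_ge) auto
    finally have 1: "\<bar>q t2 x p - q t2 x (p - h)\<bar> \<le> A * (T powr (\<beta>/2) * ?\<theta> ^ n)" .
    have 2: "\<bar>F (clamp_to t1 t2 (p + h)) - F (clamp_to t1 t2 p)\<bar> \<le> Cf * (T powr (b - \<gamma>) * d powr \<gamma>)"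
      using t h0 by (intro Fd) (auto simp: clamp_to_def)
    have "\<bar>q t2 x p - q t2 x (p - h)\<bar> * \<bar>F (clamp_to t1 t2 (p + h)) - F (clamp_to t1 t2 p)\<bar> \<le> (A * (T powr (\<beta>/2) * ?\<theta> ^ n)) * (Cf * (T powr (b - \<gamma>) * d powr \<gamma>))"
      by (intro mult_mono 1 2) (use A_ge in auto)
    then show ?thesis by (simp only: mult_ac)
  qed
  have side: "1/2 < \<beta> - \<gamma>" "0 \<le> A * d powr \<gamma>" "0 \<le> A * T powr (\<beta>/2) * (Cf * (T powr (b - \<gamma>) * d powr \<gamma>))" "0 \<le> ?\<theta>" "?\<theta> < 1"
    "\<And>n. (\<Sum>k<2^n. (F (dyadic T n (Suc k)) - F (dyadic T n k))\<^sup>2) \<le> (R * (2 powr ((\<beta> - \<gamma> - 1/2)/2)) ^ n)\<^sup>2"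
    using \<gamma> A_ge Cf half_powr_less_1[of "\<beta>/2"] \<beta>0 R by (auto simp: grid_bound_def)
  show "convergent (interval_sum T F (q t2 x) t1 t2)" by (rule interval_sum_convergent(1)[OF T_pos t \<beta>0 \<beta>(2) side(1,2) R0 side(3-6)], rule full, assumption+, rule part, assumption+)
  have "\<bar>lim (interval_sum T F (q t2 x) t1 t2)\<bar> \<le> \<bar>q t2 x 0 * (F t2 - F t1)\<bar> + (A * d powr \<gamma>) * R * level_const T (\<beta> - \<gamma>) \<beta>
      + (A * T powr (\<beta>/2) * (Cf * (T powr (b - \<gamma>) * d powr \<gamma>))) * (2 / (1 - ?\<theta>))" by (rule interval_sum_convergent(2)[OF T_pos t \<beta>0 \<beta>(2) side(1,2) R0 side(3-6)], rule full, assumption+, rule part, assumption+)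
  moreover have "\<bar>q t2 x 0 * (F t2 - F t1)\<bar> \<le> A * (Cf * (T powr (b - \<gamma>) * d powr \<gamma>))"
    unfolding abs_mult using q_bound[of t2 x 0] A_ge(1,6) Fd[of t1 t2] t by (intro mult_mono) auto
  moreover have "A * (Cf * (T powr (b - \<gamma>) * d powr \<gamma>)) + (A * d powr \<gamma>) * R * level_const T (\<beta> - \<gamma>) \<beta>
      + (A * T powr (\<beta>/2) * (Cf * (T powr (b - \<gamma>) * d powr \<gamma>))) * (2 / (1 - ?\<theta>)) \<le> tail_const \<gamma> b * (Cf + R) * d powr \<gamma>"
  proof -
    define c0 where "c0 = T powr (b - \<gamma>)"
    define c1 where "c1 = level_const T (\<beta> - \<gamma>) \<beta>"
    define c2 where "c2 = T powr (\<beta>/2) * T powr (b - \<gamma>) * (2 / (1 - ?\<theta>))"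
    have c: "0 \<le> c0" "0 \<le> c1" "0 \<le> c2" unfolding c0_def c1_def c2_def using level_const_nonneg[of "\<beta> - \<gamma>" T \<beta>] half_powr_less_1[of "\<beta>/2"] \<gamma> \<beta>0 by auto
    have s: "c0 * Cf + c1 * R + c2 * Cf \<le> (c0 + c1 + c2) * (Cf + R)"
      using c R0 Cf by (simp add: algebra_simps)
    have "A * (Cf * (T powr (b - \<gamma>) * d powr \<gamma>)) + (A * d powr \<gamma>) * R * level_const T (\<beta> - \<gamma>) \<beta>
      + (A * T powr (\<beta>/2) * (Cf * (T powr (b - \<gamma>) * d powr \<gamma>))) * (2 / (1 - ?\<theta>)) = (A * d powr \<gamma>) * (c0 * Cf + c1 * R + c2 * Cf)"
      by (simp add: c0_def c1_def c2_def algebra_simps)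
    also have "\<dots> \<le> (A * d powr \<gamma>) * ((c0 + c1 + c2) * (Cf + R))" using A_ge(1) s by (intro mult_left_mono) auto
    also have "\<dots> = tail_const \<gamma> b * (Cf + R) * d powr \<gamma>" by (simp add: tail_const_def c0_def c1_def c2_def mult_ac)
    finally show ?thesis .
  qed
  ultimately show "\<bar>lim (interval_sum T F (q t2 x) t1 t2)\<bar> \<le> tail_const \<gamma> b * (Cf + R) * (t2 - t1) powr \<gamma>"
    unfolding d_def by linarith
qed

end

section \<open>The equation\<close>

lemma abs_add3_diff:
  fixes p1 p2 p3 q1 q2 q3 A B C :: real
  assumes "\<bar>p1 - q1\<bar> \<le> A" "\<bar>p2 - q2\<bar> \<le> B" "\<bar>p3 - q3\<bar> \<le> C"
  shows "\<bar>(p1 + p2 + p3) - (q1 + q2 + q3)\<bar> \<le> A + B + C"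
  using assms by linarith

lemma clamp_to_measurable [measurable]: "clamp_to t1 t2 \<in> borel_measurable borel"
  unfolding clamp_to_def[abs_def] by measurable

lemma clamp_to_in: "t1 \<le> t2 \<Longrightarrow> t1 \<le> clamp_to t1 t2 s \<and> clamp_to t1 t2 s \<le> t2"
  by (auto simp: clamp_to_def)

lemma clamp_to_id: "t1 \<le> s \<Longrightarrow> s \<le> t2 \<Longrightarrow> clamp_to t1 t2 s = s"
  by (auto simp: clamp_to_def)

lemma clamp_to_restrict_measurable:
  "t1 \<le> t2 \<Longrightarrow> clamp_to t1 t2 \<in> measurable borel (restrict_space borel {t1..t2})"
  by (rule measurable_restrict_space2) (auto simp: clamp_to_in)

lemma drift_cong:
  assumes "\<And>s. 0 \<le> s \<Longrightarrow> s \<le> t \<Longrightarrow> h1 s = h2 s"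
  shows "drift a h1 t x = drift a h2 t x"
  unfolding drift_def using assms by (intro set_lebesgue_integral_cong) auto

text \<open>Clamping the time to \<open>[0, T]\<close> makes \<open>f\<close> and
  \<open>\<sigma>\<close> total while preserving their bounds and moduli of continuity; on
  \<open>[0, T]\<close> nothing changes.\<close>

locale spde = time_measure M T \<mu> +
  nl: nonlinearity "\<lambda>s. f (clamp_to 0 T s)" Kf Lf +
  hc: heat_coefficient "\<lambda>s. \<sigma> (clamp_to 0 T s)" a Cs Ks \<beta> T
  for M :: "'w measure" and T \<mu> f Kf Lf \<sigma> a Cs Ks \<beta> +
  fixes u0 :: "real \<Rightarrow> 'w \<Rightarrow> real" and \<beta>0 :: real and C0 C1 :: "'w \<Rightarrow> real"
  assumes a: "a \<noteq> 0"
    and u0_meas: "(\<lambda>(y, \<omega>). u0 y \<omega>) \<in> borel_measurable (borel \<Otimes>\<^sub>M M)"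
    and C0_meas: "C0 \<in> borel_measurable M" and C1_meas: "C1 \<in> borel_measurable M"
    and u0_bound: "\<And>\<omega> y. \<omega> \<in> space M \<Longrightarrow> \<bar>u0 y \<omega>\<bar> \<le> C0 \<omega>"
    and u0_holder: "\<And>\<omega> y1 y2. \<omega> \<in> space M \<Longrightarrow> \<bar>u0 y1 \<omega> - u0 y2 \<omega>\<bar> \<le> C1 \<omega> * \<bar>y1 - y2\<bar> powr \<beta>0"
    and \<beta>0: "1/2 \<le> \<beta>0" "\<beta>0 \<le> 1"
begin

abbreviation cl :: "real \<Rightarrow> real" where "cl \<equiv> clamp_to 0 T"
abbreviation fc :: "real \<Rightarrow> real \<Rightarrow> real \<Rightarrow> real" where "fc \<equiv> \<lambda>s. f (cl s)"

definition init :: "real \<Rightarrow> real \<Rightarrow> 'w \<Rightarrow> real" where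
  "init t x \<omega> = gauss_avg (heat_sd a t) x (\<lambda>y. u0 y \<omega>)"

definition noise :: "real \<Rightarrow> real \<Rightarrow> 'w \<Rightarrow> real" where
  "noise t x = stochastic_integral M BT \<mu> {0<..t} (\<lambda>s. indicator {0<..t} s * hc.q t x s)"

lemma cl_in: "0 \<le> cl t \<and> cl t \<le> T" and cl_id: "0 \<le> t \<Longrightarrow> t \<le> T \<Longrightarrow> cl t = t"
  using clamp_to_in[of 0 T t] clamp_to_id[of 0 t T] T_pos by auto

lemma cl_BT: "cl \<in> measurable borel BT"
  using clamp_to_restrict_measurable[of 0 T] T_pos by simp

lemma noise_integrand:
  assumes "0 \<le> t" "t \<le> T"
  shows "(\<lambda>s. indicator {0<..t} s * heat_convolution a (t - s) x (\<lambda>y. \<sigma> s y)) = (\<lambda>s. indicator {0<..t} s * hc.q t x s)"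
proof (rule ext)
  fix s
  show "indicator {0<..t} s * heat_convolution a (t - s) x (\<lambda>y. \<sigma> s y) = indicator {0<..t} s * hc.q t x s"
  proof (cases "s \<in> {0<..t}")
    case True
    then have "cl s = s" using assms by (intro cl_id) auto
    then show ?thesis using True a by (simp add: hc.q_def heat_convolution_eq_gauss_avg heat_sd_def)
  qed simp
qed

lemma noise_facts:
  assumes H: "0 < H" "H \<le> T" and t: "0 \<le> t" "t \<le> H"
    and F: "\<And>s. 0 \<le> s \<Longrightarrow> s \<le> t \<Longrightarrow> F s \<in> borel_measurable M" "\<And>s. 0 \<le> s \<Longrightarrow> s \<le> t \<Longrightarrow> AE \<omega> in M. F s \<omega> = \<mu> {0<..s} \<omega>"
  shows "stochastic_integrable M BT \<mu> (\<lambda>s. indicator {0<..t} s * hc.q t x s)"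
    and "noise t x \<in> borel_measurable M"
    and "(\<lambda>n. l0norm M (\<lambda>\<omega>. dyadic_sum H (\<lambda>s. F s \<omega>) (hc.q t x) t n - noise t x \<omega>)) \<longlonglongrightarrow> 0"
  unfolding noise_def
  by (rule stochastic_integral_dyadic_sum[OF H t F, where \<kappa>="\<beta>/2" and C=hc.A1];
      use hc.q_s1 hc.A1_nonneg hc.\<beta> t H in force)+

lemma noise_integrable:
  assumes "0 \<le> t" "t \<le> T"
  shows "stochastic_integrable M BT \<mu> (\<lambda>s. indicator {0<..t} s * hc.q t x s)" "noise t x \<in> borel_measurable M"
  using noise_facts(1,2)[OF T_pos order_refl assms, of "\<lambda>s. \<mu> {0<..s}" x] assms by auto

lemma section_u0: "\<omega> \<in> space M \<Longrightarrow> (\<lambda>y. u0 y \<omega>) \<in> borel_measurable borel"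
  using measurable_compose[OF measurable_Pair2' u0_meas] by simp

lemma C0_nonneg: "\<omega> \<in> space M \<Longrightarrow> 0 \<le> C0 \<omega>"
  using u0_bound[of \<omega> 0] by linarith

lemma C1_nonneg: "\<omega> \<in> space M \<Longrightarrow> 0 \<le> C1 \<omega>"
  using u0_holder[of \<omega> 0 1] by simp

lemma init_measurable:
  assumes "t \<in> borel_measurable P" "x \<in> borel_measurable P" and w: "w \<in> measurable P M"
  shows "(\<lambda>p. init (t p) (x p) (w p)) \<in> borel_measurable P"
  unfolding init_def
proof (rule gauss_avg_measurable)
  have "(\<lambda>q. (snd q, w (fst q))) \<in> measurable (P \<Otimes>\<^sub>M borel) (borel \<Otimes>\<^sub>M M)" using w by measurable
  from measurable_compose[OF this u0_meas]
  show "(\<lambda>(p, y). u0 y (w p)) \<in> borel_measurable (P \<Otimes>\<^sub>M borel)" by (simp add: split_beta')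
qed (use assms in measurable)

lemma process_clamp:
  assumes u: "(\<lambda>(t, x, \<omega>). u t x \<omega>) \<in> borel_measurable (BT \<Otimes>\<^sub>M borel \<Otimes>\<^sub>M M)"
  shows "(\<lambda>(t, x, \<omega>). u (cl t) x \<omega>) \<in> borel_measurable (borel \<Otimes>\<^sub>M borel \<Otimes>\<^sub>M M)"
proof -
  note [measurable] = cl_BT
  have "(\<lambda>p. (cl (fst p), fst (snd p), snd (snd p))) \<in> measurable (borel \<Otimes>\<^sub>M borel \<Otimes>\<^sub>M M) (BT \<Otimes>\<^sub>M borel \<Otimes>\<^sub>M M)" by measurable
  from measurable_compose[OF this u] show ?thesis by (simp add: split_beta')
qed

text \<open>The clause on stochastic integrability disappears because Hoelder continuity of the
  integrand in \<open>s\<close> provides it; the rest is a change to Gaussian averages and clamped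
  times.\<close>

lemma mild_solution_iff:
  "mild_solution M T a \<mu> u0 f \<sigma> u \<longleftrightarrow>
    (\<lambda>(t, x, \<omega>). u t x \<omega>) \<in> borel_measurable (BT \<Otimes>\<^sub>M borel \<Otimes>\<^sub>M M) \<and>
    (\<forall>t\<in>{0..T}. \<forall>x. AE \<omega> in M. u t x \<omega> = init t x \<omega> + drift a (\<lambda>s y. fc s y (u (cl s) y \<omega>)) t x + noise t x \<omega>)"
proof -
  have 1: "heat_convolution a t x (\<lambda>y. u0 y \<omega>) = init t x \<omega>" if "t \<in> {0..T}" for t x \<omega>
    using that a by (simp add: init_def heat_convolution_eq_gauss_avg heat_sd_def)
  have 2: "(LINT s:{0..t}|lborel. heat_convolution a (t - s) x (\<lambda>y. f s y (u s y \<omega>))) = drift a (\<lambda>s y. fc s y (u (cl s) y \<omega>)) t x"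
    if "t \<in> {0..T}" for t x \<omega>
    unfolding drift_def
  proof (rule set_lebesgue_integral_cong)
    show "\<forall>s. s \<in> {0..t} \<longrightarrow> heat_convolution a (t - s) x (\<lambda>y. f s y (u s y \<omega>)) = gauss_avg (heat_sd a (t - s)) x (\<lambda>y. fc s y (u (cl s) y \<omega>))"
    proof (intro allI impI)
      fix s assume "s \<in> {0..t}"
      then have "cl s = s" "0 \<le> t - s" using that by (auto intro!: cl_id)
      then show "heat_convolution a (t - s) x (\<lambda>y. f s y (u s y \<omega>)) = gauss_avg (heat_sd a (t - s)) x (\<lambda>y. fc s y (u (cl s) y \<omega>))"
        using a by (simp add: heat_convolution_eq_gauss_avg heat_sd_def)
    qed
  qed simp
  show ?thesis
    unfolding mild_solution_def
  proof (intro conj_cong refl ball_cong all_cong1)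
    fix t x assume t: "t \<in> {0..T}"
    have 3: "(\<lambda>s. indicator {0<..t} s * heat_convolution a (t - s) x (\<lambda>y. \<sigma> s y)) = (\<lambda>s. indicator {0<..t} s * hc.q t x s)"
      using t by (intro noise_integrand) auto
    show "(stochastic_integrable M BT \<mu> (\<lambda>s. indicator {0<..t} s * heat_convolution a (t - s) x (\<lambda>y. \<sigma> s y)) \<and>
        (AE \<omega> in M. u t x \<omega> = heat_convolution a t x (\<lambda>y. u0 y \<omega>)
             + (LINT s:{0..t}|lborel. heat_convolution a (t - s) x (\<lambda>y. f s y (u s y \<omega>)))
             + stochastic_integral M BT \<mu> {0<..t} (\<lambda>s. indicator {0<..t} s * heat_convolution a (t - s) x (\<lambda>y. \<sigma> s y)) \<omega>)) =
        (AE \<omega> in M. u t x \<omega> = init t x \<omega> + drift a (\<lambda>s y. fc s y (u (cl s) y \<omega>)) t x + noise t x \<omega>)"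
      unfolding 3 1[OF t] 2[OF t] noise_def[symmetric] using noise_integrable(1)[of t x] t by auto
  qed
qed

text \<open>The stochastic term is only a class at each \<open>(t, x)\<close>. Dyadic sums of a
  jointly measurable \<open>F\<close> converge to it in probability, and
  \<open>measurable_version\<close> turns them into \<open>Z\<close>. With \<open>V\<close> built
  from \<open>Z\<close> the equation is solved for every \<omega>, and \<open>Z\<close> agrees with
  the stochastic term almost surely at each point.\<close>

theorem mild_solution_exists: "\<exists>u. mild_solution M T a \<mu> u0 f \<sigma> u"
proof -
  obtain F0 where F0: "(\<lambda>(t, \<omega>). F0 t \<omega>) \<in> borel_measurable (BT \<Otimes>\<^sub>M M)" "\<And>t. t \<in> {0..T} \<Longrightarrow> AE \<omega> in M. F0 t \<omega> = \<mu> {0<..t} \<omega>"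
    using measurable_distribution_process by blast
  define F where "F t \<omega> = F0 (cl t) \<omega>" for t \<omega>
  have Fm: "(\<lambda>p. F (t p) (w p)) \<in> borel_measurable P" if t: "t \<in> borel_measurable P" and w: "w \<in> measurable P M" for t w and P :: "'x measure"
  proof -
    note [measurable] = cl_BT t w
    have "(\<lambda>p. (cl (t p), w p)) \<in> measurable P (BT \<Otimes>\<^sub>M M)" by measurable
    from measurable_compose[OF this F0(1)] show ?thesis by (simp add: F_def)
  qed
  have Fae: "AE \<omega> in M. F t \<omega> = \<mu> {0<..t} \<omega>" if "0 \<le> t" "t \<le> T" for t
    using F0(2)[of t] cl_id[OF that] that by (simp add: F_def)
  define X where "X n p \<omega> = dyadic_sum T (\<lambda>s. F s \<omega>) (hc.q (cl (fst p)) (snd p)) (cl (fst p)) n" for n p \<omega>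
  have "\<exists>Z. (\<lambda>(p, \<omega>). Z p \<omega>) \<in> borel_measurable ((borel \<Otimes>\<^sub>M borel) \<Otimes>\<^sub>M M) \<and>
      (\<forall>p\<in>space (borel \<Otimes>\<^sub>M borel). AE \<omega> in M. Z p \<omega> = noise (cl (fst p)) (snd p) \<omega>)"
  proof (rule measurable_version[where X=X])
    fix n
    show "(\<lambda>(p, \<omega>). X n p \<omega>) \<in> borel_measurable ((borel \<Otimes>\<^sub>M borel) \<Otimes>\<^sub>M M)"
      unfolding X_def dyadic_sum_def split_beta'
      by (intro borel_measurable_sum borel_measurable_times borel_measurable_diff hc.q_measurable Fm) measurable
  next
    fix p :: "real \<times> real"
    have t: "0 \<le> cl (fst p)" "cl (fst p) \<le> T" using cl_in by auto
    show "noise (cl (fst p)) (snd p) \<in> borel_measurable M" by (rule noise_integrable(2)[OF t])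
    show "(\<lambda>n. l0norm M (\<lambda>\<omega>. X n p \<omega> - noise (cl (fst p)) (snd p) \<omega>)) \<longlonglongrightarrow> 0"
      unfolding X_def
    proof (rule noise_facts(3)[OF T_pos order_refl t])
      show "F s \<in> borel_measurable M" for s using Fm[of "\<lambda>_. s" M "\<lambda>\<omega>. \<omega>"] by simp
      show "AE \<omega> in M. F s \<omega> = \<mu> {0<..s} \<omega>" if "0 \<le> s" "s \<le> cl (fst p)" for s using that t by (intro Fae) auto
    qed
  qed
  then obtain Z where Z: "(\<lambda>(p, \<omega>). Z p \<omega>) \<in> borel_measurable ((borel \<Otimes>\<^sub>M borel) \<Otimes>\<^sub>M M)"
    "\<And>p. AE \<omega> in M. Z p \<omega> = noise (cl (fst p)) (snd p) \<omega>"
    by (auto simp: space_pair_measure)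
  define V where "V t x \<omega> = init (cl t) x \<omega> + Z (t, x) \<omega>" for t x \<omega>
  have "(\<lambda>p. init (cl (fst p)) (fst (snd p)) (snd (snd p))) \<in> borel_measurable (borel \<Otimes>\<^sub>M borel \<Otimes>\<^sub>M M)"
    by (rule init_measurable) measurable
  moreover have "(\<lambda>p. Z (fst p, fst (snd p)) (snd (snd p))) \<in> borel_measurable (borel \<Otimes>\<^sub>M borel \<Otimes>\<^sub>M M)"
  proof -
    have "(\<lambda>p. ((fst p, fst (snd p)), snd (snd p))) \<in> measurable (borel \<Otimes>\<^sub>M borel \<Otimes>\<^sub>M M) ((borel \<Otimes>\<^sub>M borel) \<Otimes>\<^sub>M M)" by measurable
    from measurable_compose[OF this Z(1)] show ?thesis by simp
  qed
  ultimately have Vm: "(\<lambda>(t, x, \<omega>). V t x \<omega>) \<in> borel_measurable (borel \<Otimes>\<^sub>M borel \<Otimes>\<^sub>M M)"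
    by (simp add: V_def split_beta')
  obtain u where u: "(\<lambda>(t, x, \<omega>). u t x \<omega>) \<in> borel_measurable (borel \<Otimes>\<^sub>M borel \<Otimes>\<^sub>M M)"
    "\<And>\<omega> t x. \<omega> \<in> space M \<Longrightarrow> u t x \<omega> = V t x \<omega> + drift a (\<lambda>s y. fc s y (u s y \<omega>)) t x"
    using nl.mild_equation_solvable[OF Vm, of a] by blast
  have "mild_solution M T a \<mu> u0 f \<sigma> u"
    unfolding mild_solution_iff
  proof (intro conjI ballI allI)
    have id: "(\<lambda>t. t) \<in> measurable BT borel" by (rule measurable_restrict_space1) simp
    note [measurable] = id
    have "(\<lambda>p. (fst p, fst (snd p), snd (snd p))) \<in> measurable (BT \<Otimes>\<^sub>M borel \<Otimes>\<^sub>M M) (borel \<Otimes>\<^sub>M borel \<Otimes>\<^sub>M M)"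
      by (intro measurable_Pair measurable_compose[OF measurable_fst id] measurable_compose[OF measurable_snd measurable_fst] measurable_compose[OF measurable_snd measurable_snd])
    from measurable_compose[OF this u(1)]
    show "(\<lambda>(t, x, \<omega>). u t x \<omega>) \<in> borel_measurable (BT \<Otimes>\<^sub>M borel \<Otimes>\<^sub>M M)" by (simp add: split_beta')
    fix t x assume t: "t \<in> {0..T}"
    then have ct: "cl t = t" by (intro cl_id) auto
    show "AE \<omega> in M. u t x \<omega> = init t x \<omega> + drift a (\<lambda>s y. fc s y (u (cl s) y \<omega>)) t x + noise t x \<omega>"
      using Z(2)[of "(t, x)"] AE_space
    proof eventually_elim
      case (elim \<omega>)
      have "drift a (\<lambda>s y. fc s y (u (cl s) y \<omega>)) t x = drift a (\<lambda>s y. fc s y (u s y \<omega>)) t x"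
        using t by (intro drift_cong) (auto simp: cl_id)
      then show ?case using u(2)[OF elim(2), of t x] elim(1) by (simp add: V_def ct)
    qed
  qed
  then show ?thesis by blast
qed

theorem mild_solution_unique:
  assumes u: "mild_solution M T a \<mu> u0 f \<sigma> u" and v: "mild_solution M T a \<mu> u0 f \<sigma> v" and t: "t \<in> {0..T}"
  shows "AE \<omega> in M. u t x \<omega> = v t x \<omega>"
proof -
  have um: "(\<lambda>(t, x, \<omega>). u t x \<omega>) \<in> borel_measurable (BT \<Otimes>\<^sub>M borel \<Otimes>\<^sub>M M)"
    and ue: "\<And>t x. t \<in> {0..T} \<Longrightarrow> AE \<omega> in M. u t x \<omega> = init t x \<omega> + drift a (\<lambda>s y. fc s y (u (cl s) y \<omega>)) t x + noise t x \<omega>"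
    using u unfolding mild_solution_iff by auto
  have vm: "(\<lambda>(t, x, \<omega>). v t x \<omega>) \<in> borel_measurable (BT \<Otimes>\<^sub>M borel \<Otimes>\<^sub>M M)"
    and ve: "\<And>t x. t \<in> {0..T} \<Longrightarrow> AE \<omega> in M. v t x \<omega> = init t x \<omega> + drift a (\<lambda>s y. fc s y (v (cl s) y \<omega>)) t x + noise t x \<omega>"
    using v unfolding mild_solution_iff by auto
  have "AE \<omega> in M. u (cl t) x \<omega> = v (cl t) x \<omega>"
  proof (rule nl.mild_equation_unique[OF prob_space_axioms process_clamp[OF um] process_clamp[OF vm], where T=T and a=a])
    fix t x assume t: "0 \<le> t" "t \<le> T"
    have tT: "t \<in> {0..T}" using t by simp
    have "AE \<omega> in M. u t x \<omega> - v t x \<omega> = drift a (\<lambda>s y. fc s y (u (cl s) y \<omega>)) t x - drift a (\<lambda>s y. fc s y (v (cl s) y \<omega>)) t x"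
      using ue[OF tT, of x] ve[OF tT, of x] by eventually_elim simp
    then show "AE \<omega> in M. u (cl t) x \<omega> - v (cl t) x \<omega> = drift a (\<lambda>s y. fc s y (u (cl s) y \<omega>)) t x - drift a (\<lambda>s y. fc s y (v (cl s) y \<omega>)) t x"
      by (simp add: cl_id[OF t])
  qed (use t in auto)
  then show ?thesis using t by (simp add: cl_id)
qed

text \<open>For distances above 1 a bound of order \<open>\<beta>0\<close> does not imply one of
  order \<open>\<gamma>\<close>; there boundedness of \<open>u0\<close> takes over, whence the
  summand \<open>2 * C0 \<omega>\<close>.\<close>

lemma init_space:
  assumes w: "\<omega> \<in> space M" and \<gamma>: "0 < \<gamma>" "\<gamma> \<le> \<beta>0"
  shows "\<bar>init t x1 \<omega> - init t x2 \<omega>\<bar> \<le> (C1 \<omega> + 2 * C0 \<omega>) * \<bar>x1 - x2\<bar> powr \<gamma>"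
proof -
  have "\<bar>init t x1 \<omega> - init t x2 \<omega>\<bar> \<le> 0 + C1 \<omega> * (\<bar>x1 - x2\<bar> powr \<beta>0 + gauss_moment * \<bar>heat_sd a t - heat_sd a t\<bar> powr \<beta>0)"
    unfolding init_def using w \<beta>0 C1_nonneg[OF w] u0_holder[OF w] u0_bound[OF w]
    by (intro gauss_avg_holder[OF section_u0[OF w] _ section_u0[OF w], where K="C0 \<omega>"]) auto
  then have 1: "\<bar>init t x1 \<omega> - init t x2 \<omega>\<bar> \<le> C1 \<omega> * \<bar>x1 - x2\<bar> powr \<beta>0" by simp
  have b: "\<bar>init t x \<omega>\<bar> \<le> C0 \<omega>" for x
    unfolding init_def by (rule gauss_avg_bounded[OF section_u0[OF w] u0_bound[OF w]])
  have 2: "\<bar>init t x1 \<omega> - init t x2 \<omega>\<bar> \<le> 2 * C0 \<omega>" using b[of x1] b[of x2] by linarith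
  note nn = C0_nonneg[OF w] C1_nonneg[OF w]
  show ?thesis
  proof (cases "\<bar>x1 - x2\<bar> \<le> 1")
    case True
    have "\<bar>x1 - x2\<bar> powr \<beta>0 \<le> \<bar>x1 - x2\<bar> powr \<gamma>" using True \<gamma> by (intro powr_mono') auto
    then have "C1 \<omega> * \<bar>x1 - x2\<bar> powr \<beta>0 \<le> C1 \<omega> * \<bar>x1 - x2\<bar> powr \<gamma>" using nn by (intro mult_left_mono)
    moreover have "0 \<le> 2 * C0 \<omega> * \<bar>x1 - x2\<bar> powr \<gamma>" using nn by simp
    ultimately show ?thesis using 1 by (simp add: distrib_right)
  next
    case False
    have "1 \<le> \<bar>x1 - x2\<bar> powr \<gamma>" using False \<gamma> by (intro ge_one_powr_ge_zero) auto
    then have "2 * C0 \<omega> * 1 \<le> 2 * C0 \<omega> * \<bar>x1 - x2\<bar> powr \<gamma>" using nn by (intro mult_left_mono) auto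
    moreover have "0 \<le> C1 \<omega> * \<bar>x1 - x2\<bar> powr \<gamma>" using nn by simp
    ultimately show ?thesis using 2 by (simp add: distrib_right)
  qed
qed

text \<open>Down to time 0 the available order is only \<open>\<beta>0 / 2\<close>, since the kernel
  width grows like a square root. Away from 0 the order is \<open>\<beta>0\<close>, at the price of
  \<open>\<delta> powr (-(\<beta>0/2))\<close>; this is the reason for \<open>\<delta>\<close> in
  the final statement.\<close>

lemma init_time:
  assumes w: "\<omega> \<in> space M" and \<gamma>: "0 < \<gamma>" "\<gamma> \<le> \<beta>0" and t: "0 < \<delta>" "\<delta> \<le> t1" "t1 \<le> t2" "t2 \<le> T"
  shows "\<bar>init t2 x \<omega> - init t1 x \<omega>\<bar> \<le> (C1 \<omega> * gauss_moment * (\<bar>a\<bar> * sqrt 2) powr \<beta>0 * T powr (\<beta>0 - \<gamma>) * \<delta> powr (-(\<beta>0/2))) * (t2 - t1) powr \<gamma>"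
proof -
  note nn = C1_nonneg[OF w] gauss_moment_nonneg
  have "\<bar>init t2 x \<omega> - init t1 x \<omega>\<bar> \<le> 0 + C1 \<omega> * (\<bar>x - x\<bar> powr \<beta>0 + gauss_moment * \<bar>heat_sd a t2 - heat_sd a t1\<bar> powr \<beta>0)"
    unfolding init_def using w \<beta>0 C1_nonneg[OF w] u0_holder[OF w] u0_bound[OF w]
    by (intro gauss_avg_holder[OF section_u0[OF w] _ section_u0[OF w], where K="C0 \<omega>"]) auto
  also have "\<dots> = C1 \<omega> * gauss_moment * \<bar>heat_sd a t2 - heat_sd a t1\<bar> powr \<beta>0" by simp
  also have "\<dots> \<le> C1 \<omega> * gauss_moment * ((\<bar>a\<bar> * sqrt 2) powr \<beta>0 * ((t2 - t1) powr \<beta>0 * t2 powr (-(\<beta>0/2))))"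
    using t \<beta>0 nn by (intro mult_left_mono heat_sd_diff(2)) auto
  also have "\<dots> \<le> C1 \<omega> * gauss_moment * ((\<bar>a\<bar> * sqrt 2) powr \<beta>0 * ((T powr (\<beta>0 - \<gamma>) * (t2 - t1) powr \<gamma>) * \<delta> powr (-(\<beta>0/2))))"
  proof (intro mult_left_mono mult_mono)
    have "(t2 - t1) powr \<beta>0 = (t2 - t1) powr (\<beta>0 - \<gamma>) * (t2 - t1) powr \<gamma>" by (simp add: powr_add[symmetric])
    also have "\<dots> \<le> T powr (\<beta>0 - \<gamma>) * (t2 - t1) powr \<gamma>" using t \<gamma> by (intro mult_right_mono powr_mono2) auto
    finally show "(t2 - t1) powr \<beta>0 \<le> T powr (\<beta>0 - \<gamma>) * (t2 - t1) powr \<gamma>" .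
    show "t2 powr (-(\<beta>0/2)) \<le> \<delta> powr (-(\<beta>0/2))" using t \<beta>0 by (intro powr_mono2') auto
  qed (use nn in auto)
  finally show ?thesis by (simp only: mult_ac)
qed

text \<open>The root of a weighted series over all levels, so that every single level is bounded by
  the whole. The weight is the reciprocal of the growth that \<open>grid_bound\<close>
  allows.\<close>

definition grid_const :: "real \<Rightarrow> (real \<Rightarrow> 'w \<Rightarrow> real) \<Rightarrow> real \<Rightarrow> 'w \<Rightarrow> real" where
  "grid_const H F \<alpha> \<omega> = sqrt (\<Sum>n. ((2 powr (-(\<alpha> - 1/2)/2)) ^ n)\<^sup>2 * (\<Sum>k<2^n. (F (dyadic H n (Suc k)) \<omega> - F (dyadic H n k) \<omega>)\<^sup>2))"

lemma grid_const_bound: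
  assumes H: "0 < H" "H \<le> T" and \<alpha>: "1/2 < \<alpha>"
    and F: "\<And>s. 0 \<le> s \<Longrightarrow> s \<le> H \<Longrightarrow> F s \<in> borel_measurable M" "\<And>s. 0 \<le> s \<Longrightarrow> s \<le> H \<Longrightarrow> AE \<omega> in M. F s \<omega> = \<mu> {0<..s} \<omega>"
  shows "grid_const H F \<alpha> \<in> borel_measurable M"
    and "AE \<omega> in M. hc.grid_bound H (\<lambda>s. F s \<omega>) \<alpha> (grid_const H F \<alpha> \<omega>)"
proof -
  define c where "c = 2 powr (-(\<alpha> - 1/2)/2)"
  have c: "0 < c" "c < 1" using \<alpha> powr_less_mono[of "-(\<alpha> - 1/2)/2" 0 2] by (auto simp: c_def)
  let ?S = "\<lambda>\<omega> n. (c ^ n)\<^sup>2 * (\<Sum>k<2^n. (F (dyadic H n (Suc k)) \<omega> - F (dyadic H n k) \<omega>)\<^sup>2)"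
  have Fd: "F (dyadic H n k) \<in> borel_measurable M" if "k \<le> 2^n" for n k
    using that H by (intro F) (auto intro: dyadic_le)
  have m: "(\<lambda>\<omega>. ?S \<omega> n) \<in> borel_measurable M" for n
    by (intro borel_measurable_times borel_measurable_const borel_measurable_sum borel_measurable_power borel_measurable_diff Fd) auto
  have gc: "grid_const H F \<alpha> = (\<lambda>\<omega>. sqrt (\<Sum>n. ?S \<omega> n))" by (simp add: grid_const_def c_def fun_eq_iff)
  show "grid_const H F \<alpha> \<in> borel_measurable M"
    unfolding gc by (intro measurable_compose[OF borel_measurable_suminf[OF m] borel_measurable_continuous_onI] continuous_intros)
  have "AE \<omega> in M. F (dyadic H n (Suc k)) \<omega> - F (dyadic H n k) \<omega> = \<mu> {dyadic H n k<..dyadic H n (Suc k)} \<omega>" if k: "k < 2^n" for n k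
  proof -
    have d: "0 \<le> dyadic H n k" "dyadic H n k \<le> dyadic H n (Suc k)" "dyadic H n (Suc k) \<le> H"
      using H k dyadic_mono[of H k "Suc k" n] dyadic_le[of H "Suc k" n] by auto
    have a1: "AE \<omega> in M. \<mu> {dyadic H n k<..dyadic H n (Suc k)} \<omega> = \<mu> {0<..dyadic H n (Suc k)} \<omega> - \<mu> {0<..dyadic H n k} \<omega>"
      using d H by (intro mu_interval_diff) auto
    have a2: "AE \<omega> in M. F (dyadic H n (Suc k)) \<omega> = \<mu> {0<..dyadic H n (Suc k)} \<omega>" using d by (intro F(2)) auto
    have a3: "AE \<omega> in M. F (dyadic H n k) \<omega> = \<mu> {0<..dyadic H n k} \<omega>" using d by (intro F(2)) auto
    show ?thesis using a1 a2 a3 by eventually_elim simp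
  qed
  then have "AE \<omega> in M. \<forall>n. \<forall>k\<in>{..<2^n}. F (dyadic H n (Suc k)) \<omega> - F (dyadic H n k) \<omega> = \<mu> {dyadic H n k<..dyadic H n (Suc k)} \<omega>"
    unfolding AE_all_countable by (intro allI AE_finite_allI) auto
  then show "AE \<omega> in M. hc.grid_bound H (\<lambda>s. F s \<omega>) \<alpha> (grid_const H F \<alpha> \<omega>)"
    using dyadic_square_summable[OF H c]
  proof eventually_elim
    case (elim \<omega>)
    have s: "summable (?S \<omega>)"
    proof -
      have "?S \<omega> = (\<lambda>n. (c^n)\<^sup>2 * (\<Sum>k<2^n. (\<mu> {dyadic H n k<..dyadic H n (Suc k)} \<omega>)\<^sup>2))"
        by (rule ext) (use elim(1) in simp)
      then show ?thesis using elim(2) by (simp only:)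
    qed
    have nn: "0 \<le> ?S \<omega> n" for n by (intro mult_nonneg_nonneg sum_nonneg) auto
    have sn: "0 \<le> (\<Sum>n. ?S \<omega> n)" by (rule suminf_nonneg[OF s nn])
    show ?case unfolding hc.grid_bound_def
    proof (intro conjI allI)
      show "0 \<le> grid_const H F \<alpha> \<omega>" using sn by (simp add: gc)
      fix n
      define Q where "Q = (\<Sum>k<2^n. (F (dyadic H n (Suc k)) \<omega> - F (dyadic H n k) \<omega>)\<^sup>2)"
      have "?S \<omega> n \<le> (\<Sum>n. ?S \<omega> n)" using sum_le_suminf[OF s, of "{n}"] nn by simp
      then have 1: "(c^n)\<^sup>2 * Q \<le> (grid_const H F \<alpha> \<omega>)\<^sup>2" using sn by (simp add: gc Q_def)
      have "c ^ n * (2 powr ((\<alpha> - 1/2)/2)) ^ n = 1"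
      proof -
        have e: "-(\<alpha> - 1/2)/2 + (\<alpha> - 1/2)/2 = 0" by (simp add: field_simps)
        show ?thesis unfolding c_def power_mult_distrib[symmetric] powr_add[symmetric] e by simp
      qed
      then have "(c^n)\<^sup>2 * ((2 powr ((\<alpha> - 1/2)/2)) ^ n)\<^sup>2 = 1" by (metis power_mult_distrib power_one)
      then have "Q = ((c^n)\<^sup>2 * Q) * ((2 powr ((\<alpha> - 1/2)/2)) ^ n)\<^sup>2" by (metis mult.assoc mult.commute mult_1)
      also have "\<dots> \<le> (grid_const H F \<alpha> \<omega>)\<^sup>2 * ((2 powr ((\<alpha> - 1/2)/2)) ^ n)\<^sup>2"
        by (rule mult_right_mono[OF 1]) simp
      also have "\<dots> = (grid_const H F \<alpha> \<omega> * (2 powr ((\<alpha> - 1/2)/2)) ^ n)\<^sup>2" by (rule power_mult_distrib[symmetric])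
      finally show "Q \<le> (grid_const H F \<alpha> \<omega> * (2 powr ((\<alpha> - 1/2)/2)) ^ n)\<^sup>2" .
    qed
  qed
qed

text \<open>The same sums converge pathwise to the limit and in probability to the stochastic
  integral, and limits in probability are almost surely unique.\<close>

lemma noise_version:
  assumes H: "0 < H" "H \<le> T" and t: "0 \<le> t" "t \<le> H"
    and F: "\<And>s. 0 \<le> s \<Longrightarrow> s \<le> t \<Longrightarrow> F s \<in> borel_measurable M" "\<And>s. 0 \<le> s \<Longrightarrow> s \<le> t \<Longrightarrow> AE \<omega> in M. F s \<omega> = \<mu> {0<..s} \<omega>"
    and c: "AE \<omega> in M. convergent (interval_sum H (\<lambda>s. F s \<omega>) (hc.q t x) 0 t)"
  shows "(\<lambda>\<omega>. lim (interval_sum H (\<lambda>s. F s \<omega>) (hc.q t x) 0 t)) \<in> borel_measurable M"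
    and "AE \<omega> in M. lim (interval_sum H (\<lambda>s. F s \<omega>) (hc.q t x) 0 t) = noise t x \<omega>"
proof -
  note ds = dyadic_sum_eq_interval_sum[OF H(1) t(1)]
  have Fm: "F (min (dyadic H n k) t) \<in> borel_measurable M" for n k using t H by (intro F) auto
  have m: "(\<lambda>\<omega>. dyadic_sum H (\<lambda>s. F s \<omega>) (hc.q t x) t n) \<in> borel_measurable M" for n
    unfolding dyadic_sum_def by (intro borel_measurable_sum borel_measurable_times borel_measurable_diff borel_measurable_const Fm)
  then have m': "(\<lambda>\<omega>. interval_sum H (\<lambda>s. F s \<omega>) (hc.q t x) 0 t n) \<in> borel_measurable M" for n by (simp add: ds)
  show lm: "(\<lambda>\<omega>. lim (interval_sum H (\<lambda>s. F s \<omega>) (hc.q t x) 0 t)) \<in> borel_measurable M"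
    using borel_measurable_lim_metric[OF m'] by simp
  have nm: "noise t x \<in> borel_measurable M" using t H by (intro noise_integrable) auto
  have "(\<lambda>n. l0norm M (\<lambda>\<omega>. interval_sum H (\<lambda>s. F s \<omega>) (hc.q t x) 0 t n - lim (interval_sum H (\<lambda>s. F s \<omega>) (hc.q t x) 0 t))) \<longlonglongrightarrow> 0"
    using c by (intro l0norm_tendsto_AE[OF m' lm]) (auto simp: convergent_LIMSEQ_iff)
  moreover have "(\<lambda>n. l0norm M (\<lambda>\<omega>. interval_sum H (\<lambda>s. F s \<omega>) (hc.q t x) 0 t n - noise t x \<omega>)) \<longlonglongrightarrow> 0"
    using noise_facts(3)[OF H t F, of x] by (simp add: ds)
  ultimately show "AE \<omega> in M. lim (interval_sum H (\<lambda>s. F s \<omega>) (hc.q t x) 0 t) = noise t x \<omega>"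
    by (intro l0norm_unique[OF m' lm nm])
qed

lemma lim_interval_sum_diff:
  assumes "convergent (interval_sum H F q1 t1 t2)" "convergent (interval_sum H F q2 t1 t2)"
  shows "lim (interval_sum H F q1 t1 t2) - lim (interval_sum H F q2 t1 t2) = lim (interval_sum H F (\<lambda>s. q1 s - q2 s) t1 t2)"
proof -
  have "(\<lambda>n. interval_sum H F q1 t1 t2 n - interval_sum H F q2 t1 t2 n) \<longlonglongrightarrow> lim (interval_sum H F q1 t1 t2) - lim (interval_sum H F q2 t1 t2)"
    using assms by (intro tendsto_diff) (auto simp: convergent_LIMSEQ_iff)
  then have "interval_sum H F (\<lambda>s. q1 s - q2 s) t1 t2 \<longlonglongrightarrow> lim (interval_sum H F q1 t1 t2) - lim (interval_sum H F q2 t1 t2)"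
    by (simp add: interval_sum_diff[abs_def])
  then show ?thesis by (simp add: limI)
qed

definition drift_space_const :: "real \<Rightarrow> real" where
  "drift_space_const \<gamma> = 2 * Kf * (\<bar>a\<bar> * sqrt 2) powr (-\<gamma>) * (T powr (1 - \<gamma>/2) / (1 - \<gamma>/2))"

lemma drift_process:
  assumes u: "(\<lambda>(t, x, \<omega>). u t x \<omega>) \<in> borel_measurable (BT \<Otimes>\<^sub>M borel \<Otimes>\<^sub>M M)"
  shows "\<omega> \<in> space M \<Longrightarrow> bounded_field (\<lambda>s y. fc s y (u (cl s) y \<omega>)) Kf"
    and "(\<lambda>\<omega>. drift a (\<lambda>s y. fc s y (u (cl s) y \<omega>)) t x) \<in> borel_measurable M"
proof -
  note uc = process_clamp[OF u]
  show "\<omega> \<in> space M \<Longrightarrow> bounded_field (\<lambda>s y. fc s y (u (cl s) y \<omega>)) Kf" by (rule nl.field[OF uc])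
  have "(\<lambda>\<omega>. (t, x, \<omega>)) \<in> measurable M (borel \<Otimes>\<^sub>M borel \<Otimes>\<^sub>M M)" by measurable
  from measurable_compose[OF this nl.drift_process_measurable[OF uc, of a]]
  show "(\<lambda>\<omega>. drift a (\<lambda>s y. fc s y (u (cl s) y \<omega>)) t x) \<in> borel_measurable M" by simp
qed

lemma init_section_measurable: "init t x \<in> borel_measurable M"
  using init_measurable[of "\<lambda>_. t" M "\<lambda>_. x" "\<lambda>\<omega>. \<omega>"] by simp

text \<open>The pathwise estimates are to hold on a measurable set of full probability; versions are
  set to 0 outside it, so that Hoelder bounds become valid for every \<omega>.\<close>

lemma AE_good_set:
  assumes "AE \<omega> in M. P \<omega>"
  obtains G where "G \<in> events" "AE \<omega> in M. \<omega> \<in> G" "\<And>\<omega>. \<omega> \<in> G \<Longrightarrow> \<omega> \<in> space M \<and> P \<omega>"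
proof -
  obtain N where N: "{\<omega> \<in> space M. \<not> P \<omega>} \<subseteq> N" "emeasure M N = 0" "N \<in> events" using assms by (rule AE_E)
  show ?thesis
  proof (rule that[of "space M - N"])
    have "AE \<omega> in M. \<omega> \<notin> N" using N by (intro AE_not_in) auto
    then show "AE \<omega> in M. \<omega> \<in> space M - N" using AE_space by eventually_elim simp
  qed (use N in auto)
qed

theorem space_regularity:
  assumes u: "mild_solution M T a \<mu> u0 f \<sigma> u" and t: "t \<in> {0..T}" and \<gamma>: "0 < \<gamma>" "\<gamma> < \<beta> - 1/2"
  shows "\<exists>u'. is_version M UNIV (\<lambda>x. u t x) u' \<and> random_holder M \<gamma> u'"
proof -
  have um: "(\<lambda>(t, x, \<omega>). u t x \<omega>) \<in> borel_measurable (BT \<Otimes>\<^sub>M borel \<Otimes>\<^sub>M M)"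
    and ue: "\<And>x. AE \<omega> in M. u t x \<omega> = init t x \<omega> + drift a (\<lambda>s y. fc s y (u (cl s) y \<omega>)) t x + noise t x \<omega>"
    using u t unfolding mild_solution_iff by auto
  \<comment> \<open>As \<open>\<beta> \<le> 1\<close>, the exponent \<open>\<gamma>\<close> is below
    1/2 and hence below \<open>\<beta>0\<close>.\<close>
  have \<gamma>1: "\<gamma> \<le> \<beta>0" "\<gamma> \<le> 1" using \<gamma> \<beta>0 hc.\<beta> by auto
  \<comment> \<open>The grid is fitted to \<open>t\<close>, so that no cell is cut: without Hoelder
    continuity of \<open>\<mu>\<close> there is no pathwise bound on \<open>F\<close> between grid
    points. For \<open>t = 0\<close> any positive length will do.\<close>
  define H where "H = (if t = 0 then T else t)"
  have H: "0 < H" "H \<le> T" "0 \<le> t" "t \<le> H" using t T_pos by (auto simp: H_def)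
  \<comment> \<open>For \<open>t = 0\<close> only the value at 0 has to represent
    \<open>\<mu>\<close>, and the zero function supplies the bound that \<open>t < H\<close>
    requires.\<close>
  define F where "F s \<omega> = (if t = 0 then 0 else \<mu> {0<..s} \<omega>)" for s \<omega>
  have Fm: "F s \<in> borel_measurable M" if "0 \<le> s" "s \<le> H" for s unfolding F_def using that H by auto
  have Fae: "AE \<omega> in M. F s \<omega> = \<mu> {0<..s} \<omega>" if "0 \<le> s" "s \<le> t" for s
    using that mu_empty by (cases "t = 0") (auto simp: F_def elim: eventually_mono)
  have gb: "grid_const H F (\<beta> - \<gamma>) \<in> borel_measurable M \<and> (AE \<omega> in M. hc.grid_bound H (\<lambda>s. F s \<omega>) (\<beta> - \<gamma>) (grid_const H F (\<beta> - \<gamma>) \<omega>))"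
  proof (cases "t = 0")
    case True
    then have "grid_const H F (\<beta> - \<gamma>) = (\<lambda>_. 0)" by (simp add: grid_const_def F_def fun_eq_iff)
    then show ?thesis using True by (simp add: hc.grid_bound_def F_def)
  next
    case False
    then show ?thesis using grid_const_bound[OF H(1,2), of "\<beta> - \<gamma>" F] Fm Fae \<gamma> by (auto simp: H_def)
  qed
  obtain G where G: "G \<in> events" "AE \<omega> in M. \<omega> \<in> G"
    "\<And>\<omega>. \<omega> \<in> G \<Longrightarrow> \<omega> \<in> space M \<and> hc.grid_bound H (\<lambda>s. F s \<omega>) (\<beta> - \<gamma>) (grid_const H F (\<beta> - \<gamma>) \<omega>)"
    using AE_good_set[OF conjunct2[OF gb]] by blast
  have F0: "t < H \<Longrightarrow> \<forall>s\<in>{0..H}. \<bar>F s \<omega>\<bar> \<le> 0" for \<omega> using H by (auto simp: H_def F_def split: if_splits)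
  define J where "J x \<omega> = lim (interval_sum H (\<lambda>s. F s \<omega>) (hc.q t x) 0 t)" for x \<omega>
  have conv: "convergent (interval_sum H (\<lambda>s. F s \<omega>) (hc.q t x) 0 t)" if "\<omega> \<in> G" for x \<omega>
    using hc.q_integral_convergent[OF H \<gamma> conjunct2[OF G(3)[OF that]] F0] by simp
  have Jx: "J x \<in> borel_measurable M" "AE \<omega> in M. J x \<omega> = noise t x \<omega>" for x
    unfolding J_def
    by (rule noise_version[OF H _ Fae]; use H Fm G(2) conv in \<open>auto elim: eventually_mono\<close>)+
  define u' where "u' x \<omega> = (if \<omega> \<in> G then init t x \<omega> + drift a (\<lambda>s y. fc s y (u (cl s) y \<omega>)) t x + J x \<omega> else 0)" for x \<omega>
  have "is_version M UNIV (\<lambda>x. u t x) u'"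
    unfolding is_version_def
  proof (intro ballI conjI)
    fix x
    note [measurable] = init_section_measurable drift_process(2)[OF um] Jx(1) G(1)
    have "(\<lambda>\<omega>. if \<omega> \<in> G then init t x \<omega> + drift a (\<lambda>s y. fc s y (u (cl s) y \<omega>)) t x + J x \<omega> else 0) \<in> borel_measurable M"
      by measurable
    then show "u' x \<in> borel_measurable M" by (simp add: u'_def[abs_def])
    show "AE \<omega> in M. u' x \<omega> = u t x \<omega>" using ue[of x] Jx(2)[of x] G(2) by eventually_elim (simp add: u'_def)
  qed
  moreover have "random_holder M \<gamma> u'"
    unfolding random_holder_def
  proof (intro bexI ballI allI)
    let ?C = "\<lambda>\<omega>. (C1 \<omega> + 2 * C0 \<omega>) + drift_space_const \<gamma> + hc.space_const H \<gamma> * (\<bar>F t \<omega> - F 0 \<omega>\<bar> + grid_const H F (\<beta> - \<gamma>) \<omega> + 0)"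
    let ?D = "\<lambda>\<omega>. if \<omega> \<in> G then ?C \<omega> else 0"
    have "F t \<in> borel_measurable M" "F 0 \<in> borel_measurable M" using H by (auto intro: Fm)
    note [measurable] = this C0_meas C1_meas G(1) conjunct1[OF gb]
    show "?D \<in> borel_measurable M" by measurable
    fix \<omega> x1 x2 assume w: "\<omega> \<in> space M"
    show "\<bar>u' x1 \<omega> - u' x2 \<omega>\<bar> \<le> ?D \<omega> * \<bar>x1 - x2\<bar> powr \<gamma>"
    proof (cases "\<omega> \<in> G")
      case True
      have 1: "\<bar>init t x1 \<omega> - init t x2 \<omega>\<bar> \<le> (C1 \<omega> + 2 * C0 \<omega>) * \<bar>x1 - x2\<bar> powr \<gamma>"
        by (rule init_space[OF w \<gamma>(1) \<gamma>1(1)])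
      have 2: "\<bar>drift a (\<lambda>s y. fc s y (u (cl s) y \<omega>)) t x1 - drift a (\<lambda>s y. fc s y (u (cl s) y \<omega>)) t x2\<bar> \<le> drift_space_const \<gamma> * \<bar>x1 - x2\<bar> powr \<gamma>"
        unfolding drift_space_const_def using t \<gamma> \<gamma>1 by (intro drift_holder_space[OF drift_process(1)[OF um w] a]) auto
      have "J x1 \<omega> - J x2 \<omega> = lim (interval_sum H (\<lambda>s. F s \<omega>) (\<lambda>s. hc.q t x1 s - hc.q t x2 s) 0 t)"
        unfolding J_def by (intro lim_interval_sum_diff conv True)
      moreover have "\<bar>lim (interval_sum H (\<lambda>s. F s \<omega>) (\<lambda>s. hc.q t x1 s - hc.q t x2 s) 0 t)\<bar> \<le>
        hc.space_const H \<gamma> * (\<bar>F t \<omega> - F 0 \<omega>\<bar> + grid_const H F (\<beta> - \<gamma>) \<omega> + 0) * \<bar>x1 - x2\<bar> powr \<gamma>"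
        by (rule hc.q_integral_space[OF H \<gamma> conjunct2[OF G(3)[OF True]] F0]) auto
      ultimately have 3: "\<bar>J x1 \<omega> - J x2 \<omega>\<bar> \<le> hc.space_const H \<gamma> * (\<bar>F t \<omega> - F 0 \<omega>\<bar> + grid_const H F (\<beta> - \<gamma>) \<omega> + 0) * \<bar>x1 - x2\<bar> powr \<gamma>" by simp
      have "\<bar>u' x1 \<omega> - u' x2 \<omega>\<bar> \<le> (C1 \<omega> + 2 * C0 \<omega>) * \<bar>x1 - x2\<bar> powr \<gamma> + drift_space_const \<gamma> * \<bar>x1 - x2\<bar> powr \<gamma>
          + hc.space_const H \<gamma> * (\<bar>F t \<omega> - F 0 \<omega>\<bar> + grid_const H F (\<beta> - \<gamma>) \<omega> + 0) * \<bar>x1 - x2\<bar> powr \<gamma>"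
        unfolding u'_def if_P[OF True] by (rule abs_add3_diff[OF 1 2 3])
      then show ?thesis using True by (simp add: distrib_right)
    qed (simp add: u'_def)
  qed
  ultimately show ?thesis by blast
qed

end

section \<open>Regularity in time\<close>

definition dyadic_below :: "real \<Rightarrow> real \<Rightarrow> nat \<Rightarrow> nat" where
  "dyadic_below H t n = nat \<lfloor>t * 2 ^ n / H\<rfloor>"

lemma dyadic_below:
  assumes H: "0 < H" and t: "0 \<le> t" "t \<le> H"
  shows "dyadic_below H t n \<le> 2 ^ n"
    and "dyadic H n (dyadic_below H t n) \<le> t" "t - H / 2 ^ n \<le> dyadic H n (dyadic_below H t n)"
proof -
  have "0 \<le> t * 2 ^ n / H" using H t by simp
  then have r: "real (dyadic_below H t n) \<le> t * 2 ^ n / H" "t * 2 ^ n / H \<le> real (dyadic_below H t n) + 1"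
    unfolding dyadic_below_def by linarith+
  have "t * 2 ^ n / H \<le> 2 ^ n" using H t by (simp add: field_simps)
  then have "real (dyadic_below H t n) \<le> real (2 ^ n)" unfolding of_nat_power of_nat_numeral by (rule order_trans[OF r(1)])
  then show "dyadic_below H t n \<le> 2 ^ n" by (simp only: of_nat_le_iff)
  show "dyadic H n (dyadic_below H t n) \<le> t" using r(1) H by (simp add: dyadic_def field_simps)
  have "t = (t * 2 ^ n / H) * (H / 2 ^ n)" using H by simp
  also have "\<dots> \<le> (real (dyadic_below H t n) + 1) * (H / 2 ^ n)" using H by (intro mult_right_mono r(2)) simp
  also have "\<dots> = dyadic H n (dyadic_below H t n) + H / 2 ^ n" by (simp add: dyadic_def add_divide_distrib algebra_simps)
  finally show "t - H / 2 ^ n \<le> dyadic H n (dyadic_below H t n)" by simp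
qed

lemma mesh_tendsto: "(\<lambda>n. H / 2 ^ n) \<longlonglongrightarrow> (0::real)"
  using tendsto_mult[OF tendsto_const LIMSEQ_power_zero[of "1/2 :: real"], of H] by (simp add: power_one_over)

lemma powr_mesh_tendsto:
  assumes "0 < b" "0 \<le> H"
  shows "(\<lambda>n. C * (H / 2 ^ n) powr b) \<longlonglongrightarrow> (0::real)"
proof -
  have "(\<lambda>n. (H / 2 ^ n) powr b) \<longlonglongrightarrow> 0 powr b"
    using assms by (intro tendsto_powr2 mesh_tendsto tendsto_const) auto
  then show ?thesis using tendsto_mult[OF tendsto_const[of C]] assms by fastforce
qed

lemma dyadic_below_tendsto:
  assumes "0 < H" "0 \<le> t" "t \<le> H"
  shows "(\<lambda>n. dyadic H n (dyadic_below H t n)) \<longlonglongrightarrow> t"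
proof (rule tendsto_sandwich)
  show "(\<lambda>n. t - H / 2 ^ n) \<longlonglongrightarrow> t" using tendsto_diff[OF tendsto_const mesh_tendsto, of t H] by simp
qed (use dyadic_below[OF assms] in auto)

section \<open>A Hoelder continuous path of the distribution process\<close>

context time_measure
begin

text \<open>The given representatives are additive only up to null sets that depend on the interval,
  so they need not be the increments of one function. On the countable dyadic grid all relations
  hold simultaneously, and the Hoelder bound extends the values \<open>m 0 d\<close> from there to a
  path on \<open>[0, T]\<close>.\<close>

lemma holder_representative:
  assumes h: "holder_stochastic_measure M T \<mu> b" and b: "0 < b"
  shows "\<exists>F C. C \<in> borel_measurable M \<and> (\<forall>\<omega>\<in>space M. 0 \<le> C \<omega>) \<and>
    (\<forall>t\<in>{0..T}. F t \<in> borel_measurable M \<and> (AE \<omega> in M. F t \<omega> = \<mu> {0<..t} \<omega>)) \<and>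
    (AE \<omega> in M. F 0 \<omega> = 0 \<and> (\<forall>s s'. 0 \<le> s \<longrightarrow> s \<le> s' \<longrightarrow> s' \<le> T \<longrightarrow> \<bar>F s' \<omega> - F s \<omega>\<bar> \<le> C \<omega> * (s' - s) powr b))"
proof -
  obtain m C where C: "C \<in> borel_measurable M" and m: "\<forall>s1 s2. 0 \<le> s1 \<and> s1 < s2 \<and> s2 \<le> T \<longrightarrow>
        m s1 s2 \<in> borel_measurable M \<and> (AE \<omega> in M. m s1 s2 \<omega> = \<mu> {s1<..s2} \<omega>) \<and>
        (\<forall>\<omega>\<in>space M. \<bar>m s1 s2 \<omega>\<bar> \<le> C \<omega> * \<bar>s1 - s2\<bar> powr b)"
    using h unfolding holder_stochastic_measure_def by auto
  have C0: "0 \<le> C \<omega>" if "\<omega> \<in> space M" for \<omega>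
  proof -
    have "\<bar>m 0 T \<omega>\<bar> \<le> C \<omega> * \<bar>0 - T\<bar> powr b" using m T_pos that by blast
    then have "0 \<le> C \<omega> * T powr b" using T_pos by simp
    then show ?thesis using T_pos by (simp add: zero_le_mult_iff)
  qed
  \<comment> \<open>The assumption says nothing about \<open>m 0 0\<close>, so the value at 0 is set
    by hand.\<close>
  define G where "G d \<omega> = (if d = 0 then 0 else m 0 d \<omega>)" for d \<omega>
  have Gm: "G d \<in> borel_measurable M" if "0 \<le> d" "d \<le> T" for d
    using m that by (cases "d = 0") (auto simp: G_def[abs_def])
  have Gmu: "AE \<omega> in M. G d \<omega> = \<mu> {0<..d} \<omega>" if "0 \<le> d" "d \<le> T" for d
    using m that mu_empty by (cases "d = 0") (auto simp: G_def elim: eventually_mono)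
  have incr: "AE \<omega> in M. \<bar>\<mu> {0<..d'} \<omega> - G d \<omega>\<bar> \<le> C \<omega> * (d' - d) powr b" if d: "0 \<le> d" "d \<le> d'" "d' \<le> T" for d d'
  proof (cases "d = d'")
    case True
    have "AE \<omega> in M. G d \<omega> = \<mu> {0<..d} \<omega>" using d by (intro Gmu) auto
    then show ?thesis by eventually_elim (use True in simp)
  next
    case False
    have a1: "AE \<omega> in M. m d d' \<omega> = \<mu> {d<..d'} \<omega>" using m d False by auto
    have a2: "AE \<omega> in M. G d \<omega> = \<mu> {0<..d} \<omega>" using d by (intro Gmu) auto
    have a3: "AE \<omega> in M. \<mu> {d<..d'} \<omega> = \<mu> {0<..d'} \<omega> - \<mu> {0<..d} \<omega>" using d by (intro mu_interval_diff)
    show ?thesis using a1 a2 a3 AE_space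
    proof eventually_elim
      case (elim \<omega>)
      have "\<bar>m d d' \<omega>\<bar> \<le> C \<omega> * \<bar>d - d'\<bar> powr b" using m d False elim(4) by auto
      then show ?case using elim d by simp
    qed
  qed
  \<comment> \<open>\<open>min\<close> keeps every index inside \<open>[0, T]\<close>, so that the
    countable conjunction can range over all \<open>k\<close>.\<close>
  let ?d = "\<lambda>n k. dyadic T n (min k (2^n))"
  have dT: "0 \<le> ?d n k" "?d n k \<le> T" for n k using T_pos dyadic_le[of T "min k (2^n)" n] by (auto simp: dyadic_def)
  have grid1: "AE \<omega> in M. \<bar>G (?d n k) \<omega> - G (?d n' k') \<omega>\<bar> \<le> C \<omega> * \<bar>?d n k - ?d n' k'\<bar> powr b" for n k n' k'
  proof (cases "?d n k \<le> ?d n' k'")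
    case True
    show ?thesis using incr[OF dT(1) True dT(2)] Gmu[OF dT, of n' k'] by eventually_elim (use True in \<open>simp add: abs_minus_commute\<close>)
  next
    case False
    then have F: "?d n' k' \<le> ?d n k" by simp
    show ?thesis using incr[OF dT(1) F dT(2)] Gmu[OF dT, of n k] by eventually_elim (use F in simp)
  qed
  have grid: "AE \<omega> in M. \<forall>n k n' k'. \<bar>G (?d n k) \<omega> - G (?d n' k') \<omega>\<bar> \<le> C \<omega> * \<bar>?d n k - ?d n' k'\<bar> powr b"
    unfolding AE_all_countable using grid1 by blast
  define e where "e t n = dyadic T n (dyadic_below T t n)" for t n
  define F where "F t \<omega> = lim (\<lambda>n. G (e t n) \<omega>)" for t \<omega>
  have e: "0 \<le> e t n" "e t n \<le> t" "t - T / 2^n \<le> e t n" if "0 \<le> t" "t \<le> T" for t n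
    using dyadic_below[OF T_pos that] T_pos by (auto simp: e_def dyadic_def)
  have etend: "e t \<longlonglongrightarrow> t" if "0 \<le> t" "t \<le> T" for t
    using dyadic_below_tendsto[OF T_pos that] by (simp add: e_def[abs_def])
  have ed: "e t n = ?d n (dyadic_below T t n)" if "0 \<le> t" "t \<le> T" for t n
    using dyadic_below(1)[OF T_pos that] by (simp add: e_def min_absorb1)
  have hol: "AE \<omega> in M. \<omega> \<in> space M \<and> (\<forall>s s' n n'. 0 \<le> s \<longrightarrow> s \<le> T \<longrightarrow> 0 \<le> s' \<longrightarrow> s' \<le> T \<longrightarrow>
      \<bar>G (e s n) \<omega> - G (e s' n') \<omega>\<bar> \<le> C \<omega> * \<bar>e s n - e s' n'\<bar> powr b)"
    using grid AE_space by eventually_elim (simp add: ed)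
  have conv: "AE \<omega> in M. \<omega> \<in> space M \<and> (\<forall>s s' n n'. 0 \<le> s \<longrightarrow> s \<le> T \<longrightarrow> 0 \<le> s' \<longrightarrow> s' \<le> T \<longrightarrow>
      \<bar>G (e s n) \<omega> - G (e s' n') \<omega>\<bar> \<le> C \<omega> * \<bar>e s n - e s' n'\<bar> powr b) \<and>
      (\<forall>s. 0 \<le> s \<longrightarrow> s \<le> T \<longrightarrow> (\<lambda>n. G (e s n) \<omega>) \<longlonglongrightarrow> F s \<omega>)"
    using hol
  proof eventually_elim
    case (elim \<omega>)
    have "convergent (\<lambda>n. G (e s n) \<omega>)" if s: "0 \<le> s" "s \<le> T" for s
    proof (rule Cauchy_convergent, rule metric_CauchyI)
      fix \<epsilon> :: real assume "0 < \<epsilon>"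
      then have "eventually (\<lambda>n. C \<omega> * (T / 2^n) powr b < \<epsilon>) sequentially"
        using powr_mesh_tendsto[OF b, of T "C \<omega>"] T_pos by (intro order_tendstoD(2)) auto
      then obtain N where N: "C \<omega> * (T / 2^N) powr b < \<epsilon>" by (auto simp: eventually_sequentially)
      show "\<exists>N. \<forall>n\<ge>N. \<forall>n'\<ge>N. dist (G (e s n) \<omega>) (G (e s n') \<omega>) < \<epsilon>"
      proof (intro exI allI impI)
        fix n n' assume n: "N \<le> n" "N \<le> n'"
        have le: "s - T / 2^N \<le> e s k" if "N \<le> k" for k
        proof -
          have "T / 2^k \<le> T / 2^N" using T_pos that by (intro divide_left_mono) (auto simp: power_increasing)
          then show ?thesis using e(3)[OF s, of k] by linarith
        qed
        have "\<bar>e s n - e s n'\<bar> \<le> T / 2^N" using e(2)[OF s, of n] e(2)[OF s, of n'] le[OF n(1)] le[OF n(2)] by linarith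
        then have "C \<omega> * \<bar>e s n - e s n'\<bar> powr b \<le> C \<omega> * (T / 2^N) powr b"
          using b C0 elim by (intro mult_left_mono powr_mono2) auto
        moreover have "\<bar>G (e s n) \<omega> - G (e s n') \<omega>\<bar> \<le> C \<omega> * \<bar>e s n - e s n'\<bar> powr b" using elim s by blast
        ultimately show "dist (G (e s n) \<omega>) (G (e s n') \<omega>) < \<epsilon>" using N by (simp add: dist_real_def)
      qed
    qed
    then show ?case using elim by (simp add: F_def convergent_LIMSEQ_iff)
  qed
  have em: "G (e t n) \<in> borel_measurable M" if t: "0 \<le> t" "t \<le> T" for t n
    using e(1,2)[OF t, of n] t by (intro Gm) auto
  have Fm: "F t \<in> borel_measurable M" if "0 \<le> t" "t \<le> T" for t
    unfolding F_def[abs_def] by (rule borel_measurable_lim_metric) (rule em[OF that])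
  \<comment> \<open>At a fixed \<open>t\<close> the Hoelder bound on the interval from
    \<open>e t n\<close> to \<open>t\<close> identifies the limit with \<open>\<mu> {0<..t}\<close>;
    here the null set may depend on \<open>t\<close>.\<close>
  have Fmu: "AE \<omega> in M. F t \<omega> = \<mu> {0<..t} \<omega>" if t: "0 \<le> t" "t \<le> T" for t
  proof -
    have "AE \<omega> in M. \<forall>n. \<bar>\<mu> {0<..t} \<omega> - G (e t n) \<omega>\<bar> \<le> C \<omega> * (t - e t n) powr b"
      unfolding AE_all_countable using e[OF t] t by (intro allI incr) auto
    then show ?thesis using conv
    proof eventually_elim
      case (elim \<omega>)
      have "(\<lambda>n. C \<omega> * (t - e t n) powr b) \<longlonglongrightarrow> C \<omega> * (t - t) powr b"
        using b e(2)[OF t] by (intro tendsto_mult tendsto_const tendsto_powr2 tendsto_diff etend[OF t]) auto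
      then have z: "(\<lambda>n. C \<omega> * (t - e t n) powr b) \<longlonglongrightarrow> 0" by simp
      have "\<forall>\<^sub>F n in sequentially. norm (\<mu> {0<..t} \<omega> - G (e t n) \<omega>) \<le> C \<omega> * (t - e t n) powr b"
        unfolding real_norm_def by (rule always_eventually) (rule elim(1))
      from Lim_null_comparison[OF this z]
      have "(\<lambda>n. \<mu> {0<..t} \<omega> - G (e t n) \<omega>) \<longlonglongrightarrow> 0" .
      then have "(\<lambda>n. \<mu> {0<..t} \<omega> - (\<mu> {0<..t} \<omega> - G (e t n) \<omega>)) \<longlonglongrightarrow> \<mu> {0<..t} \<omega> - 0" by (intro tendsto_intros)
      then have "(\<lambda>n. G (e t n) \<omega>) \<longlonglongrightarrow> \<mu> {0<..t} \<omega>" by simp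
      moreover have "(\<lambda>n. G (e t n) \<omega>) \<longlonglongrightarrow> F t \<omega>" using elim(2) t by blast
      ultimately show ?case by (rule LIMSEQ_unique[symmetric])
    qed
  qed
  have "AE \<omega> in M. F 0 \<omega> = 0 \<and> (\<forall>s s'. 0 \<le> s \<longrightarrow> s \<le> s' \<longrightarrow> s' \<le> T \<longrightarrow> \<bar>F s' \<omega> - F s \<omega>\<bar> \<le> C \<omega> * (s' - s) powr b)"
    using conv
  proof eventually_elim
    case (elim \<omega>)
    show ?case
    proof (intro conjI allI impI)
      have "e 0 n = 0" for n by (simp add: e_def dyadic_below_def dyadic_def)
      then show "F 0 \<omega> = 0" by (simp add: F_def G_def)
      fix s s' assume s: "0 \<le> s" "s \<le> s'" "s' \<le> T"
      have "(\<lambda>n. \<bar>G (e s' n) \<omega> - G (e s n) \<omega>\<bar>) \<longlonglongrightarrow> \<bar>F s' \<omega> - F s \<omega>\<bar>"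
        using elim s by (intro tendsto_intros) auto
      moreover have "e s \<longlonglongrightarrow> s" "e s' \<longlonglongrightarrow> s'" using s by (auto intro: etend)
      then have "(\<lambda>n. C \<omega> * \<bar>e s' n - e s n\<bar> powr b) \<longlonglongrightarrow> C \<omega> * \<bar>s' - s\<bar> powr b"
        using b s by (intro tendsto_mult tendsto_const tendsto_powr2 tendsto_rabs tendsto_diff) auto
      ultimately have "\<bar>F s' \<omega> - F s \<omega>\<bar> \<le> C \<omega> * \<bar>s' - s\<bar> powr b"
        using elim s by (intro LIMSEQ_le) auto
      then show "\<bar>F s' \<omega> - F s \<omega>\<bar> \<le> C \<omega> * (s' - s) powr b" using s by simp
    qed
  qed
  then show ?thesis using C C0 Fm Fmu by (intro exI[of _ F] exI[of _ C]) auto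
qed

end

section \<open>Joint regularity in time and space\<close>

context spde
begin

text \<open>On the common grid the integral up to \<open>t2\<close> splits at \<open>t1\<close>:
  what remains is the change of the integrand on \<open>[0, t1]\<close> and the new piece over
  \<open>[t1, t2]\<close>.\<close>

lemma q_integral_increment:
  assumes t: "0 \<le> t1" "t1 \<le> t2" "t2 \<le> T" and \<gamma>: "0 < \<gamma>" "\<gamma> < \<beta> - 1/2" "\<gamma> \<le> b"
    and R: "hc.grid_bound T F (\<beta> - \<gamma>) R" and Cf: "0 \<le> Cf" and Fb: "\<forall>s\<in>{0..T}. \<bar>F s\<bar> \<le> Fm" and Fm: "0 \<le> Fm"
    and F: "\<forall>s s'. 0 \<le> s \<longrightarrow> s \<le> s' \<longrightarrow> s' \<le> T \<longrightarrow> \<bar>F s' - F s\<bar> \<le> Cf * (s' - s) powr b"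
  shows "\<bar>lim (interval_sum T F (hc.q t2 x) 0 t2) - lim (interval_sum T F (hc.q t1 x) 0 t1)\<bar> \<le>
    (hc.time_const \<gamma> * (2 * Fm + R + Fm) + hc.tail_const \<gamma> b * (Cf + R)) * (t2 - t1) powr \<gamma>"
proof -
  let ?S = "interval_sum T F"
  have F': "\<And>s s'. 0 \<le> s \<Longrightarrow> s \<le> s' \<Longrightarrow> s' \<le> T \<Longrightarrow> \<bar>F s' - F s\<bar> \<le> Cf * (s' - s) powr b" using F by blast
  note time = hc.q_integral_time[OF t \<gamma>(1,2) R Fb Fm, of x]
  note tail = hc.q_integral_tail[OF t \<gamma> R Cf F', of x]
  have c1: "convergent (?S (hc.q t1 x) 0 t1)"
    using t T_pos by (intro hc.q_integral_convergent[OF _ _ _ _ \<gamma>(1,2) R Fb Fm]) auto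
  have "(\<lambda>n. ?S (\<lambda>s. hc.q t2 x s - hc.q t1 x s) 0 t1 n + ?S (hc.q t1 x) 0 t1 n + ?S (hc.q t2 x) t1 t2 n) \<longlonglongrightarrow>
      lim (?S (\<lambda>s. hc.q t2 x s - hc.q t1 x s) 0 t1) + lim (?S (hc.q t1 x) 0 t1) + lim (?S (hc.q t2 x) t1 t2)"
    using time(2) c1 tail(2) by (intro tendsto_add) (auto simp: convergent_LIMSEQ_iff)
  then have "?S (hc.q t2 x) 0 t2 \<longlonglongrightarrow> lim (?S (\<lambda>s. hc.q t2 x s - hc.q t1 x s) 0 t1) + lim (?S (hc.q t1 x) 0 t1) + lim (?S (hc.q t2 x) t1 t2)"
    unfolding interval_sum_diff by (simp add: interval_sum_split[OF t(1,2), symmetric])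
  from limI[OF this] show ?thesis using time(1) tail(1) by (simp add: distrib_right)
qed

text \<open>Unlike at a fixed time, one path \<open>F\<close> and one grid of \<open>[0, T]\<close>
  must serve all \<open>t\<close>. Cut cells are then unavoidable; they are controlled by the
  uniform bound \<open>Fs\<close> and the modulus of continuity of \<open>F\<close>.\<close>

theorem space_time_regularity:
  assumes u: "mild_solution M T a \<mu> u0 f \<sigma> u" and hm: "holder_stochastic_measure M T \<mu> b"
    and \<delta>: "0 < \<delta>" and \<gamma>1: "0 < \<gamma>1" "\<gamma>1 < \<beta> - 1/2" and \<gamma>2: "0 < \<gamma>2" "\<gamma>2 < \<beta> - 1/2" "\<gamma>2 \<le> b"
  shows "\<exists>u'. is_version M ({0..T} \<times> UNIV) (\<lambda>(t, x). u t x) (\<lambda>(t, x). u' t x) \<and>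
    (\<exists>C\<in>borel_measurable M. \<forall>\<omega>\<in>space M. \<forall>t1\<in>{\<delta>..T}. \<forall>t2\<in>{\<delta>..T}. \<forall>x1 x2.
      \<bar>u' t1 x1 \<omega> - u' t2 x2 \<omega>\<bar> \<le> C \<omega> * (\<bar>t1 - t2\<bar> powr \<gamma>2 + \<bar>x1 - x2\<bar> powr \<gamma>1))"
proof -
  have um: "(\<lambda>(t, x, \<omega>). u t x \<omega>) \<in> borel_measurable (BT \<Otimes>\<^sub>M borel \<Otimes>\<^sub>M M)"
    and ue: "\<And>t x. t \<in> {0..T} \<Longrightarrow> AE \<omega> in M. u t x \<omega> = init t x \<omega> + drift a (\<lambda>s y. fc s y (u (cl s) y \<omega>)) t x + noise t x \<omega>"
    using u unfolding mild_solution_iff by auto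
  have \<gamma>le: "\<gamma>1 \<le> \<beta>0" "\<gamma>1 \<le> 1" "\<gamma>2 \<le> \<beta>0" "\<gamma>2 < 1" using \<gamma>1 \<gamma>2 \<beta>0 hc.\<beta> by auto
  have b: "0 < b" using \<gamma>2 by simp
  obtain F Cf where Cf: "Cf \<in> borel_measurable M" "\<forall>\<omega>\<in>space M. 0 \<le> Cf \<omega>"
    and F: "\<forall>t\<in>{0..T}. F t \<in> borel_measurable M \<and> (AE \<omega> in M. F t \<omega> = \<mu> {0<..t} \<omega>)"
    and Fh: "AE \<omega> in M. F 0 \<omega> = 0 \<and> (\<forall>s s'. 0 \<le> s \<longrightarrow> s \<le> s' \<longrightarrow> s' \<le> T \<longrightarrow> \<bar>F s' \<omega> - F s \<omega>\<bar> \<le> Cf \<omega> * (s' - s) powr b)"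
    using holder_representative[OF hm b] by blast
  have Fm: "F s \<in> borel_measurable M" and Fae: "AE \<omega> in M. F s \<omega> = \<mu> {0<..s} \<omega>" if "0 \<le> s" "s \<le> T" for s
    using F that by auto
  let ?R1 = "grid_const T F (\<beta> - \<gamma>1)" and ?R2 = "grid_const T F (\<beta> - \<gamma>2)"
  have R1: "?R1 \<in> borel_measurable M" "AE \<omega> in M. hc.grid_bound T (\<lambda>s. F s \<omega>) (\<beta> - \<gamma>1) (?R1 \<omega>)"
    using grid_const_bound[OF T_pos order_refl _ Fm Fae, of "\<beta> - \<gamma>1"] \<gamma>1 by auto
  have R2: "?R2 \<in> borel_measurable M" "AE \<omega> in M. hc.grid_bound T (\<lambda>s. F s \<omega>) (\<beta> - \<gamma>2) (?R2 \<omega>)"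
    using grid_const_bound[OF T_pos order_refl _ Fm Fae, of "\<beta> - \<gamma>2"] \<gamma>2 by auto
  obtain G where G: "G \<in> events" "AE \<omega> in M. \<omega> \<in> G"
    and GG: "\<And>\<omega>. \<omega> \<in> G \<Longrightarrow> \<omega> \<in> space M \<and> (F 0 \<omega> = 0 \<and> (\<forall>s s'. 0 \<le> s \<longrightarrow> s \<le> s' \<longrightarrow> s' \<le> T \<longrightarrow> \<bar>F s' \<omega> - F s \<omega>\<bar> \<le> Cf \<omega> * (s' - s) powr b)) \<and>
      hc.grid_bound T (\<lambda>s. F s \<omega>) (\<beta> - \<gamma>1) (?R1 \<omega>) \<and> hc.grid_bound T (\<lambda>s. F s \<omega>) (\<beta> - \<gamma>2) (?R2 \<omega>)"
    using AE_good_set[OF AE_conjI[OF Fh AE_conjI[OF R1(2) R2(2)]]] by blast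
  have Gs: "\<omega> \<in> space M" and Gh: "\<forall>s s'. 0 \<le> s \<longrightarrow> s \<le> s' \<longrightarrow> s' \<le> T \<longrightarrow> \<bar>F s' \<omega> - F s \<omega>\<bar> \<le> Cf \<omega> * (s' - s) powr b"
    and G1: "hc.grid_bound T (\<lambda>s. F s \<omega>) (\<beta> - \<gamma>1) (?R1 \<omega>)" and G2: "hc.grid_bound T (\<lambda>s. F s \<omega>) (\<beta> - \<gamma>2) (?R2 \<omega>)"
    and G0: "F 0 \<omega> = 0" if "\<omega> \<in> G" for \<omega> using GG[OF that] by auto
  define Fs where "Fs \<omega> = Cf \<omega> * T powr b" for \<omega>
  have Fs0: "0 \<le> Fs \<omega>" if "\<omega> \<in> G" for \<omega> using Gs[OF that] Cf(2) by (simp add: Fs_def)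
  have Fb: "\<forall>s\<in>{0..T}. \<bar>F s \<omega>\<bar> \<le> Fs \<omega>" if w: "\<omega> \<in> G" for \<omega>
  proof
    fix s assume s: "s \<in> {0..T}"
    have "\<bar>F s \<omega> - F 0 \<omega>\<bar> \<le> Cf \<omega> * (s - 0) powr b" using Gh[OF w] s by (metis atLeastAtMost_iff order_refl)
    also have "\<dots> \<le> Fs \<omega>" unfolding Fs_def using s b Cf(2) Gs[OF w] by (intro mult_left_mono powr_mono2) auto
    finally show "\<bar>F s \<omega>\<bar> \<le> Fs \<omega>" by (simp add: G0[OF w])
  qed
  define J where "J t x \<omega> = lim (interval_sum T (\<lambda>s. F s \<omega>) (hc.q t x) 0 t)" for t x \<omega>
  have conv: "convergent (interval_sum T (\<lambda>s. F s \<omega>) (hc.q t x) 0 t)" if "\<omega> \<in> G" "0 \<le> t" "t \<le> T" for x t \<omega>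
    using hc.q_integral_convergent[OF T_pos order_refl that(2,3) \<gamma>1 G1[OF that(1)] Fb[OF that(1)] Fs0[OF that(1)]] .
  have Jx: "J t x \<in> borel_measurable M" "AE \<omega> in M. J t x \<omega> = noise t x \<omega>" if t: "0 \<le> t" "t \<le> T" for t x
  proof -
    have "AE \<omega> in M. convergent (interval_sum T (\<lambda>s. F s \<omega>) (hc.q t x) 0 t)"
      using G(2) by eventually_elim (rule conv[OF _ t])
    note nv = noise_version[OF T_pos order_refl t Fm Fae this]
    show "J t x \<in> borel_measurable M" "AE \<omega> in M. J t x \<omega> = noise t x \<omega>"
      unfolding J_def[abs_def] using nv t by auto
  qed
  define u' where "u' t x \<omega> = (if \<omega> \<in> G then init t x \<omega> + drift a (\<lambda>s y. fc s y (u (cl s) y \<omega>)) t x + J t x \<omega> else 0)" for t x \<omega>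
  define K1 where "K1 \<omega> = (C1 \<omega> + 2 * C0 \<omega>) + drift_space_const \<gamma>1 + hc.space_const T \<gamma>1 * (2 * Fs \<omega> + ?R1 \<omega> + Fs \<omega>)" for \<omega>
  define K2 where "K2 \<omega> = C1 \<omega> * gauss_moment * (\<bar>a\<bar> * sqrt 2) powr \<beta>0 * T powr (\<beta>0 - \<gamma>2) * \<delta> powr (-(\<beta>0/2))
    + (Kf * T powr (1 - \<gamma>2) + 4 * Kf * (T powr (1 - \<gamma>2) / (1 - \<gamma>2)))
    + (hc.time_const \<gamma>2 * (2 * Fs \<omega> + ?R2 \<omega> + Fs \<omega>) + hc.tail_const \<gamma>2 b * (Cf \<omega> + ?R2 \<omega>))" for \<omega>
  have space: "\<bar>u' t x1 \<omega> - u' t x2 \<omega>\<bar> \<le> K1 \<omega> * \<bar>x1 - x2\<bar> powr \<gamma>1" if w: "\<omega> \<in> G" and t: "0 \<le> t" "t \<le> T" for \<omega> t x1 x2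
  proof -
    note fd = drift_process(1)[OF um Gs[OF w]]
    have D: "\<bar>F t \<omega> - F 0 \<omega>\<bar> \<le> 2 * Fs \<omega>" using bspec[OF Fb[OF w], of t] t G0[OF w] Fs0[OF w] by simp
    have 1: "\<bar>init t x1 \<omega> - init t x2 \<omega>\<bar> \<le> (C1 \<omega> + 2 * C0 \<omega>) * \<bar>x1 - x2\<bar> powr \<gamma>1"
      by (rule init_space[OF Gs[OF w] \<gamma>1(1) \<gamma>le(1)])
    have 2: "\<bar>drift a (\<lambda>s y. fc s y (u (cl s) y \<omega>)) t x1 - drift a (\<lambda>s y. fc s y (u (cl s) y \<omega>)) t x2\<bar> \<le> drift_space_const \<gamma>1 * \<bar>x1 - x2\<bar> powr \<gamma>1"
      unfolding drift_space_const_def by (rule drift_holder_space[OF fd a t \<gamma>1(1) \<gamma>le(2)])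
    have 3: "\<bar>J t x1 \<omega> - J t x2 \<omega>\<bar> \<le> hc.space_const T \<gamma>1 * (2 * Fs \<omega> + ?R1 \<omega> + Fs \<omega>) * \<bar>x1 - x2\<bar> powr \<gamma>1"
      unfolding J_def lim_interval_sum_diff[OF conv[OF w t] conv[OF w t]]
      by (rule hc.q_integral_space[OF T_pos order_refl t \<gamma>1 G1[OF w] Fb[OF w] Fs0[OF w] D])
    show ?thesis unfolding u'_def K1_def if_P[OF w] distrib_right[of _ _ "\<bar>x1 - x2\<bar> powr \<gamma>1"]
      using abs_add3_diff[OF 1 2 3] by (simp only: distrib_right)
  qed
  have time: "\<bar>u' t2 x \<omega> - u' t1 x \<omega>\<bar> \<le> K2 \<omega> * (t2 - t1) powr \<gamma>2" if w: "\<omega> \<in> G" and t: "\<delta> \<le> t1" "t1 \<le> t2" "t2 \<le> T" for \<omega> t1 t2 x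
  proof -
    note fd = drift_process(1)[OF um Gs[OF w]]
    have t0: "0 \<le> t1" using t \<delta> by simp
    have cf: "0 \<le> Cf \<omega>" using Cf(2) Gs[OF w] by simp
    note 1 = init_time[OF Gs[OF w] \<gamma>2(1) \<gamma>le(3) \<delta> t, of x]
    note 2 = drift_holder_time[OF fd a t0 t(2,3) \<gamma>2(1) \<gamma>le(4), of x]
    note 3 = q_integral_increment[OF t0 t(2,3) \<gamma>2 G2[OF w] cf Fb[OF w] Fs0[OF w] Gh[OF w], of x, folded J_def]
    show ?thesis unfolding u'_def K2_def if_P[OF w] using abs_add3_diff[OF 1 2 3] by (simp only: distrib_right)
  qed
  have "is_version M ({0..T} \<times> UNIV) (\<lambda>(t, x). u t x) (\<lambda>(t, x). u' t x)"
    unfolding is_version_def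
  proof (rule ballI, clarify)
    fix t x assume t: "t \<in> {0..T}"
    then have t': "0 \<le> t" "t \<le> T" by auto
    note [measurable] = init_section_measurable drift_process(2)[OF um] Jx(1)[OF t'] G(1)
    have "(\<lambda>\<omega>. if \<omega> \<in> G then init t x \<omega> + drift a (\<lambda>s y. fc s y (u (cl s) y \<omega>)) t x + J t x \<omega> else 0) \<in> borel_measurable M"
      by measurable
    moreover have "AE \<omega> in M. u' t x \<omega> = u t x \<omega>" using ue[OF t, of x] Jx(2)[OF t', of x] G(2) by eventually_elim (simp add: u'_def)
    ultimately show "u' t x \<in> borel_measurable M \<and> (AE \<omega> in M. u' t x \<omega> = u t x \<omega>)" by (simp add: u'_def[abs_def])
  qed
  moreover have "\<exists>C\<in>borel_measurable M. \<forall>\<omega>\<in>space M. \<forall>t1\<in>{\<delta>..T}. \<forall>t2\<in>{\<delta>..T}. \<forall>x1 x2.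
      \<bar>u' t1 x1 \<omega> - u' t2 x2 \<omega>\<bar> \<le> C \<omega> * (\<bar>t1 - t2\<bar> powr \<gamma>2 + \<bar>x1 - x2\<bar> powr \<gamma>1)"
  proof (intro bexI ballI allI)
    note [measurable] = C0_meas C1_meas Cf(1) R1(1) R2(1)
    have [measurable]: "Fs \<in> borel_measurable M" unfolding Fs_def[abs_def] by measurable
    show "(\<lambda>\<omega>. \<bar>K1 \<omega>\<bar> + \<bar>K2 \<omega>\<bar>) \<in> borel_measurable M" unfolding K1_def K2_def by measurable
    fix \<omega> t1 t2 x1 x2 assume w: "\<omega> \<in> space M" and t: "t1 \<in> {\<delta>..T}" "t2 \<in> {\<delta>..T}"
    show "\<bar>u' t1 x1 \<omega> - u' t2 x2 \<omega>\<bar> \<le> (\<bar>K1 \<omega>\<bar> + \<bar>K2 \<omega>\<bar>) * (\<bar>t1 - t2\<bar> powr \<gamma>2 + \<bar>x1 - x2\<bar> powr \<gamma>1)"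
    proof (cases "\<omega> \<in> G")
      case True
      have 1: "\<bar>u' t1 x1 \<omega> - u' t2 x1 \<omega>\<bar> \<le> K2 \<omega> * \<bar>t1 - t2\<bar> powr \<gamma>2"
        using time[OF True, of t1 t2 x1] time[OF True, of t2 t1 x1] t by (cases "t1 \<le> t2") (auto simp: abs_minus_commute)
      have 2: "\<bar>u' t2 x1 \<omega> - u' t2 x2 \<omega>\<bar> \<le> K1 \<omega> * \<bar>x1 - x2\<bar> powr \<gamma>1" using t \<delta> by (intro space[OF True]) auto
      have 3: "K2 \<omega> * \<bar>t1 - t2\<bar> powr \<gamma>2 \<le> (\<bar>K1 \<omega>\<bar> + \<bar>K2 \<omega>\<bar>) * \<bar>t1 - t2\<bar> powr \<gamma>2" by (intro mult_right_mono) auto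
      have 4: "K1 \<omega> * \<bar>x1 - x2\<bar> powr \<gamma>1 \<le> (\<bar>K1 \<omega>\<bar> + \<bar>K2 \<omega>\<bar>) * \<bar>x1 - x2\<bar> powr \<gamma>1" by (intro mult_right_mono) auto
      show ?thesis unfolding distrib_left using 1 2 3 4 by linarith
    qed (simp add: u'_def)
  qed
  ultimately show ?thesis by blast
qed

end

lemma clamp_to_dist_le: "\<bar>clamp_to t1 t2 s1 - clamp_to t1 t2 s2\<bar> \<le> \<bar>s1 - s2\<bar>"
  by (auto simp: clamp_to_def max_def min_def abs_if)

theorem theorem1:
  fixes M :: "'w measure" and T a \<beta>u0 \<beta>\<sigma> :: real
    and \<mu> :: "real set \<Rightarrow> 'w \<Rightarrow> real"
    and u0 :: "real \<Rightarrow> 'w \<Rightarrow> real"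
    and f :: "real \<Rightarrow> real \<Rightarrow> real \<Rightarrow> real"
    and \<sigma> :: "real \<Rightarrow> real \<Rightarrow> real"
  assumes "prob_space M" and "complete_measure M"
    and "T > 0" and "a \<noteq> 0"
    and "stochastic_measure M (restrict_space borel {0..T}) \<mu>"
    and A1: "(\<lambda>(y, \<omega>). u0 y \<omega>) \<in> borel_measurable (borel \<Otimes>\<^sub>M M)"
      "\<exists>C\<in>borel_measurable M. \<forall>\<omega>\<in>space M. \<forall>y. \<bar>u0 y \<omega>\<bar> \<le> C \<omega>"
    and A2: "1/2 \<le> \<beta>u0" "\<beta>u0 \<le> 1" "random_holder M \<beta>u0 u0"
    and A3: "(\<lambda>(s, y, v). f s y v) \<in>
        borel_measurable (restrict_space borel {0..T} \<Otimes>\<^sub>M borel \<Otimes>\<^sub>M borel)"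
      "\<exists>C. \<forall>s\<in>{0..T}. \<forall>y v. \<bar>f s y v\<bar> \<le> C"
    and A4: "\<exists>C. \<forall>s\<in>{0..T}. \<forall>y1 y2 v1 v2.
        \<bar>f s y1 v1 - f s y2 v2\<bar> \<le> C * (\<bar>y1 - y2\<bar> + \<bar>v1 - v2\<bar>)"
    and A5: "(\<lambda>(s, y). \<sigma> s y) \<in> borel_measurable (restrict_space borel {0..T} \<Otimes>\<^sub>M borel)"
      "\<exists>C. \<forall>s\<in>{0..T}. \<forall>y. \<bar>\<sigma> s y\<bar> \<le> C"
    and A6: "1/2 < \<beta>\<sigma>" "\<beta>\<sigma> \<le> 1"
      "\<exists>C. \<forall>s1\<in>{0..T}. \<forall>s2\<in>{0..T}. \<forall>y1 y2.
        \<bar>\<sigma> s1 y1 - \<sigma> s2 y2\<bar> \<le> C * (\<bar>s1 - s2\<bar> powr \<beta>\<sigma> + \<bar>y1 - y2\<bar> powr \<beta>\<sigma>)"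
  shows
    "((\<exists>u. mild_solution M T a \<mu> u0 f \<sigma> u) \<and>
      (\<forall>u v. mild_solution M T a \<mu> u0 f \<sigma> u \<longrightarrow> mild_solution M T a \<mu> u0 f \<sigma> v \<longrightarrow>
         (\<forall>t\<in>{0..T}. \<forall>x. AE \<omega> in M. u t x \<omega> = v t x \<omega>)))
     \<and>
     (\<forall>u. mild_solution M T a \<mu> u0 f \<sigma> u \<longrightarrow>
        (\<forall>t\<in>{0..T}. \<forall>\<gamma>1. 0 < \<gamma>1 \<and> \<gamma>1 < \<beta>\<sigma> - 1/2 \<longrightarrow>
           (\<exists>u'. is_version M UNIV (\<lambda>x. u t x) u' \<and> random_holder M \<gamma>1 u')))
     \<and>
     (\<forall>u. mild_solution M T a \<mu> u0 f \<sigma> u \<longrightarrow>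
        (\<forall>\<beta>\<mu>. 0 < \<beta>\<mu> \<and> \<beta>\<mu> \<le> 1 \<and> holder_stochastic_measure M T \<mu> \<beta>\<mu> \<longrightarrow>
           (\<forall>\<delta>>0. \<forall>\<gamma>1 \<gamma>2.
              0 < \<gamma>1 \<and> \<gamma>1 < \<beta>\<sigma> - 1/2 \<and> 0 < \<gamma>2 \<and> \<gamma>2 \<le> \<beta>\<mu> \<and> \<gamma>2 < \<beta>\<sigma> - 1/2 \<longrightarrow>
              (\<exists>u'. is_version M ({0..T} \<times> UNIV) (\<lambda>(t, x). u t x) (\<lambda>(t, x). u' t x) \<and>
                 (\<exists>C\<in>borel_measurable M. \<forall>\<omega>\<in>space M.
                    \<forall>t1\<in>{\<delta>..T}. \<forall>t2\<in>{\<delta>..T}. \<forall>x1 x2.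
                      \<bar>u' t1 x1 \<omega> - u' t2 x2 \<omega>\<bar>
                        \<le> C \<omega> * (\<bar>t1 - t2\<bar> powr \<gamma>2 + \<bar>x1 - x2\<bar> powr \<gamma>1))))))"
proof -
  interpret prob_space M by fact
  let ?cl = "clamp_to 0 T"
  have clin: "?cl s \<in> {0..T}" for s using clamp_to_in[of 0 T s] \<open>T > 0\<close> by simp
  have clm: "?cl \<in> measurable borel (restrict_space borel {0..T})"
    using clamp_to_restrict_measurable[of 0 T] \<open>T > 0\<close> by simp
  obtain C0 where C0: "C0 \<in> borel_measurable M" "\<forall>\<omega>\<in>space M. \<forall>y. \<bar>u0 y \<omega>\<bar> \<le> C0 \<omega>" using A1(2) by blast
  obtain C1 where C1: "C1 \<in> borel_measurable M" "\<forall>\<omega>\<in>space M. \<forall>x1 x2. \<bar>u0 x1 \<omega> - u0 x2 \<omega>\<bar> \<le> C1 \<omega> * \<bar>x1 - x2\<bar> powr \<beta>u0"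
    using A2(3) unfolding random_holder_def by blast
  obtain Kf where Kf: "\<forall>s\<in>{0..T}. \<forall>y v. \<bar>f s y v\<bar> \<le> Kf" using A3(2) by blast
  obtain Lf where Lf: "\<forall>s\<in>{0..T}. \<forall>y1 y2 v1 v2. \<bar>f s y1 v1 - f s y2 v2\<bar> \<le> Lf * (\<bar>y1 - y2\<bar> + \<bar>v1 - v2\<bar>)" using A4 by blast
  obtain Ks where Ks: "\<forall>s\<in>{0..T}. \<forall>y. \<bar>\<sigma> s y\<bar> \<le> Ks" using A5(2) by blast
  obtain Cs where Cs: "\<forall>s1\<in>{0..T}. \<forall>s2\<in>{0..T}. \<forall>y1 y2. \<bar>\<sigma> s1 y1 - \<sigma> s2 y2\<bar> \<le> Cs * (\<bar>s1 - s2\<bar> powr \<beta>\<sigma> + \<bar>y1 - y2\<bar> powr \<beta>\<sigma>)"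
    using A6(3) by blast
  \<comment> \<open>Two points that differ only in \<open>y\<close>, and by 1, show that the Hoelder
    constant is nonnegative.\<close>
  have "\<bar>\<sigma> 0 0 - \<sigma> 0 1\<bar> \<le> Cs * (\<bar>0 - 0\<bar> powr \<beta>\<sigma> + \<bar>0 - 1\<bar> powr \<beta>\<sigma>)" using Cs \<open>T > 0\<close> by (meson atLeastAtMost_iff less_imp_le order_refl)
  then have Cs0: "0 \<le> Cs" by simp
  interpret spde M T \<mu> f Kf Lf \<sigma> a Cs Ks \<beta>\<sigma> u0 \<beta>u0 C0 C1
  proof unfold_locales
    show "stochastic_measure M (restrict_space borel {0..T}) \<mu>" "0 < T" by fact+
    have "(\<lambda>p. (?cl (fst p), snd p)) \<in> measurable (borel \<Otimes>\<^sub>M borel \<Otimes>\<^sub>M borel) (restrict_space borel {0..T} \<Otimes>\<^sub>M (borel :: real measure) \<Otimes>\<^sub>M (borel :: real measure))"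
      using measurable_compose[OF measurable_fst clm] by (intro measurable_Pair measurable_snd)
    from measurable_compose[OF this A3(1)]
    show "(\<lambda>(s, y, v). f (?cl s) y v) \<in> borel_measurable (borel \<Otimes>\<^sub>M borel \<Otimes>\<^sub>M borel)" by (simp add: split_beta')
    show "\<bar>f (?cl s) y v\<bar> \<le> Kf" for s y v using Kf clin by blast
    show "\<bar>f (?cl s) y v - f (?cl s) y w\<bar> \<le> Lf * \<bar>v - w\<bar>" for s y v w
      using bspec[OF Lf clin[of s], rule_format, of y v y w] by simp
    have "(\<lambda>p. (?cl (fst p), snd p)) \<in> measurable (borel \<Otimes>\<^sub>M borel) (restrict_space borel {0..T} \<Otimes>\<^sub>M (borel :: real measure))"
      using measurable_compose[OF measurable_fst clm] by (intro measurable_Pair measurable_snd)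
    from measurable_compose[OF this A5(1)]
    show "(\<lambda>(s, y). \<sigma> (?cl s) y) \<in> borel_measurable (borel \<Otimes>\<^sub>M borel)" by (simp add: split_beta')
    show "\<bar>\<sigma> (?cl s) y\<bar> \<le> Ks" for s y using Ks clin by blast
    \<comment> \<open>Clamping does not increase distances between times, so the Hoelder bound
      survives the extension.\<close>
    show "\<bar>\<sigma> (?cl s1) y1 - \<sigma> (?cl s2) y2\<bar> \<le> Cs * (\<bar>s1 - s2\<bar> powr \<beta>\<sigma> + \<bar>y1 - y2\<bar> powr \<beta>\<sigma>)" for s1 s2 y1 y2
    proof -
      have "\<bar>\<sigma> (?cl s1) y1 - \<sigma> (?cl s2) y2\<bar> \<le> Cs * (\<bar>?cl s1 - ?cl s2\<bar> powr \<beta>\<sigma> + \<bar>y1 - y2\<bar> powr \<beta>\<sigma>)" using Cs clin by blast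
      also have "\<dots> \<le> Cs * (\<bar>s1 - s2\<bar> powr \<beta>\<sigma> + \<bar>y1 - y2\<bar> powr \<beta>\<sigma>)"
        using A6(1) by (intro mult_left_mono[OF _ Cs0] add_right_mono powr_mono2 clamp_to_dist_le) auto
      finally show ?thesis .
    qed
    show "\<bar>u0 y1 \<omega> - u0 y2 \<omega>\<bar> \<le> C1 \<omega> * \<bar>y1 - y2\<bar> powr \<beta>u0" if "\<omega> \<in> space M" for \<omega> y1 y2 using C1(2) that by blast
    show "\<bar>u0 y \<omega>\<bar> \<le> C0 \<omega>" if "\<omega> \<in> space M" for \<omega> y using C0(2) that by blast
  qed (fact \<open>a \<noteq> 0\<close> A1(1) A2(1,2) A6(1,2) Cs0 C0(1) C1(1))+
  show ?thesis
    using mild_solution_exists mild_solution_unique space_regularity space_time_regularity by auto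
qed

end
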